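(* Consider, for each $n\in\mathbb N$, the interacting particle system $\bm{\widetilde X}=(\widetilde X^1,\ldots,\widetilde X^n)$ of the context, for some $p\in[1,2]$, and the flow $(\widetilde\mu_t)_{t\in[0,T]}$ of marginal laws of the associated McKean–Vlasov equation. If $\mathbb E[|\widetilde X^1_0|^{2p+\delta}]<\infty$ for some $\delta>0$, then there exists $C<\infty$ such that for each $n$ and each $t\in[0,T]$ $$\mathbb E\big[\mathcal W_p^p(m^n_{\bm{\widetilde X}_t},\widetilde\mu_t)\big]\le C\,r_{n,p},$$ where $r_{n,p}=n^{-1/2}$ if $d<2p$, $r_{n,p}=n^{-1/2}\log(1+n)$ if $d=2p$, and $r_{n,p}=n^{-p/d}$ if $d>2p$. If $\mathbb E[|\widetilde X^1_0|^{d+5}]<\infty$, then there exists $C<\infty$ such that for each $n$ $$\mathbb E\Big[\sup_{s\in[0,T]}\mathcal W_2^2(m^n_{\bm{\widetilde X}_s},\widetilde\mu_s)\Big]\le C\,n^{-2/(d+8)}.$$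
   Context: $\mathcal P^p(\mathbb R^d)$ is the set of Borel probability measures on $\mathbb R^d$ with finite $p$-th moment, with the $p$-Wasserstein distance $\mathcal W_p$ (associated to the Euclidean norm). For $\bm x\in(\mathbb R^d)^n$, $m^n_{\bm x}=\frac1n\sum_{i=1}^n\delta_{x_i}$. **Particle system.** Let $T\in(0,\infty)$, $(B^i)_{i\ge1}$ i.i.d. standard $d$-dimensional Wiener processes, $\sigma\in\mathbb R^{d\times d}$, $p\in[1,2]$, and $\widetilde b:[0,T]\times\mathbb R^d\times\mathcal P^p(\mathbb R^d)\to\mathbb R^d$ jointly measurable with, for some $\widetilde L<\infty$, $|\widetilde b(t,x,m)-\widetilde b(t,x',m')|\le\widetilde L(|x-x'|+\mathcal W_p(m,m'))$ for all $t,x,x',m,m'$, and $\sup_{t\in[0,T]}|\widetilde b(t,0,\delta_0)|<\infty$. The system is the unique strong solution of $$d\widetilde X^i_t=\widetilde b(t,\widetilde X^i_t,m^n_{\bm{\widetilde X}_t})dt+\sigma dB^i_t,\quad i=1,\ldots,n,$$ with initial states $\widetilde X^i_0$ i.i.d. (and independent of the Wiener processes) with law $\widetilde\mu_0$ satisfying $\mathbb E|\widetilde X^1_0|^2<\infty$. The data $d,T,\sigma,\widetilde b,\widetilde\mu_0$ do not depend on $n$. **McKean–Vlasov limit.** $(\widetilde Y^1,\widetilde\mu)$ is the unique strong solution of $d\widetilde Y^1_t=\widetilde b(t,\widetilde Y^1_t,\widetilde\mu_t)dt+\sigma dB^1_t$, $\widetilde Y^1_0=\widetilde X^1_0$, $\widetilde\mu_t=\mathrm{Law}(\widetilde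 Y^1_t)$. *)

theory Defs
  imports "HOL-Probability.Probability"
begin

subsection \<open>Wasserstein distances on \<open>\<real>\<^sup>d\<close>\<close>

definition finite_moment_measures :: "real \<Rightarrow> (real ^ 'd) measure set" where
  "finite_moment_measures p =
     {m. prob_space m \<and> sets m = sets borel \<and> (\<integral>\<^sup>+x. ennreal (norm x powr p) \<partial>m) < \<infinity>}"

definition couplings ::
    "(real ^ 'd) measure \<Rightarrow> (real ^ 'd) measure \<Rightarrow> ((real ^ 'd) \<times> (real ^ 'd)) measure set" where
  "couplings m m' =
     {\<pi>. sets \<pi> = sets borel \<and> distr \<pi> borel fst = m \<and> distr \<pi> borel snd = m'}"

text \<open>Real powers on \<^typ>\<open>ennreal\<close>, used only for positive exponents.\<close>

definition epowr :: "ennreal \<Rightarrow> real \<Rightarrow> ennreal" (infixr "epowr" 80) where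
  "x epowr a = (if x = \<infinity> then \<infinity> else ennreal (enn2real x powr a))"

text \<open>The distance takes values in \<^typ>\<open>ennreal\<close>, so that it is \<open>\<infinity>\<close>, and not a default value,
  whenever no coupling has finite cost; it is finite on \<^const>\<open>finite_moment_measures\<close>.\<close>

definition wasserstein ::
    "real \<Rightarrow> (real ^ 'd) measure \<Rightarrow> (real ^ 'd) measure \<Rightarrow> ennreal" where
  "wasserstein p m m' =
     (INF \<pi>\<in>couplings m m'. \<integral>\<^sup>+z. ennreal (dist (fst z) (snd z) powr p) \<partial>\<pi>) epowr (1 / p)"

text \<open>The Borel \<open>\<sigma>\<close>-algebra of the metric space of measures with finite \<open>p\<close>-th moment.\<close>

definition wasserstein_borel :: "real \<Rightarrow> (real ^ 'd) measure measure" where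
  "wasserstein_borel p = sigma (finite_moment_measures p)
     {U. U \<subseteq> finite_moment_measures p \<and>
         (\<forall>m\<in>U. \<exists>e>0. \<forall>m'\<in>finite_moment_measures p. wasserstein p m m' < ennreal e \<longrightarrow> m' \<in> U)}"

text \<open>\<open>(1/n) \<Sum> \<delta>\<close> over the points \<open>x 0, \<dots>, x (n - 1)\<close>, as the image of the uniform distribution
  on the indices; the formula is \<open>emeasure_empirical\<close>. Particles are numbered from \<open>0\<close>.\<close>

definition empirical :: "nat \<Rightarrow> (nat \<Rightarrow> real ^ 'd) \<Rightarrow> (real ^ 'd) measure" where
  "empirical n x = distr (uniform_count_measure {..<n}) borel x"

lemma emeasure_empirical:
  fixes x :: "nat \<Rightarrow> real ^ 'd"
  assumes "n \<ge> 1" "A \<in> sets borel"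
  shows "emeasure (empirical n x) A = ennreal ((1 / real n) * (\<Sum>i<n. indicator A (x i)))"
proof -
  have x: "x \<in> measurable (uniform_count_measure {..<n}) borel"
    by (simp add: measurable_def space_uniform_count_measure sets_uniform_count_measure)
  have "emeasure (empirical n x) A = emeasure (uniform_count_measure {..<n}) {i\<in>{..<n}. x i \<in> A}"
    unfolding empirical_def using assms(2) x
    by (subst emeasure_distr)
       (auto simp: space_uniform_count_measure intro!: arg_cong[of _ _ "emeasure _"])
  also have "\<dots> = ennreal (real (card {i\<in>{..<n}. x i \<in> A}) / real n)"
    by (subst emeasure_uniform_count_measure) auto
  also have "real (card {i\<in>{..<n}. x i \<in> A}) = (\<Sum>i<n. indicator A (x i))"
    by (simp add: indicator_def Int_def flip: sum.inter_filter)
  finally show ?thesis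
    by simp
qed


subsection \<open>Wiener processes and generated \<open>\<sigma>\<close>-algebras\<close>

text \<open>For \<open>s < t\<close> the increment has the density of the normal law with mean \<open>0\<close> and covariance
  \<open>(t - s) I\<close>; the second argument of \<^const>\<open>normal_density\<close> is the standard deviation.\<close>

definition wiener_process :: "'w measure \<Rightarrow> (real \<Rightarrow> 'w \<Rightarrow> real ^ 'd) \<Rightarrow> bool" where
  "wiener_process M W \<longleftrightarrow>
     (\<forall>t\<ge>0. W t \<in> borel_measurable M) \<and>
     (AE \<omega> in M. W 0 \<omega> = 0) \<and>
     (AE \<omega> in M. continuous_on {0..} (\<lambda>t. W t \<omega>)) \<and>
     (\<forall>k (\<tau>::nat \<Rightarrow> real). 0 \<le> \<tau> 0 \<and> mono \<tau> \<longrightarrow>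
        prob_space.indep_vars M (\<lambda>_. borel) (\<lambda>i \<omega>. W (\<tau> (Suc i)) \<omega> - W (\<tau> i) \<omega>) {..<k}) \<and>
     (\<forall>s t. 0 \<le> s \<and> s < t \<longrightarrow>
        distributed M lborel (\<lambda>\<omega>. W t \<omega> - W s \<omega>)
          (\<lambda>x. ennreal (\<Prod>j\<in>UNIV. normal_density 0 (sqrt (t - s)) (x $ j))))"

definition generated_events :: "'w measure \<Rightarrow> 'i set \<Rightarrow> ('i \<Rightarrow> 'w \<Rightarrow> real ^ 'd) \<Rightarrow> 'w set set" where
  "generated_events M I Z =
     sigma_sets (space M) {Z i -` A \<inter> space M | i A. i \<in> I \<and> A \<in> sets borel}"

text \<open>The initial states are i.i.d. with law \<open>\<mu>0\<close>, the \<open>B i\<close> are independent standard Wiener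
  processes, and the two sequences are independent of each other: jointly, all initial states
  and all Wiener processes (as processes) form one independent family.\<close>

definition driving_data :: "'w measure \<Rightarrow> (real ^ 'd) measure \<Rightarrow> (nat \<Rightarrow> 'w \<Rightarrow> real ^ 'd) \<Rightarrow>
    (nat \<Rightarrow> real \<Rightarrow> 'w \<Rightarrow> real ^ 'd) \<Rightarrow> bool" where
  "driving_data M \<mu>0 X0 B \<longleftrightarrow>
     (\<forall>i. X0 i \<in> borel_measurable M \<and> distr M borel (X0 i) = \<mu>0) \<and>
     (\<forall>i. wiener_process M (B i)) \<and>
     prob_space.indep_sets M
       (case_sum (\<lambda>i. generated_events M {i} X0) (\<lambda>i. generated_events M {0..} (B i))) UNIV"

text \<open>The filtration generated by the initial states and Wiener processes of the first \<open>n\<close> particles.\<close>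

definition driving_filtration :: "'w measure \<Rightarrow> nat \<Rightarrow> (nat \<Rightarrow> 'w \<Rightarrow> real ^ 'd) \<Rightarrow>
    (nat \<Rightarrow> real \<Rightarrow> 'w \<Rightarrow> real ^ 'd) \<Rightarrow> real \<Rightarrow> 'w measure" where
  "driving_filtration M n X0 B t =
     sigma (space M) (generated_events M {..<n} X0 \<union> (\<Union>i<n. generated_events M {0..t} (B i)))"


subsection \<open>Strong solutions\<close>

text \<open>\<open>X\<close> is continuous, adapted to \<open>F\<close> up to null sets, and satisfies
  \<open>dX = drift dt + \<sigma> dW\<close>, \<open>X\<^sub>0 = \<xi>\<close> on \<open>[0, T]\<close>. Since \<open>\<sigma>\<close> is constant, the stochastic
  integral is \<open>\<sigma> W\<close>.\<close>

definition strong_solution :: "'w measure \<Rightarrow> real \<Rightarrow> (real \<Rightarrow> 'w measure) \<Rightarrow> real ^ 'd ^ 'd \<Rightarrow>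
    ('w \<Rightarrow> real ^ 'd) \<Rightarrow> (real \<Rightarrow> 'w \<Rightarrow> real ^ 'd) \<Rightarrow> (real \<Rightarrow> 'w \<Rightarrow> real ^ 'd) \<Rightarrow>
    (real \<Rightarrow> 'w \<Rightarrow> real ^ 'd) \<Rightarrow> bool" where
  "strong_solution M T F \<sigma> \<xi> W drift X \<longleftrightarrow>
     (\<forall>t\<in>{0..T}. X t \<in> borel_measurable M \<and>
        (\<exists>Z\<in>borel_measurable (F t). AE \<omega> in M. X t \<omega> = Z \<omega>)) \<and>
     (AE \<omega> in M.
        continuous_on {0..T} (\<lambda>t. X t \<omega>) \<and>
        set_integrable lborel {0..T} (\<lambda>s. drift s \<omega>) \<and>
        (\<forall>t\<in>{0..T}. X t \<omega> = \<xi> \<omega> + (LINT s:{0..t}|lborel. drift s \<omega>) + \<sigma> *v W t \<omega>))"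

definition particle_system :: "'w measure \<Rightarrow> real \<Rightarrow>
    (real \<Rightarrow> real ^ 'd \<Rightarrow> (real ^ 'd) measure \<Rightarrow> real ^ 'd) \<Rightarrow> real ^ 'd ^ 'd \<Rightarrow>
    (nat \<Rightarrow> 'w \<Rightarrow> real ^ 'd) \<Rightarrow> (nat \<Rightarrow> real \<Rightarrow> 'w \<Rightarrow> real ^ 'd) \<Rightarrow> nat \<Rightarrow>
    (nat \<Rightarrow> real \<Rightarrow> 'w \<Rightarrow> real ^ 'd) \<Rightarrow> bool" where
  "particle_system M T b \<sigma> X0 B n X \<longleftrightarrow>
     (\<forall>i<n. strong_solution M T (driving_filtration M n X0 B) \<sigma> (X0 i) (B i)
        (\<lambda>s \<omega>. b s (X i s \<omega>) (empirical n (\<lambda>j. X j s \<omega>))) (X i))"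

definition mckean_vlasov :: "'w measure \<Rightarrow> real \<Rightarrow> real \<Rightarrow>
    (real \<Rightarrow> real ^ 'd \<Rightarrow> (real ^ 'd) measure \<Rightarrow> real ^ 'd) \<Rightarrow> real ^ 'd ^ 'd \<Rightarrow>
    (nat \<Rightarrow> 'w \<Rightarrow> real ^ 'd) \<Rightarrow> (nat \<Rightarrow> real \<Rightarrow> 'w \<Rightarrow> real ^ 'd) \<Rightarrow>
    (real \<Rightarrow> 'w \<Rightarrow> real ^ 'd) \<Rightarrow> (real \<Rightarrow> (real ^ 'd) measure) \<Rightarrow> bool" where
  "mckean_vlasov M T p b \<sigma> X0 B Y \<mu> \<longleftrightarrow>
     strong_solution M T (driving_filtration M 1 X0 B) \<sigma> (X0 0) (B 0)
       (\<lambda>s \<omega>. b s (Y s \<omega>) (\<mu> s)) Y \<and>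
     (\<forall>t\<in>{0..T}. \<mu> t = distr M borel (Y t) \<and> \<mu> t \<in> finite_moment_measures p)"

definition rate :: "nat \<Rightarrow> real \<Rightarrow> nat \<Rightarrow> real" where
  "rate d p n =
     (if real d < 2 * p then real n powr (- 1 / 2)
      else if real d = 2 * p then real n powr (- 1 / 2) * ln (1 + real n)
      else real n powr (- p / real d))"

end

theory Submission imports Defs begin

text \<open>The particles are compared with i.i.d. copies of the McKean--Vlasov process, driven by the same
  initial states and the same Wiener processes. The averaged \<open>r\<close>-th power of the differences is bounded
  through Gronwall's inequality by the distance of the empirical measure of the copies to \<open>\<mu>\<close>.

  That distance is bounded by coupling greedily along a tree of partitions: \<open>\<real>\<^sup>d\<close> is cut into the
  shells \<open>2^(k-1) < |x| \<le> 2^k\<close> around the unit ball, and each of these into cubes of side \<open>2^(k-l)\<close> at level \<open>l\<close>. The mass that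
  the coupling separates at level \<open>l\<close> is the \<open>l\<^sup>1\<close>-difference of the masses of the cells, whose
  expectation is estimated by variances, the moment assumption providing summability over the shells.
  For a single time this gives the rate of the first claim. For the second claim the \<open>l\<^sup>2\<close>-sum over the
  \<open>2^m\<close> points of a time grid bounds the supremum over the grid, and between grid points the paths are
  controlled by chaining of sixth powers of their dyadic increments; the rate results from \<open>m = 4 L\<close>
  and \<open>2^(L (d + 8)) \<approx> n\<close>, where \<open>L\<close> is the finest level.

  Since the noise is additive, all equations are solved path by path. That the copies have the law
  \<open>\<mu>\<close> and are independent follows from the convergence of the Euler scheme, which is an explicit
  measurable function of the initial state and finitely many increments.\<close>

subsection \<open>Multi-scale couplings\<close>

text \<open>The mass of a cell \<open>c\<close> deviates by about \<open>sqrt (\<mu> c / n)\<close>.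
  Weighting by \<open>2 ^ (r k)\<close>, \<open>k\<close> the shell, and applying Cauchy-Schwarz
  against the summable weight \<open>2 ^ (- \<delta> k)\<close> costs the moment of order
  \<open>2 r + \<delta>\<close>: the origin of \<open>2 p + \<delta>\<close>, and of the order 5
  used with \<open>r = 2\<close>, \<open>\<delta> = 1\<close>. A shell meets about
  \<open>2 ^ (l d)\<close> cells of level \<open>l\<close>, so this level contributes
  \<open>2 ^ (- r l) * sqrt (2 ^ (l d) / n)\<close>, while pairs never separated cost
  \<open>2 ^ (- r L)\<close>. The ratio \<open>2 ^ (d / 2 - r)\<close> of this geometric sum being
  below, equal to or above 1 gives the three cases of the rate. For \<open>2 ^ m\<close> times, the
  number under the root is multiplied by \<open>2 ^ m\<close>. With \<open>m = 4 L\<close> the root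
  is of order \<open>2 ^ (- 2 L)\<close> once \<open>2 ^ (L d + 4 L) / n\<close> is at most
  \<open>2 ^ (- 4 L)\<close>: hence \<open>d + 8\<close>. The oscillation between grid points,
  \<open>2 ^ (- 2 m / 3)\<close>, does not exceed this. For the drift with frozen law, boundedness
  at 0 and measurability in time depend on \<mu>, about which only finite moments are assumed; both
  are extracted from the paths of \<open>Y\<close>.\<close>

lemma epowr_epowr_inverse:
  assumes "0 < p" shows "(x epowr (1 / p)) epowr p = x"
  using assms by (cases x) (auto simp: epowr_def powr_powr)

lemma epowr_mono: "0 < a \<Longrightarrow> x \<le> y \<Longrightarrow> x epowr a \<le> y epowr a"
  by (cases x; cases y) (auto simp: epowr_def powr_mono2 top_unique intro!: ennreal_leI)

lemma epowr_2: "x epowr 2 = x\<^sup>2"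
  by (cases x) (auto simp: epowr_def power2_eq_square ennreal_mult ennreal_top_mult)

section \<open>Elementary properties of the Wasserstein distances\<close>

lemma wasserstein_epowr:
  assumes "0 < p"
  shows "wasserstein p m m' epowr p = (INF \<pi>\<in>couplings m m'. \<integral>\<^sup>+z. ennreal (dist (fst z) (snd z) powr p) \<partial>\<pi>)"
  unfolding wasserstein_def by (rule epowr_epowr_inverse[OF assms])

lemma wasserstein_le_coupling:
  assumes "0 < p" "\<pi> \<in> couplings m m'"
  shows "wasserstein p m m' epowr p \<le> (\<integral>\<^sup>+z. ennreal (dist (fst z) (snd z) powr p) \<partial>\<pi>)"
  unfolding wasserstein_epowr[OF assms(1)] using assms(2) by (rule INF_lower)

lemma couplings_distr_pair:
  assumes [measurable]: "U \<in> borel_measurable N" "V \<in> borel_measurable N"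
  shows "distr N borel (\<lambda>\<omega>. (U \<omega>, V \<omega>)) \<in> couplings (distr N borel U) (distr N borel V)"
  by (auto simp: couplings_def distr_distr comp_def simp flip: borel_prod)

lemma wasserstein_le_distr:
  assumes "0 < p" and [measurable]: "U \<in> borel_measurable N" "V \<in> borel_measurable N"
  shows "wasserstein p (distr N borel U) (distr N borel V) epowr p \<le> (\<integral>\<^sup>+\<omega>. ennreal (dist (U \<omega>) (V \<omega>) powr p) \<partial>N)"
proof -
  have "wasserstein p (distr N borel U) (distr N borel V) epowr p \<le>
     (\<integral>\<^sup>+z. ennreal (dist (fst z) (snd z) powr p) \<partial>distr N borel (\<lambda>\<omega>. (U \<omega>, V \<omega>)))"
    by (rule wasserstein_le_coupling[OF assms(1) couplings_distr_pair]) measurable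
  also have "\<dots> = (\<integral>\<^sup>+\<omega>. ennreal (dist (U \<omega>) (V \<omega>) powr p) \<partial>N)"
    by (subst nn_integral_distr) (auto simp flip: borel_prod)
  finally show ?thesis .
qed

text \<open>Young's inequality at scale \<open>e\<close> bounds \<open>f powr p\<close> by an affine
  function of \<open>f powr q\<close>. Integrated with \<open>e = J\<close> it gives exactly
  \<open>J powr (p/q)\<close>; for \<open>J = 0\<close> the function vanishes almost
  everywhere.\<close>

lemma (in prob_space) nn_integral_powr_le:
  assumes p: "1 \<le> p" "p \<le> q" and [measurable]: "f \<in> borel_measurable M"
    and nn: "\<And>x. 0 \<le> f x"
  shows "(\<integral>\<^sup>+x. ennreal (f x powr p) \<partial>M) epowr (1 / p) \<le> (\<integral>\<^sup>+x. ennreal (f x powr q) \<partial>M) epowr (1 / q)"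
proof (cases "(\<integral>\<^sup>+x. ennreal (f x powr q) \<partial>M) = \<infinity>")
  case True
  then show ?thesis by (simp add: epowr_def)
next
  case False
  then obtain J where J: "0 \<le> J" "(\<integral>\<^sup>+x. ennreal (f x powr q) \<partial>M) = ennreal J"
    by (cases "(\<integral>\<^sup>+x. ennreal (f x powr q) \<partial>M)") auto
  have young: "z powr p \<le> e powr (p/q) * (p / q * (z powr q / e) + (1 - p / q))" if "0 < e" "0 \<le> z" for e z :: real
  proof (cases "z = 0")
    case True
    then show ?thesis using p by auto
  next
    case False
    have "(z powr q / e) powr (p/q) * 1 powr (1 - p/q) \<le> p/q * (z powr q / e) + (1 - p/q) * 1"
      by (rule Youngs_inequality_0) (use p that False in auto)
    moreover have "z powr p = e powr (p/q) * (z powr q / e) powr (p/q)"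
      using p that False by (simp add: powr_divide powr_powr)
    ultimately show ?thesis using that by (auto intro!: mult_left_mono)
  qed
  have bd: "(\<integral>\<^sup>+x. ennreal (f x powr p) \<partial>M) \<le> ennreal (e powr (p/q) * (p / q * (J / e) + (1 - p / q)))" if "0 < e" for e
  proof -
    define c1 where "c1 = e powr (p/q) * (p / q) / e"
    define c2 where "c2 = e powr (p/q) * (1 - p / q)"
    have c: "0 \<le> c1" "0 \<le> c2" using p that by (auto simp: c1_def c2_def)
    have y: "f x powr p \<le> c1 * f x powr q + c2" for x
      using young[OF that nn[of x]] by (simp add: c1_def c2_def distrib_left)
    have "(\<integral>\<^sup>+x. ennreal (f x powr p) \<partial>M) \<le> (\<integral>\<^sup>+x. ennreal c1 * ennreal (f x powr q) + ennreal c2 \<partial>M)"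
      using y c
      by (intro nn_integral_mono) (auto simp: ennreal_mult[symmetric] ennreal_plus[symmetric] simp del: ennreal_plus intro!: ennreal_leI)
    also have "\<dots> = ennreal c1 * ennreal J + ennreal c2"
      by (subst nn_integral_add) (auto simp: nn_integral_cmult J emeasure_space_1)
    also have "\<dots> = ennreal (c1 * J + c2)"
      using c J by (simp add: ennreal_mult)
    also have "c1 * J + c2 = e powr (p/q) * (p / q * (J / e) + (1 - p / q))"
      by (simp add: c1_def c2_def distrib_left)
    finally show ?thesis .
  qed
  have "(\<integral>\<^sup>+x. ennreal (f x powr p) \<partial>M) \<le> ennreal (J powr (p/q))"
  proof (cases "J = 0")
    case True
    then have "AE x in M. f x powr q = 0"
      using J(2) by (simp add: nn_integral_0_iff_AE)
    then have "AE x in M. ennreal (f x powr p) = 0" by eventually_elim auto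
    then have "(\<integral>\<^sup>+x. ennreal (f x powr p) \<partial>M) = 0"
      by (simp add: nn_integral_0_iff_AE)
    then show ?thesis by simp
  next
    case False
    then show ?thesis using bd[of J] J p by simp
  qed
  then have "(\<integral>\<^sup>+x. ennreal (f x powr p) \<partial>M) epowr (1 / p) \<le> ennreal (J powr (p/q)) epowr (1 / p)"
    using p by (intro epowr_mono) auto
  also have "\<dots> = ennreal J epowr (1 / q)"
    using J p by (simp add: epowr_def powr_powr)
  finally show ?thesis by (simp add: J)
qed

text \<open>A coupling of a probability measure is itself one, so \<open>nn_integral_powr_le\<close>
  applies to each coupling. The drift is Lipschitz for the exponent \<open>p\<close>, while the
  uniform bound is derived with exponent 2; this lemma connects the two.\<close>

lemma wasserstein_mono:
  assumes p: "1 \<le> p" "p \<le> q" and m: "prob_space m" "sets m = sets borel"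
  shows "wasserstein p m m' \<le> wasserstein q m m'"
proof -
  let ?c = "\<lambda>p \<pi>. \<integral>\<^sup>+z. ennreal (dist (fst z) (snd z) powr p) \<partial>\<pi>"
  have *: "?c p \<pi> epowr (1/p) \<le> ?c q \<pi> epowr (1/q)" if "\<pi> \<in> couplings m m'" for \<pi>
  proof -
    have [measurable_cong]: "sets \<pi> = sets (borel \<Otimes>\<^sub>M borel)"
      using that by (simp add: couplings_def flip: borel_prod)
    have fst: "distr \<pi> borel fst = m"
      using that by (simp add: couplings_def)
    have "prob_space \<pi>"
      by (rule prob_space_distrD[of fst _ borel]) (simp_all add: m fst)
    then interpret prob_space \<pi> .
    show ?thesis
      by (rule nn_integral_powr_le) (use p in auto)
  qed
  have "wasserstein p m m' epowr q \<le> ?c q \<pi>" if \<pi>: "\<pi> \<in> couplings m m'" for \<pi>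
  proof -
    have "wasserstein p m m' \<le> ?c p \<pi> epowr (1/p)"
      unfolding wasserstein_def using p \<pi> by (intro epowr_mono INF_lower) auto
    also note *[OF \<pi>]
    finally have "wasserstein p m m' epowr q \<le> (?c q \<pi> epowr (1/q)) epowr q"
      using p by (intro epowr_mono) auto
    then show ?thesis using p by (simp add: epowr_epowr_inverse)
  qed
  then have "wasserstein p m m' epowr q \<le> wasserstein q m m' epowr q"
    using p by (auto simp: wasserstein_epowr[of q] intro: INF_greatest)
  then have "(wasserstein p m m' epowr q) epowr (1/q) \<le> (wasserstein q m m' epowr q) epowr (1/q)"
    using p by (auto intro: epowr_mono)
  moreover have inv: "(x epowr q) epowr (1/q) = x" for x
    using p epowr_epowr_inverse[of "1/q" x] by simp
  ultimately show ?thesis by (simp only: inv)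
qed

section \<open>Greedy matching along nested partitions\<close>

text \<open>One step of a greedy bottom-up matching: what \<open>g\<close> leaves unmatched inside a cell is matched
  there by a multiple of the product of the two remainders.\<close>

lemma matching_step:
  fixes \<phi> :: "'a \<Rightarrow> 'c" and \<psi> :: "'b \<Rightarrow> 'c"
  assumes P: "prob_space P" and Q: "prob_space Q"
    and \<phi>[measurable]: "\<phi> \<in> P \<rightarrow>\<^sub>M count_space UNIV" and \<psi>[measurable]: "\<psi> \<in> Q \<rightarrow>\<^sub>M count_space UNIV"
    and g[measurable]: "g \<in> borel_measurable (P \<Otimes>\<^sub>M Q)"
    and gP: "\<And>x. x \<in> space P \<Longrightarrow> (\<integral>\<^sup>+y. g (x, y) \<partial>Q) \<le> 1"
    and gQ: "\<And>y. y \<in> space Q \<Longrightarrow> (\<integral>\<^sup>+x. g (x, y) \<partial>P) \<le> 1"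
    and supp: "\<And>x y. \<phi> x \<noteq> \<psi> y \<Longrightarrow> g (x, y) = 0"
    and cnt: "countable (UNIV :: 'c set)"
  obtains g' :: "'a \<times> 'b \<Rightarrow> ennreal" where "g' \<in> borel_measurable (P \<Otimes>\<^sub>M Q)"
    "\<And>x. x \<in> space P \<Longrightarrow> (\<integral>\<^sup>+y. g' (x, y) \<partial>Q) \<le> 1"
    "\<And>y. y \<in> space Q \<Longrightarrow> (\<integral>\<^sup>+x. g' (x, y) \<partial>P) \<le> 1"
    "\<And>x y. \<phi> x \<noteq> \<psi> y \<Longrightarrow> g' (x, y) = 0"
    "\<And>z. g z \<le> g' z"
    "\<And>c. (\<integral>\<^sup>+x. (\<integral>\<^sup>+y. indicator {c} (\<phi> x) * g' (x, y) \<partial>Q) \<partial>P) =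
       min (emeasure P (\<phi> -` {c} \<inter> space P)) (emeasure Q (\<psi> -` {c} \<inter> space Q))"
proof -
  interpret P: prob_space P by fact
  interpret Q: prob_space Q by fact
  interpret PQ: pair_sigma_finite P Q ..
  define r where "r x = 1 - (\<integral>\<^sup>+y. g (x, y) \<partial>Q)" for x
  define s where "s y = 1 - (\<integral>\<^sup>+x. g (x, y) \<partial>P)" for y
  have [measurable]: "r \<in> borel_measurable P" "s \<in> borel_measurable Q"
    unfolding r_def s_def by measurable
  have [measurable]: "(\<lambda>x. indicator {c} (\<phi> x) :: ennreal) \<in> borel_measurable P"
    "(\<lambda>y. indicator {c} (\<psi> y) :: ennreal) \<in> borel_measurable Q" for c
    by (auto intro: measurable_compose[OF \<phi>] measurable_compose[OF \<psi>])
  define R where "R c = (\<integral>\<^sup>+x. indicator {c} (\<phi> x) * r x \<partial>P)" for c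
  define S where "S c = (\<integral>\<^sup>+y. indicator {c} (\<psi> y) * s y \<partial>Q)" for c
  \<comment> \<open>The largest factor for which neither marginal of the product exceeds its
    remainder. If both remainders vanish it is \<open>\<infinity>\<close>, and
    \<open>\<infinity> * 0 = 0\<close> keeps the products below correct.\<close>
  define w where "w c = inverse (max (R c) (S c))" for c
  have [measurable]: "(\<lambda>z. \<phi> (fst z)) \<in> P \<Otimes>\<^sub>M Q \<rightarrow>\<^sub>M count_space UNIV" "(\<lambda>z. \<psi> (snd z)) \<in> P \<Otimes>\<^sub>M Q \<rightarrow>\<^sub>M count_space UNIV"
    by measurable
  have le1: "R c \<le> 1" "S c \<le> 1" for c
  proof -
    have "R c \<le> (\<integral>\<^sup>+x. 1 \<partial>P)" unfolding R_def r_def by (intro nn_integral_mono) (auto simp: indicator_def)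
    then show "R c \<le> 1" by (simp add: P.emeasure_space_1)
    have "S c \<le> (\<integral>\<^sup>+x. 1 \<partial>Q)" unfolding S_def s_def by (intro nn_integral_mono) (auto simp: indicator_def)
    then show "S c \<le> 1" by (simp add: Q.emeasure_space_1)
  qed
  have wS: "w c * S c \<le> 1" and wR: "w c * R c \<le> 1" and wRS: "w c * (R c * S c) = min (R c) (S c)" for c
  proof -
    obtain a b where ab: "0 \<le> a" "R c = ennreal a" "0 \<le> b" "S c = ennreal b"
      using le1[of c] by (cases "R c"; cases "S c") (auto simp: top_unique)
    have "w c * S c \<le> 1 \<and> w c * R c \<le> 1 \<and> w c * (R c * S c) = min (R c) (S c)"
    proof (cases "max a b = 0")
      case True
      then have "a = 0" "b = 0" using ab by auto
      then show ?thesis using ab by simp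
    next
      case False
      then have m: "max a b > 0" using ab by auto
      have "max (R c) (S c) = ennreal (max a b)"
        using ab by (simp add: max_def ennreal_le_iff)
      then have w: "w c = ennreal (inverse (max a b))"
        unfolding w_def using m by (simp only: inverse_ennreal)
      have "inverse (max a b) * b \<le> inverse (max a b) * max a b" "inverse (max a b) * a \<le> inverse (max a b) * max a b"
        by (rule mult_left_mono; use m in simp)+
      moreover have "inverse (max a b) * max a b = 1" using m by (intro left_inverse) linarith
      ultimately have "inverse (max a b) * b \<le> 1" "inverse (max a b) * a \<le> 1"
        by (simp_all only:)
      moreover have "inverse (max a b) * (a * b) = min a b"
        using m ab by (cases "a \<le> b") (auto simp: max_def min_def)
      moreover have "min (R c) (S c) = ennreal (min a b)"
        using ab by (simp add: min_def ennreal_le_iff)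
      ultimately show ?thesis
        using ab m unfolding w by (simp add: ennreal_mult[symmetric])
    qed
    then show "w c * S c \<le> 1" "w c * R c \<le> 1" "w c * (R c * S c) = min (R c) (S c)" by auto
  qed
  define h where "h z = indicator {\<phi> (fst z)} (\<psi> (snd z)) * (w (\<phi> (fst z)) * (r (fst z) * s (snd z)))" for z
  have hm[measurable]: "h \<in> borel_measurable (P \<Otimes>\<^sub>M Q)"
  proof -
    have "(\<lambda>z. w (\<phi> (fst z)) * (r (fst z) * s (snd z))) \<in> borel_measurable (P \<Otimes>\<^sub>M Q)"
    proof (intro borel_measurable_times_ennreal)
      show "(\<lambda>z. w (\<phi> (fst z))) \<in> borel_measurable (P \<Otimes>\<^sub>M Q)"
        by (rule measurable_compose[where N="count_space UNIV" and g=w]) measurable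
    qed measurable
    moreover have "Measurable.pred (P \<Otimes>\<^sub>M Q) (\<lambda>z. \<psi> (snd z) = \<phi> (fst z))"
    proof -
      have eq: "count_space UNIV \<Otimes>\<^sub>M count_space UNIV = (count_space UNIV :: ('c \<times> 'c) measure)"
        using cnt by (simp add: pair_measure_countable)
      have "(\<lambda>z. (\<psi> (snd z), \<phi> (fst z))) \<in> P \<Otimes>\<^sub>M Q \<rightarrow>\<^sub>M (count_space UNIV :: ('c \<times> 'c) measure)"
        unfolding eq[symmetric] by measurable
      from measurable_compose[OF this, of "\<lambda>(a, b). a = b"] show ?thesis by simp
    qed
    ultimately have "(\<lambda>z. if \<psi> (snd z) = \<phi> (fst z) then w (\<phi> (fst z)) * (r (fst z) * s (snd z)) else 0) \<in> borel_measurable (P \<Otimes>\<^sub>M Q)"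
      by (intro measurable_If) auto
    then show ?thesis
      by (rule measurable_cong[THEN iffD1, rotated]) (auto simp: h_def indicator_def)
  qed
  define g' where "g' z = g z + h z" for z
  have hP: "(\<integral>\<^sup>+y. h (x, y) \<partial>Q) = r x * (w (\<phi> x) * S (\<phi> x))" for x
  proof -
    have "(\<integral>\<^sup>+y. h (x, y) \<partial>Q) = (\<integral>\<^sup>+y. (r x * w (\<phi> x)) * (indicator {\<phi> x} (\<psi> y) * s y) \<partial>Q)"
      unfolding h_def by (intro nn_integral_cong) (simp add: ac_simps)
    also have "\<dots> = (r x * w (\<phi> x)) * S (\<phi> x)"
      unfolding S_def by (subst nn_integral_cmult) auto
    finally show ?thesis by (simp add: ac_simps)
  qed
  have hQ: "(\<integral>\<^sup>+x. h (x, y) \<partial>P) = s y * (w (\<psi> y) * R (\<psi> y))" for y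
  proof -
    have "(\<integral>\<^sup>+x. h (x, y) \<partial>P) = (\<integral>\<^sup>+x. (s y * w (\<psi> y)) * (indicator {\<psi> y} (\<phi> x) * r x) \<partial>P)"
      unfolding h_def by (intro nn_integral_cong) (auto simp: ac_simps indicator_def)
    also have "\<dots> = (s y * w (\<psi> y)) * R (\<psi> y)"
      unfolding R_def by (subst nn_integral_cmult) auto
    finally show ?thesis by (simp add: ac_simps)
  qed
  have 1: "g' \<in> borel_measurable (P \<Otimes>\<^sub>M Q)" unfolding g'_def by measurable
  have 2: "(\<integral>\<^sup>+y. g' (x, y) \<partial>Q) \<le> 1" if "x \<in> space P" for x
  proof -
    have "(\<integral>\<^sup>+y. g' (x, y) \<partial>Q) = (\<integral>\<^sup>+y. g (x, y) \<partial>Q) + (\<integral>\<^sup>+y. h (x, y) \<partial>Q)"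
      unfolding g'_def using that by (intro nn_integral_add) measurable
    also have "\<dots> \<le> (\<integral>\<^sup>+y. g (x, y) \<partial>Q) + r x * 1"
      unfolding hP by (intro add_left_mono mult_left_mono wS) auto
    also have "\<dots> = 1" unfolding r_def using gP[OF that] by (simp add: ennreal_add_diff_cancel_right)
    finally show ?thesis .
  qed
  have 3: "(\<integral>\<^sup>+x. g' (x, y) \<partial>P) \<le> 1" if "y \<in> space Q" for y
  proof -
    have "(\<integral>\<^sup>+x. g' (x, y) \<partial>P) = (\<integral>\<^sup>+x. g (x, y) \<partial>P) + (\<integral>\<^sup>+x. h (x, y) \<partial>P)"
      unfolding g'_def using that by (intro nn_integral_add) measurable
    also have "\<dots> \<le> (\<integral>\<^sup>+x. g (x, y) \<partial>P) + s y * 1"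
      unfolding hQ by (intro add_left_mono mult_left_mono wR) auto
    also have "\<dots> = 1" unfolding s_def using gQ[OF that] by (simp add: ennreal_add_diff_cancel_right)
    finally show ?thesis .
  qed
  have 4: "g' (x, y) = 0" if "\<phi> x \<noteq> \<psi> y" for x y
    using that supp[OF that] by (auto simp: g'_def h_def indicator_def)
  have 5: "g z \<le> g' z" for z by (simp add: g'_def)
  have 6: "(\<integral>\<^sup>+x. (\<integral>\<^sup>+y. indicator {c} (\<phi> x) * g' (x, y) \<partial>Q) \<partial>P) =
       min (emeasure P (\<phi> -` {c} \<inter> space P)) (emeasure Q (\<psi> -` {c} \<inter> space Q))" for c
  proof -
    \<comment> \<open>The mass that \<open>g\<close> has already matched in \<open>c\<close>. Since
      \<open>g\<close> joins equal cells only, it can be computed from either side, so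
      \<open>G + R c\<close> and \<open>G + S c\<close> are the full masses of the cell.\<close>
    define G where "G = (\<integral>\<^sup>+x. (\<integral>\<^sup>+y. indicator {c} (\<phi> x) * g (x, y) \<partial>Q) \<partial>P)"
    have G1: "G = (\<integral>\<^sup>+x. indicator {c} (\<phi> x) * (\<integral>\<^sup>+y. g (x, y) \<partial>Q) \<partial>P)"
      unfolding G_def by (intro nn_integral_cong nn_integral_cmult) measurable
    have "G = (\<integral>\<^sup>+y. (\<integral>\<^sup>+x. indicator {c} (\<phi> x) * g (x, y) \<partial>P) \<partial>Q)"
      unfolding G_def by (rule PQ.Fubini'[symmetric]) measurable
    also have "\<dots> = (\<integral>\<^sup>+y. (\<integral>\<^sup>+x. indicator {c} (\<psi> y) * g (x, y) \<partial>P) \<partial>Q)"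
    proof -
      have "indicator {c} (\<phi> x) * g (x, y) = indicator {c} (\<psi> y) * g (x, y)" for x y
        using supp[of x y] by (cases "\<phi> x = \<psi> y") auto
      then show ?thesis by simp
    qed
    also have "\<dots> = (\<integral>\<^sup>+y. indicator {c} (\<psi> y) * (\<integral>\<^sup>+x. g (x, y) \<partial>P) \<partial>Q)"
      by (intro nn_integral_cong nn_integral_cmult) measurable
    finally have G2: "G = (\<integral>\<^sup>+y. indicator {c} (\<psi> y) * (\<integral>\<^sup>+x. g (x, y) \<partial>P) \<partial>Q)" .
    have Pc: "G + R c = emeasure P (\<phi> -` {c} \<inter> space P)"
    proof -
      have "G + R c = (\<integral>\<^sup>+x. indicator {c} (\<phi> x) * (\<integral>\<^sup>+y. g (x, y) \<partial>Q) + indicator {c} (\<phi> x) * r x \<partial>P)"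
        unfolding G1 R_def by (rule nn_integral_add[symmetric]) measurable
      also have "\<dots> = (\<integral>\<^sup>+x. indicator (\<phi> -` {c} \<inter> space P) x \<partial>P)"
        using gP by (intro nn_integral_cong) (auto simp: r_def indicator_def ennreal_add_diff_cancel_right)
      finally show ?thesis by simp
    qed
    have Qc: "G + S c = emeasure Q (\<psi> -` {c} \<inter> space Q)"
    proof -
      have "G + S c = (\<integral>\<^sup>+y. indicator {c} (\<psi> y) * (\<integral>\<^sup>+x. g (x, y) \<partial>P) + indicator {c} (\<psi> y) * s y \<partial>Q)"
        unfolding G2 S_def by (rule nn_integral_add[symmetric]) measurable
      also have "\<dots> = (\<integral>\<^sup>+y. indicator (\<psi> -` {c} \<inter> space Q) y \<partial>Q)"
        using gQ by (intro nn_integral_cong) (auto simp: s_def indicator_def ennreal_add_diff_cancel_right)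
      finally show ?thesis by simp
    qed
    have "(\<integral>\<^sup>+x. (\<integral>\<^sup>+y. indicator {c} (\<phi> x) * g' (x, y) \<partial>Q) \<partial>P) =
      (\<integral>\<^sup>+x. (\<integral>\<^sup>+y. indicator {c} (\<phi> x) * g (x, y) \<partial>Q) + indicator {c} (\<phi> x) * (\<integral>\<^sup>+y. h (x, y) \<partial>Q) \<partial>P)"
      unfolding g'_def by (intro nn_integral_cong) (simp add: distrib_left nn_integral_add nn_integral_cmult)
    also have "\<dots> = G + (\<integral>\<^sup>+x. indicator {c} (\<phi> x) * (r x * (w (\<phi> x) * S (\<phi> x))) \<partial>P)"
      unfolding G_def hP[symmetric] by (rule nn_integral_add) measurable
    also have "(\<integral>\<^sup>+x. indicator {c} (\<phi> x) * (r x * (w (\<phi> x) * S (\<phi> x))) \<partial>P) = (\<integral>\<^sup>+x. (w c * S c) * (indicator {c} (\<phi> x) * r x) \<partial>P)"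
      by (intro nn_integral_cong) (auto simp: indicator_def ac_simps)
    also have "\<dots> = w c * S c * R c" unfolding R_def by (rule nn_integral_cmult) measurable
    also have "\<dots> = min (R c) (S c)" using wRS[of c] by (simp add: ac_simps)
    also have "G + min (R c) (S c) = min (G + R c) (G + S c)"
      by (simp add: min_def)
    finally show ?thesis by (simp add: Pc Qc)
  qed
  from that[OF 1 2 3 4 5 6] show thesis by blast
qed

lemma (in prob_space) AE_eq_1I:
  fixes f :: "'a \<Rightarrow> ennreal"
  assumes [measurable]: "f \<in> borel_measurable M" and "\<And>x. x \<in> space M \<Longrightarrow> f x \<le> 1" and "1 \<le> (\<integral>\<^sup>+x. f x \<partial>M)"
  shows "AE x in M. f x = 1"
proof -
  have le: "(\<integral>\<^sup>+x. f x \<partial>M) \<le> (\<integral>\<^sup>+x. 1 \<partial>M)" by (intro nn_integral_mono) (use assms in auto)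
  then have eq: "(\<integral>\<^sup>+x. f x \<partial>M) = 1" using assms(3) by (simp add: emeasure_space_1)
  have "(\<integral>\<^sup>+x. 1 - f x \<partial>M) = (\<integral>\<^sup>+x. 1 \<partial>M) - (\<integral>\<^sup>+x. f x \<partial>M)"
    by (intro nn_integral_diff) (use assms eq in auto)
  then have "(\<integral>\<^sup>+x. 1 - f x \<partial>M) = 0" by (simp add: eq emeasure_space_1)
  then have "AE x in M. 1 - f x = 0" by (subst (asm) nn_integral_0_iff_AE) auto
  with AE_space show ?thesis
    by eventually_elim (use assms(2) in \<open>auto simp: diff_eq_0_iff_ennreal intro: antisym\<close>)
qed

text \<open>\<open>F 0\<close> and \<open>H 0\<close> are the finest partitions, \<open>F m\<close>
  and \<open>H m\<close> the trivial ones. Matching from fine to coarse only ever adds mass, so the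
  final \<open>g\<close> dominates the matching of level \<open>j\<close>, which already keeps the
  smaller of the two masses of each cell inside that cell. Only the excess of a cell can leave
  it.\<close>

lemma tree_coupling:
  fixes F :: "nat \<Rightarrow> 'a \<Rightarrow> 'c" and H :: "nat \<Rightarrow> 'b \<Rightarrow> 'c"
  assumes P: "prob_space P" and Q: "prob_space Q"
    and F[measurable]: "\<And>j. F j \<in> P \<rightarrow>\<^sub>M count_space UNIV" and H[measurable]: "\<And>j. H j \<in> Q \<rightarrow>\<^sub>M count_space UNIV"
    and nested: "\<And>j x y. F j x = H j y \<Longrightarrow> F (Suc j) x = H (Suc j) y"
    and top: "\<And>x. F m x = c0" "\<And>y. H m y = c0"
    and cnt: "countable (UNIV :: 'c set)"
  obtains g :: "'a \<times> 'b \<Rightarrow> ennreal" where "g \<in> borel_measurable (P \<Otimes>\<^sub>M Q)"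
    "AE x in P. (\<integral>\<^sup>+y. g (x, y) \<partial>Q) = 1"
    "AE y in Q. (\<integral>\<^sup>+x. g (x, y) \<partial>P) = 1"
    "\<And>j c. j \<le> m \<Longrightarrow> (\<integral>\<^sup>+x. (\<integral>\<^sup>+y. (indicator {c} (F j x) * indicator (- {c}) (H j y)) * g (x, y) \<partial>Q) \<partial>P) \<le>
       emeasure P (F j -` {c} \<inter> space P) - emeasure Q (H j -` {c} \<inter> space Q)"
    "\<And>j c. j \<le> m \<Longrightarrow> (\<integral>\<^sup>+x. (\<integral>\<^sup>+y. (indicator (- {c}) (F j x) * indicator {c} (H j y)) * g (x, y) \<partial>Q) \<partial>P) \<le>
       emeasure Q (H j -` {c} \<inter> space Q) - emeasure P (F j -` {c} \<inter> space P)"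
proof -
  interpret P: prob_space P by fact
  interpret Q: prob_space Q by fact
  interpret PQ: pair_sigma_finite P Q ..
  define mass where "mass j c = min (emeasure P (F j -` {c} \<inter> space P)) (emeasure Q (H j -` {c} \<inter> space Q))" for j c
  define ok where "ok j g \<longleftrightarrow> g \<in> borel_measurable (P \<Otimes>\<^sub>M Q) \<and>
    (\<forall>x\<in>space P. (\<integral>\<^sup>+y. g (x, y) \<partial>Q) \<le> 1) \<and> (\<forall>y\<in>space Q. (\<integral>\<^sup>+x. g (x, y) \<partial>P) \<le> 1) \<and>
    (\<forall>x y. F j x \<noteq> H j y \<longrightarrow> g (x, y) = 0) \<and>
    (\<forall>c. (\<integral>\<^sup>+x. (\<integral>\<^sup>+y. indicator {c} (F j x) * g (x, y) \<partial>Q) \<partial>P) = mass j c)" for j and g :: "'a \<times> 'b \<Rightarrow> ennreal"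
  have "\<exists>G. \<forall>j. ok j (G j) \<and> (\<forall>z. G j z \<le> G (Suc j) z)"
  proof (rule dependent_nat_choice)
    show "\<exists>g. ok 0 g"
    proof (rule matching_step[OF P Q F H, of "\<lambda>_. 0" 0 0])
      fix g' assume "g' \<in> borel_measurable (P \<Otimes>\<^sub>M Q)"
        "\<And>x. x \<in> space P \<Longrightarrow> (\<integral>\<^sup>+y. g' (x, y) \<partial>Q) \<le> 1"
        "\<And>y. y \<in> space Q \<Longrightarrow> (\<integral>\<^sup>+x. g' (x, y) \<partial>P) \<le> 1"
        "\<And>x y. F 0 x \<noteq> H 0 y \<Longrightarrow> g' (x, y) = 0"
        "\<And>c. (\<integral>\<^sup>+x. (\<integral>\<^sup>+y. indicator {c} (F 0 x) * g' (x, y) \<partial>Q) \<partial>P) =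
           min (emeasure P (F 0 -` {c} \<inter> space P)) (emeasure Q (H 0 -` {c} \<inter> space Q))"
      then show ?thesis unfolding ok_def mass_def by blast
    qed (auto simp: cnt)
  next
    fix g j assume g: "ok j g"
    show "\<exists>g'. ok (Suc j) g' \<and> (\<forall>z. g z \<le> g' z)"
    proof (rule matching_step[OF P Q F H, of g "Suc j" "Suc j"])
      fix g' assume "g' \<in> borel_measurable (P \<Otimes>\<^sub>M Q)"
        "\<And>x. x \<in> space P \<Longrightarrow> (\<integral>\<^sup>+y. g' (x, y) \<partial>Q) \<le> 1"
        "\<And>y. y \<in> space Q \<Longrightarrow> (\<integral>\<^sup>+x. g' (x, y) \<partial>P) \<le> 1"
        "\<And>x y. F (Suc j) x \<noteq> H (Suc j) y \<Longrightarrow> g' (x, y) = 0"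
        "\<And>z. g z \<le> g' z"
        "\<And>c. (\<integral>\<^sup>+x. (\<integral>\<^sup>+y. indicator {c} (F (Suc j) x) * g' (x, y) \<partial>Q) \<partial>P) =
           min (emeasure P (F (Suc j) -` {c} \<inter> space P)) (emeasure Q (H (Suc j) -` {c} \<inter> space Q))"
      then show ?thesis unfolding ok_def mass_def by blast
    next
      show "g (x, y) = 0" if "F (Suc j) x \<noteq> H (Suc j) y" for x y
        using g nested[of j x y] that unfolding ok_def by blast
    qed (use g cnt in \<open>auto simp: ok_def\<close>)
  qed
  then obtain G where ok: "\<And>j. ok j (G j)" and inc: "\<And>j z. G j z \<le> G (Suc j) z" by blast
  have Gm[measurable]: "G j \<in> borel_measurable (P \<Otimes>\<^sub>M Q)"
    and GP: "x \<in> space P \<Longrightarrow> (\<integral>\<^sup>+y. G j (x, y) \<partial>Q) \<le> 1"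
    and GQ: "y \<in> space Q \<Longrightarrow> (\<integral>\<^sup>+x. G j (x, y) \<partial>P) \<le> 1"
    and supp: "F j x \<noteq> H j y \<Longrightarrow> G j (x, y) = 0"
    and ms: "(\<integral>\<^sup>+x. (\<integral>\<^sup>+y. indicator {c} (F j x) * G j (x, y) \<partial>Q) \<partial>P) = mass j c" for j x y c
    using ok[of j] unfolding ok_def by blast+
  have mono: "G j z \<le> G m z" if "j \<le> m" for j z
    using lift_Suc_mono_le[of "\<lambda>j. G j z"] inc that by blast
  have [measurable]: "(\<lambda>x. indicator A (F j x) :: ennreal) \<in> borel_measurable P"
    "(\<lambda>y. indicator A (H j y) :: ennreal) \<in> borel_measurable Q" for A j
    by (auto intro: measurable_compose[OF F] measurable_compose[OF H])
  have ms': "(\<integral>\<^sup>+x. (\<integral>\<^sup>+y. indicator {c} (H j y) * G j (x, y) \<partial>Q) \<partial>P) = mass j c" for j c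
  proof -
    have "indicator {c} (H j y) * G j (x, y) = indicator {c} (F j x) * G j (x, y)" for x y
      using supp[of j x y] by (cases "F j x = H j y") auto
    then show ?thesis by (simp add: ms)
  qed
  have sub: "a \<le> b - min b d" if "a + min b d \<le> b" "min b d \<noteq> \<infinity>" for a b d :: ennreal
    using ennreal_minus_mono[OF that(1) order.refl, of "min b d"] that(2) by simp
  have mn: "b - min b d = b - d" for b d :: ennreal
    by (cases b; cases d) (auto simp: min_def ennreal_minus top_unique ennreal_neg)
  have mfin: "mass j c \<noteq> \<infinity>" for j c
    unfolding mass_def by (metis P.emeasure_finite infinity_ennreal_def min.cobounded1 neq_top_trans)
  have 4: "(\<integral>\<^sup>+x. (\<integral>\<^sup>+y. (indicator {c} (F j x) * indicator (- {c}) (H j y)) * G m (x, y) \<partial>Q) \<partial>P) \<le>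
       emeasure P (F j -` {c} \<inter> space P) - emeasure Q (H j -` {c} \<inter> space Q)" (is "?A \<le> ?p - ?q") if "j \<le> m" for j c
  proof -
    have "?A + mass j c = (\<integral>\<^sup>+x. (\<integral>\<^sup>+y. (indicator {c} (F j x) * indicator (- {c}) (H j y)) * G m (x, y) + indicator {c} (F j x) * G j (x, y) \<partial>Q) \<partial>P)"
      unfolding ms[symmetric]
      by (subst nn_integral_add[symmetric], measurable, measurable)
        (intro nn_integral_cong nn_integral_add[symmetric]; measurable)
    \<comment> \<open>At most one of the two summands is nonzero: \<open>G j\<close> vanishes where
      the cells of level \<open>j\<close> differ, the product of indicators where they agree. Where
      it does not vanish, \<open>G j \<le> G m\<close> applies.\<close>
    also have "\<dots> \<le> (\<integral>\<^sup>+x. (\<integral>\<^sup>+y. indicator {c} (F j x) * G m (x, y) \<partial>Q) \<partial>P)"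
      using mono[OF that] supp[of j] by (intro nn_integral_mono) (auto simp: indicator_def)
    also have "\<dots> = (\<integral>\<^sup>+x. indicator {c} (F j x) * (\<integral>\<^sup>+y. G m (x, y) \<partial>Q) \<partial>P)"
      by (intro nn_integral_cong nn_integral_cmult) measurable
    also have "\<dots> \<le> (\<integral>\<^sup>+x. indicator (F j -` {c} \<inter> space P) x \<partial>P)"
      using GP by (intro nn_integral_mono) (auto simp: indicator_def)
    also have "\<dots> = ?p" by simp
    finally have "?A \<le> ?p - mass j c"
      using mfin[of j c] unfolding mass_def by (intro sub)
    then show ?thesis unfolding mass_def mn .
  qed
  have 5: "(\<integral>\<^sup>+x. (\<integral>\<^sup>+y. (indicator (- {c}) (F j x) * indicator {c} (H j y)) * G m (x, y) \<partial>Q) \<partial>P) \<le>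
       emeasure Q (H j -` {c} \<inter> space Q) - emeasure P (F j -` {c} \<inter> space P)" (is "?A \<le> ?q - ?p") if "j \<le> m" for j c
  proof -
    have "?A + mass j c = (\<integral>\<^sup>+x. (\<integral>\<^sup>+y. (indicator (- {c}) (F j x) * indicator {c} (H j y)) * G m (x, y) + indicator {c} (H j y) * G j (x, y) \<partial>Q) \<partial>P)"
      unfolding ms'[symmetric]
      by (subst nn_integral_add[symmetric], measurable, measurable)
        (intro nn_integral_cong nn_integral_add[symmetric]; measurable)
    also have "\<dots> \<le> (\<integral>\<^sup>+x. (\<integral>\<^sup>+y. indicator {c} (H j y) * G m (x, y) \<partial>Q) \<partial>P)"
      using mono[OF that] supp[of j] by (intro nn_integral_mono) (auto simp: indicator_def)
    also have "\<dots> = (\<integral>\<^sup>+y. (\<integral>\<^sup>+x. indicator {c} (H j y) * G m (x, y) \<partial>P) \<partial>Q)"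
      by (rule PQ.Fubini'[symmetric]) measurable
    also have "\<dots> = (\<integral>\<^sup>+y. indicator {c} (H j y) * (\<integral>\<^sup>+x. G m (x, y) \<partial>P) \<partial>Q)"
      by (intro nn_integral_cong nn_integral_cmult) measurable
    also have "\<dots> \<le> (\<integral>\<^sup>+y. indicator (H j -` {c} \<inter> space Q) y \<partial>Q)"
      using GQ by (intro nn_integral_mono) (auto simp: indicator_def)
    also have "\<dots> = ?q" by simp
    finally have "?A \<le> ?q - mass j c"
      using mfin[of j c] sub[of ?A ?q ?p] unfolding mass_def min.commute[of ?p ?q] by blast
    then show ?thesis unfolding mass_def min.commute[of ?p ?q] mn .
  qed
  \<comment> \<open>The top partition has one cell, so the whole unit mass is matched in the end;
    marginal densities bounded by 1 must then equal 1 almost everywhere.\<close>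
  have tot: "(\<integral>\<^sup>+x. (\<integral>\<^sup>+y. G m (x, y) \<partial>Q) \<partial>P) = 1"
  proof -
    have "F m -` {c0} \<inter> space P = space P" "H m -` {c0} \<inter> space Q = space Q" using top by auto
    then show ?thesis
      using ms[of c0 m] top by (simp add: mass_def P.emeasure_space_1 Q.emeasure_space_1)
  qed
  have 2: "AE x in P. (\<integral>\<^sup>+y. G m (x, y) \<partial>Q) = 1"
    by (rule P.AE_eq_1I) (use tot GP in auto)
  have 3: "AE y in Q. (\<integral>\<^sup>+x. G m (x, y) \<partial>P) = 1"
    by (rule Q.AE_eq_1I) (use tot GQ in \<open>auto simp: PQ.Fubini'\<close>)
  from that[OF Gm[of m] 2 3 4 5] show thesis by blast
qed

section \<open>Dyadic shells and their cubes\<close>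

definition shell :: "real ^ 'd \<Rightarrow> nat" where
  "shell x = (LEAST k. norm x \<le> 2 ^ k)"

text \<open>The cubes scale with the shell, so that every shell meets the same number of cells.\<close>

definition cell :: "nat \<Rightarrow> real ^ 'd \<Rightarrow> nat \<times> ('d \<Rightarrow> int)" where
  "cell l x = (shell x, \<lambda>i. \<lfloor>2 ^ l * (x $ i) / 2 ^ shell x\<rfloor>)"

lemma norm_le_shell: "norm x \<le> 2 ^ shell x"
proof -
  obtain k where "norm x < 2 ^ k" using real_arch_pow[of 2 "norm x"] by auto
  then have "norm x \<le> 2 ^ k" by simp
  then show ?thesis unfolding shell_def by (rule LeastI[of "\<lambda>k. norm x \<le> 2 ^ k"])
qed

text \<open>Turns exponential weights in the shell index into moments. The summand 1 accounts for
  shell 0; in every other shell the preceding power of 2 is still below the norm.\<close>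

lemma shell_le: "2 ^ shell x \<le> 1 + 2 * norm x"
proof (cases "shell x")
  case (Suc k)
  have "\<not> norm x \<le> 2 ^ k"
    using not_less_Least[of k "\<lambda>k. norm x \<le> 2 ^ k"] Suc unfolding shell_def by auto
  then show ?thesis using Suc by simp
qed simp

lemma measurable_shell[measurable]: "shell \<in> borel \<rightarrow>\<^sub>M count_space UNIV"
  unfolding shell_def by measurable

lemma measurable_cell[measurable]: "cell l \<in> borel \<rightarrow>\<^sub>M count_space UNIV"
  unfolding measurable_count_space_eq2_countable
proof (intro conjI ballI)
  fix a :: "nat \<times> ('d::finite \<Rightarrow> int)"
  have "cell l -` {a} \<inter> space borel = {x \<in> space borel. shell x = fst a \<and> (\<forall>i. \<lfloor>2 ^ l * (x $ i) / 2 ^ fst a\<rfloor> = snd a i)}"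
    by (cases a) (auto simp: cell_def fun_eq_iff)
  also have "\<dots> \<in> sets borel" by measurable
  finally show "cell l -` {a} \<inter> space borel \<in> sets (borel :: (real ^ 'd) measure)" .
qed auto

text \<open>The index of a point at level \<open>l\<close> is its index at level
  \<open>Suc l\<close> halved and rounded down.\<close>

lemma cell_nested:
  assumes "cell (Suc l) x = cell (Suc l) y" shows "cell l x = cell l y"
proof -
  have *: "\<lfloor>2 ^ l * a / b\<rfloor> = \<lfloor>2 ^ Suc l * a / b\<rfloor> div 2" for a b :: real
    using floor_divide_real_eq_div[of 2 "2 ^ Suc l * a / b"] by (simp add: field_simps)
  have "shell x = shell y" "\<And>i. \<lfloor>2 ^ Suc l * (x $ i) / 2 ^ shell x\<rfloor> = \<lfloor>2 ^ Suc l * (y $ i) / 2 ^ shell y\<rfloor>"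
    using assms by (auto simp: cell_def fun_eq_iff)
  then show ?thesis unfolding cell_def by (simp add: * del: power_Suc)
qed

text \<open>The range of indices depends on the level only, so every shell has at most the number of
  cells counted in \<open>card_cell_box\<close>.\<close>

lemma cell_index_bound:
  assumes "cell l x = (k, z)" shows "z i \<in> {- (2 ^ l) .. 2 ^ l}"
proof -
  have k: "k = shell x" and z: "z i = \<lfloor>2 ^ l * (x $ i) / 2 ^ shell x\<rfloor>" using assms by (auto simp: cell_def)
  have "\<bar>x $ i\<bar> \<le> 2 ^ shell x" using component_le_norm_cart[of x i] norm_le_shell[of x] by linarith
  then have "\<bar>2 ^ l * (x $ i) / 2 ^ shell x\<bar> \<le> 2 ^ l"
    by (simp add: abs_mult field_simps)
  then have "2 ^ l * (x $ i) / 2 ^ shell x \<le> of_int (2 ^ l)" "of_int (- (2 ^ l)) \<le> 2 ^ l * (x $ i) / 2 ^ shell x"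
    unfolding abs_le_iff by auto
  then show ?thesis unfolding z by (auto simp: le_floor_iff floor_le_iff)
qed

text \<open>The dimension appears as a factor because the norm is estimated by the sum of the
  coordinates.\<close>

lemma dist_cell:
  fixes x y :: "real ^ 'd"
  assumes "cell l x = cell l y"
  shows "dist x y \<le> real CARD('d) * 2 ^ shell x / 2 ^ l"
proof -
  have k: "shell x = shell y" and e: "\<lfloor>2 ^ l * (x $ i) / 2 ^ shell x\<rfloor> = \<lfloor>2 ^ l * (y $ i) / 2 ^ shell y\<rfloor>" for i
    using assms by (auto simp: cell_def fun_eq_iff)
  have "\<bar>x $ i - y $ i\<bar> \<le> 2 ^ shell x / 2 ^ l" for i
  proof -
    have "\<bar>2 ^ l * (x $ i) / 2 ^ shell x - 2 ^ l * (y $ i) / 2 ^ shell x\<bar> \<le> 1"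
      using e[of i] unfolding k by linarith
    then have "\<bar>2 ^ l / 2 ^ shell x * (x $ i - y $ i)\<bar> \<le> 1" by (simp add: right_diff_distrib)
    then have "2 ^ l / 2 ^ shell x * \<bar>x $ i - y $ i\<bar> \<le> 1" by (simp add: abs_mult)
    then show ?thesis by (simp add: divide_simps mult.commute)
  qed
  then have "(\<Sum>i\<in>UNIV. \<bar>(x - y) $ i\<bar>) \<le> (\<Sum>i\<in>(UNIV :: 'd set). 2 ^ shell x / 2 ^ l)"
    by (intro sum_mono) simp
  then show ?thesis using norm_le_l1_cart[of "x - y"] by (simp add: dist_norm)
qed

text \<open>If \<open>l\<close> is the first level separating \<open>x\<close> and \<open>y\<close>, their distance is at most the diameter
  of the common cell at level \<open>l - 1\<close>.\<close>

lemma dist_powr_le_cells: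
  fixes x y :: "real ^ 'd"
  assumes r: "0 < r"
  shows "dist x y powr r \<le> (2 * real CARD('d)) powr r *
     ((\<Sum>l\<le>L. of_bool (cell l x \<noteq> cell l y) * (2 powr (r * (real (shell x) - real l)) + 2 powr (r * (real (shell y) - real l)))) +
      2 powr (r * (real (shell x) - real L)))"
proof -
  let ?d = "2 * real CARD('d)"
  let ?t = "\<lambda>x l. 2 powr (real (shell x) - real l)"
  have d: "2 \<le> ?d" by (simp add: Suc_leI)
  have pp: "?t x l powr r = 2 powr (r * (real (shell x) - real l))" for x :: "real ^ 'd" and l
    by (simp add: powr_powr ac_simps)
  have t: "?t x l = 2 ^ shell x / 2 ^ l" for x :: "real ^ 'd" and l
    by (simp add: powr_diff powr_realpow)
  let ?s = "\<lambda>l. of_bool (cell l x \<noteq> cell l y) * (?t x l powr r + ?t y l powr r)"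
  have "dist x y powr r \<le> ?d powr r * ((\<Sum>l\<le>L. ?s l) + ?t x L powr r)"
  proof (cases "\<exists>l\<le>L. cell l x \<noteq> cell l y")
    case False
    then have "dist x y \<le> real CARD('d) * ?t x L" using dist_cell[of L x y] by (simp add: t)
    also have "\<dots> \<le> ?d * ?t x L" by simp
    finally have "dist x y powr r \<le> (?d * ?t x L) powr r" using r by (intro powr_mono2) auto
    also have "\<dots> = ?d powr r * ?t x L powr r" by (simp add: powr_mult)
    also have "\<dots> \<le> ?d powr r * ((\<Sum>l\<le>L. ?s l) + ?t x L powr r)"
      by (intro mult_left_mono) (auto intro!: sum_nonneg)
    finally show ?thesis .
  next
    case True
    define l where "l = (LEAST l. cell l x \<noteq> cell l y)"
    have l: "cell l x \<noteq> cell l y" using True unfolding l_def by (metis (mono_tags, lifting) LeastI)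
    have lL: "l \<le> L" using True unfolding l_def by (meson Least_le order_trans)
    have "dist x y \<le> ?d * max (?t x l) (?t y l)"
    proof (cases l)
      \<comment> \<open>There is no coarser common cell, and the shells of the two points may
        differ. The norms themselves are bounded by the shells, whence the maximum over both
        points.\<close>
      case 0
      have "dist x y \<le> norm x + norm y" by (simp add: dist_norm norm_triangle_ineq4)
      also have "\<dots> \<le> ?t x l + ?t y l" unfolding t using norm_le_shell[of x] norm_le_shell[of y] 0 by simp
      also have "\<dots> \<le> 2 * max (?t x l) (?t y l)" by simp
      also have "\<dots> \<le> ?d * max (?t x l) (?t y l)" using d by (intro mult_right_mono) (auto simp: le_max_iff_disj)
      finally show ?thesis .
    next
      case (Suc l')
      \<comment> \<open>The parent cell is twice as large; this is the factor 2 in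
        \<open>?d\<close>.\<close>
      then have "cell l' x = cell l' y" using not_less_Least[of l' "\<lambda>l. cell l x \<noteq> cell l y"] unfolding l_def by auto
      then have "dist x y \<le> real CARD('d) * (2 * ?t x l)" using dist_cell[of l' x y] Suc unfolding t by simp
      also have "\<dots> \<le> ?d * max (?t x l) (?t y l)" by (simp add: mult_left_mono)
      finally show ?thesis .
    qed
    then have "dist x y powr r \<le> (?d * max (?t x l) (?t y l)) powr r" using r by (intro powr_mono2) auto
    also have "\<dots> = ?d powr r * max (?t x l) (?t y l) powr r" by (simp add: powr_mult le_max_iff_disj)
    also have "max (?t x l) (?t y l) powr r \<le> ?t x l powr r + ?t y l powr r" by (simp add: max_def)
    also have "\<dots> = ?s l" using l by simp
    also have "\<dots> \<le> (\<Sum>l\<le>L. ?s l)" using lL by (intro member_le_sum) auto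
    also have "\<dots> \<le> (\<Sum>l\<le>L. ?s l) + ?t x L powr r" by simp
    finally show ?thesis by (simp add: mult_left_mono)
  qed
  then show ?thesis unfolding pp .
qed

section \<open>Wasserstein distance and cell discrepancies\<close>

text \<open>Subtraction on \<^typ>\<open>ennreal\<close> is truncated, so the two differences add up to the absolute value.
  The last term is the cost of the pairs that share a cell at level \<open>L\<close>.\<close>

definition discrepancy :: "real \<Rightarrow> nat \<Rightarrow> (real ^ 'd) measure \<Rightarrow> (real ^ 'd) measure \<Rightarrow> ennreal" where
  "discrepancy r L m m' =
     (\<Sum>l\<le>L. ennreal (2 powr (- (r * real l))) *
        (\<integral>\<^sup>+c. ennreal (2 powr (r * real (fst c))) *
           ((emeasure m (cell l -` {c}) - emeasure m' (cell l -` {c})) +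
            (emeasure m' (cell l -` {c}) - emeasure m (cell l -` {c}))) \<partial>count_space UNIV)) +
     ennreal (2 powr (- (r * real L))) * (\<integral>\<^sup>+x. ennreal (2 powr (r * real (shell x))) \<partial>m)"

lemma powr_add3_le:
  fixes a b c r :: real
  assumes "0 \<le> a" "0 \<le> b" "0 \<le> c" "0 < r"
  shows "(a + b + c) powr r \<le> 3 powr r * (a powr r + b powr r + c powr r)"
proof -
  have "(a + b + c) powr r \<le> (3 * max a (max b c)) powr r"
    using assms by (intro powr_mono2) auto
  also have "\<dots> = 3 powr r * max a (max b c) powr r"
    using assms by (simp add: powr_mult le_max_iff_disj)
  also have "\<dots> \<le> 3 powr r * (a powr r + b powr r + c powr r)"
    using assms by (intro mult_left_mono) (auto simp: max_def)
  finally show ?thesis .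
qed

text \<open>The coupling is a density on the product of the underlying spaces, not on the product of
  the laws. It therefore couples \<open>X'\<close> and \<open>Z'\<close> as well as \<open>X\<close>
  and \<open>Z\<close>, at the cost of two more terms in the triangle inequality, and no couplings
  have to be glued. In this way laws at a time \<open>t\<close> are compared through the discrepancy
  at a nearby grid time.\<close>

lemma wasserstein_le_discrepancy:
  fixes X X' :: "'a \<Rightarrow> real ^ 'd" and Z Z' :: "'b \<Rightarrow> real ^ 'd"
  assumes r: "0 < r" and P: "prob_space P" and Q: "prob_space Q"
    and [measurable]: "X \<in> borel_measurable P" "X' \<in> borel_measurable P" "Z \<in> borel_measurable Q" "Z' \<in> borel_measurable Q"
  shows "wasserstein r (distr P borel X') (distr Q borel Z') epowr r \<le>
    ennreal (3 powr r) * ((\<integral>\<^sup>+x. ennreal (dist (X' x) (X x) powr r) \<partial>P) + (\<integral>\<^sup>+y. ennreal (dist (Z' y) (Z y) powr r) \<partial>Q) +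
      ennreal ((2 * real CARD('d)) powr r) * discrepancy r L (distr P borel X) (distr Q borel Z))"
proof -
  interpret P: prob_space P by fact
  interpret Q: prob_space Q by fact
  interpret PQ: pair_sigma_finite P Q ..
  \<comment> \<open>\<open>tree_coupling\<close> proceeds from fine to coarse while cells are
    numbered from coarse to fine. At level 0 the shells are still separate cells, so
    \<open>None\<close> at index \<open>Suc L\<close> supplies the trivial partition.\<close>
  define F where "F j x = (if j \<le> L then Some (cell (L - j) (X x)) else None)" for j x
  define H where "H j x = (if j \<le> L then Some (cell (L - j) (Z x)) else None)" for j x
  have [measurable]: "F j \<in> P \<rightarrow>\<^sub>M count_space UNIV" "H j \<in> Q \<rightarrow>\<^sub>M count_space UNIV" for j
    unfolding F_def H_def by (cases "j \<le> L"; simp)+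
  have nested: "F (Suc j) x = H (Suc j) y" if "F j x = H j y" for j x y
  proof (cases "Suc j \<le> L")
    case True
    then have "cell (Suc (L - Suc j)) (X x) = cell (Suc (L - Suc j)) (Z y)"
      using that by (simp add: F_def H_def Suc_diff_Suc)
    then show ?thesis using True cell_nested by (auto simp: F_def H_def)
  qed (simp add: F_def H_def)
  obtain g :: "'a \<times> 'b \<Rightarrow> ennreal" where g[measurable]: "g \<in> borel_measurable (P \<Otimes>\<^sub>M Q)"
    and gP: "AE x in P. (\<integral>\<^sup>+y. g (x, y) \<partial>Q) = 1"
    and gQ: "AE y in Q. (\<integral>\<^sup>+x. g (x, y) \<partial>P) = 1"
    and mis1: "\<And>j c. j \<le> Suc L \<Longrightarrow> (\<integral>\<^sup>+x. (\<integral>\<^sup>+y. (indicator {c} (F j x) * indicator (- {c}) (H j y)) * g (x, y) \<partial>Q) \<partial>P) \<le>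
       emeasure P (F j -` {c} \<inter> space P) - emeasure Q (H j -` {c} \<inter> space Q)"
    and mis2: "\<And>j c. j \<le> Suc L \<Longrightarrow> (\<integral>\<^sup>+x. (\<integral>\<^sup>+y. (indicator (- {c}) (F j x) * indicator {c} (H j y)) * g (x, y) \<partial>Q) \<partial>P) \<le>
       emeasure Q (H j -` {c} \<inter> space Q) - emeasure P (F j -` {c} \<inter> space P)"
  proof (rule tree_coupling[OF P Q, of F H "Suc L" None])
  qed (use nested in \<open>auto simp: F_def H_def\<close>)
  let ?PQ = "P \<Otimes>\<^sub>M Q"
  \<comment> \<open>As \<open>g\<close> integrates to 1 over the second variable, functions of the
    first variable keep their integral; this gives the marginals of \<open>\<pi>\<close> and all
    cost terms that involve one space only.\<close>
  have Ix: "(\<integral>\<^sup>+z. g z * f (fst z) \<partial>?PQ) = (\<integral>\<^sup>+x. f x \<partial>P)" if [measurable]: "f \<in> borel_measurable P" for f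
  proof -
    have "(\<integral>\<^sup>+z. g z * f (fst z) \<partial>?PQ) = (\<integral>\<^sup>+x. (\<integral>\<^sup>+y. g (x, y) * f x \<partial>Q) \<partial>P)"
      by (subst Q.nn_integral_fst[symmetric]) auto
    also have "\<dots> = (\<integral>\<^sup>+x. (\<integral>\<^sup>+y. g (x, y) \<partial>Q) * f x \<partial>P)"
      by (intro nn_integral_cong nn_integral_multc) measurable
    also have "\<dots> = (\<integral>\<^sup>+x. f x \<partial>P)"
      by (intro nn_integral_cong_AE) (use gP in eventually_elim, simp)
    finally show ?thesis .
  qed
  have Iy: "(\<integral>\<^sup>+z. g z * f (snd z) \<partial>?PQ) = (\<integral>\<^sup>+x. f x \<partial>Q)" if [measurable]: "f \<in> borel_measurable Q" for f
  proof -
    have "(\<integral>\<^sup>+z. g z * f (snd z) \<partial>?PQ) = (\<integral>\<^sup>+y. (\<integral>\<^sup>+x. g (x, y) * f y \<partial>P) \<partial>Q)"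
      by (subst PQ.nn_integral_snd[symmetric]) auto
    also have "\<dots> = (\<integral>\<^sup>+y. (\<integral>\<^sup>+x. g (x, y) \<partial>P) * f y \<partial>Q)"
      by (intro nn_integral_cong nn_integral_multc) measurable
    also have "\<dots> = (\<integral>\<^sup>+x. f x \<partial>Q)"
      by (intro nn_integral_cong_AE) (use gQ in eventually_elim, simp)
    finally show ?thesis .
  qed
  define \<pi> where "\<pi> = distr (density ?PQ g) borel (\<lambda>z. (X' (fst z), Z' (snd z)))"
  have pim[measurable]: "(\<lambda>z. (X' (fst z), Z' (snd z))) \<in> borel_measurable (density ?PQ g)"
    by (simp add: borel_prod[symmetric])
  have \<pi>: "\<pi> \<in> couplings (distr P borel X') (distr Q borel Z')"
  proof -
    have 1: "distr \<pi> borel fst = distr (density ?PQ g) borel (\<lambda>z. X' (fst z))"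
      unfolding \<pi>_def by (subst distr_distr) (auto simp: comp_def simp flip: borel_prod)
    have 2: "distr \<pi> borel snd = distr (density ?PQ g) borel (\<lambda>z. Z' (snd z))"
      unfolding \<pi>_def by (subst distr_distr) (auto simp: comp_def simp flip: borel_prod)
    have "distr (density ?PQ g) borel (\<lambda>z. X' (fst z)) = distr P borel X'"
    proof (rule measure_eqI)
      fix A assume "A \<in> sets (distr (density ?PQ g) borel (\<lambda>z. X' (fst z)))"
      then have [measurable]: "A \<in> sets borel" by simp
      have "emeasure (distr (density ?PQ g) borel (\<lambda>z. X' (fst z))) A = (\<integral>\<^sup>+z. g z * indicator A (X' (fst z)) \<partial>?PQ)"
        by (subst emeasure_distr, simp, simp, subst emeasure_density)
           (auto intro!: nn_integral_cong simp: indicator_def)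
      also have "\<dots> = (\<integral>\<^sup>+x. indicator A (X' x) \<partial>P)" by (rule Ix[of "\<lambda>x. indicator A (X' x)"]) measurable
      also have "\<dots> = emeasure (distr P borel X') A"
        by (subst emeasure_distr) (auto simp flip: nn_integral_indicator intro!: nn_integral_cong simp: indicator_def)
      finally show "emeasure (distr (density ?PQ g) borel (\<lambda>z. X' (fst z))) A = emeasure (distr P borel X') A" .
    qed simp
    moreover have "distr (density ?PQ g) borel (\<lambda>z. Z' (snd z)) = distr Q borel Z'"
    proof (rule measure_eqI)
      fix A assume "A \<in> sets (distr (density ?PQ g) borel (\<lambda>z. Z' (snd z)))"
      then have [measurable]: "A \<in> sets borel" by simp
      have "emeasure (distr (density ?PQ g) borel (\<lambda>z. Z' (snd z))) A = (\<integral>\<^sup>+z. g z * indicator A (Z' (snd z)) \<partial>?PQ)"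
        by (subst emeasure_distr, simp, simp, subst emeasure_density)
           (auto intro!: nn_integral_cong simp: indicator_def)
      also have "\<dots> = (\<integral>\<^sup>+x. indicator A (Z' x) \<partial>Q)" by (rule Iy[of "\<lambda>x. indicator A (Z' x)"]) measurable
      also have "\<dots> = emeasure (distr Q borel Z') A"
        by (subst emeasure_distr) (auto simp flip: nn_integral_indicator intro!: nn_integral_cong simp: indicator_def)
      finally show "emeasure (distr (density ?PQ g) borel (\<lambda>z. Z' (snd z))) A = emeasure (distr Q borel Z') A" .
    qed simp
    ultimately show ?thesis by (simp add: couplings_def 1 2) (simp add: \<pi>_def)
  qed
  have 1: "(\<integral>\<^sup>+z. g z * ennreal (dist (X (fst z)) (Z (snd z)) powr r) \<partial>?PQ) \<le>
     ennreal ((2 * real CARD('d)) powr r) * discrepancy r L (distr P borel X) (distr Q borel Z)"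
  proof -
    let ?s = "\<lambda>x. 2 powr (r * real (shell x)) :: real"
    let ?e = "\<lambda>l. 2 powr (- (r * real l)) :: real"
    let ?N = "\<lambda>l z. of_bool (cell l (X (fst z)) \<noteq> cell l (Z (snd z))) :: ennreal"
    have [measurable]: "?N l \<in> borel_measurable ?PQ" for l
    proof -
      have eq: "count_space UNIV \<Otimes>\<^sub>M count_space UNIV = (count_space UNIV :: ((nat \<times> ('d \<Rightarrow> int)) \<times> (nat \<times> ('d \<Rightarrow> int))) measure)"
        by (simp add: pair_measure_countable)
      have "(\<lambda>z. (cell l (X (fst z)), cell l (Z (snd z)))) \<in> ?PQ \<rightarrow>\<^sub>M (count_space UNIV :: ((nat \<times> ('d \<Rightarrow> int)) \<times> (nat \<times> ('d \<Rightarrow> int))) measure)"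
        unfolding eq[symmetric] by measurable
      from measurable_compose[OF this, of "\<lambda>(a, b). of_bool (a \<noteq> b) :: ennreal" borel] show ?thesis by simp
    qed
    have [measurable]: "(\<lambda>x. ?s (X x)) \<in> borel_measurable P" "(\<lambda>x. ?s (Z x)) \<in> borel_measurable Q" by measurable
    have s: "2 powr (r * (real a - real b)) = ?e b * 2 powr (r * real a)" for a b
      by (simp add: powr_add[symmetric] algebra_simps)
    have pw: "ennreal (dist (X (fst z)) (Z (snd z)) powr r) \<le> ennreal ((2 * real CARD('d)) powr r) *
       ((\<Sum>l\<le>L. ennreal (?e l) * (?N l z * ennreal (?s (X (fst z))) + ?N l z * ennreal (?s (Z (snd z))))) + ennreal (?e L) * ennreal (?s (X (fst z))))" for z
    proof -
      have "ennreal (dist (X (fst z)) (Z (snd z)) powr r) \<le> ennreal ((2 * real CARD('d)) powr r *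
        ((\<Sum>l\<le>L. ?e l * (of_bool (cell l (X (fst z)) \<noteq> cell l (Z (snd z))) * ?s (X (fst z)) + of_bool (cell l (X (fst z)) \<noteq> cell l (Z (snd z))) * ?s (Z (snd z)))) + ?e L * ?s (X (fst z))))"
        using dist_powr_le_cells[OF r, of "X (fst z)" "Z (snd z)" L]
        unfolding s by (intro ennreal_leI) (simp add: distrib_left ac_simps)
      also have "\<dots> = ennreal ((2 * real CARD('d)) powr r) *
       ((\<Sum>l\<le>L. ennreal (?e l) * (?N l z * ennreal (?s (X (fst z))) + ?N l z * ennreal (?s (Z (snd z))))) + ennreal (?e L) * ennreal (?s (X (fst z))))"
        by (simp add: ennreal_mult sum_nonneg sum_ennreal[symmetric] of_bool_def if_distrib[of ennreal] cong: if_cong)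
      finally show ?thesis .
    qed
    define D where "D l c = ennreal (?e l) * (ennreal (2 powr (r * real (fst c))))" for l :: nat and c :: "nat \<times> ('d \<Rightarrow> int)"
    have mX: "emeasure P (F (L - l) -` {Some c} \<inter> space P) = emeasure (distr P borel X) (cell l -` {c})"
      and mZ: "emeasure Q (H (L - l) -` {Some c} \<inter> space Q) = emeasure (distr Q borel Z) (cell l -` {c})" if "l \<le> L" for l c
    proof -
      have [measurable]: "cell l -` {c} \<in> sets borel"
        using measurable_sets[OF measurable_cell[of l], of "{c}"] by simp
      show "emeasure P (F (L - l) -` {Some c} \<inter> space P) = emeasure (distr P borel X) (cell l -` {c})"
        using that by (subst emeasure_distr) (auto simp: F_def intro!: arg_cong[of _ _ "emeasure P"])
      show "emeasure Q (H (L - l) -` {Some c} \<inter> space Q) = emeasure (distr Q borel Z) (cell l -` {c})"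
        using that by (subst emeasure_distr) (auto simp: H_def intro!: arg_cong[of _ _ "emeasure Q"])
    qed
    have A1: "(\<integral>\<^sup>+z. g z * (?N l z * ennreal (?s (X (fst z)))) \<partial>?PQ) \<le> (\<integral>\<^sup>+c. ennreal (2 powr (r * real (fst c))) *
           (emeasure (distr P borel X) (cell l -` {c}) - emeasure (distr Q borel Z) (cell l -` {c})) \<partial>count_space UNIV)" if l: "l \<le> L" for l
    proof -
      let ?I = "\<lambda>c z. (indicator {c} (cell l (X (fst z))) * indicator (- {c}) (cell l (Z (snd z)))) * g z :: ennreal"
      have [measurable]: "(\<lambda>x. indicator A (cell l (X x)) :: ennreal) \<in> borel_measurable P"
        "(\<lambda>x. indicator A (cell l (Z x)) :: ennreal) \<in> borel_measurable Q" for A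
        by (rule measurable_compose[of _ _ "count_space UNIV"], measurable)+
      \<comment> \<open>The pairs separated at level \<open>l\<close> are sorted by the cell of
        \<open>X\<close>; for given \<open>z\<close> a single \<open>c\<close> contributes. The
        weight depends on \<open>c\<close> alone, since the shell is the first component of the
        cell, so \<open>mis1\<close> can be applied cell by cell.\<close>
      have pt: "g z * (?N l z * ennreal (?s (X (fst z)))) = (\<integral>\<^sup>+c. ennreal (2 powr (r * real (fst c))) * ?I c z \<partial>count_space UNIV)" for z
      proof -
        have "(\<integral>\<^sup>+c. ennreal (2 powr (r * real (fst c))) * ?I c z \<partial>count_space UNIV) =
           (\<integral>\<^sup>+c. (g z * (?N l z * ennreal (?s (X (fst z))))) * indicator {cell l (X (fst z))} c \<partial>count_space UNIV)"
          by (intro nn_integral_cong) (auto simp: indicator_def cell_def ac_simps)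
        then show ?thesis by (simp add: nn_integral_cmult_indicator)
      qed
      have "(\<integral>\<^sup>+z. g z * (?N l z * ennreal (?s (X (fst z)))) \<partial>?PQ) = (\<integral>\<^sup>+c. (\<integral>\<^sup>+z. ennreal (2 powr (r * real (fst c))) * ?I c z \<partial>?PQ) \<partial>count_space UNIV)"
        unfolding pt by (rule nn_integral_count_space_nn_integral) (simp, measurable)
      also have "\<dots> \<le> (\<integral>\<^sup>+c. ennreal (2 powr (r * real (fst c))) * (emeasure (distr P borel X) (cell l -` {c}) - emeasure (distr Q borel Z) (cell l -` {c})) \<partial>count_space UNIV)"
      proof (intro nn_integral_mono)
        fix c :: "nat \<times> ('d \<Rightarrow> int)"
        have "(\<integral>\<^sup>+z. ?I c z \<partial>?PQ) = (\<integral>\<^sup>+x. (\<integral>\<^sup>+y. ?I c (x, y) \<partial>Q) \<partial>P)"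
          by (subst Q.nn_integral_fst[symmetric]) auto
        also have "\<dots> \<le> (emeasure (distr P borel X) (cell l -` {c}) - emeasure (distr Q borel Z) (cell l -` {c}))"
          using mis1[of "L - l" "Some c"] l unfolding mX[OF l] mZ[OF l] by (simp add: F_def H_def indicator_def)
        finally have "(\<integral>\<^sup>+z. ?I c z \<partial>?PQ) \<le> (emeasure (distr P borel X) (cell l -` {c}) - emeasure (distr Q borel Z) (cell l -` {c}))" .
        then show "(\<integral>\<^sup>+z. ennreal (2 powr (r * real (fst c))) * ?I c z \<partial>?PQ) \<le> ennreal (2 powr (r * real (fst c))) * (emeasure (distr P borel X) (cell l -` {c}) - emeasure (distr Q borel Z) (cell l -` {c}))"
          by (subst nn_integral_cmult) (auto intro!: mult_left_mono)
      qed
      finally show ?thesis .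
    qed
    have A2: "(\<integral>\<^sup>+z. g z * (?N l z * ennreal (?s (Z (snd z)))) \<partial>?PQ) \<le> (\<integral>\<^sup>+c. ennreal (2 powr (r * real (fst c))) *
           (emeasure (distr Q borel Z) (cell l -` {c}) - emeasure (distr P borel X) (cell l -` {c})) \<partial>count_space UNIV)" if l: "l \<le> L" for l
    proof -
      let ?I = "\<lambda>c z. (indicator (- {c}) (cell l (X (fst z))) * indicator {c} (cell l (Z (snd z)))) * g z :: ennreal"
      have [measurable]: "(\<lambda>x. indicator A (cell l (X x)) :: ennreal) \<in> borel_measurable P"
        "(\<lambda>x. indicator A (cell l (Z x)) :: ennreal) \<in> borel_measurable Q" for A
        by (rule measurable_compose[of _ _ "count_space UNIV"], measurable)+
      have pt: "g z * (?N l z * ennreal (?s (Z (snd z)))) = (\<integral>\<^sup>+c. ennreal (2 powr (r * real (fst c))) * ?I c z \<partial>count_space UNIV)" for z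
      proof -
        have "(\<integral>\<^sup>+c. ennreal (2 powr (r * real (fst c))) * ?I c z \<partial>count_space UNIV) =
           (\<integral>\<^sup>+c. (g z * (?N l z * ennreal (?s (Z (snd z))))) * indicator {cell l (Z (snd z))} c \<partial>count_space UNIV)"
          by (intro nn_integral_cong) (auto simp: indicator_def cell_def ac_simps)
        then show ?thesis by (simp add: nn_integral_cmult_indicator)
      qed
      have "(\<integral>\<^sup>+z. g z * (?N l z * ennreal (?s (Z (snd z)))) \<partial>?PQ) = (\<integral>\<^sup>+c. (\<integral>\<^sup>+z. ennreal (2 powr (r * real (fst c))) * ?I c z \<partial>?PQ) \<partial>count_space UNIV)"
        unfolding pt by (rule nn_integral_count_space_nn_integral) (simp, measurable)
      also have "\<dots> \<le> (\<integral>\<^sup>+c. ennreal (2 powr (r * real (fst c))) * (emeasure (distr Q borel Z) (cell l -` {c}) - emeasure (distr P borel X) (cell l -` {c})) \<partial>count_space UNIV)"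
      proof (intro nn_integral_mono)
        fix c :: "nat \<times> ('d \<Rightarrow> int)"
        have "(\<integral>\<^sup>+z. ?I c z \<partial>?PQ) = (\<integral>\<^sup>+x. (\<integral>\<^sup>+y. ?I c (x, y) \<partial>Q) \<partial>P)"
          by (subst Q.nn_integral_fst[symmetric]) auto
        also have "\<dots> \<le> (emeasure (distr Q borel Z) (cell l -` {c}) - emeasure (distr P borel X) (cell l -` {c}))"
          using mis2[of "L - l" "Some c"] l unfolding mX[OF l] mZ[OF l] by (simp add: F_def H_def indicator_def)
        finally have "(\<integral>\<^sup>+z. ?I c z \<partial>?PQ) \<le> (emeasure (distr Q borel Z) (cell l -` {c}) - emeasure (distr P borel X) (cell l -` {c}))" .
        then show "(\<integral>\<^sup>+z. ennreal (2 powr (r * real (fst c))) * ?I c z \<partial>?PQ) \<le> ennreal (2 powr (r * real (fst c))) * (emeasure (distr Q borel Z) (cell l -` {c}) - emeasure (distr P borel X) (cell l -` {c}))"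
          by (subst nn_integral_cmult) (auto intro!: mult_left_mono)
      qed
      finally show ?thesis .
    qed
    have "(\<integral>\<^sup>+z. g z * ennreal (dist (X (fst z)) (Z (snd z)) powr r) \<partial>?PQ) \<le>
       (\<integral>\<^sup>+z. ennreal ((2 * real CARD('d)) powr r) *
       ((\<Sum>l\<le>L. ennreal (?e l) * (g z * (?N l z * ennreal (?s (X (fst z)))) + g z * (?N l z * ennreal (?s (Z (snd z)))))) + ennreal (?e L) * (g z * ennreal (?s (X (fst z))))) \<partial>?PQ)"
      by (intro nn_integral_mono order.trans[OF mult_left_mono[OF pw]]) (simp_all add: distrib_left sum_distrib_left ac_simps)
    also have "\<dots> = ennreal ((2 * real CARD('d)) powr r) *
       ((\<Sum>l\<le>L. ennreal (?e l) * ((\<integral>\<^sup>+z. g z * (?N l z * ennreal (?s (X (fst z)))) \<partial>?PQ) + (\<integral>\<^sup>+z. g z * (?N l z * ennreal (?s (Z (snd z)))) \<partial>?PQ))) + ennreal (?e L) * (\<integral>\<^sup>+z. g z * ennreal (?s (X (fst z))) \<partial>?PQ))"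
      by (simp add: nn_integral_cmult nn_integral_add nn_integral_sum)
    also have "\<dots> \<le> ennreal ((2 * real CARD('d)) powr r) * discrepancy r L (distr P borel X) (distr Q borel Z)"
      unfolding discrepancy_def
    proof (intro mult_left_mono add_mono sum_mono)
      fix l assume "l \<in> {..L}"
      then have l: "l \<le> L" by simp
      show "(\<integral>\<^sup>+z. g z * (?N l z * ennreal (?s (X (fst z)))) \<partial>?PQ) + (\<integral>\<^sup>+z. g z * (?N l z * ennreal (?s (Z (snd z)))) \<partial>?PQ) \<le>
         (\<integral>\<^sup>+c. ennreal (2 powr (r * real (fst c))) *
           ((emeasure (distr P borel X) (cell l -` {c}) - emeasure (distr Q borel Z) (cell l -` {c})) +
            (emeasure (distr Q borel Z) (cell l -` {c}) - emeasure (distr P borel X) (cell l -` {c}))) \<partial>count_space UNIV)"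
        using add_mono[OF A1[OF l] A2[OF l]] by (simp add: distrib_left nn_integral_add)
    next
      show "(\<integral>\<^sup>+z. g z * ennreal (?s (X (fst z))) \<partial>?PQ) \<le> (\<integral>\<^sup>+x. ennreal (2 powr (r * real (shell x))) \<partial>distr P borel X)"
        by (subst Ix[of "\<lambda>x. ennreal (?s (X x))"]) (auto simp: nn_integral_distr)
    qed auto
    finally show ?thesis .
  qed
  have "wasserstein r (distr P borel X') (distr Q borel Z') epowr r \<le> (\<integral>\<^sup>+z. ennreal (dist (fst z) (snd z) powr r) \<partial>\<pi>)"
    by (rule wasserstein_le_coupling[OF r \<pi>])
  also have "\<dots> = (\<integral>\<^sup>+z. g z * ennreal (dist (X' (fst z)) (Z' (snd z)) powr r) \<partial>?PQ)"
    unfolding \<pi>_def by (subst nn_integral_distr, simp, simp add: borel_prod[symmetric], subst nn_integral_density) (auto simp: )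
  also have "\<dots> \<le> (\<integral>\<^sup>+z. ennreal (3 powr r) * (g z * ennreal (dist (X' (fst z)) (X (fst z)) powr r) +
      g z * ennreal (dist (Z' (snd z)) (Z (snd z)) powr r) + g z * ennreal (dist (X (fst z)) (Z (snd z)) powr r)) \<partial>?PQ)"
  proof (intro nn_integral_mono)
    fix z
    let ?a = "dist (X' (fst z)) (X (fst z))" and ?b = "dist (Z' (snd z)) (Z (snd z))" and ?c = "dist (X (fst z)) (Z (snd z))"
    have "dist (X' (fst z)) (Z' (snd z)) \<le> ?a + ?b + ?c"
      using dist_triangle[of "X' (fst z)" "Z' (snd z)" "X (fst z)"] dist_triangle[of "X (fst z)" "Z' (snd z)" "Z (snd z)"] by (simp add: dist_commute)
    then have "dist (X' (fst z)) (Z' (snd z)) powr r \<le> (?a + ?b + ?c) powr r" using r by (intro powr_mono2) auto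
    also have "\<dots> \<le> 3 powr r * (?a powr r + ?b powr r + ?c powr r)" by (rule powr_add3_le) (use r in auto)
    finally have "ennreal (dist (X' (fst z)) (Z' (snd z)) powr r) \<le> ennreal (3 powr r) * (ennreal (?a powr r) + ennreal (?b powr r) + ennreal (?c powr r))"
      by (simp add: ennreal_mult[symmetric] ennreal_plus[symmetric] ennreal_leI del: ennreal_plus)
    then have "g z * ennreal (dist (X' (fst z)) (Z' (snd z)) powr r) \<le> g z * (ennreal (3 powr r) * (ennreal (?a powr r) + ennreal (?b powr r) + ennreal (?c powr r)))"
      by (rule mult_left_mono) simp
    then show "g z * ennreal (dist (X' (fst z)) (Z' (snd z)) powr r) \<le> ennreal (3 powr r) * (g z * ennreal (?a powr r) + g z * ennreal (?b powr r) + g z * ennreal (?c powr r))"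
      by (simp add: distrib_left ac_simps)
  qed
  also have "\<dots> = ennreal (3 powr r) * ((\<integral>\<^sup>+z. g z * ennreal (dist (X' (fst z)) (X (fst z)) powr r) \<partial>?PQ) +
      (\<integral>\<^sup>+z. g z * ennreal (dist (Z' (snd z)) (Z (snd z)) powr r) \<partial>?PQ) + (\<integral>\<^sup>+z. g z * ennreal (dist (X (fst z)) (Z (snd z)) powr r) \<partial>?PQ))"
    by (simp add: nn_integral_cmult nn_integral_add)
  also have "(\<integral>\<^sup>+z. g z * ennreal (dist (X' (fst z)) (X (fst z)) powr r) \<partial>?PQ) = (\<integral>\<^sup>+x. ennreal (dist (X' x) (X x) powr r) \<partial>P)"
    by (rule Ix[of "\<lambda>x. ennreal (dist (X' x) (X x) powr r)"]) measurable
  also have "(\<integral>\<^sup>+z. g z * ennreal (dist (Z' (snd z)) (Z (snd z)) powr r) \<partial>?PQ) = (\<integral>\<^sup>+x. ennreal (dist (Z' x) (Z x) powr r) \<partial>Q)"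
    by (rule Iy[of "\<lambda>x. ennreal (dist (Z' x) (Z x) powr r)"]) measurable
  finally show ?thesis
    using 1 by (meson add_left_mono mult_left_mono order.trans zero_le)
qed

subsection \<open>Empirical measures\<close>

lemma ennreal_le_of_power2_le:
  fixes x :: ennreal
  assumes "x\<^sup>2 \<le> ennreal a"
  shows "x \<le> ennreal (sqrt a)"
proof (cases "0 \<le> a")
  case True
  obtain y where y: "0 \<le> y" "x = ennreal y"
    using assms by (cases x) (auto simp: power2_eq_square ennreal_top_mult top_unique)
  then show ?thesis using assms True by (auto simp: ennreal_power intro!: ennreal_leI real_le_rsqrt)
next
  case False
  then have "x\<^sup>2 = 0" using assms by (simp add: ennreal_neg)
  then show ?thesis by simp
qed

text \<open>Pairwise independence removes the off-diagonal covariances, and each diagonal one is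
  \<open>a - a * a \<le> a\<close>. Keeping the factor \<open>a\<close> makes the bound summable
  over the cells.\<close>

lemma (in prob_space) empirical_second_moment:
  assumes n: "n \<ge> 1" and ev[measurable]: "\<And>i. i < n \<Longrightarrow> Ev i \<in> events"
    and a: "\<And>i. i < n \<Longrightarrow> prob (Ev i) = a"
    and ind: "\<And>i k. i < n \<Longrightarrow> k < n \<Longrightarrow> i \<noteq> k \<Longrightarrow> prob (Ev i \<inter> Ev k) = a * a"
  shows "(\<integral>\<^sup>+\<omega>. ennreal (((1 / real n) * (\<Sum>i<n. indicator (Ev i) \<omega>) - a)\<^sup>2) \<partial>M) \<le> ennreal (a / real n)"
proof -
  let ?x = "\<lambda>i \<omega>. indicator (Ev i) \<omega> - a :: real"
  have a0: "0 \<le> a" using a[of 0] n by (metis measure_nonneg less_le_trans zero_less_one)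
  have sq: "((1 / real n) * (\<Sum>i<n. indicator (Ev i) \<omega>) - a)\<^sup>2 = (\<Sum>i<n. \<Sum>k<n. ?x i \<omega> * ?x k \<omega>) / (real n)\<^sup>2" for \<omega>
  proof -
    have "(1 / real n) * (\<Sum>i<n. indicator (Ev i) \<omega>) - a = (\<Sum>i<n. ?x i \<omega>) / real n"
      using n by (simp add: sum_subtractf field_simps)
    then show ?thesis by (simp add: power_divide power2_eq_square sum_product)
  qed
  have int: "integrable M (\<lambda>\<omega>. ?x i \<omega> * ?x k \<omega>)" if "i < n" "k < n" for i k
  proof (rule integrable_const_bound[of _ "(1 + \<bar>a\<bar>) * (1 + \<bar>a\<bar>)"])
    have b: "\<bar>indicator A x - a\<bar> \<le> 1 + \<bar>a\<bar>" for A and x :: 'a by (auto simp: indicator_def)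
    show "AE \<omega> in M. norm (?x i \<omega> * ?x k \<omega>) \<le> (1 + \<bar>a\<bar>) * (1 + \<bar>a\<bar>)"
      unfolding real_norm_def abs_mult by (intro AE_I2 mult_mono b) auto
  qed (use that in measurable)
  have ex: "expectation (\<lambda>\<omega>. ?x i \<omega> * ?x k \<omega>) \<le> (if i = k then a else 0)" if "i < n" "k < n" for i k
  proof -
    have "expectation (\<lambda>\<omega>. ?x i \<omega> * ?x k \<omega>) = expectation (\<lambda>\<omega>. indicator (Ev i \<inter> Ev k) \<omega> - a * indicator (Ev i) \<omega> - a * indicator (Ev k) \<omega> + a * a)"
      by (intro Bochner_Integration.integral_cong) (auto simp: indicator_def algebra_simps)
    also have "\<dots> = prob (Ev i \<inter> Ev k) - a * a"
    proof -
      have i: "integrable M (indicator A :: _ \<Rightarrow> real)" "expectation (indicator A) = prob A" if "A \<in> events" for A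
        using that by (simp_all add: emeasure_eq_measure sets.Int_space_eq2)
      have "Ev i \<in> events" "Ev k \<in> events" "Ev i \<inter> Ev k \<in> events" using that ev by auto
      then show ?thesis using that by (simp add: i a prob_space)
    qed
    also have "\<dots> \<le> (if i = k then a else 0)"
      using ind[OF that] a[OF that(1)] a0 by auto
    finally show ?thesis .
  qed
  have "(\<integral>\<^sup>+\<omega>. ennreal (((1 / real n) * (\<Sum>i<n. indicator (Ev i) \<omega>) - a)\<^sup>2) \<partial>M)
     = ennreal (expectation (\<lambda>\<omega>. (\<Sum>i<n. \<Sum>k<n. ?x i \<omega> * ?x k \<omega>) / (real n)\<^sup>2))"
    unfolding sq
  proof (rule nn_integral_eq_integral)
    show "integrable M (\<lambda>\<omega>. (\<Sum>i<n. \<Sum>k<n. ?x i \<omega> * ?x k \<omega>) / (real n)\<^sup>2)"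
      by (intro integrable_divide Bochner_Integration.integrable_sum int) auto
  qed (simp add: sq[symmetric])
  also have "expectation (\<lambda>\<omega>. (\<Sum>i<n. \<Sum>k<n. ?x i \<omega> * ?x k \<omega>) / (real n)\<^sup>2) = (\<Sum>i<n. \<Sum>k<n. expectation (\<lambda>\<omega>. ?x i \<omega> * ?x k \<omega>)) / (real n)\<^sup>2"
  proof -
    have "expectation (\<lambda>\<omega>. \<Sum>i<n. \<Sum>k<n. ?x i \<omega> * ?x k \<omega>) = (\<Sum>i<n. expectation (\<lambda>\<omega>. \<Sum>k<n. ?x i \<omega> * ?x k \<omega>))"
      by (intro Bochner_Integration.integral_sum Bochner_Integration.integrable_sum int) auto
    also have "\<dots> = (\<Sum>i<n. \<Sum>k<n. expectation (\<lambda>\<omega>. ?x i \<omega> * ?x k \<omega>))"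
      by (intro sum.cong Bochner_Integration.integral_sum int) auto
    finally show ?thesis by simp
  qed
  also have "\<dots> \<le> (\<Sum>i<n. \<Sum>k<n. if i = k then a else 0) / (real n)\<^sup>2"
    using ex by (intro divide_right_mono sum_mono) auto
  also have "\<dots> = a / real n"
    using n by (simp add: sum.delta power2_eq_square)
  finally show ?thesis by (simp add: ennreal_leI)
qed

section \<open>Expected discrepancy of an empirical measure\<close>

lemma nn_integral_shell_eq_cells:
  fixes m :: "(real ^ 'd) measure"
  assumes [measurable_cong]: "sets m = sets borel"
  shows "(\<integral>\<^sup>+c. f (fst c) * emeasure m (cell l -` {c}) \<partial>count_space UNIV) = (\<integral>\<^sup>+x. f (shell x) \<partial>m)"
proof -
  have [measurable]: "cell l -` {c} \<in> sets borel" for c :: "nat \<times> ('d \<Rightarrow> int)"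
    using measurable_sets[OF measurable_cell[of l], of "{c}"] by simp
  have "(\<integral>\<^sup>+c. f (fst c) * emeasure m (cell l -` {c}) \<partial>count_space UNIV) = (\<integral>\<^sup>+c. (\<integral>\<^sup>+x. f (fst c) * indicator (cell l -` {c}) x \<partial>m) \<partial>count_space UNIV)"
    by (intro nn_integral_cong, subst nn_integral_cmult_indicator) (auto simp: assms)
  also have "\<dots> = (\<integral>\<^sup>+x. (\<integral>\<^sup>+c. f (fst c) * indicator (cell l -` {c}) x \<partial>count_space UNIV) \<partial>m)"
    by (rule nn_integral_count_space_nn_integral[symmetric]) auto
  also have "\<dots> = (\<integral>\<^sup>+x. (\<integral>\<^sup>+c. f (shell x) * indicator {cell l x} c \<partial>count_space UNIV) \<partial>m)"
    by (intro nn_integral_cong) (auto simp: indicator_def cell_def)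
  also have "\<dots> = (\<integral>\<^sup>+x. f (shell x) \<partial>m)"
    by (simp add: nn_integral_cmult_indicator)
  finally show ?thesis .
qed

definition cell_box :: "nat \<Rightarrow> ('d::finite \<Rightarrow> int) set" where
  "cell_box l = {z. \<forall>i. z i \<in> {- (2 ^ l) .. 2 ^ l}}"

lemma finite_cell_box: "finite (cell_box l :: ('d::finite \<Rightarrow> int) set)"
  and card_cell_box: "real (card (cell_box l :: ('d::finite \<Rightarrow> int) set)) \<le> 3 ^ CARD('d) * 2 ^ (l * CARD('d))"
proof -
  have eq: "(cell_box l :: ('d \<Rightarrow> int) set) = (\<Pi>\<^sub>E i\<in>UNIV. {- (2 ^ l) .. 2 ^ l})"
    by (auto simp: cell_box_def PiE_def)
  show "finite (cell_box l :: ('d \<Rightarrow> int) set)" unfolding eq by (rule finite_PiE) auto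
  have "real (card (cell_box l :: ('d \<Rightarrow> int) set)) = real (nat (1 + 2 * 2 ^ l)) ^ CARD('d)"
    unfolding eq by (subst card_PiE) (auto simp: algebra_simps)
  also have "real (nat (1 + 2 * 2 ^ l)) = 1 + 2 * 2 ^ l"
    by (simp add: of_nat_nat)
  also have "(1 + 2 * 2 ^ l :: real) ^ CARD('d) \<le> (3 * 2 ^ l) ^ CARD('d)"
    by (intro power_mono) auto
  also have "\<dots> = 3 ^ CARD('d) * 2 ^ (l * CARD('d))"
    by (simp add: power_mult_distrib power_mult)
  finally show "real (card (cell_box l :: ('d \<Rightarrow> int) set)) \<le> 3 ^ CARD('d) * 2 ^ (l * CARD('d))" .
qed

text \<open>The second factor of the Cauchy-Schwarz inequality in
  \<open>expected_discrepancy\<close>. The number of boxes is the same in every shell, so the sum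
  over the shells is a geometric series.\<close>

lemma cell_weight_sum:
  assumes "0 < \<delta>"
  shows "(\<integral>\<^sup>+c. ennreal (2 powr (- \<delta> * real (fst c))) * indicator (cell_box l) (snd c) \<partial>count_space (UNIV :: (nat \<times> ('d::finite \<Rightarrow> int)) set))
     \<le> ennreal (3 ^ CARD('d) / (1 - 2 powr - \<delta>) * 2 ^ (l * CARD('d)))"
proof -
  let ?B = "cell_box l :: ('d \<Rightarrow> int) set"
  have "2 powr - \<delta> < 2 powr (0::real)" using assms by (intro powr_less_mono) auto
  then have q: "2 powr - \<delta> < (1::real)" by simp
  have "(\<integral>\<^sup>+c. ennreal (2 powr (- \<delta> * real (fst c))) * indicator (cell_box l) (snd c) \<partial>count_space (UNIV :: (nat \<times> ('d::finite \<Rightarrow> int)) set))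
     = (\<integral>\<^sup>+k. (\<integral>\<^sup>+z. ennreal (2 powr (- \<delta> * real k)) * indicator ?B z \<partial>count_space UNIV) \<partial>count_space UNIV)"
    by (subst nn_integral_fst_count_space[symmetric]) simp
  also have "\<dots> = (\<integral>\<^sup>+k. ennreal (2 powr (- \<delta> * real k)) * of_nat (card ?B) \<partial>count_space UNIV)"
    by (simp add: nn_integral_cmult_indicator finite_cell_box)
  also have "\<dots> = (\<integral>\<^sup>+k. ennreal (2 powr (- \<delta> * real k)) \<partial>count_space UNIV) * of_nat (card ?B)"
    by (rule nn_integral_multc) simp
  also have "(\<integral>\<^sup>+k. ennreal (2 powr (- \<delta> * real k)) \<partial>count_space UNIV) = (\<Sum>k. ennreal ((2 powr - \<delta>) ^ k))"
  proof -
    have "(2 powr - \<delta>) ^ k = 2 powr (- \<delta> * real k)" for k :: nat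
      by (simp add: powr_realpow[symmetric] powr_powr)
    then show ?thesis by (simp add: nn_integral_count_space_nat)
  qed
  also have "\<dots> = ennreal (1 / (1 - 2 powr - \<delta>))"
    using q by (intro suminf_ennreal_eq geometric_sums) auto
  also have "\<dots> * of_nat (card ?B) = ennreal (1 / (1 - 2 powr - \<delta>) * real (card ?B))"
    using q by (subst ennreal_mult) (auto simp: ennreal_of_nat_eq_real_of_nat)
  also have "\<dots> \<le> ennreal (1 / (1 - 2 powr - \<delta>) * (3 ^ CARD('d) * 2 ^ (l * CARD('d))))"
    using q by (intro ennreal_leI mult_left_mono card_cell_box) auto
  finally show ?thesis by simp
qed

lemma borel_measurable_nn_integral_count_space:
  fixes f :: "'c :: countable \<Rightarrow> 'a \<Rightarrow> ennreal"
  assumes "\<And>c. f c \<in> borel_measurable M"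
  shows "(\<lambda>x. \<integral>\<^sup>+c. f c x \<partial>count_space UNIV) \<in> borel_measurable M"
proof (rule sigma_finite_measure.borel_measurable_nn_integral[OF sigma_finite_measure_count_space])
  have "(\<lambda>(c, x). f c x) \<in> borel_measurable (count_space UNIV \<Otimes>\<^sub>M M)"
    by (rule measurable_pair_measure_countable1) (simp_all add: assms)
  from measurable_pair_swap[OF this]
  show "(\<lambda>(x, c). f c x) \<in> borel_measurable (M \<Otimes>\<^sub>M count_space UNIV)" by simp
qed

lemma nn_integral_empirical:
  fixes x :: "nat \<Rightarrow> real ^ 'd"
  assumes n: "n \<ge> 1" and [measurable]: "f \<in> borel_measurable borel"
  shows "(\<integral>\<^sup>+y. f y \<partial>empirical n x) = ennreal (1 / real n) * (\<Sum>i<n. f (x i))"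
proof -
  have "(\<integral>\<^sup>+y. f y \<partial>empirical n x) = (\<integral>\<^sup>+i. f (x i) \<partial>uniform_count_measure {..<n})"
    unfolding empirical_def
  proof (rule nn_integral_distr)
    show "x \<in> uniform_count_measure {..<n} \<rightarrow>\<^sub>M borel"
      by (simp add: measurable_def space_uniform_count_measure sets_uniform_count_measure)
  qed measurable
  also have "\<dots> = (\<Sum>i<n. f (x i) * ennreal (1 / real n))"
    unfolding uniform_count_measure_def by (subst nn_integral_point_measure_finite) (auto simp: ac_simps)
  finally show ?thesis by (simp add: sum_distrib_left ac_simps)
qed

text \<open>The root of the sum of squares over \<open>J\<close> majorises the deviation at each
  \<open>j\<close>, so one \<open>\<Psi>\<close> serves all of \<open>J\<close> and the expected
  cell deviations grow only like \<open>sqrt (card J)\<close>. The last term of the discrepancy is a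
  random shell moment; its majorant \<open>e\<close> is likewise chosen independently of
  \<open>j\<close>.\<close>

lemma (in prob_space) expected_discrepancy:
  fixes Y :: "nat \<Rightarrow> 'j \<Rightarrow> 'a \<Rightarrow> real ^ 'd" and \<mu> :: "'j \<Rightarrow> (real ^ 'd) measure"
  assumes n: "n \<ge> 1" and r: "0 < r" and \<delta>: "0 < \<delta>" and J: "finite J"
    and Y[measurable]: "\<And>i j. i < n \<Longrightarrow> j \<in> J \<Longrightarrow> Y i j \<in> borel_measurable M"
    and law: "\<And>i j. i < n \<Longrightarrow> j \<in> J \<Longrightarrow> distr M borel (Y i j) = \<mu> j"
    and ind: "\<And>i k j A. i < n \<Longrightarrow> k < n \<Longrightarrow> i \<noteq> k \<Longrightarrow> j \<in> J \<Longrightarrow> A \<in> sets borel \<Longrightarrow>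
       prob {\<omega> \<in> space M. Y i j \<omega> \<in> A \<and> Y k j \<omega> \<in> A} = measure (\<mu> j) A * measure (\<mu> j) A"
    and mom: "\<And>j. j \<in> J \<Longrightarrow> (\<integral>\<^sup>+x. ennreal (2 powr ((2 * r + \<delta>) * real (shell x))) \<partial>\<mu> j) \<le> ennreal K" and K: "0 \<le> K"
    and e[measurable]: "\<And>i. i < n \<Longrightarrow> e i \<in> borel_measurable M" and eY: "\<And>i j \<omega>. i < n \<Longrightarrow> j \<in> J \<Longrightarrow> \<omega> \<in> space M \<Longrightarrow> ennreal (2 powr (r * real (shell (Y i j \<omega>)))) \<le> e i \<omega>"
    and eK: "\<And>i. i < n \<Longrightarrow> (\<integral>\<^sup>+\<omega>. e i \<omega> \<partial>M) \<le> ennreal K"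
  obtains \<Psi> where "\<Psi> \<in> borel_measurable M"
    "\<And>j \<omega>. j \<in> J \<Longrightarrow> \<omega> \<in> space M \<Longrightarrow> discrepancy r L (empirical n (\<lambda>i. Y i j \<omega>)) (\<mu> j) \<le> \<Psi> \<omega>"
    "(\<integral>\<^sup>+\<omega>. \<Psi> \<omega> \<partial>M) \<le> ennreal (sqrt (3 ^ CARD('d) / (1 - 2 powr - \<delta>) * K) * (\<Sum>l\<le>L. 2 powr (- (r * real l)) * sqrt (2 ^ (l * CARD('d)) * real (card J) / real n))
        + K * 2 powr (- (r * real L)))"
proof -
  have cm[measurable]: "cell l -` {c} \<in> sets borel" for l and c :: "nat \<times> ('d \<Rightarrow> int)"
    using measurable_sets[OF measurable_cell[of l], of "{c}"] by simp
  define V where "V l c j \<omega> = (1 / real n) * (\<Sum>i<n. indicator (cell l -` {c}) (Y i j \<omega>)) - measure (\<mu> j) (cell l -` {c})" for l c j \<omega>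
  have [measurable]: "V l c j \<in> borel_measurable M" if "j \<in> J" for l c j
    unfolding V_def using that by (intro borel_measurable_diff borel_measurable_times borel_measurable_sum) auto
  have \<mu>p: "prob_space (\<mu> j)" and \<mu>s[measurable_cong]: "sets (\<mu> j) = sets borel" if "j \<in> J" for j
  proof -
    have "0 < n" using n by simp
    note * = prob_space_distr[OF Y[OF this that]] law[OF this that]
    then show "prob_space (\<mu> j)" by simp
    have "sets (distr M borel (Y 0 j)) = sets borel" by simp
    then show "sets (\<mu> j) = sets borel" unfolding * .
  qed
  define \<Psi> where "\<Psi> \<omega> = (\<Sum>l\<le>L. ennreal (2 powr (- (r * real l))) *
        (\<integral>\<^sup>+c. ennreal (2 powr (r * real (fst c))) * ennreal (sqrt (\<Sum>j\<in>J. (V l c j \<omega>)\<^sup>2)) \<partial>count_space UNIV))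
      + ennreal (2 powr (- (r * real L))) * (ennreal (1 / real n) * (\<Sum>i<n. e i \<omega>))" for \<omega>
  have [measurable]: "(\<lambda>\<omega>. sqrt (\<Sum>j\<in>J. (V l c j \<omega>)\<^sup>2)) \<in> borel_measurable M" for l c
    by measurable
  have [measurable]: "(\<lambda>\<omega>. \<integral>\<^sup>+c. ennreal (2 powr (r * real (fst c))) * ennreal (sqrt (\<Sum>j\<in>J. (V l c j \<omega>)\<^sup>2)) \<partial>count_space UNIV) \<in> borel_measurable M" for l
    by (rule borel_measurable_nn_integral_count_space) measurable
  have 1: "\<Psi> \<in> borel_measurable M"
    unfolding \<Psi>_def by measurable
  have 2: "discrepancy r L (empirical n (\<lambda>i. Y i j \<omega>)) (\<mu> j) \<le> \<Psi> \<omega>" if j: "j \<in> J" and \<omega>: "\<omega> \<in> space M" for j \<omega>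
  proof -
    interpret \<mu>: prob_space "\<mu> j" by (rule \<mu>p[OF j])
    let ?m = "empirical n (\<lambda>i. Y i j \<omega>)"
    have d: "(emeasure ?m (cell l -` {c}) - emeasure (\<mu> j) (cell l -` {c})) + (emeasure (\<mu> j) (cell l -` {c}) - emeasure ?m (cell l -` {c})) \<le>
       ennreal (sqrt (\<Sum>j\<in>J. (V l c j \<omega>)\<^sup>2))" for l c
    proof -
      have "(emeasure ?m (cell l -` {c}) - emeasure (\<mu> j) (cell l -` {c})) + (emeasure (\<mu> j) (cell l -` {c}) - emeasure ?m (cell l -` {c})) = ennreal \<bar>V l c j \<omega>\<bar>"
        unfolding V_def using n
        by (subst (1 2) emeasure_empirical) (auto simp: \<mu>.emeasure_eq_measure ennreal_minus sum_nonneg abs_if ennreal_neg)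
      also have "\<dots> = ennreal (sqrt ((V l c j \<omega>)\<^sup>2))" by simp
      also have "\<dots> \<le> ennreal (sqrt (\<Sum>j\<in>J. (V l c j \<omega>)\<^sup>2))"
        using J j by (intro ennreal_leI real_sqrt_le_mono member_le_sum) auto
      finally show ?thesis .
    qed
    have "(\<integral>\<^sup>+x. ennreal (2 powr (r * real (shell x))) \<partial>?m) = ennreal (1 / real n) * (\<Sum>i<n. ennreal (2 powr (r * real (shell (Y i j \<omega>)))))"
      by (rule nn_integral_empirical[OF n]) measurable
    also have "\<dots> \<le> ennreal (1 / real n) * (\<Sum>i<n. e i \<omega>)"
      using eY j \<omega> by (intro mult_left_mono sum_mono) auto
    finally have "(\<integral>\<^sup>+x. ennreal (2 powr (r * real (shell x))) \<partial>?m) \<le> ennreal (1 / real n) * (\<Sum>i<n. e i \<omega>)" .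
    then show ?thesis unfolding discrepancy_def \<Psi>_def
      using d by (intro add_mono mult_left_mono sum_mono nn_integral_mono) auto
  qed
  \<comment> \<open>The square of the mean is at most the mean of the square, and the latter is a
    sum of variances.\<close>
  have V1: "(\<integral>\<^sup>+\<omega>. ennreal (sqrt (\<Sum>j\<in>J. (V l c j \<omega>)\<^sup>2)) \<partial>M) \<le> ennreal (sqrt ((\<Sum>j\<in>J. measure (\<mu> j) (cell l -` {c})) / real n))" for l c
  proof (rule ennreal_le_of_power2_le)
    have "(\<integral>\<^sup>+\<omega>. ennreal (sqrt (\<Sum>j\<in>J. (V l c j \<omega>)\<^sup>2)) \<partial>M)\<^sup>2 \<le> (\<integral>\<^sup>+\<omega>. (ennreal (sqrt (\<Sum>j\<in>J. (V l c j \<omega>)\<^sup>2)))\<^sup>2 \<partial>M)"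
      using Cauchy_Schwarz_nn_integral[of "\<lambda>\<omega>. ennreal (sqrt (\<Sum>j\<in>J. (V l c j \<omega>)\<^sup>2))" M "\<lambda>_. 1"] by (simp add: emeasure_space_1)
    also have "\<dots> = (\<Sum>j\<in>J. (\<integral>\<^sup>+\<omega>. ennreal ((V l c j \<omega>)\<^sup>2) \<partial>M))"
    proof -
      have "(ennreal (sqrt (\<Sum>j\<in>J. (V l c j \<omega>)\<^sup>2)))\<^sup>2 = (\<Sum>j\<in>J. ennreal ((V l c j \<omega>)\<^sup>2))" for \<omega>
      proof -
        have nn: "0 \<le> (\<Sum>j\<in>J. (V l c j \<omega>)\<^sup>2)" by (rule sum_nonneg) simp
        then have "(ennreal (sqrt (\<Sum>j\<in>J. (V l c j \<omega>)\<^sup>2)))\<^sup>2 = ennreal ((sqrt (\<Sum>j\<in>J. (V l c j \<omega>)\<^sup>2))\<^sup>2)"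
          by (intro ennreal_power) simp
        also have "(sqrt (\<Sum>j\<in>J. (V l c j \<omega>)\<^sup>2))\<^sup>2 = (\<Sum>j\<in>J. (V l c j \<omega>)\<^sup>2)" using nn by simp
        finally show ?thesis by (simp add: sum_ennreal)
      qed
      then show ?thesis by (simp add: nn_integral_sum del: sum_ennreal)
    qed
    also have "\<dots> \<le> (\<Sum>j\<in>J. ennreal (measure (\<mu> j) (cell l -` {c}) / real n))"
    proof (intro sum_mono)
      fix j assume j: "j \<in> J"
      let ?A = "cell l -` {c}"
      have p: "prob (Y i j -` ?A \<inter> space M) = measure (\<mu> j) ?A" if "i < n" for i
        unfolding law[OF that j, symmetric] using that j by (subst measure_distr) auto
      have pp: "prob ((Y i j -` ?A \<inter> space M) \<inter> (Y k j -` ?A \<inter> space M)) = measure (\<mu> j) ?A * measure (\<mu> j) ?A" if "i < n" "k < n" "i \<noteq> k" for i k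
      proof -
        have "(Y i j -` ?A \<inter> space M) \<inter> (Y k j -` ?A \<inter> space M) = {\<omega> \<in> space M. Y i j \<omega> \<in> ?A \<and> Y k j \<omega> \<in> ?A}" by blast
        then show ?thesis using ind[OF that j cm[of l c]] by simp
      qed
      have "(\<integral>\<^sup>+\<omega>. ennreal ((V l c j \<omega>)\<^sup>2) \<partial>M) = (\<integral>\<^sup>+\<omega>. ennreal (((1 / real n) * (\<Sum>i<n. indicator (Y i j -` ?A \<inter> space M) \<omega>) - measure (\<mu> j) ?A)\<^sup>2) \<partial>M)"
        unfolding V_def by (intro nn_integral_cong) (simp add: indicator_def)
      also have "\<dots> \<le> ennreal (measure (\<mu> j) ?A / real n)"
        by (rule empirical_second_moment[OF n]) (use p pp j Y in \<open>auto intro!: measurable_sets[OF Y cm]\<close>)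
      finally show "(\<integral>\<^sup>+\<omega>. ennreal ((V l c j \<omega>)\<^sup>2) \<partial>M) \<le> ennreal (measure (\<mu> j) ?A / real n)" .
    qed
    also have "\<dots> = ennreal ((\<Sum>j\<in>J. measure (\<mu> j) (cell l -` {c})) / real n)"
      by (simp add: sum_divide_distrib)
    finally show "(\<integral>\<^sup>+\<omega>. ennreal (sqrt (\<Sum>j\<in>J. (V l c j \<omega>)\<^sup>2)) \<partial>M)\<^sup>2 \<le> ennreal ((\<Sum>j\<in>J. measure (\<mu> j) (cell l -` {c})) / real n)" .
  qed
  have V2: "(\<integral>\<^sup>+c. ennreal (2 powr (r * real (fst c))) * ennreal (sqrt ((\<Sum>j\<in>J. measure (\<mu> j) (cell l -` {c})) / real n)) \<partial>count_space UNIV)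
     \<le> ennreal (sqrt (3 ^ CARD('d) / (1 - 2 powr - \<delta>) * K) * sqrt (2 ^ (l * CARD('d)) * real (card J) / real n))" (is "?I \<le> _") for l
  proof -
    let ?w = "\<lambda>c :: nat \<times> ('d \<Rightarrow> int). (\<Sum>j\<in>J. measure (\<mu> j) (cell l -` {c})) / real n"
    \<comment> \<open>The weight \<open>2 powr (r * k)\<close> is split so that the square of the
      first part yields the moment of order \<open>2 * r + \<delta>\<close> and the square of the
      second is summable over the shells.\<close>
    let ?f = "\<lambda>c :: nat \<times> ('d \<Rightarrow> int). ennreal (2 powr ((r + \<delta> / 2) * real (fst c)) * sqrt (?w c))"
    let ?g = "\<lambda>c :: nat \<times> ('d \<Rightarrow> int). ennreal (2 powr (- (\<delta> / 2) * real (fst c))) * indicator (cell_box l) (snd c)"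
    have w0: "0 \<le> ?w c" for c by (simp add: sum_nonneg)
    \<comment> \<open>Indices outside the box belong to empty cells. The indicator of the box may
      thus be inserted into \<open>?g\<close>; without it the sum over the second component would be
      infinite.\<close>
    have wz: "?w c = 0" if "snd c \<notin> cell_box l" for c
    proof -
      have "cell l -` {c} = {}" using that cell_index_bound[of l] by (cases c) (auto simp: cell_box_def)
      then show ?thesis by simp
    qed
    have "?I = (\<integral>\<^sup>+c. ?f c * ?g c \<partial>count_space UNIV)"
    proof (intro nn_integral_cong)
      fix c
      show "ennreal (2 powr (r * real (fst c))) * ennreal (sqrt (?w c)) = ?f c * ?g c"
      proof (cases "snd c \<in> cell_box l")
        case True
        have "2 powr (r * real (fst c)) = 2 powr ((r + \<delta> / 2) * real (fst c)) * 2 powr (- (\<delta> / 2) * real (fst c))"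
          by (simp add: powr_add[symmetric] algebra_simps)
        then have "2 powr (r * real (fst c)) * sqrt (?w c) = (2 powr ((r + \<delta> / 2) * real (fst c)) * sqrt (?w c)) * 2 powr (- (\<delta> / 2) * real (fst c))"
          by (simp only: ac_simps)
        then show ?thesis using True w0[of c] by (simp add: ennreal_mult[symmetric])
      next
        case False
        show ?thesis unfolding wz[OF False] by simp
      qed
    qed
    then have "?I\<^sup>2 \<le> (\<integral>\<^sup>+c. (?f c)\<^sup>2 \<partial>count_space UNIV) * (\<integral>\<^sup>+c. (?g c)\<^sup>2 \<partial>count_space UNIV)"
      by (simp only:) (rule Cauchy_Schwarz_nn_integral, simp_all)
    also have "(\<integral>\<^sup>+c. (?g c)\<^sup>2 \<partial>count_space UNIV) = (\<integral>\<^sup>+c. ennreal (2 powr (- \<delta> * real (fst c))) * indicator (cell_box l) (snd c) \<partial>count_space (UNIV :: (nat \<times> ('d \<Rightarrow> int)) set))"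
      by (intro nn_integral_cong) (auto simp: indicator_def ennreal_power power2_eq_square powr_add[symmetric] ennreal_mult[symmetric])
    also have "(\<integral>\<^sup>+c. (?f c)\<^sup>2 \<partial>count_space UNIV) = (\<integral>\<^sup>+c. ennreal (1 / real n) * (\<Sum>j\<in>J. ennreal (2 powr ((2 * r + \<delta>) * real (fst c))) * emeasure (\<mu> j) (cell l -` {c})) \<partial>count_space UNIV)"
    proof (intro nn_integral_cong)
      fix c
      have "(2 powr ((r + \<delta> / 2) * real (fst c)) * sqrt (?w c))\<^sup>2 = 2 powr ((2 * r + \<delta>) * real (fst c)) * ?w c"
      proof -
        have "(2 powr ((r + \<delta> / 2) * real (fst c)))\<^sup>2 = 2 powr ((2 * r + \<delta>) * real (fst c))"
          by (simp add: power2_eq_square powr_add[symmetric] algebra_simps)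
        then show ?thesis using w0[of c] by (simp only: power_mult_distrib real_sqrt_pow2)
      qed
      also have "\<dots> = (1 / real n) * (\<Sum>j\<in>J. 2 powr ((2 * r + \<delta>) * real (fst c)) * measure (\<mu> j) (cell l -` {c}))"
        by (simp add: sum_distrib_left sum_divide_distrib)
      finally have "(?f c)\<^sup>2 = ennreal ((1 / real n) * (\<Sum>j\<in>J. 2 powr ((2 * r + \<delta>) * real (fst c)) * measure (\<mu> j) (cell l -` {c})))"
        using w0[of c] by (simp add: ennreal_power)
      also have "\<dots> = ennreal (1 / real n) * (\<Sum>j\<in>J. ennreal (2 powr ((2 * r + \<delta>) * real (fst c))) * emeasure (\<mu> j) (cell l -` {c}))"
      proof -
        have "emeasure (\<mu> j) A = ennreal (measure (\<mu> j) A)" if "j \<in> J" for j A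
          using \<mu>p[OF that] by (simp add: finite_measure.emeasure_eq_measure prob_space.finite_measure)
        then show ?thesis
          by (subst ennreal_mult) (auto intro!: sum_nonneg simp: ennreal_mult sum_ennreal[symmetric] simp del: sum_ennreal)
      qed
      finally show "(?f c)\<^sup>2 = \<dots>" .
    qed
    also have "\<dots> = ennreal (1 / real n) * (\<Sum>j\<in>J. (\<integral>\<^sup>+x. ennreal (2 powr ((2 * r + \<delta>) * real (shell x))) \<partial>\<mu> j))"
    proof -
      have "(\<integral>\<^sup>+c. ennreal (2 powr ((2 * r + \<delta>) * real (fst c))) * emeasure (\<mu> j) (cell l -` {c}) \<partial>count_space UNIV) =
         (\<integral>\<^sup>+x. ennreal (2 powr ((2 * r + \<delta>) * real (shell x))) \<partial>\<mu> j)" if "j \<in> J" for j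
        by (rule nn_integral_shell_eq_cells[OF \<mu>s[OF that]])
      then show ?thesis by (simp add: nn_integral_cmult nn_integral_sum)
    qed
    also have "\<dots> \<le> ennreal (1 / real n) * (\<Sum>j\<in>J. ennreal K)"
      by (intro mult_left_mono sum_mono mom) auto
    also have "\<dots> = ennreal (real (card J) * K / real n)"
    proof -
      have "ennreal (1 / real n) * (\<Sum>j\<in>J. ennreal K) = ennreal (1 / real n * (\<Sum>j\<in>J. K))"
        using K by (subst ennreal_mult) (auto simp: sum_ennreal sum_nonneg simp del: sum_constant)
      then show ?thesis by simp
    qed
    finally have "?I\<^sup>2 \<le> ennreal (real (card J) * K / real n) * ennreal (3 ^ CARD('d) / (1 - 2 powr - \<delta>) * 2 ^ (l * CARD('d)))"
      using cell_weight_sum[OF \<delta>, of l, where 'd='d] by (meson mult_left_mono mult_right_mono order.trans zero_le)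
    also have "\<dots> = ennreal ((3 ^ CARD('d) / (1 - 2 powr - \<delta>) * K) * (2 ^ (l * CARD('d)) * real (card J) / real n))"
    proof -
      have "2 powr - \<delta> < 2 powr (0::real)" using \<delta> by (intro powr_less_mono) auto
      then show ?thesis using K by (subst ennreal_mult[symmetric]) (auto intro!: arg_cong[of _ _ ennreal] simp: field_simps)
    qed
    finally have "?I \<le> ennreal (sqrt ((3 ^ CARD('d) / (1 - 2 powr - \<delta>) * K) * (2 ^ (l * CARD('d)) * real (card J) / real n)))"
      by (rule ennreal_le_of_power2_le)
    then show ?thesis by (simp only: real_sqrt_mult)
  qed
  have "(\<integral>\<^sup>+\<omega>. \<Psi> \<omega> \<partial>M) = (\<Sum>l\<le>L. ennreal (2 powr (- (r * real l))) *
        (\<integral>\<^sup>+c. ennreal (2 powr (r * real (fst c))) * (\<integral>\<^sup>+\<omega>. ennreal (sqrt (\<Sum>j\<in>J. (V l c j \<omega>)\<^sup>2)) \<partial>M) \<partial>count_space UNIV))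
      + ennreal (2 powr (- (r * real L))) * (ennreal (1 / real n) * (\<Sum>i<n. (\<integral>\<^sup>+\<omega>. e i \<omega> \<partial>M)))"
  proof -
    have "(\<integral>\<^sup>+\<omega>. (\<Sum>i<n. e i \<omega>) \<partial>M) = (\<Sum>i<n. (\<integral>\<^sup>+\<omega>. e i \<omega> \<partial>M))"
      by (rule nn_integral_sum) auto
    then show ?thesis unfolding \<Psi>_def
      by (simp add: nn_integral_add nn_integral_sum nn_integral_cmult nn_integral_count_space_nn_integral)
  qed
  also have "\<dots> \<le> (\<Sum>l\<le>L. ennreal (2 powr (- (r * real l))) * ennreal (sqrt (3 ^ CARD('d) / (1 - 2 powr - \<delta>) * K) * sqrt (2 ^ (l * CARD('d)) * real (card J) / real n)))
      + ennreal (2 powr (- (r * real L))) * (ennreal (1 / real n) * (\<Sum>i<n. ennreal K))"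
    using eK by (intro add_mono sum_mono mult_left_mono order.trans[OF nn_integral_mono V2]) (auto intro!: mult_left_mono V1)
  also have "\<dots> = ennreal (sqrt (3 ^ CARD('d) / (1 - 2 powr - \<delta>) * K) * (\<Sum>l\<le>L. 2 powr (- (r * real l)) * sqrt (2 ^ (l * CARD('d)) * real (card J) / real n))
        + K * 2 powr (- (r * real L)))"
  proof -
    let ?A = "sqrt (3 ^ CARD('d) / (1 - 2 powr - \<delta>) * K)"
    let ?s = "\<lambda>l. sqrt (2 ^ (l * CARD('d)) * real (card J) / real n)"
    have "2 powr - \<delta> < 2 powr (0::real)" using \<delta> by (intro powr_less_mono) auto
    then have A: "0 \<le> ?A" using K by simp
    have "(\<Sum>l\<le>L. ennreal (2 powr (- (r * real l))) * ennreal (?A * ?s l)) = ennreal (\<Sum>l\<le>L. 2 powr (- (r * real l)) * (?A * ?s l))"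
      using A by (subst sum_ennreal[symmetric]) (auto simp: ennreal_mult)
    also have "(\<Sum>l\<le>L. 2 powr (- (r * real l)) * (?A * ?s l)) = ?A * (\<Sum>l\<le>L. 2 powr (- (r * real l)) * ?s l)"
      by (simp add: sum_distrib_left ac_simps)
    finally have 1: "(\<Sum>l\<le>L. ennreal (2 powr (- (r * real l))) * ennreal (?A * ?s l)) = ennreal (?A * (\<Sum>l\<le>L. 2 powr (- (r * real l)) * ?s l))" .
    have "ennreal (1 / real n) * (\<Sum>i<n. ennreal K) = ennreal (1 / real n * (\<Sum>i<n. K))"
      using K by (subst ennreal_mult) (auto simp: sum_ennreal sum_nonneg simp del: sum_constant)
    also have "1 / real n * (\<Sum>i<n. K) = K" using n by simp
    finally have 2: "ennreal (1 / real n) * (\<Sum>i<n. ennreal K) = ennreal K" .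
    show ?thesis unfolding 1 2 using A K
      by (subst ennreal_plus) (auto simp: ennreal_mult[symmetric] ac_simps intro!: mult_nonneg_nonneg sum_nonneg)
  qed
  finally show thesis using that[OF 1 2] by blast
qed

subsection \<open>Wiener paths\<close>

lemma nn_integral_normal_density_6:
  assumes "0 < \<sigma>"
  shows "(\<integral>\<^sup>+x. ennreal (normal_density 0 \<sigma> x) * ennreal (x ^ 6) \<partial>lborel) = ennreal (15 * \<sigma> ^ 6)"
proof -
  have "has_bochner_integral lborel (\<lambda>x. normal_density 0 \<sigma> x * (x - 0) ^ (2 * 3)) (fact (2 * 3) / ((2 / \<sigma>\<^sup>2) ^ 3 * fact 3))"
    using normal_moment_even[OF assms, of 0 3] by simp
  also have "fact (2 * 3) / ((2 / \<sigma>\<^sup>2) ^ 3 * fact 3) = 15 * \<sigma> ^ 6"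
    using assms by (simp add: fact_numeral power_divide power_mult[symmetric] field_simps)
  finally have "has_bochner_integral lborel (\<lambda>x. normal_density 0 \<sigma> x * x ^ 6) (15 * \<sigma> ^ 6)" by simp
  then have "(\<integral>\<^sup>+x. ennreal (normal_density 0 \<sigma> x * x ^ 6) \<partial>lborel) = ennreal (15 * \<sigma> ^ 6)"
    by (intro nn_integral_eq_integral[THEN trans]) (auto simp: has_bochner_integral_iff zero_le_even_power)
  then show ?thesis by (simp add: ennreal_mult zero_le_even_power)
qed

lemma Basis_vec_eq: "(Basis :: (real ^ 'd) set) = range (\<lambda>i. axis i 1)"
  by (auto simp: Basis_vec_def)

lemma inj_axis_1: "inj (\<lambda>i. axis i (1::real) :: real ^ 'd)"
  by (auto simp: inj_on_def axis_eq_axis)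

lemma nn_integral_gaussian_component_6:
  fixes j :: "'d::finite"
  assumes "0 < \<sigma>"
  shows "(\<integral>\<^sup>+x. ennreal (\<Prod>k\<in>UNIV. normal_density 0 \<sigma> ((x :: real ^ 'd) $ k)) * ennreal ((x $ j) ^ 6) \<partial>lborel) = ennreal (15 * \<sigma> ^ 6)"
proof -
  \<comment> \<open>The product formula for \<open>lborel\<close> runs over \<open>Basis\<close>;
    \<open>f b\<close> is the density in the direction \<open>b\<close>, with the sixth power
    attached in the direction of \<open>j\<close> only.\<close>
  define f where "f b y = ennreal (normal_density 0 \<sigma> y) * (if b = axis j 1 then ennreal (y ^ 6) else 1)" for b :: "real ^ 'd" and y
  have f1: "(\<integral>\<^sup>+y. f b y \<partial>lborel) = (if b = axis j 1 then ennreal (15 * \<sigma> ^ 6) else 1)" for b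
  proof (cases "b = axis j 1")
    case True
    then show ?thesis by (simp add: f_def nn_integral_normal_density_6[OF assms])
  next
    case False
    interpret N: prob_space "density lborel (normal_density 0 \<sigma>)" by (rule prob_space_normal_density[OF assms])
    have "f b = (\<lambda>y. ennreal (normal_density 0 \<sigma> y))" using False by (simp add: f_def fun_eq_iff)
    then have "(\<integral>\<^sup>+y. f b y \<partial>lborel) = emeasure (density lborel (normal_density 0 \<sigma>)) UNIV"
      by (subst emeasure_density) auto
    then show ?thesis using False N.emeasure_space_1 by simp
  qed
  have "(\<integral>\<^sup>+x. ennreal (\<Prod>k\<in>UNIV. normal_density 0 \<sigma> ((x :: real ^ 'd) $ k)) * ennreal ((x $ j) ^ 6) \<partial>lborel) =
      (\<integral>\<^sup>+x. (\<Prod>b\<in>Basis. f b (x \<bullet> b)) \<partial>lborel)"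
  proof (intro nn_integral_cong)
    fix x :: "real ^ 'd"
    have "(\<Prod>b\<in>Basis. f b (x \<bullet> b)) = (\<Prod>k\<in>UNIV. f (axis k 1) (x $ k))"
      unfolding Basis_vec_eq by (subst prod.reindex[OF inj_axis_1]) (simp add: inner_axis)
    also have "\<dots> = (\<Prod>k\<in>UNIV. ennreal (normal_density 0 \<sigma> (x $ k)) * (if k = j then ennreal ((x $ k) ^ 6) else 1))"
      by (intro prod.cong) (auto simp: f_def axis_eq_axis)
    also have "\<dots> = ennreal (\<Prod>k\<in>UNIV. normal_density 0 \<sigma> (x $ k)) * ennreal ((x $ j) ^ 6)"
      by (simp add: prod.distrib prod_ennreal prod.delta)
    finally show "ennreal (\<Prod>k\<in>UNIV. normal_density 0 \<sigma> (x $ k)) * ennreal ((x $ j) ^ 6) = (\<Prod>b\<in>Basis. f b (x \<bullet> b))" ..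
  qed
  also have "\<dots> = (\<Prod>b\<in>Basis. (\<integral>\<^sup>+y. f b y \<partial>lborel))"
    by (rule nn_integral_lborel_prod) (auto simp: f_def)
  also have "\<dots> = (\<Prod>k\<in>(UNIV::'d set). if k = j then ennreal (15 * \<sigma> ^ 6) else 1)"
    unfolding Basis_vec_eq f1 by (subst prod.reindex[OF inj_axis_1]) (simp add: axis_eq_axis)
  also have "\<dots> = ennreal (15 * \<sigma> ^ 6)" by (simp add: prod.delta)
  finally show ?thesis .
qed

lemma norm_pow6_le:
  fixes x :: "real ^ 'd"
  shows "norm x ^ 6 \<le> real CARD('d) ^ 6 * (\<Sum>j\<in>UNIV. (x $ j) ^ 6)"
proof -
  have "Max (range (\<lambda>j. \<bar>x $ j\<bar>)) \<in> range (\<lambda>j. \<bar>x $ j\<bar>)" by (rule Max_in) auto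
  then obtain i where "Max (range (\<lambda>j. \<bar>x $ j\<bar>)) = \<bar>x $ i\<bar>" by (elim rangeE)
  then have i: "\<bar>x $ j\<bar> \<le> \<bar>x $ i\<bar>" for j
    using Max_ge[of "range (\<lambda>j. \<bar>x $ j\<bar>)" "\<bar>x $ j\<bar>"] by simp
  have "norm x \<le> (\<Sum>j\<in>UNIV. \<bar>x $ j\<bar>)" by (rule norm_le_l1_cart)
  also have "\<dots> \<le> real CARD('d) * \<bar>x $ i\<bar>" using i by (intro sum_bounded_above) auto
  finally have "norm x ^ 6 \<le> (real CARD('d) * \<bar>x $ i\<bar>) ^ 6" by (intro power_mono) auto
  also have "\<dots> = real CARD('d) ^ 6 * (x $ i) ^ 6" by (simp add: power_mult_distrib power_even_abs)
  also have "\<dots> \<le> real CARD('d) ^ 6 * (\<Sum>j\<in>UNIV. (x $ j) ^ 6)"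
    by (intro mult_left_mono member_le_sum) (auto simp: zero_le_even_power)
  finally show ?thesis .
qed

text \<open>Six powers of the dimension come from \<open>norm_pow6_le\<close> and one from the sum
  over the coordinates; 15 is the sixth moment \<open>1 * 3 * 5\<close> of a standard normal
  variable. The case \<open>s = t\<close> is separate because a density exists for
  \<open>s < t\<close> only.\<close>

lemma wiener_increment_moment_6:
  fixes W :: "real \<Rightarrow> 'w \<Rightarrow> real ^ 'd"
  assumes W: "wiener_process M W" and st: "0 \<le> s" "s \<le> t"
  shows "(\<integral>\<^sup>+\<omega>. ennreal (norm (W t \<omega> - W s \<omega>) ^ 6) \<partial>M) \<le> ennreal (15 * real CARD('d) ^ 7 * (t - s) ^ 3)"
proof (cases "s = t")
  case False
  then have lt: "s < t" using st by simp
  have D: "distributed M lborel (\<lambda>\<omega>. W t \<omega> - W s \<omega>) (\<lambda>x. ennreal (\<Prod>j\<in>UNIV. normal_density 0 (sqrt (t - s)) (x $ j)))"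
    using W lt st unfolding wiener_process_def by blast
  have \<sigma>: "0 < sqrt (t - s)" using lt by simp
  have "(\<integral>\<^sup>+\<omega>. ennreal (norm (W t \<omega> - W s \<omega>) ^ 6) \<partial>M) =
      (\<integral>\<^sup>+x. ennreal (\<Prod>j\<in>UNIV. normal_density 0 (sqrt (t - s)) (x $ j)) * ennreal (norm (x :: real ^ 'd) ^ 6) \<partial>lborel)"
    using distributed_nn_integral[OF D, of "\<lambda>x. ennreal (norm x ^ 6)"] by simp
  also have "\<dots> \<le> (\<integral>\<^sup>+x. ennreal (real CARD('d) ^ 6) * (\<Sum>i\<in>UNIV. ennreal (\<Prod>j\<in>UNIV. normal_density 0 (sqrt (t - s)) (x $ j)) * ennreal (((x :: real ^ 'd) $ i) ^ 6)) \<partial>lborel)"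
  proof (intro nn_integral_mono)
    fix x :: "real ^ 'd"
    have "ennreal (norm x ^ 6) \<le> ennreal (real CARD('d) ^ 6 * (\<Sum>j\<in>UNIV. (x $ j) ^ 6))"
      by (intro ennreal_leI norm_pow6_le)
    also have "\<dots> = ennreal (real CARD('d) ^ 6) * (\<Sum>i\<in>UNIV. ennreal ((x $ i) ^ 6))"
      by (subst ennreal_mult) (auto simp: sum_nonneg zero_le_even_power sum_ennreal)
    finally have "ennreal (\<Prod>j\<in>UNIV. normal_density 0 (sqrt (t - s)) (x $ j)) * ennreal (norm x ^ 6) \<le>
      ennreal (\<Prod>j\<in>UNIV. normal_density 0 (sqrt (t - s)) (x $ j)) * (ennreal (real CARD('d) ^ 6) * (\<Sum>i\<in>UNIV. ennreal ((x $ i) ^ 6)))"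
      by (intro mult_left_mono) auto
    then show "ennreal (\<Prod>j\<in>UNIV. normal_density 0 (sqrt (t - s)) (x $ j)) * ennreal (norm x ^ 6) \<le>
      ennreal (real CARD('d) ^ 6) * (\<Sum>i\<in>UNIV. ennreal (\<Prod>j\<in>UNIV. normal_density 0 (sqrt (t - s)) (x $ j)) * ennreal ((x $ i) ^ 6))"
      by (simp add: sum_distrib_left ac_simps del: sum_ennreal)
  qed
  also have "\<dots> = ennreal (real CARD('d) ^ 6) * (\<Sum>i\<in>(UNIV::'d set). ennreal (15 * sqrt (t - s) ^ 6))"
    by (simp add: nn_integral_cmult nn_integral_sum nn_integral_gaussian_component_6[OF \<sigma>] del: sum_constant)
  also have "\<dots> = ennreal (real CARD('d) ^ 6 * (\<Sum>i\<in>(UNIV::'d set). 15 * sqrt (t - s) ^ 6))"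
    using st by (subst ennreal_mult) (auto simp: sum_ennreal simp del: sum_constant intro!: sum_nonneg)
  also have "real CARD('d) ^ 6 * (\<Sum>i\<in>(UNIV::'d set). 15 * sqrt (t - s) ^ 6) = 15 * real CARD('d) ^ 7 * (t - s) ^ 3"
  proof -
    have "sqrt (t - s) ^ 6 = (sqrt (t - s) ^ 2) ^ 3" by (simp flip: power_mult)
    also have "\<dots> = (t - s) ^ 3" using st by simp
    finally show ?thesis by (simp add: power_Suc[of _ 6, simplified] eval_nat_numeral)
  qed
  finally show ?thesis .
qed simp

text \<open>The last of the points \<open>T k / 2 ^ m\<close> that does not exceed \<open>s\<close>.
  At \<open>s = T\<close> the index is \<open>2 ^ m\<close>, so \<open>2 ^ m + 1\<close> indices
  occur although there are \<open>2 ^ m\<close> intervals.\<close>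

definition grid :: "real \<Rightarrow> nat \<Rightarrow> real \<Rightarrow> real" where
  "grid T m s = T * real_of_int \<lfloor>s * 2 ^ m / T\<rfloor> / 2 ^ m"

definition incr6 :: "real \<Rightarrow> (real \<Rightarrow> real ^ 'd) \<Rightarrow> nat \<Rightarrow> ennreal" where
  "incr6 T w m = (\<Sum>j<2 ^ m. ennreal (norm (w (T * real (Suc j) / 2 ^ m) - w (T * real j / 2 ^ m)) ^ 6))"

text \<open>Controls the oscillation of \<open>w\<close> at scale \<open>2^(-m)\<close>. For a Wiener path the expectation of the
  \<open>k\<close>-th term is of order \<open>2^(-(m + k))\<close>: sixth powers leave room for the weight \<open>2^(m + k)\<close>.\<close>

definition roughness :: "real \<Rightarrow> (real \<Rightarrow> real ^ 'd) \<Rightarrow> nat \<Rightarrow> ennreal" where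
  "roughness T w m = (\<Sum>k. ennreal (2 ^ (m + k)) * incr6 T w (m + k))"

lemma grid_bounds:
  assumes "0 < T" "s \<in> {0..T}"
  shows "grid T m s \<in> {0..T}" "grid T m s \<le> s" "s - grid T m s \<le> T / 2 ^ m"
proof -
  have g: "grid T m s * 2 ^ m / T = of_int \<lfloor>s * 2 ^ m / T\<rfloor>" using assms by (simp add: grid_def)
  have "of_int \<lfloor>s * 2 ^ m / T\<rfloor> \<le> s * 2 ^ m / T" "s * 2 ^ m / T < of_int \<lfloor>s * 2 ^ m / T\<rfloor> + 1" by linarith+
  then have "grid T m s * 2 ^ m / T \<le> s * 2 ^ m / T" "s * 2 ^ m / T < grid T m s * 2 ^ m / T + 1" unfolding g .
  then show *: "grid T m s \<le> s" "s - grid T m s \<le> T / 2 ^ m"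
    using assms(1) by (simp_all add: field_simps)
  have "0 \<le> \<lfloor>s * 2 ^ m / T\<rfloor>" using assms by auto
  then have "0 \<le> grid T m s" using assms unfolding grid_def by (intro divide_nonneg_nonneg mult_nonneg_nonneg) auto
  then show "grid T m s \<in> {0..T}" using * assms by auto
qed

lemma grid_index:
  assumes "0 < T" "s \<in> {0..T}"
  obtains k where "k \<le> 2 ^ m" "grid T m s = T * real k / 2 ^ m"
proof
  have "s * 2 ^ m / T \<le> 2 ^ m" using assms by (simp add: field_simps mult_left_mono)
  then have "\<lfloor>s * 2 ^ m / T\<rfloor> \<le> 2 ^ m" by (metis floor_mono floor_of_int of_int_numeral of_int_power)
  then show "nat \<lfloor>s * 2 ^ m / T\<rfloor> \<le> 2 ^ m" by (simp add: nat_le_iff)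
  have "0 \<le> \<lfloor>s * 2 ^ m / T\<rfloor>" using assms by auto
  then show "grid T m s = T * real (nat \<lfloor>s * 2 ^ m / T\<rfloor>) / 2 ^ m" by (simp add: grid_def)
qed

text \<open>Doubling the argument of the floor appends one binary digit to the index: digit 0 leaves
  the grid point in place, digit 1 moves it by one step of the finer grid.\<close>

lemma grid_refine:
  assumes "0 < T" "s \<in> {0..T}"
  obtains "grid T (Suc m) s = grid T m s"
  | j where "j < 2 ^ Suc m" "grid T m s = T * real j / 2 ^ Suc m" "grid T (Suc m) s = T * real (Suc j) / 2 ^ Suc m"
proof -
  define u where "u = s * 2 ^ m / T"
  have u: "s * 2 ^ Suc m / T = 2 * u" by (simp add: u_def)
  have u0: "0 \<le> \<lfloor>u\<rfloor>" "0 \<le> u" using assms by (auto simp: u_def)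
  have u1: "2 * u \<le> 2 ^ Suc m" using assms by (simp add: u_def field_simps mult_left_mono)
  have "\<lfloor>2 * u\<rfloor> = 2 * \<lfloor>u\<rfloor> \<or> \<lfloor>2 * u\<rfloor> = 2 * \<lfloor>u\<rfloor> + 1" by linarith
  then show thesis
  proof
    assume "\<lfloor>2 * u\<rfloor> = 2 * \<lfloor>u\<rfloor>"
    then have "grid T (Suc m) s = grid T m s" unfolding grid_def u by (simp add: u_def)
    then show thesis by (rule that)
  next
    assume *: "\<lfloor>2 * u\<rfloor> = 2 * \<lfloor>u\<rfloor> + 1"
    define j where "j = nat (2 * \<lfloor>u\<rfloor>)"
    have j: "real j = 2 * of_int \<lfloor>u\<rfloor>" using u0 by (simp add: j_def)
    have "real_of_int (2 * \<lfloor>u\<rfloor> + 1) \<le> 2 * u" using * by linarith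
    then have "real (Suc j) \<le> 2 ^ Suc m" using u1 j by simp
    then have "Suc j \<le> 2 ^ Suc m" by (metis of_nat_le_iff of_nat_numeral of_nat_power)
    then have "j < 2 ^ Suc m" by simp
    moreover have "grid T m s = T * real j / 2 ^ Suc m" by (simp add: j grid_def u_def)
    moreover have "grid T (Suc m) s = T * real (Suc j) / 2 ^ Suc m"
      unfolding grid_def u * by (simp add: j algebra_simps)
    ultimately show thesis by (rule that)
  qed
qed

text \<open>The sixth power of the geometric sum with ratio \<open>2 powr (- 1 / 6)\<close>, the
  factor gained per level in \<open>chaining\<close>.\<close>

definition chain_const :: real where
  "chain_const = (1 / (1 - 2 powr (- 1 / 6))) ^ 6"

text \<open>From one level to the next the grid point of \<open>s\<close> moves by at most one grid
  step, and a single term of the roughness bounds the increment over that step. Summing the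
  geometric series and using continuity at \<open>s\<close> gives the bound.\<close>

lemma chaining:
  fixes w :: "real \<Rightarrow> real ^ 'd"
  assumes T: "0 < T" and cont: "continuous_on {0..T} w" and s: "s \<in> {0..T}"
  shows "ennreal (norm (w s - w (grid T m s)) ^ 6) \<le> ennreal (chain_const / 2 ^ m) * roughness T w m"
proof -
  \<comment> \<open>The sixth root of 1/2: the weight \<open>2 ^ (m + k)\<close> bounds the sixth
    power of an increment at level \<open>m + k\<close> by \<open>(1/2) ^ (m + k)\<close> times the
    roughness.\<close>
  define \<rho> :: real where "\<rho> = 2 powr (- 1 / 6)"
  have "2 powr (- 1 / 6) < 2 powr (0::real)" by (intro powr_less_mono) auto
  then have \<rho>: "0 < \<rho>" "\<rho> < 1" by (auto simp: \<rho>_def)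
  have \<rho>6: "\<rho> ^ 6 = 1 / 2"
  proof -
    have "\<rho> ^ 6 = \<rho> powr real 6" by (rule powr_realpow[symmetric]) (rule \<rho>(1))
    also have "\<dots> = 2 powr (-1)" by (simp add: \<rho>_def powr_powr)
    finally show ?thesis by (simp add: powr_minus_divide)
  qed
  have \<rho>6n: "(\<rho> ^ k) ^ 6 = (1 / 2) ^ k" for k
    unfolding power_mult[symmetric] mult.commute[of k] power_mult[of \<rho> 6] \<rho>6 ..
  have cc: "0 < chain_const" using \<rho> unfolding chain_const_def \<rho>_def by simp
  show ?thesis
  proof (cases "roughness T w m = \<infinity>")
    case True
    then show ?thesis using cc by (simp add: ennreal_mult_top)
  next
    case False
    then obtain u where u: "0 \<le> u" "roughness T w m = ennreal u" by (cases "roughness T w m") auto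
    define a where "a = root 6 u"
    have a: "0 \<le> a" "a ^ 6 = u" using u by (auto simp: a_def real_root_pow_pos2)
    have step: "norm (w (T * real (Suc j) / 2 ^ (m + k)) - w (T * real j / 2 ^ (m + k))) \<le> \<rho> ^ (m + k) * a"
      if "j < 2 ^ (m + k)" for j k
    proof -
      let ?x = "norm (w (T * real (Suc j) / 2 ^ (m + k)) - w (T * real j / 2 ^ (m + k)))"
      have "ennreal (2 ^ (m + k)) * ennreal (?x ^ 6) \<le> ennreal (2 ^ (m + k)) * incr6 T w (m + k)"
        unfolding incr6_def using that by (intro mult_left_mono member_le_sum) auto
      also have "\<dots> \<le> roughness T w m"
        unfolding roughness_def using sum_le_suminf[of "\<lambda>k. ennreal (2 ^ (m + k)) * incr6 T w (m + k)" "{k}"] by simp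
      finally have "2 ^ (m + k) * ?x ^ 6 \<le> u"
        using u by (simp add: ennreal_mult[symmetric])
      then have "?x ^ 6 \<le> (1/2) ^ (m + k) * u" by (simp add: field_simps power_one_over)
      also have "\<dots> = (\<rho> ^ (m + k) * a) ^ 6"
        by (simp only: power_mult_distrib a \<rho>6n)
      finally show ?thesis using \<rho> a by (subst (asm) power_mono_iff) auto
    qed
    have tele: "norm (w (grid T (m + k) s) - w (grid T m s)) \<le> (\<Sum>i<k. \<rho> ^ (m + Suc i) * a)" for k
    proof (induction k)
      case (Suc k)
      have "norm (w (grid T (m + Suc k) s) - w (grid T (m + k) s)) \<le> \<rho> ^ (m + Suc k) * a"
        using T s
      proof (cases rule: grid_refine[of T s "m + k"])
        case 1
        then show ?thesis using \<rho> a by simp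
      next
        case (2 j)
        then show ?thesis using step[of j "Suc k"] by simp
      qed
      then show ?case using Suc norm_triangle_ineq[of "w (grid T (m + Suc k) s) - w (grid T (m + k) s)" "w (grid T (m + k) s) - w (grid T m s)"] by simp
    qed simp
    have "(\<Sum>i<k. \<rho> ^ (m + Suc i) * a) \<le> \<rho> ^ m * a / (1 - \<rho>)" for k
    proof -
      have "(\<Sum>i<k. \<rho> ^ (m + Suc i) * a) = (\<rho> ^ m * a * \<rho>) * (\<Sum>i<k. \<rho> ^ i)"
        by (simp add: sum_distrib_left power_add ac_simps)
      also have "(\<Sum>i<k. \<rho> ^ i) \<le> 1 / (1 - \<rho>)" using \<rho> by (simp add: sum_gp_strict field_simps)
      also have "(\<rho> ^ m * a * \<rho>) * (1 / (1 - \<rho>)) \<le> (\<rho> ^ m * a * 1) * (1 / (1 - \<rho>))"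
        using \<rho> a by (intro mult_right_mono mult_left_mono) auto
      finally show ?thesis using \<rho> a by (simp add: mult_left_mono)
    qed
    then have bd: "norm (w (grid T (m + k) s) - w (grid T m s)) \<le> \<rho> ^ m * a / (1 - \<rho>)" for k
      using tele[of k] by (meson order.trans)
    have "(\<lambda>k. grid T (m + k) s) \<longlonglongrightarrow> s"
    proof (rule tendsto_sandwich[of "\<lambda>k. s - T * (1/2) ^ k" _ _ "\<lambda>_. s"])
      have "(\<lambda>k. s - T * (1/2) ^ k) \<longlonglongrightarrow> s - T * 0" by (intro tendsto_intros LIMSEQ_power_zero) auto
      then show "(\<lambda>k. s - T * (1/2) ^ k) \<longlonglongrightarrow> s" by simp
      have "s - T * (1/2) ^ k \<le> grid T (m + k) s" for k
      proof -
        have "T / 2 ^ (m + k) \<le> T / 2 ^ k" using T by (intro divide_left_mono power_increasing) auto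
        then show ?thesis using grid_bounds[OF T s, of "m + k"] by (simp add: power_one_over)
      qed
      then show "eventually (\<lambda>k. s - T * (1/2) ^ k \<le> grid T (m + k) s) sequentially" by simp
    qed (use grid_bounds[OF T s] in auto)
    then have "(\<lambda>k. w (grid T (m + k) s)) \<longlonglongrightarrow> w s"
      using grid_bounds(1)[OF T s] s by (intro continuous_on_tendsto_compose[OF cont]) auto
    then have "(\<lambda>k. norm (w (grid T (m + k) s) - w (grid T m s))) \<longlonglongrightarrow> norm (w s - w (grid T m s))"
      by (intro tendsto_intros)
    then have "norm (w s - w (grid T m s)) \<le> \<rho> ^ m * a / (1 - \<rho>)"
      by (rule LIMSEQ_le_const2) (use bd in auto)
    then have "norm (w s - w (grid T m s)) ^ 6 \<le> (\<rho> ^ m * a / (1 - \<rho>)) ^ 6" by (intro power_mono) auto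
    also have "\<dots> = chain_const / 2 ^ m * u"
      by (simp only: chain_const_def power_divide power_mult_distrib a \<rho>6n flip: \<rho>_def) simp
    finally show ?thesis using u cc by (simp add: ennreal_mult[symmetric] ennreal_leI)
  qed
qed

lemma roughness_measurable:
  assumes W: "wiener_process M W" and T: "0 < T"
  shows "(\<lambda>\<omega>. roughness T (\<lambda>s. W s \<omega>) m) \<in> borel_measurable M"
proof -
  have [measurable]: "W t \<in> borel_measurable M" if "0 \<le> t" for t
    using W that unfolding wiener_process_def by blast
  have "(\<lambda>\<omega>. norm (W (T * real (Suc j) / 2 ^ k) \<omega> - W (T * real j / 2 ^ k) \<omega>) ^ 6) \<in> borel_measurable M" for j k
    using T by (intro borel_measurable_power borel_measurable_norm borel_measurable_diff) (auto intro!: divide_nonneg_nonneg mult_nonneg_nonneg)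
  then show ?thesis unfolding roughness_def incr6_def by measurable
qed

text \<open>Level \<open>k\<close> has \<open>2 ^ k\<close> increments with sixth moments of order
  \<open>8 ^ (- k)\<close>, together \<open>4 ^ (- k)\<close>; the weight leaves
  \<open>2 ^ (- k)\<close>. The sum 2 of the remaining geometric series turns 15 into 30.\<close>

lemma roughness_expectation:
  fixes W :: "real \<Rightarrow> 'w \<Rightarrow> real ^ 'd"
  assumes W: "wiener_process M W" and T: "0 < T"
  shows "(\<integral>\<^sup>+\<omega>. roughness T (\<lambda>s. W s \<omega>) m \<partial>M) \<le> ennreal (30 * real CARD('d) ^ 7 * T ^ 3 / 2 ^ m)"
proof -
  have [measurable]: "W t \<in> borel_measurable M" if "0 \<le> t" for t
    using W that unfolding wiener_process_def by blast
  have im[measurable]: "(\<lambda>\<omega>. norm (W (T * real (Suc j) / 2 ^ k) \<omega> - W (T * real j / 2 ^ k) \<omega>) ^ 6) \<in> borel_measurable M" for j k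
    using T by (intro borel_measurable_power borel_measurable_norm borel_measurable_diff) (auto intro!: divide_nonneg_nonneg mult_nonneg_nonneg)
  let ?c = "15 * real CARD('d) ^ 7 * T ^ 3"
  have V: "(\<integral>\<^sup>+\<omega>. incr6 T (\<lambda>s. W s \<omega>) k \<partial>M) \<le> ennreal (?c / 4 ^ k)" for k
  proof -
    have "(\<integral>\<^sup>+\<omega>. incr6 T (\<lambda>s. W s \<omega>) k \<partial>M) = (\<Sum>j<2 ^ k. \<integral>\<^sup>+\<omega>. ennreal (norm (W (T * real (Suc j) / 2 ^ k) \<omega> - W (T * real j / 2 ^ k) \<omega>) ^ 6) \<partial>M)"
      unfolding incr6_def by (rule nn_integral_sum) measurable
    also have "\<dots> \<le> (\<Sum>j<(2 ^ k::nat). ennreal (?c / 8 ^ k))"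
    proof (intro sum_mono)
      fix j
      have "(\<integral>\<^sup>+\<omega>. ennreal (norm (W (T * real (Suc j) / 2 ^ k) \<omega> - W (T * real j / 2 ^ k) \<omega>) ^ 6) \<partial>M) \<le>
        ennreal (15 * real CARD('d) ^ 7 * (T * real (Suc j) / 2 ^ k - T * real j / 2 ^ k) ^ 3)"
        using T by (intro wiener_increment_moment_6[OF W]) (auto simp: divide_right_mono)
      also have "T * real (Suc j) / 2 ^ k - T * real j / 2 ^ k = T / 2 ^ k"
        by (simp add: diff_divide_distrib[symmetric] algebra_simps)
      also have "15 * real CARD('d) ^ 7 * (T / 2 ^ k) ^ 3 = ?c / 8 ^ k"
        by (simp add: power_divide power_mult[symmetric] mult.commute[of _ 3] power_mult[of 2 3])
      finally show "(\<integral>\<^sup>+\<omega>. ennreal (norm (W (T * real (Suc j) / 2 ^ k) \<omega> - W (T * real j / 2 ^ k) \<omega>) ^ 6) \<partial>M) \<le> ennreal (?c / 8 ^ k)" .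
    qed
    also have "\<dots> = ennreal (\<Sum>j<(2 ^ k::nat). ?c / 8 ^ k)"
      using T by (intro sum_ennreal) auto
    also have "(\<Sum>j<(2 ^ k::nat). ?c / 8 ^ k) = ?c / 4 ^ k"
    proof -
      have "(8::real) ^ k = 2 ^ k * 4 ^ k" by (simp flip: power_mult_distrib)
      then show ?thesis by simp
    qed
    finally show ?thesis .
  qed
  have [measurable]: "(\<lambda>\<omega>. incr6 T (\<lambda>s. W s \<omega>) k) \<in> borel_measurable M" for k
    unfolding incr6_def by measurable
  have "(\<integral>\<^sup>+\<omega>. roughness T (\<lambda>s. W s \<omega>) m \<partial>M) = (\<Sum>k. ennreal (2 ^ (m + k)) * (\<integral>\<^sup>+\<omega>. incr6 T (\<lambda>s. W s \<omega>) (m + k) \<partial>M))"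
    unfolding roughness_def by (simp add: nn_integral_suminf nn_integral_cmult)
  also have "\<dots> \<le> (\<Sum>k. ennreal (?c / 2 ^ m * (1/2) ^ k))"
  proof (intro suminf_le allI)
    fix k
    have "ennreal (2 ^ (m + k)) * (\<integral>\<^sup>+\<omega>. incr6 T (\<lambda>s. W s \<omega>) (m + k) \<partial>M) \<le> ennreal (2 ^ (m + k)) * ennreal (?c / 4 ^ (m + k))"
      by (intro mult_left_mono V) auto
    also have "\<dots> = ennreal (2 ^ (m + k) * (?c / 4 ^ (m + k)))"
      using T by (intro ennreal_mult[symmetric]) auto
    also have "2 ^ (m + k) * (?c / 4 ^ (m + k)) = ?c / 2 ^ m * (1/2) ^ k"
    proof -
      have "(4::real) ^ (m + k) = 2 ^ (m + k) * 2 ^ (m + k)" by (simp flip: power_mult_distrib)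
      then show ?thesis by (simp add: power_add power_one_over)
    qed
    finally show "ennreal (2 ^ (m + k)) * (\<integral>\<^sup>+\<omega>. incr6 T (\<lambda>s. W s \<omega>) (m + k) \<partial>M) \<le> ennreal (?c / 2 ^ m * (1/2) ^ k)" .
  qed auto
  also have "\<dots> = ennreal (?c / 2 ^ m * 2)"
  proof (rule suminf_ennreal_eq)
    have "(\<lambda>k. (1/2::real) ^ k) sums (1 / (1 - 1/2))" by (rule geometric_sums) simp
    then show "(\<lambda>k. ?c / 2 ^ m * (1/2) ^ k) sums (?c / 2 ^ m * 2)" by (intro sums_mult) simp
  qed (use T in auto)
  finally show ?thesis by (simp add: mult.assoc)
qed

subsection \<open>Equations driven by a continuous path\<close>

text \<open>With the exponent \<open>2 * K\<close> the weight turns integration with factor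
  \<open>K\<close> into a contraction by 1/2. This serves both Gronwall's inequality and the Picard
  iteration.\<close>

lemma integral_exp_weight:
  fixes K m t :: real
  assumes "0 \<le> t"
  shows "((\<lambda>s. K * (m * exp (2 * K * s))) has_integral (m * exp (2 * K * t) - m) / 2) {0..t}"
proof -
  have "((\<lambda>s. 2 * K * m * exp (2 * K * s)) has_integral m * exp (2 * K * t) - m * exp (2 * K * 0)) {0..t}"
    by (rule fundamental_theorem_of_calculus[OF assms])
       (auto intro!: derivative_eq_intros simp flip: has_real_derivative_iff_has_vector_derivative)
  from has_integral_mult_right[OF this, of "1/2"] show ?thesis by (simp add: mult.assoc)
qed

text \<open>The constant \<open>2\<close> in front of \<open>c\<close> makes the maximum of \<open>u\<close>, weighted by \<open>exp (- 2 K t)\<close>,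
  absorb the integral term at once.\<close>

lemma gronwall:
  fixes u :: "real \<Rightarrow> real"
  assumes u: "continuous_on {0..T} u" and K: "0 \<le> K" and c: "0 \<le> c" and u0: "\<And>t. t \<in> {0..T} \<Longrightarrow> 0 \<le> u t"
    and ineq: "\<And>t. t \<in> {0..T} \<Longrightarrow> u t \<le> c + K * integral {0..t} u" and t: "t \<in> {0..T}"
  shows "u t \<le> 2 * c * exp (2 * K * T)"
proof -
  have "continuous_on {0..T} (\<lambda>t. u t * exp (- 2 * K * t))" by (intro continuous_intros u)
  moreover have "compact {0..T}" "{0..T} \<noteq> {}" using t by auto
  ultimately obtain t0 where t0: "t0 \<in> {0..T}" and mx: "\<And>s. s \<in> {0..T} \<Longrightarrow> u s * exp (- 2 * K * s) \<le> u t0 * exp (- 2 * K * t0)"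
    using continuous_attains_sup by (metis (no_types, lifting))
  define m where "m = u t0 * exp (- 2 * K * t0)"
  have m0: "0 \<le> m" using u0[OF t0] by (simp add: m_def)
  have um: "u s \<le> m * exp (2 * K * s)" if "s \<in> {0..T}" for s
  proof -
    have "u s = u s * exp (- 2 * K * s) * exp (2 * K * s)" by (simp add: exp_minus)
    also have "\<dots> \<le> m * exp (2 * K * s)" using mx[OF that] by (intro mult_right_mono) (auto simp: m_def)
    finally show ?thesis .
  qed
  have "u t0 \<le> c + K * integral {0..t0} u" by (rule ineq[OF t0])
  also have "K * integral {0..t0} u = integral {0..t0} (\<lambda>s. K * u s)" by simp
  also have "\<dots> \<le> integral {0..t0} (\<lambda>s. K * (m * exp (2 * K * s)))"
  proof (rule integral_le)
    show "(\<lambda>s. K * u s) integrable_on {0..t0}"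
      using t0 by (intro integrable_continuous_interval continuous_intros continuous_on_subset[OF u]) auto
    show "(\<lambda>s. K * (m * exp (2 * K * s))) integrable_on {0..t0}"
      using integral_exp_weight[of t0 K m] t0 by (auto simp: integrable_on_def)
  qed (use um K t0 in \<open>auto intro!: mult_left_mono\<close>)
  also have "\<dots> = (m * exp (2 * K * t0) - m) / 2"
    using integral_exp_weight[of t0] t0 by (intro integral_unique) auto
  finally have "u t0 \<le> c + m * exp (2 * K * t0) / 2" using m0 by (simp add: diff_divide_distrib)
  then have "m \<le> (c + m * exp (2 * K * t0) / 2) * exp (- 2 * K * t0)" by (simp add: m_def mult_right_mono)
  also have "\<dots> = c * exp (- 2 * K * t0) + m / 2" by (simp add: distrib_right exp_minus)
  also have "c * exp (- 2 * K * t0) \<le> c * 1" using c K t0 by (intro mult_left_mono) auto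
  finally have m2: "m \<le> 2 * c" by simp
  have "u t \<le> m * exp (2 * K * t)" by (rule um[OF t])
  also have "\<dots> \<le> (2 * c) * exp (2 * K * T)"
    using m2 c K t by (intro mult_mono) (auto intro!: mult_left_mono)
  finally show ?thesis .
qed

text \<open>In the application \<open>\<beta> s y\<close> is the drift with the law at time
  \<open>s\<close> inserted. Its dependence on time is merely measurable, so integrability along a
  continuous path is derived from joint measurability and linear growth.\<close>

locale lipschitz_drift =
  fixes T L A :: real and \<beta> :: "real \<Rightarrow> real ^ 'd \<Rightarrow> real ^ 'd"
  assumes T: "0 < T" and L: "0 \<le> L" and A: "0 \<le> A"
    and meas: "(\<lambda>(s, y). \<beta> s y) \<in> borel_measurable (restrict_space borel {0..T} \<Otimes>\<^sub>M borel)"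
    and lip: "\<And>s x y. s \<in> {0..T} \<Longrightarrow> norm (\<beta> s x - \<beta> s y) \<le> L * norm (x - y)"
    and bdd: "\<And>s. s \<in> {0..T} \<Longrightarrow> norm (\<beta> s 0) \<le> A"
begin

lemma growth: "s \<in> {0..T} \<Longrightarrow> norm (\<beta> s y) \<le> A + L * norm y"
  using lip[of s y 0] bdd[of s] norm_triangle_sub[of "\<beta> s y" "\<beta> s 0"] by simp

lemma drift_integrable:
  assumes y: "continuous_on {0..T} y"
  shows "(\<lambda>s. \<beta> s (y s)) integrable_on {0..T}"
proof -
  have "y \<in> borel_measurable (restrict_space borel {0..T})"
    by (rule borel_measurable_continuous_on_restrict[OF y])
  then have "(\<lambda>s. (s, y s)) \<in> restrict_space borel {0..T} \<rightarrow>\<^sub>M (restrict_space borel {0..T} \<Otimes>\<^sub>M borel)"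
    by measurable
  from measurable_compose[OF this meas] have "(\<lambda>s. \<beta> s (y s)) \<in> borel_measurable (restrict_space borel {0..T})" by simp
  then have m: "(\<lambda>s. indicator {0..T} s *\<^sub>R \<beta> s (y s)) \<in> borel_measurable lborel"
    by (subst (asm) borel_measurable_restrict_space_iff) (auto simp: scaleR_conv_of_real)
  have "bounded (y ` {0..T})" by (intro compact_imp_bounded compact_continuous_image[OF y]) simp
  then obtain Bd where Bd: "\<And>s. s \<in> {0..T} \<Longrightarrow> norm (y s) \<le> Bd" unfolding bounded_iff by (metis imageI)
  have "integrable lborel (\<lambda>s. indicator {0..T} s *\<^sub>R (indicator {0..T} s *\<^sub>R \<beta> s (y s)))"
  proof (rule integrableI_bounded_set_indicator[OF _ m, of _ "A + L * Bd"])
    show "AE s in lborel. s \<in> {0..T} \<longrightarrow> norm (indicator {0..T} s *\<^sub>R \<beta> s (y s)) \<le> A + L * Bd"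
      using order.trans[OF growth add_left_mono[OF mult_left_mono[OF Bd L]]] by (intro AE_I2) simp
  qed (use T in auto)
  then have "set_integrable lborel {0..T} (\<lambda>s. \<beta> s (y s))"
    unfolding set_integrable_def by (rule Bochner_Integration.integrable_cong[THEN iffD1, rotated 2]) (auto simp: indicator_def)
  then show ?thesis by (rule set_borel_integral_eq_integral(1))
qed

lemma drift_integrable_sub:
  assumes y: "continuous_on {0..T} y" and "0 \<le> a" "b \<le> T"
  shows "(\<lambda>s. \<beta> s (y s)) integrable_on {a..b}"
  using integrable_on_subinterval[OF drift_integrable[OF y]] assms by auto

lemma drift_diff_bound:
  assumes y: "continuous_on {0..T} y" "continuous_on {0..T} y'" and ab: "0 \<le> a" "b \<le> T"
    and g: "g integrable_on {a..b}" "\<And>s. s \<in> {a..b} \<Longrightarrow> L * norm (y s - y' s) \<le> g s"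
  shows "norm (integral {a..b} (\<lambda>s. \<beta> s (y s)) - integral {a..b} (\<lambda>s. \<beta> s (y' s))) \<le> integral {a..b} g"
proof -
  note i = drift_integrable_sub[OF y(1) ab] drift_integrable_sub[OF y(2) ab]
  have "norm (integral {a..b} (\<lambda>s. \<beta> s (y s) - \<beta> s (y' s))) \<le> integral {a..b} g"
    by (intro integral_norm_bound_integral integrable_diff i g(1) order.trans[OF lip g(2)]) (use ab in auto)
  then show ?thesis by (simp add: integral_diff[OF i])
qed

section \<open>Existence and a priori bounds of solutions\<close>

definition solves :: "(real \<Rightarrow> real ^ 'd) \<Rightarrow> (real \<Rightarrow> real ^ 'd) \<Rightarrow> bool" where
  "solves z y \<longleftrightarrow> continuous_on {0..T} y \<and> (\<forall>t\<in>{0..T}. y t = z t + integral {0..t} (\<lambda>s. \<beta> s (y s)))"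

text \<open>Picard iteration. Measured against \<open>exp (2 * L * t)\<close>, the difference of
  successive iterates is halved in each step on the whole interval, whatever the sizes of
  \<open>L\<close> and \<open>T\<close>; uniform convergence then carries the equation to the
  limit.\<close>

lemma solves_exists:
  assumes z: "continuous_on {0..T} z"
  obtains y where "solves z y"
proof -
  define Y where "Y = rec_nat z (\<lambda>_ y t. z t + integral {0..t} (\<lambda>s. \<beta> s (y s)))"
  have Y0: "Y 0 = z" and YS: "Y (Suc k) t = z t + integral {0..t} (\<lambda>s. \<beta> s (Y k s))" for k t
    by (simp_all add: Y_def)
  have cY: "continuous_on {0..T} (Y k)" for k
  proof (induction k)
    case (Suc k)
    have "continuous_on {0..T} (\<lambda>t. z t + integral {0..t} (\<lambda>s. \<beta> s (Y k s)))"
      by (intro continuous_on_add z indefinite_integral_continuous_1 drift_integrable Suc)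
    then show ?case by (simp add: YS[abs_def])
  qed (simp add: Y0 z)
  have "bounded ((\<lambda>t. Y 1 t - Y 0 t) ` {0..T})"
    by (intro compact_imp_bounded compact_continuous_image continuous_on_diff cY) simp
  then obtain C where C: "\<And>t. t \<in> {0..T} \<Longrightarrow> norm (Y 1 t - Y 0 t) \<le> C" unfolding bounded_iff by (metis (no_types, lifting) imageI)
  have C0: "0 \<le> C" using order.trans[OF norm_ge_zero C[of 0]] T by simp
  have step: "norm (Y (Suc k) t - Y k t) \<le> C * (1/2) ^ k * exp (2 * L * t)" if "t \<in> {0..T}" for k t
    using that
  proof (induction k arbitrary: t)
    case 0
    then have "C * 1 \<le> C * exp (2 * L * t)" using L C0 by (intro mult_left_mono) auto
    then show ?case using C[OF 0] by simp
  next
    case (Suc k)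
    let ?m = "C * (1/2) ^ k"
    note w = integral_exp_weight[of t L ?m]
    have "norm (Y (Suc (Suc k)) t - Y (Suc k) t) = norm (integral {0..t} (\<lambda>s. \<beta> s (Y (Suc k) s)) - integral {0..t} (\<lambda>s. \<beta> s (Y k s)))"
      by (simp add: YS[of "Suc k"] YS[of k])
    also have "\<dots> \<le> integral {0..t} (\<lambda>s. L * (?m * exp (2 * L * s)))"
      by (rule drift_diff_bound[OF cY cY]) (use w Suc L in \<open>auto intro!: mult_left_mono\<close>)
    also have "\<dots> = (?m * exp (2 * L * t) - ?m) / 2" using w Suc.prems by (intro integral_unique) auto
    also have "\<dots> \<le> C * (1/2) ^ Suc k * exp (2 * L * t)" using C0 by (simp add: field_simps)
    finally show ?case .
  qed
  have step': "norm (Y (Suc k) t - Y k t) \<le> C * exp (2 * L * T) * (1/2) ^ k" if "t \<in> {0..T}" for k t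
  proof -
    have "C * (1/2) ^ k * exp (2 * L * t) \<le> C * (1/2) ^ k * exp (2 * L * T)"
      using that L C0 by (intro mult_left_mono) (auto intro!: mult_left_mono)
    then show ?thesis using step[OF that, of k] by (simp add: ac_simps)
  qed
  have "uniform_limit {0..T} (\<lambda>n t. \<Sum>i<n. Y (Suc i) t - Y i t) (\<lambda>t. \<Sum>i. Y (Suc i) t - Y i t) sequentially"
    by (rule Weierstrass_m_test[OF step']) (auto intro!: summable_mult)
  then have "uniform_limit {0..T} (\<lambda>n t. Y n t - Y 0 t) (\<lambda>t. \<Sum>i. Y (Suc i) t - Y i t) sequentially"
    by (subst (asm) sum_lessThan_telescope)
  from uniform_limit_add[OF this uniform_limit_const, of "Y 0"]
  have ul: "uniform_limit {0..T} Y (\<lambda>t. (\<Sum>i. Y (Suc i) t - Y i t) + Y 0 t) sequentially" by simp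
  define y where "y t = (\<Sum>i. Y (Suc i) t - Y i t) + Y 0 t" for t
  note ul = ul[folded y_def[abs_def]]
  have cy: "continuous_on {0..T} y"
    by (rule uniform_limit_theorem[OF _ ul]) (auto intro: cY always_eventually)
  have "y t = z t + integral {0..t} (\<lambda>s. \<beta> s (y s))" if t: "t \<in> {0..T}" for t
  proof -
    have "(\<lambda>k. integral {0..t} (\<lambda>s. \<beta> s (Y k s))) \<longlonglongrightarrow> integral {0..t} (\<lambda>s. \<beta> s (y s))"
    proof (rule metric_LIMSEQ_I)
      fix e :: real assume e: "0 < e"
      \<comment> \<open>The summand 1 keeps the denominator positive when
        \<open>L = 0\<close>.\<close>
      define e' where "e' = e / (2 * (L * T + 1))"
      have e': "0 < e'" using e L T by (simp add: e'_def add_nonneg_pos)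
      from uniform_limitD[OF ul e'] obtain N where N: "\<And>n s. n \<ge> N \<Longrightarrow> s \<in> {0..T} \<Longrightarrow> dist (Y n s) (y s) < e'"
        unfolding eventually_sequentially by blast
      have "dist (integral {0..t} (\<lambda>s. \<beta> s (Y n s))) (integral {0..t} (\<lambda>s. \<beta> s (y s))) < e" if "n \<ge> N" for n
      proof -
        have "dist (integral {0..t} (\<lambda>s. \<beta> s (Y n s))) (integral {0..t} (\<lambda>s. \<beta> s (y s))) \<le> integral {0..t} (\<lambda>s. L * e')"
          unfolding dist_norm
        proof (rule drift_diff_bound[OF cY cy])
          fix s assume "s \<in> {0..t}"
          then have "norm (Y n s - y s) < e'" using N[OF that, of s] t by (simp add: dist_norm)
          then show "L * norm (Y n s - y s) \<le> L * e'" using L by (intro mult_left_mono) auto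
        qed (use t in auto)
        also have "\<dots> = t * (L * e')" using t by simp
        also have "\<dots> \<le> T * (L * e')" using t L e' by (intro mult_right_mono) auto
        also have "\<dots> \<le> (L * T + 1) * e'" using e' by (simp add: algebra_simps)
        also have "\<dots> = e / 2"
        proof -
          have "0 < L * T + 1" using L T by (simp add: add_nonneg_pos)
          then have "(L * T + 1) * (e / (2 * (L * T + 1))) = e / 2" by (simp add: divide_simps)
          then show ?thesis unfolding e'_def .
        qed
        also have "\<dots> < e" using e by simp
        finally show ?thesis .
      qed
      then show "\<exists>no. \<forall>n\<ge>no. dist (integral {0..t} (\<lambda>s. \<beta> s (Y n s))) (integral {0..t} (\<lambda>s. \<beta> s (y s))) < e" by blast
    qed
    then have "(\<lambda>k. Y (Suc k) t) \<longlonglongrightarrow> z t + integral {0..t} (\<lambda>s. \<beta> s (y s))"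
      unfolding YS by (intro tendsto_intros)
    moreover have "(\<lambda>k. Y (Suc k) t) \<longlonglongrightarrow> y t"
      using tendsto_uniform_limitI[OF ul t] by (rule LIMSEQ_Suc)
    ultimately show ?thesis by (rule LIMSEQ_unique[symmetric])
  qed
  then have "solves z y" using cy by (auto simp: solves_def)
  then show thesis by (rule that)
qed

lemma solves_0: "solves z y \<Longrightarrow> y 0 = z 0"
  using T by (auto simp: solves_def)

lemma solves_bound:
  assumes y: "solves z y" and Z: "\<And>t. t \<in> {0..T} \<Longrightarrow> norm (z t) \<le> Z" and t: "t \<in> {0..T}"
  shows "norm (y t) \<le> 2 * (Z + A * T) * exp (2 * L * T)"
proof (rule gronwall[where u = "\<lambda>t. norm (y t)", OF _ L _ _ _ t])
  have c: "continuous_on {0..T} y" using y by (simp add: solves_def)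
  show "continuous_on {0..T} (\<lambda>t. norm (y t))" by (intro continuous_on_norm c)
  have "0 \<le> Z" using Z[OF t] norm_ge_zero order.trans by blast
  then show "0 \<le> Z + A * T" using A T by simp
  fix t assume t: "t \<in> {0..T}"
  have ci: "(\<lambda>s. norm (y s)) integrable_on {0..t}"
    using t by (intro integrable_continuous_interval continuous_on_norm continuous_on_subset[OF c]) auto
  have "norm (integral {0..t} (\<lambda>s. \<beta> s (y s))) \<le> integral {0..t} (\<lambda>s. A + L * norm (y s))"
    using t by (intro integral_norm_bound_integral drift_integrable_sub[OF c] growth integrable_add integrable_const_ivl integrable_on_cmult_left[where 'b=real, simplified] ci) auto
  also have "\<dots> = t * A + L * integral {0..t} (\<lambda>s. norm (y s))"
    using t by (subst integral_add) (auto intro: integrable_on_cmult_left[where 'b=real, simplified] ci)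
  also have "t * A \<le> A * T" using t A by (simp add: mult.commute mult_left_mono)
  finally have "norm (integral {0..t} (\<lambda>s. \<beta> s (y s))) \<le> A * T + L * integral {0..t} (\<lambda>s. norm (y s))" by simp
  moreover have "y t = z t + integral {0..t} (\<lambda>s. \<beta> s (y s))" using y t by (auto simp: solves_def)
  ultimately show "norm (y t) \<le> Z + A * T + L * integral {0..t} (\<lambda>s. norm (y s))"
    using Z[OF t] norm_triangle_ineq[of "z t" "integral {0..t} (\<lambda>s. \<beta> s (y s))"] by simp
qed auto

lemma solves_diff:
  assumes y: "solves z y" and st: "0 \<le> s" "s \<le> t" "t \<le> T"
  shows "y t - y s = z t - z s + integral {s..t} (\<lambda>s. \<beta> s (y s))"
proof -
  have "integral {0..s} (\<lambda>s. \<beta> s (y s)) + integral {s..t} (\<lambda>s. \<beta> s (y s)) = integral {0..t} (\<lambda>s. \<beta> s (y s))"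
    using st y by (intro Henstock_Kurzweil_Integration.integral_combine drift_integrable_sub) (auto simp: solves_def)
  moreover have "y t = z t + integral {0..t} (\<lambda>s. \<beta> s (y s))" "y s = z s + integral {0..s} (\<lambda>s. \<beta> s (y s))"
    using y st by (auto simp: solves_def)
  ultimately show ?thesis by (simp add: algebra_simps)
qed

lemma solves_increment:
  assumes y: "solves z y" and st: "0 \<le> s" "s \<le> t" "t \<le> T" and E: "\<And>s. s \<in> {0..T} \<Longrightarrow> norm (y s) \<le> E"
  shows "norm (y t - y s) \<le> norm (z t - z s) + (t - s) * (A + L * E)"
proof -
  have "norm (integral {s..t} (\<lambda>s. \<beta> s (y s))) \<le> integral {s..t} (\<lambda>s. A + L * E)"
    using y st order.trans[OF growth add_left_mono[OF mult_left_mono[OF E L]]]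
    by (intro integral_norm_bound_integral drift_integrable_sub) (auto simp: solves_def)
  also have "\<dots> = (t - s) * (A + L * E)" using st by simp
  finally show ?thesis
    using norm_triangle_ineq[of "z t - z s" "integral {s..t} (\<lambda>s. \<beta> s (y s))"] solves_diff[OF y st] by simp
qed

text \<open>Only the state is frozen during a step; the drift is still integrated in time, because
  the value of a merely measurable function at the left endpoint says nothing about the step. The
  increments of the driving path are an argument, which shows the scheme to be a function of
  finitely many vectors.\<close>

primrec euler :: "real \<Rightarrow> real ^ 'd \<Rightarrow> (nat \<Rightarrow> real ^ 'd) \<Rightarrow> nat \<Rightarrow> real ^ 'd" where
  "euler h x \<delta> 0 = x"
| "euler h x \<delta> (Suc k) = euler h x \<delta> k + integral {real k * h..real (Suc k) * h} (\<lambda>s. \<beta> s (euler h x \<delta> k)) + \<delta> k"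

text \<open>Adding the oscillation \<open>e\<close> of the solution within a step to the error makes
  the recursion homogeneous: every step multiplies the sum of the two by at most
  \<open>1 + L * h\<close>.\<close>

lemma euler_error:
  assumes y: "solves z y" and h: "0 \<le> h" "real N * h \<le> T" and k: "k \<le> N"
    and e: "\<And>s s'. s \<in> {0..T} \<Longrightarrow> s' \<in> {0..T} \<Longrightarrow> \<bar>s - s'\<bar> \<le> h \<Longrightarrow> norm (y s - y s') \<le> e"
  shows "norm (y (real k * h) - euler h (z 0) (\<lambda>k. z (real (Suc k) * h) - z (real k * h)) k) + e \<le> (1 + L * h) ^ k * e"
  using k
proof (induction k)
  case 0
  then show ?case using solves_0[OF y] by simp
next
  case (Suc k)
  let ?E = "euler h (z 0) (\<lambda>k. z (real (Suc k) * h) - z (real k * h))"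
  let ?a = "real k * h" and ?b = "real (Suc k) * h"
  let ?err = "norm (y ?a - ?E k)"
  have c: "continuous_on {0..T} y" using y by (simp add: solves_def)
  have a0: "0 \<le> ?a" using h by simp
  have ab: "?a \<le> ?b" using h by (simp add: mult_right_mono)
  have "?b \<le> real N * h" using Suc.prems h by (intro mult_right_mono) auto
  then have bT: "?b \<le> T" using h by simp
  have e0: "0 \<le> e" using e[of 0 0] T h by simp
  have "y ?b - ?E (Suc k) = (y ?a - ?E k) + (integral {?a..?b} (\<lambda>s. \<beta> s (y s)) - integral {?a..?b} (\<lambda>s. \<beta> s (?E k)))"
    using solves_diff[OF y a0 ab bT] unfolding euler.simps by (simp only: algebra_simps)
  then have "norm (y ?b - ?E (Suc k)) = norm ((y ?a - ?E k) + (integral {?a..?b} (\<lambda>s. \<beta> s (y s)) - integral {?a..?b} (\<lambda>s. \<beta> s (?E k))))"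
    by (simp only:)
  also have "\<dots> \<le> ?err + norm (integral {?a..?b} (\<lambda>s. \<beta> s (y s)) - integral {?a..?b} (\<lambda>s. \<beta> s (?E k)))"
    by (rule norm_triangle_ineq)
  also have "norm (integral {?a..?b} (\<lambda>s. \<beta> s (y s)) - integral {?a..?b} (\<lambda>s. \<beta> s (?E k))) \<le> integral {?a..?b} (\<lambda>s. L * (?err + e))"
  proof (rule drift_diff_bound[OF c _ a0 bT])
    fix s assume s: "s \<in> {?a..?b}"
    have "norm (y s - ?E k) \<le> ?err + norm (y s - y ?a)" using norm_triangle_ineq[of "y s - y ?a" "y ?a - ?E k"] by simp
    also have "norm (y s - y ?a) \<le> e"
    proof (rule e)
      have "s - ?a \<le> ?b - ?a" "0 \<le> s - ?a" using s by auto
      then show "\<bar>s - ?a\<bar> \<le> h" by (simp add: algebra_simps)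
      have "0 \<le> s" "s \<le> T" "?a \<le> T" using s a0 ab bT unfolding atLeastAtMost_iff by linarith+
      then show "s \<in> {0..T}" "?a \<in> {0..T}" using a0 by auto
    qed
    finally show "L * norm (y s - ?E k) \<le> L * (?err + e)" using L by (intro mult_left_mono) auto
  qed auto
  also have "\<dots> = L * h * (?err + e)" using ab by (simp add: algebra_simps)
  finally have "norm (y ?b - ?E (Suc k)) + e \<le> (1 + L * h) * (?err + e)" by (simp add: algebra_simps)
  also have "\<dots> \<le> (1 + L * h) * ((1 + L * h) ^ k * e)" using Suc h L by (intro mult_left_mono) auto
  finally show ?case by (simp add: mult.assoc)
qed

lemma euler_converges:
  assumes y: "solves z y" and t: "t \<in> {0..T}"
  shows "(\<lambda>n. euler (t / real (Suc n)) (z 0) (\<lambda>k. z (real (Suc k) * (t / real (Suc n))) - z (real k * (t / real (Suc n)))) (Suc n)) \<longlonglongrightarrow> y t"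
proof (rule metric_LIMSEQ_I)
  fix r :: real assume r: "0 < r"
  \<comment> \<open>Over \<open>Suc n\<close> steps the error grows by a factor of at most
    \<open>exp (L * T)\<close>, so the final error is at most \<open>r / 2\<close>.\<close>
  define e where "e = r / (2 * exp (L * T))"
  have e: "0 < e" using r by (simp add: e_def)
  have "uniformly_continuous_on {0..T} y"
    using y by (intro compact_uniformly_continuous) (auto simp: solves_def)
  then obtain d where d: "0 < d" and ud: "\<And>s s'. s \<in> {0..T} \<Longrightarrow> s' \<in> {0..T} \<Longrightarrow> dist s' s < d \<Longrightarrow> dist (y s') (y s) < e"
    unfolding uniformly_continuous_on_def using e by metis
  obtain N where N: "T / d < real N" using reals_Archimedean2 by blast
  have "dist (euler (t / real (Suc n)) (z 0) (\<lambda>k. z (real (Suc k) * (t / real (Suc n))) - z (real k * (t / real (Suc n)))) (Suc n)) (y t) < r" if "n \<ge> N" for n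
  proof -
    let ?h = "t / real (Suc n)"
    have "T / d < real (Suc n)" using N that by linarith
    then have "T / real (Suc n) < d" using d by (simp add: divide_simps mult.commute)
    moreover have "?h \<le> T / real (Suc n)" using t by (intro divide_right_mono) auto
    ultimately have hd: "?h < d" by linarith
    have ht: "real (Suc n) * ?h = t" by simp
    have "norm (y (real (Suc n) * ?h) - euler ?h (z 0) (\<lambda>k. z (real (Suc k) * ?h) - z (real k * ?h)) (Suc n)) + e \<le> (1 + L * ?h) ^ Suc n * e"
      by (rule euler_error[OF y, of _ "Suc n"]) (use t hd ud in \<open>auto simp: dist_norm less_imp_le simp del: of_nat_Suc\<close>)
    also have "(1 + L * ?h) ^ Suc n * e \<le> exp (L * T) * e"
    proof (rule mult_right_mono)
      have "(1 + L * ?h) ^ Suc n \<le> exp (L * ?h) ^ Suc n"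
        using L t by (intro power_mono exp_ge_add_one_self) auto
      also have "exp (L * ?h) ^ Suc n = exp (L * t)"
        by (subst exp_of_nat_mult[symmetric]) (simp del: of_nat_Suc)
      also have "\<dots> \<le> exp (L * T)" using L t by (auto intro: mult_left_mono)
      finally show "(1 + L * ?h) ^ Suc n \<le> exp (L * T)" .
    qed (use e in simp)
    also have "exp (L * T) * e = r / 2" by (simp add: e_def)
    finally have "norm (y t - euler ?h (z 0) (\<lambda>k. z (real (Suc k) * ?h) - z (real k * ?h)) (Suc n)) < r"
      using e r unfolding ht by linarith
    then show ?thesis by (simp only: dist_norm norm_minus_commute)
  qed
  then show "\<exists>no. \<forall>n\<ge>no. dist (euler (t / real (Suc n)) (z 0) (\<lambda>k. z (real (Suc k) * (t / real (Suc n))) - z (real k * (t / real (Suc n)))) (Suc n)) (y t) < r" by blast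
qed

text \<open>The Euler scheme is determined by \<open>z\<close>, and every solution is its
  limit.\<close>

lemma solves_unique:
  assumes "solves z y" "solves z y'" "t \<in> {0..T}"
  shows "y t = y' t"
  using LIMSEQ_unique[OF euler_converges[OF assms(1,3)] euler_converges[OF assms(2,3)]] .

lemma euler_cong:
  "(\<And>j. j < k \<Longrightarrow> \<delta> j = \<delta>' j) \<Longrightarrow> euler h x \<delta> k = euler h x \<delta>' k"
  by (induction k) auto

lemma measurable_euler:
  assumes h: "0 \<le> h" "real N * h \<le> T" and k: "k \<le> N"
  shows "(\<lambda>(x, \<delta>). euler h x \<delta> k) \<in> borel_measurable (borel \<Otimes>\<^sub>M PiM {..<N} (\<lambda>_. borel))"
  using k
proof (induction k)
  case (Suc k)
  have a: "0 \<le> real k * h" using h by simp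
  have "real (Suc k) * h \<le> real N * h" using Suc.prems h by (intro mult_right_mono) auto
  then have b: "real (Suc k) * h \<le> T" using h by simp
  have ab: "real k * h \<le> real (Suc k) * h" using h by (simp add: mult_right_mono)
  let ?G = "\<lambda>y. integral {real k * h..real (Suc k) * h} (\<lambda>s. \<beta> s y)"
  have "dist (?G y) (?G y') \<le> (h * L) * dist y y'" for y y'
  proof -
    have "norm (?G y - ?G y') \<le> integral {real k * h..real (Suc k) * h} (\<lambda>s. L * norm (y - y'))"
      by (rule drift_diff_bound[OF continuous_on_const continuous_on_const a b]) auto
    then show ?thesis using ab by (simp add: dist_norm algebra_simps)
  qed
  then have "(h * L)-lipschitz_on UNIV ?G" using h L by (intro lipschitz_onI) auto
  then have G[measurable]: "?G \<in> borel_measurable borel"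
    by (intro borel_measurable_continuous_onI lipschitz_on_continuous_on)
  have E[measurable]: "(\<lambda>z. euler h (fst z) (snd z) k) \<in> borel_measurable (borel \<Otimes>\<^sub>M PiM {..<N} (\<lambda>_. borel))"
    using Suc by (simp add: split_beta')
  have [measurable]: "(\<lambda>z. snd z k) \<in> borel_measurable (borel \<Otimes>\<^sub>M PiM {..<N} (\<lambda>_. borel))"
    using Suc.prems by (intro measurable_compose[OF measurable_snd measurable_component_singleton]) auto
  have "(\<lambda>z. euler h (fst z) (snd z) k + ?G (euler h (fst z) (snd z) k) + snd z k) \<in> borel_measurable (borel \<Otimes>\<^sub>M PiM {..<N} (\<lambda>_. borel))"
    by (intro borel_measurable_add E measurable_compose[OF E G]) measurable
  then show ?case by (simp add: split_beta')
qed (simp add: split_beta')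

end

subsection \<open>Independent copies\<close>

text \<open>The left side is built from the laws of the \<open>Xn\<close> alone, so equality of laws
  passes to almost sure limits. The functions \<open>max 0 (1 - k * infdist x C)\<close> decrease to
  the indicator of \<open>C\<close> because \<open>C\<close> is closed; for the empty set
  \<open>infdist\<close> is 0 and the limit would be 1.\<close>

lemma (in prob_space) distr_closed_limit:
  fixes X :: "'a \<Rightarrow> real ^ 'd"
  assumes [measurable]: "\<And>n::nat. Xn n \<in> borel_measurable M" "X \<in> borel_measurable M"
    and lim: "AE \<omega> in M. (\<lambda>n. Xn n \<omega>) \<longlonglongrightarrow> X \<omega>" and C: "closed C" "C \<noteq> {}"
  shows "(\<lambda>k. lim (\<lambda>n. (\<integral>x. max 0 (1 - real k * infdist x C) \<partial>distr M borel (Xn n)))) \<longlonglongrightarrow> measure (distr M borel X) C"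
proof -
  have Cm[measurable]: "C \<in> sets borel" using C by simp
  let ?f = "\<lambda>k x. max 0 (1 - real k * infdist x C) :: real"
  have cf: "continuous_on UNIV (?f k)" for k by (intro continuous_intros)
  have fm[measurable]: "?f k \<in> borel_measurable borel" for k by (intro borel_measurable_continuous_onI cf)
  have fb: "norm (?f k x) \<le> 1" for k x using infdist_nonneg[of x C] by (auto simp: max_def)
  have "(\<lambda>n. \<integral>x. ?f k x \<partial>distr M borel (Xn n)) \<longlonglongrightarrow> (\<integral>\<omega>. ?f k (X \<omega>) \<partial>M)" for k
  proof -
    have "(\<lambda>n. \<integral>\<omega>. ?f k (Xn n \<omega>) \<partial>M) \<longlonglongrightarrow> (\<integral>\<omega>. ?f k (X \<omega>) \<partial>M)"
    proof (rule integral_dominated_convergence[where w="\<lambda>_. 1"])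
      show "AE \<omega> in M. (\<lambda>n. ?f k (Xn n \<omega>)) \<longlonglongrightarrow> ?f k (X \<omega>)"
        using lim by eventually_elim (intro continuous_on_tendsto_compose[OF cf], auto)
    qed (use fb in auto)
    then show ?thesis by (simp add: integral_distr)
  qed
  then have l: "lim (\<lambda>n. \<integral>x. ?f k x \<partial>distr M borel (Xn n)) = (\<integral>\<omega>. ?f k (X \<omega>) \<partial>M)" for k
    by (rule limI)
  have "(\<lambda>k. \<integral>\<omega>. ?f k (X \<omega>) \<partial>M) \<longlonglongrightarrow> (\<integral>\<omega>. indicator C (X \<omega>) \<partial>M)"
  proof (rule integral_dominated_convergence[where w="\<lambda>_. 1"])
    show "AE \<omega> in M. (\<lambda>k. ?f k (X \<omega>)) \<longlonglongrightarrow> indicator C (X \<omega>)"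
    proof (rule AE_I2)
      fix \<omega>
      show "(\<lambda>k. ?f k (X \<omega>)) \<longlonglongrightarrow> indicator C (X \<omega>)"
      proof (cases "X \<omega> \<in> C")
        case False
        then have p: "0 < infdist (X \<omega>) C" using C by (metis in_closed_iff_infdist_zero infdist_nonneg less_eq_real_def)
        obtain N where N: "1 / infdist (X \<omega>) C < real N" using reals_Archimedean2 by blast
        have "?f k (X \<omega>) = 0" if "k \<ge> N" for k
        proof -
          have "1 / infdist (X \<omega>) C < real k" using N that by linarith
          then have "1 < real k * infdist (X \<omega>) C" using p by (simp add: divide_simps)
          then show ?thesis by simp
        qed
        then have "eventually (\<lambda>k. ?f k (X \<omega>) = indicator C (X \<omega>)) sequentially"
          using False by (auto simp: eventually_sequentially)
        then show ?thesis by (rule tendsto_eventually)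
      qed simp
    qed
  qed (use fb in auto)
  also have "(\<integral>\<omega>. indicator C (X \<omega>) \<partial>M) = measure (distr M borel X) C"
  proof -
    have "(\<integral>\<omega>. indicator C (X \<omega>) \<partial>M) = (\<integral>\<omega>. (indicator (X -` C \<inter> space M) \<omega> :: real) \<partial>M)"
      by (intro Bochner_Integration.integral_cong) (auto simp: indicator_def)
    then show ?thesis by (simp add: measure_distr)
  qed
  finally show ?thesis unfolding l .
qed

lemma (in prob_space) distr_eq_of_limits:
  fixes X X' :: "'a \<Rightarrow> real ^ 'd"
  assumes m[measurable]: "\<And>n::nat. Xn n \<in> borel_measurable M" "X \<in> borel_measurable M" "\<And>n::nat. Xn' n \<in> borel_measurable M" "X' \<in> borel_measurable M"
    and lim: "AE \<omega> in M. (\<lambda>n. Xn n \<omega>) \<longlonglongrightarrow> X \<omega>" "AE \<omega> in M. (\<lambda>n. Xn' n \<omega>) \<longlonglongrightarrow> X' \<omega>"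
    and eq: "\<And>n. distr M borel (Xn n) = distr M borel (Xn' n)"
  shows "distr M borel X = distr M borel X'"
proof (rule measure_eqI_generator_eq[where E="Collect closed" and A="\<lambda>_. UNIV" and \<Omega>=UNIV])
  interpret X: prob_space "distr M borel X" by (rule prob_space_distr) fact
  interpret X': prob_space "distr M borel X'" by (rule prob_space_distr) fact
  fix C :: "(real ^ 'd) set" assume "C \<in> Collect closed"
  then have C: "closed C" by simp
  show "emeasure (distr M borel X) C = emeasure (distr M borel X') C"
  proof (cases "C = {}")
    case False
    have "measure (distr M borel X) C = measure (distr M borel X') C"
      by (rule LIMSEQ_unique[OF distr_closed_limit[OF m(1,2) lim(1) C False] distr_closed_limit[OF m(3,4) lim(2) C False, folded eq]])
    then show ?thesis by (simp add: X.emeasure_eq_measure X'.emeasure_eq_measure)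
  qed simp
next
  show "sets (distr M borel X) = sigma_sets UNIV (Collect closed)" "sets (distr M borel X') = sigma_sets UNIV (Collect closed)"
    by (simp_all add: borel_eq_closed)
  show "emeasure (distr M borel X) UNIV \<noteq> \<infinity>" by (simp add: emeasure_distr)
qed (auto simp: Int_stable_def)

section \<open>Generated sigma-algebras\<close>

lemma generated_sub: "generated_events M I Z \<subseteq> Pow (space M)"
proof (rule subsetI, rule PowI)
  fix x assume "x \<in> generated_events M I Z"
  then show "x \<subseteq> space M" unfolding generated_events_def by (rule sigma_sets_into_sp[rotated]) auto
qed

lemma (in prob_space) generated_measurable:
  fixes Z :: "'i \<Rightarrow> 'a \<Rightarrow> real ^ 'd"
  assumes "Z i \<in> borel_measurable M" "i \<in> I"
  shows "Z i \<in> borel_measurable (sigma (space M) (generated_events M I Z))"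
proof (rule measurableI)
  fix A :: "(real ^ 'd) set" assume A: "A \<in> sets borel"
  have sub: "generated_events M I Z \<subseteq> Pow (space M)"
    by (rule generated_sub)
  have "Z i -` A \<inter> space M \<in> generated_events M I Z"
    unfolding generated_events_def using A assms(2) by (intro sigma_sets.Basic) auto
  then show "Z i -` A \<inter> space (sigma (space M) (generated_events M I Z)) \<in> sets (sigma (space M) (generated_events M I Z))"
    using sub by (auto simp: space_measure_of_conv)
qed simp

lemma generated_events_sigma:
  "sigma_algebra (space M) (generated_events M I Z)"
  unfolding generated_events_def by (rule sigma_algebra_sigma_sets) auto

lemma sets_generated: "sets (sigma (space M) (generated_events M I Z)) = generated_events M I Z"
  using sigma_algebra.sets_measure_of_eq[OF generated_events_sigma] .

lemma Int_stable_generated: "Int_stable (generated_events M I Z)"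
  using sets.Int[of _ "sigma (space M) (generated_events M I Z)"] by (simp add: Int_stable_def sets_generated)

lemma matrix_vector_measurable[measurable]: "(\<lambda>x. (\<sigma> :: real ^ 'd ^ 'd) *v x) \<in> borel_measurable borel"
  by (intro borel_measurable_continuous_onI linear_continuous_on) (simp add: linear_linear)

text \<open>With the law in the drift frozen, each copy solves an ordinary equation in which only
  its own initial state and Wiener process occur. This is the source of the independence of the
  copies.\<close>

locale copies = prob_space M + lipschitz_drift T L A \<beta>
  for M :: "'w measure" and T L A :: real and \<beta> :: "real \<Rightarrow> real ^ 'd \<Rightarrow> real ^ 'd" +
  fixes \<mu>0 :: "(real ^ 'd) measure" and X0 :: "nat \<Rightarrow> 'w \<Rightarrow> real ^ 'd" and B :: "nat \<Rightarrow> real \<Rightarrow> 'w \<Rightarrow> real ^ 'd"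
    and \<sigma> :: "real ^ 'd ^ 'd"
  assumes driving: "driving_data M \<mu>0 X0 B"
begin

lemma X0_measurable[measurable]: "X0 i \<in> borel_measurable M" and X0_law: "distr M borel (X0 i) = \<mu>0"
  and B_wiener: "wiener_process M (B i)"
  and indep: "indep_sets (case_sum (\<lambda>i. generated_events M {i} X0) (\<lambda>i. generated_events M {0..} (B i))) UNIV"
  using driving unfolding driving_data_def by auto

lemma B_measurable[measurable]: "0 \<le> t \<Longrightarrow> B i t \<in> borel_measurable M"
  using B_wiener[of i] unfolding wiener_process_def by blast

abbreviation drive :: "nat \<Rightarrow> 'w \<Rightarrow> real \<Rightarrow> real ^ 'd" where
  "drive i \<omega> \<equiv> (\<lambda>t. X0 i \<omega> + \<sigma> *v B i t \<omega>)"

definition history :: "nat \<Rightarrow> 'w measure" where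
  "history i = sigma (space M) (generated_events M {i} X0 \<union> generated_events M {0..} (B i))"

lemma space_history[simp]: "space (history i) = space M"
  by (simp add: history_def space_measure_of_conv)

lemma sets_history: "sets (history i) = sigma_sets (space M) (generated_events M {i} X0 \<union> generated_events M {0..} (B i))"
  unfolding history_def by (rule sets_measure_of) (simp add: generated_sub)

lemma history_measurable: "X0 i \<in> borel_measurable (history i)" "0 \<le> t \<Longrightarrow> B i t \<in> borel_measurable (history i)"
proof -
  have s: "generated_events M {i} X0 \<subseteq> sets (history i)" "generated_events M {0..} (B i) \<subseteq> sets (history i)"
    unfolding sets_history by auto
  have mono: "f \<in> borel_measurable (history i)"
    if "f \<in> borel_measurable N" "sets N \<subseteq> sets (history i)" "space N = space M" for f :: "'w \<Rightarrow> real ^ 'd" and N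
    using that by (auto simp: measurable_def)
  show "X0 i \<in> borel_measurable (history i)"
    by (rule mono[OF generated_measurable[of X0 i "{i}"]]) (auto simp: sets_generated space_measure_of_conv intro: subsetD[OF s(1)])
  show "B i t \<in> borel_measurable (history i)" if "0 \<le> t"
    by (rule mono[OF generated_measurable[of "B i" t "{0..}"]]) (use that in \<open>auto simp: sets_generated space_measure_of_conv intro: subsetD[OF s(2)]\<close>)
qed

text \<open>The independent family is grouped into the pairs \<open>{Inl j, Inr j}\<close>, the
  initial state and the Wiener process of one index; its members are intersection stable, so the
  generated sigma-algebras are independent too.\<close>

lemma indep_history: "indep_sets (\<lambda>i. sets (history i)) UNIV"
proof -
  have "indep_sets (\<lambda>j. sigma_sets (space M) (\<Union>i\<in>{Inl j, Inr j}. case_sum (\<lambda>i. generated_events M {i} X0) (\<lambda>i. generated_events M {0..} (B i)) i)) UNIV"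
  proof (rule indep_sets_collect_sigma)
    have "(\<Union>j\<in>UNIV. {Inl j, Inr j}) = (UNIV :: (nat + nat) set)"
      by (metis (no_types, lifting) UNIV_eq_I UN_I insertCI old.sum.exhaust UNIV_I)
    then show "indep_sets (case_sum (\<lambda>i. generated_events M {i} X0) (\<lambda>i. generated_events M {0..} (B i))) (\<Union>j\<in>UNIV. {Inl j, Inr j})"
      using indep by simp
    show "Int_stable (case_sum (\<lambda>i. generated_events M {i} X0) (\<lambda>i. generated_events M {0..} (B i)) i)" for i
      by (cases i) (auto simp: Int_stable_generated)
    show "disjoint_family_on (\<lambda>j. {Inl j, Inr j}) (UNIV :: nat set)" by (auto simp: disjoint_family_on_def)
  qed
  then show ?thesis by (simp add: sets_history Un_commute)
qed

lemma indep_history_pair: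
  assumes "i \<noteq> k" "a \<in> sets (history i)" "b \<in> sets (history k)"
  shows "prob (a \<inter> b) = prob a * prob b"
proof -
  have "prob (\<Inter>j\<in>{i, k}. (if j = i then a else b)) = (\<Prod>j\<in>{i, k}. prob (if j = i then a else b))"
    by (rule indep_setsD[OF indep_history]) (use assms in auto)
  then show ?thesis using assms(1) by (simp add: Int_commute)
qed

definition incs :: "nat \<Rightarrow> real \<Rightarrow> 'w \<Rightarrow> nat \<Rightarrow> real ^ 'd" where
  "incs i h \<omega> k = \<sigma> *v (B i (real (Suc k) * h) \<omega> - B i (real k * h) \<omega>)"

lemma history_incs: "0 \<le> h \<Longrightarrow> (\<lambda>\<omega>. incs i h \<omega> k) \<in> borel_measurable (history i)"
  unfolding incs_def by (intro measurable_compose[OF _ matrix_vector_measurable] borel_measurable_diff history_measurable) auto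

lemma history_sub: "sets (history i) \<subseteq> events"
  using indep_history unfolding indep_sets_def by auto

lemma history_M: "f \<in> borel_measurable (history i) \<Longrightarrow> f \<in> borel_measurable M"
  using history_sub[of i] by (auto simp: measurable_def)

lemma incs_law:
  assumes "0 \<le> h" shows "distr M borel (\<lambda>\<omega>. incs i h \<omega> k) = distr M borel (\<lambda>\<omega>. incs 0 h \<omega> k)"
proof -
  let ?D = "\<lambda>i \<omega>. B i (real (Suc k) * h) \<omega> - B i (real k * h) \<omega>"
  have [measurable]: "?D i \<in> borel_measurable M" for i
    using assms by (intro borel_measurable_diff B_measurable) (auto simp del: of_nat_Suc)
  have "distr M borel (?D i) = distr M borel (?D 0)"
  \<comment> \<open>For \<open>h = 0\<close> both increments are 0, and their law has no
    density.\<close>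
  proof (cases "h = 0")
    case True
    then show ?thesis by simp
  next
    case False
    then have lt: "0 \<le> real k * h" "real k * h < real (Suc k) * h" using assms by auto
    have "distr M lborel (?D i) = density lborel (\<lambda>x. ennreal (\<Prod>j\<in>UNIV. normal_density 0 (sqrt (real (Suc k) * h - real k * h)) (x $ j)))" for i
      using B_wiener[of i] lt unfolding wiener_process_def by (intro distributed_distr_eq_density) blast
    then have "distr M lborel (?D i) = distr M lborel (?D 0)" by simp
    moreover have "distr M borel (?D i) = distr M lborel (?D i)" for i by (rule distr_cong) auto
    ultimately show ?thesis by simp
  qed
  moreover have "distr M borel (\<lambda>\<omega>. incs i h \<omega> k) = distr (distr M borel (?D i)) borel (\<lambda>x. \<sigma> *v x)" for i
    by (subst distr_distr) (auto simp: comp_def incs_def simp del: of_nat_Suc)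
  ultimately show ?thesis by simp
qed

lemma incs_indep:
  assumes h: "0 \<le> h" shows "indep_vars (\<lambda>_. borel) (\<lambda>k \<omega>. incs i h \<omega> k) {..<N}"
proof -
  have "mono (\<lambda>k. real k * h)" using h by (intro monoI mult_right_mono) auto
  then have "indep_vars (\<lambda>_. borel) (\<lambda>k \<omega>. B i (real (Suc k) * h) \<omega> - B i (real k * h) \<omega>) {..<N}"
  proof -
    have "\<forall>k (\<tau>::nat \<Rightarrow> real). 0 \<le> \<tau> 0 \<and> mono \<tau> \<longrightarrow>
        indep_vars (\<lambda>_. borel) (\<lambda>j \<omega>. B i (\<tau> (Suc j)) \<omega> - B i (\<tau> j) \<omega>) {..<k}"
      using B_wiener[of i] unfolding wiener_process_def by (elim conjE)
    from this[rule_format, of "\<lambda>k. real k * h" N] \<open>mono _\<close> show ?thesis by simp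
  qed
  from indep_vars_compose2[OF this, of "\<lambda>_ x. \<sigma> *v x" "\<lambda>_. borel"] show ?thesis by (simp add: incs_def)
qed

text \<open>The right side does not mention \<open>i\<close>: this makes the Euler schemes of all
  copies identically distributed. Independence of the initial state from the Wiener process gives
  the outer product, independence of increments the inner one.\<close>

lemma joint_law:
  assumes h: "0 \<le> h" and N: "0 < N"
  shows "distr M (borel \<Otimes>\<^sub>M PiM {..<N} (\<lambda>_. borel)) (\<lambda>\<omega>. (X0 i \<omega>, \<lambda>k\<in>{..<N}. incs i h \<omega> k)) =
     \<mu>0 \<Otimes>\<^sub>M PiM {..<N} (\<lambda>k. distr M borel (\<lambda>\<omega>. incs 0 h \<omega> k))"
proof -
  let ?P = "PiM {..<N} (\<lambda>_. borel) :: (nat \<Rightarrow> real ^ 'd) measure"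
  let ?SB = "sigma (space M) (generated_events M {0..} (B i))"
  let ?V = "\<lambda>\<omega>. \<lambda>k\<in>{..<N}. incs i h \<omega> k"
  have BSB: "B i t \<in> borel_measurable ?SB" if "0 \<le> t" for t using that by (intro generated_measurable) auto
  have iSB: "(\<lambda>\<omega>. incs i h \<omega> k) \<in> borel_measurable ?SB" for k
    unfolding incs_def using h by (intro measurable_compose[OF _ matrix_vector_measurable] borel_measurable_diff BSB) auto
  have VSB: "?V \<in> ?SB \<rightarrow>\<^sub>M ?P" by (intro measurable_restrict iSB)
  have im[measurable]: "(\<lambda>\<omega>. incs i h \<omega> k) \<in> borel_measurable M" for k by (rule history_M[OF history_incs[OF h]])
  have Vm: "?V \<in> M \<rightarrow>\<^sub>M ?P" by (intro measurable_restrict im)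
  have eq: "distr M borel (X0 i) \<Otimes>\<^sub>M distr M ?P ?V = distr M (borel \<Otimes>\<^sub>M ?P) (\<lambda>\<omega>. (X0 i \<omega>, ?V \<omega>))"
  proof (rule pair_measure_eqI)
    show "sigma_finite_measure (distr M borel (X0 i))" "sigma_finite_measure (distr M ?P ?V)"
      using prob_space_distr[OF X0_measurable[of i]] prob_space_distr[OF Vm] by (auto intro: prob_space_imp_sigma_finite)
    fix a b assume "a \<in> sets (distr M borel (X0 i))" "b \<in> sets (distr M ?P ?V)"
    then have ab[measurable]: "a \<in> sets borel" "b \<in> sets ?P" by auto
    let ?a = "X0 i -` a \<inter> space M" and ?b = "?V -` b \<inter> space M"
    have ga: "?a \<in> generated_events M {i} X0" unfolding generated_events_def using ab by (intro sigma_sets.Basic) auto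
    have gb: "?b \<in> generated_events M {0..} (B i)"
      using measurable_sets[OF VSB ab(2)] by (simp add: sets_generated space_measure_of_conv)
    have "prob (\<Inter>j\<in>{Inl i, Inr i}. case_sum (\<lambda>_. ?a) (\<lambda>_. ?b) j) = (\<Prod>j\<in>{Inl i, Inr i}. prob (case_sum (\<lambda>_. ?a) (\<lambda>_. ?b) j))"
      by (rule indep_setsD[OF indep]) (use ga gb in auto)
    then have p: "prob (?a \<inter> ?b) = prob ?a * prob ?b" by simp
    have "emeasure (distr M (borel \<Otimes>\<^sub>M ?P) (\<lambda>\<omega>. (X0 i \<omega>, ?V \<omega>))) (a \<times> b) = emeasure M (?a \<inter> ?b)"
      using Vm by (subst emeasure_distr) (auto intro!: arg_cong[of _ _ "emeasure M"])
    then show "emeasure (distr M borel (X0 i)) a * emeasure (distr M ?P ?V) b = emeasure (distr M (borel \<Otimes>\<^sub>M ?P) (\<lambda>\<omega>. (X0 i \<omega>, ?V \<omega>))) (a \<times> b)"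
      using Vm by (simp add: emeasure_distr emeasure_eq_measure p ennreal_mult)
  qed simp
  have "distr M (borel \<Otimes>\<^sub>M ?P) (\<lambda>\<omega>. (X0 i \<omega>, ?V \<omega>)) = distr M borel (X0 i) \<Otimes>\<^sub>M distr M ?P ?V" by (rule eq[symmetric])
  also have "distr M ?P ?V = PiM {..<N} (\<lambda>k. distr M borel (\<lambda>\<omega>. incs i h \<omega> k))"
  proof -
    have "{..<N} \<noteq> {}" using N by auto
    from indep_vars_iff_distr_eq_PiM'[OF this, where M'="\<lambda>_. borel" and X="\<lambda>k \<omega>. incs i h \<omega> k"] im incs_indep[OF h]
    show ?thesis by simp
  qed
  finally show ?thesis by (simp only: X0_law incs_law[OF h, of i])
qed

definition euler_at :: "nat \<Rightarrow> real \<Rightarrow> nat \<Rightarrow> 'w \<Rightarrow> real ^ 'd" where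
  "euler_at i t n \<omega> = euler (t / real (Suc n)) (X0 i \<omega>) (incs i (t / real (Suc n)) \<omega>) (Suc n)"

text \<open>One and the same \<open>\<Phi>\<close> serves every \<open>i\<close>. Measurability with
  respect to \<open>history i\<close> and equality of the laws both follow from it.\<close>

lemma euler_at_alt:
  assumes t: "t \<in> {0..T}"
  obtains \<Phi> where "\<Phi> \<in> borel_measurable (borel \<Otimes>\<^sub>M PiM {..<Suc n} (\<lambda>_. borel))"
    "\<And>i \<omega>. euler_at i t n \<omega> = \<Phi> (X0 i \<omega>, \<lambda>k\<in>{..<Suc n}. incs i (t / real (Suc n)) \<omega> k)"
proof
  show "(\<lambda>(x, \<delta>). euler (t / real (Suc n)) x \<delta> (Suc n)) \<in> borel_measurable (borel \<Otimes>\<^sub>M PiM {..<Suc n} (\<lambda>_. borel))"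
    by (rule measurable_euler) (use t in \<open>auto simp del: of_nat_Suc\<close>)
  show "euler_at i t n \<omega> = (case (X0 i \<omega>, \<lambda>k\<in>{..<Suc n}. incs i (t / real (Suc n)) \<omega> k) of (x, \<delta>) \<Rightarrow> euler (t / real (Suc n)) x \<delta> (Suc n))" for i \<omega>
    unfolding euler_at_def prod.case by (rule euler_cong) simp
qed

lemma euler_at_history:
  assumes t: "t \<in> {0..T}" shows "euler_at i t n \<in> borel_measurable (history i)"
proof -
  obtain \<Phi> where \<Phi>: "\<Phi> \<in> borel_measurable (borel \<Otimes>\<^sub>M PiM {..<Suc n} (\<lambda>_. borel))"
    "\<And>i \<omega>. euler_at i t n \<omega> = \<Phi> (X0 i \<omega>, \<lambda>k\<in>{..<Suc n}. incs i (t / real (Suc n)) \<omega> k)"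
    using euler_at_alt[OF t] by blast
  have "(\<lambda>\<omega>. (X0 i \<omega>, \<lambda>k\<in>{..<Suc n}. incs i (t / real (Suc n)) \<omega> k)) \<in> history i \<rightarrow>\<^sub>M borel \<Otimes>\<^sub>M PiM {..<Suc n} (\<lambda>_. borel)"
    using t by (intro measurable_Pair history_measurable measurable_restrict history_incs) auto
  from measurable_compose[OF this \<Phi>(1)] show ?thesis by (simp add: \<Phi>(2)[abs_def])
qed

lemma euler_at_law:
  assumes t: "t \<in> {0..T}" shows "distr M borel (euler_at i t n) = distr M borel (euler_at 0 t n)"
proof -
  obtain \<Phi> where \<Phi>: "\<Phi> \<in> borel_measurable (borel \<Otimes>\<^sub>M PiM {..<Suc n} (\<lambda>_. borel))"
    "\<And>i \<omega>. euler_at i t n \<omega> = \<Phi> (X0 i \<omega>, \<lambda>k\<in>{..<Suc n}. incs i (t / real (Suc n)) \<omega> k)"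
    using euler_at_alt[OF t] by blast
  have h: "0 \<le> t / real (Suc n)" using t by simp
  have m: "(\<lambda>\<omega>. (X0 i \<omega>, \<lambda>k\<in>{..<Suc n}. incs i (t / real (Suc n)) \<omega> k)) \<in> M \<rightarrow>\<^sub>M borel \<Otimes>\<^sub>M PiM {..<Suc n} (\<lambda>_. borel)" for i
    using h by (intro measurable_Pair X0_measurable measurable_restrict history_M[OF history_incs]) auto
  have "distr M borel (euler_at i t n) = distr (distr M (borel \<Otimes>\<^sub>M PiM {..<Suc n} (\<lambda>_. borel)) (\<lambda>\<omega>. (X0 i \<omega>, \<lambda>k\<in>{..<Suc n}. incs i (t / real (Suc n)) \<omega> k))) borel \<Phi>" for i
    by (subst distr_distr[OF \<Phi>(1) m]) (simp add: comp_def \<Phi>(2)[abs_def])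
  then show ?thesis by (simp only: joint_law[OF h zero_less_Suc])
qed

end

lemma powr_le_1_plus:
  fixes x :: real assumes "0 \<le> x" "0 \<le> a" "a \<le> b" shows "x powr a \<le> 1 + x powr b"
proof (cases "x \<le> 1")
  case True
  then have "x powr a \<le> 1" using assms by (simp add: powr_le1)
  then show ?thesis by (meson add_increasing2 powr_ge_zero)
next
  case False
  then have "x powr a \<le> x powr b" using assms by (intro powr_mono) auto
  then show ?thesis by simp
qed

lemma chain_const_ge_1: "1 \<le> chain_const"
proof -
  have "2 powr (- 1 / 6) < 2 powr (0::real)" by (intro powr_less_mono) auto
  moreover have "(0::real) < 2 powr (- 1 / 6)" by simp
  ultimately have "1 \<le> 1 / (1 - 2 powr (- 1 / 6) :: real)" by (simp add: field_simps)
  then show ?thesis unfolding chain_const_def by (rule one_le_power)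
qed

text \<open>For \<open>s < T\<close> the coarsest grid point is 0 and \<open>chaining\<close>
  applies. At \<open>s = T\<close> that grid point is \<open>T\<close> itself, but then the single
  increment of level 0 is \<open>w T - w 0\<close>.\<close>

lemma roughness_sup:
  fixes w :: "real \<Rightarrow> real ^ 'd"
  assumes T: "0 < T" and cont: "continuous_on {0..T} w" and s: "s \<in> {0..T}" and w0: "w 0 = 0"
  shows "ennreal (norm (w s) ^ 6) \<le> ennreal chain_const * roughness T w 0"
proof (cases "s = T")
  case True
  have "ennreal (norm (w T) ^ 6) \<le> incr6 T w 0" by (simp add: incr6_def w0)
  also have "\<dots> \<le> roughness T w 0"
    unfolding roughness_def using sum_le_suminf[of "\<lambda>k. ennreal (2 ^ (0 + k)) * incr6 T w (0 + k)" "{0}"] by simp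
  also have "\<dots> \<le> ennreal chain_const * roughness T w 0"
  proof -
    have "(1::ennreal) \<le> ennreal chain_const" using ennreal_leI[OF chain_const_ge_1] by simp
    from mult_right_mono[OF this, of "roughness T w 0"] show ?thesis by simp
  qed
  finally show ?thesis using True by simp
next
  case False
  then have "\<lfloor>s / T\<rfloor> = 0" using s T by (simp add: floor_eq_iff)
  then have "grid T 0 s = 0" by (simp add: grid_def)
  then show ?thesis using chaining[OF T cont s, of 0] by (simp add: w0)
qed

section \<open>Construction of the copies path by path\<close>

context copies
begin

text \<open>A measurable null set is chosen since the measure need not be complete.\<close>

definition bad :: "nat \<Rightarrow> 'w set" where
  "bad i = (SOME N. N \<in> null_sets M \<and> {\<omega> \<in> space M. \<not> (continuous_on {0..} (\<lambda>t. B i t \<omega>) \<and> B i 0 \<omega> = 0)} \<subseteq> N)"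

lemma bad: "bad i \<in> null_sets M"
  and not_bad: "\<omega> \<in> space M \<Longrightarrow> \<omega> \<notin> bad i \<Longrightarrow> continuous_on {0..T} (\<lambda>t. B i t \<omega>) \<and> B i 0 \<omega> = 0"
proof -
  have "AE \<omega> in M. continuous_on {0..} (\<lambda>t. B i t \<omega>)" "AE \<omega> in M. B i 0 \<omega> = 0"
    using B_wiener[of i] unfolding wiener_process_def by blast+
  then have "AE \<omega> in M. continuous_on {0..} (\<lambda>t. B i t \<omega>) \<and> B i 0 \<omega> = 0" by eventually_elim simp
  then obtain N where "{\<omega> \<in> space M. \<not> (continuous_on {0..} (\<lambda>t. B i t \<omega>) \<and> B i 0 \<omega> = 0)} \<subseteq> N" "emeasure M N = 0" "N \<in> events"
    by (rule AE_E)
  then have "\<exists>N. N \<in> null_sets M \<and> {\<omega> \<in> space M. \<not> (continuous_on {0..} (\<lambda>t. B i t \<omega>) \<and> B i 0 \<omega> = 0)} \<subseteq> N" by blast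
  then have *: "bad i \<in> null_sets M \<and> {\<omega> \<in> space M. \<not> (continuous_on {0..} (\<lambda>t. B i t \<omega>) \<and> B i 0 \<omega> = 0)} \<subseteq> bad i"
    unfolding bad_def by (rule someI_ex)
  then show "bad i \<in> null_sets M" by blast
  show "continuous_on {0..T} (\<lambda>t. B i t \<omega>) \<and> B i 0 \<omega> = 0" if "\<omega> \<in> space M" "\<omega> \<notin> bad i"
    using * that continuous_on_subset[of "{0..}" "\<lambda>t. B i t \<omega>" "{0..T}"] by auto
qed

text \<open>The value 0 on \<open>bad i\<close> makes every path continuous, not only almost every
  one.\<close>

definition copy :: "nat \<Rightarrow> real \<Rightarrow> 'w \<Rightarrow> real ^ 'd" where
  "copy i t \<omega> = (if \<omega> \<in> bad i then 0 else (SOME y. solves (drive i \<omega>) y) t)"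

lemma copy_solves:
  assumes "\<omega> \<in> space M" "\<omega> \<notin> bad i"
  shows "solves (drive i \<omega>) (\<lambda>t. copy i t \<omega>)"
proof -
  have "continuous_on {0..T} (drive i \<omega>)"
    using not_bad[OF assms] by (intro continuous_on_add continuous_on_const bounded_linear.continuous_on[of "\<lambda>x. \<sigma> *v x"]) (auto simp: linear_linear)
  then have "\<exists>y. solves (drive i \<omega>) y" by (rule solves_exists) blast
  then have "solves (drive i \<omega>) (SOME y. solves (drive i \<omega>) y)" by (rule someI_ex)
  then show ?thesis using assms by (simp add: copy_def)
qed

lemma copy_continuous:
  assumes "\<omega> \<in> space M" shows "continuous_on {0..T} (\<lambda>t. copy i t \<omega>)"
  using copy_solves[OF assms, of i] by (cases "\<omega> \<in> bad i") (auto simp: solves_def copy_def)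

lemma euler_at_converges:
  assumes "\<omega> \<in> space M" "\<omega> \<notin> bad i" "t \<in> {0..T}"
  shows "(\<lambda>n. euler_at i t n \<omega>) \<longlonglongrightarrow> copy i t \<omega>"
proof -
  have "incs i (t / real (Suc n)) \<omega> = (\<lambda>k. drive i \<omega> (real (Suc k) * (t / real (Suc n))) - drive i \<omega> (real k * (t / real (Suc n))))" for n
    by (simp add: incs_def matrix_vector_mult_diff_distrib fun_eq_iff)
  moreover have "drive i \<omega> 0 = X0 i \<omega>" using not_bad[OF assms(1,2)] by simp
  ultimately show ?thesis
    using euler_converges[OF copy_solves[OF assms(1,2)] assms(3)] by (simp only: euler_at_def)
qed

lemma AE_not_bad: "AE \<omega> in M. \<omega> \<notin> bad i"
  using AE_not_in[OF bad] .

lemma AE_euler_at: "t \<in> {0..T} \<Longrightarrow> AE \<omega> in M. (\<lambda>n. euler_at i t n \<omega>) \<longlonglongrightarrow> copy i t \<omega>"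
  using AE_not_bad[of i] AE_space by eventually_elim (rule euler_at_converges)

text \<open>A solution is chosen separately for each path, so measurability cannot be read off the
  definition. It holds because the Euler scheme, set to 0 on \<open>bad i\<close>, converges at
  every point of the space.\<close>

lemma copy_measurable:
  assumes t: "t \<in> {0..T}" shows "copy i t \<in> borel_measurable M"
proof (rule borel_measurable_LIMSEQ_metric)
  have [measurable]: "bad i \<in> events" using bad by auto
  have [measurable]: "euler_at i t n \<in> borel_measurable M" for n by (rule history_M[OF euler_at_history[OF t]])
  show "(\<lambda>\<omega>. indicator (space M - bad i) \<omega> *\<^sub>R euler_at i t n \<omega>) \<in> borel_measurable M" for n
    by measurable
  show "(\<lambda>n. indicator (space M - bad i) \<omega> *\<^sub>R euler_at i t n \<omega>) \<longlonglongrightarrow> copy i t \<omega>" if "\<omega> \<in> space M" for \<omega>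
    using euler_at_converges[OF that _ t, of i] that by (cases "\<omega> \<in> bad i") (auto simp: copy_def)
qed

lemma copy_law:
  assumes t: "t \<in> {0..T}" shows "distr M borel (copy i t) = distr M borel (copy 0 t)"
  by (rule distr_eq_of_limits[OF _ _ _ _ AE_euler_at[OF t] AE_euler_at[OF t]])
     (auto intro: history_M[OF euler_at_history[OF t]] copy_measurable t euler_at_law)

lemma copy_indep:
  assumes t: "t \<in> {0..T}" and ik: "i \<noteq> k" and C[measurable]: "C \<in> sets borel"
  shows "prob {\<omega> \<in> space M. copy i t \<omega> \<in> C \<and> copy k t \<omega> \<in> C} = measure (distr M borel (copy 0 t)) C * measure (distr M borel (copy 0 t)) C"
proof -
  \<comment> \<open>\<open>bad i\<close> is a null set of \<open>M\<close> that need not lie in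
    \<open>history i\<close>. \<open>Z i\<close> is a version of the copy that is measurable with
    respect to \<open>history i\<close>.\<close>
  define Z where "Z i \<omega> = lim (\<lambda>n. euler_at i t n \<omega>)" for i \<omega>
  have Zh: "Z i \<in> borel_measurable (history i)" for i
    unfolding Z_def by (rule borel_measurable_lim_metric) (rule euler_at_history[OF t])
  have [measurable]: "Z i \<in> borel_measurable M" "copy i t \<in> borel_measurable M" for i
    using history_M[OF Zh] copy_measurable[OF t] by auto
  have ZY: "AE \<omega> in M. Z i \<omega> = copy i t \<omega>" for i
    using AE_euler_at[OF t, of i] by eventually_elim (simp add: Z_def limI)
  have "prob {\<omega> \<in> space M. copy i t \<omega> \<in> C \<and> copy k t \<omega> \<in> C} = prob ((Z i -` C \<inter> space M) \<inter> (Z k -` C \<inter> space M))"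
    using ZY[of i] ZY[of k] by (intro finite_measure_eq_AE) auto
  also have "\<dots> = prob (Z i -` C \<inter> space M) * prob (Z k -` C \<inter> space M)"
    using measurable_sets[OF Zh C] by (intro indep_history_pair[OF ik]) auto
  moreover have "prob (Z i -` C \<inter> space M) = measure (distr M borel (copy 0 t)) C" for i
  proof -
    have "prob (Z i -` C \<inter> space M) = prob (copy i t -` C \<inter> space M)"
      using ZY[of i] by (intro finite_measure_eq_AE) auto
    then show ?thesis by (simp add: copy_law[OF t, of i, symmetric] measure_distr)
  qed
  ultimately show ?thesis by simp
qed

section \<open>Moments and time regularity of the copies\<close>

abbreviation rough :: "nat \<Rightarrow> nat \<Rightarrow> 'w \<Rightarrow> ennreal" where
  "rough i m \<omega> \<equiv> roughness T (\<lambda>s. B i s \<omega>) m"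

lemma rough_measurable[measurable]: "rough i m \<in> borel_measurable M"
  using roughness_measurable[OF B_wiener T] .

text \<open>The initial state and the roughness at level 0 bound the driving path uniformly in time,
  and \<open>solves_bound\<close> carries this over to the copy. The form \<open>1 + 2 * E\<close>
  fits \<open>shell_le\<close>. The restriction \<open>q \<le> 6\<close> reflects that only the
  sixth power of the Wiener path is controlled.\<close>

lemma envelope:
  assumes q: "0 < q" "q \<le> 6"
  obtains C where "0 < C" "\<And>i \<omega> u. \<omega> \<in> space M \<Longrightarrow> 0 \<le> u \<Longrightarrow> rough i 0 \<omega> = ennreal u \<Longrightarrow>
     \<exists>E\<ge>0. (\<forall>t\<in>{0..T}. norm (copy i t \<omega>) \<le> E) \<and> (1 + 2 * E) powr q \<le> C * (1 + norm (X0 i \<omega>) powr q + u)"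
proof -
  define \<kappa> where "\<kappa> = onorm (\<lambda>x. \<sigma> *v x)"
  have bl: "bounded_linear (\<lambda>x. \<sigma> *v x)" by (simp add: linear_linear)
  have \<kappa>: "norm (\<sigma> *v x) \<le> \<kappa> * norm x" for x unfolding \<kappa>_def by (rule onorm[OF bl])
  have \<kappa>0: "0 \<le> \<kappa>" unfolding \<kappa>_def by (rule onorm_pos_le[OF bl])
  define a where "a = 2 * exp (2 * L * T)"
  have a: "0 < a" by (simp add: a_def)
  have AT: "0 \<le> A * T" using A T by simp
  define C where "C = 3 powr q * ((1 + 2 * a * (A * T)) powr q + (2 * a * \<kappa>) powr q + (2 * a) powr q + (2 * a * \<kappa>) powr q * chain_const)"
  have "0 < 1 + 2 * a * (A * T)" using a A T by (intro add_pos_nonneg mult_nonneg_nonneg) auto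
  then have C1: "0 < C" unfolding C_def using a chain_const_ge_1
    by (intro mult_pos_pos add_pos_nonneg) auto
  have "\<exists>E\<ge>0. (\<forall>t\<in>{0..T}. norm (copy i t \<omega>) \<le> E) \<and> (1 + 2 * E) powr q \<le> C * (1 + norm (X0 i \<omega>) powr q + u)"
    if \<omega>: "\<omega> \<in> space M" and u: "0 \<le> u" "rough i 0 \<omega> = ennreal u" for i \<omega> u
  proof -
    let ?x = "norm (X0 i \<omega>)"
    \<comment> \<open>A bound for the norm of the Wiener path on the whole interval, by
      \<open>roughness_sup\<close>.\<close>
    define R where "R = root 6 (chain_const * u)"
    have R: "0 \<le> R" "R ^ 6 = chain_const * u" using u chain_const_ge_1 by (auto simp: R_def real_root_pow_pos2)
    define E where "E = a * (?x + \<kappa> * R + A * T)"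
    have E: "0 \<le> E" using a \<kappa>0 R AT by (simp add: E_def)
    have "norm (copy i t \<omega>) \<le> E" if t: "t \<in> {0..T}" for t
    proof (cases "\<omega> \<in> bad i")
      case True
      then show ?thesis using E by (simp add: copy_def)
    next
      case False
      note g = not_bad[OF \<omega> False]
      have "norm (drive i \<omega> s) \<le> ?x + \<kappa> * R" if s: "s \<in> {0..T}" for s
      proof -
        have "ennreal (norm (B i s \<omega>) ^ 6) \<le> ennreal (chain_const * u)"
          using roughness_sup[OF T _ s, of "\<lambda>s. B i s \<omega>"] g u chain_const_ge_1 by (simp add: ennreal_mult)
        then have "norm (B i s \<omega>) ^ 6 \<le> R ^ 6" using u chain_const_ge_1 by (simp add: R)
        then have "norm (B i s \<omega>) \<le> R" using R(1) by (subst (asm) power_mono_iff) auto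
        then have "\<kappa> * norm (B i s \<omega>) \<le> \<kappa> * R" using \<kappa>0 by (rule mult_left_mono)
        then show ?thesis using norm_triangle_ineq[of "X0 i \<omega>" "\<sigma> *v B i s \<omega>"] \<kappa>[of "B i s \<omega>"] by linarith
      qed
      from solves_bound[OF copy_solves[OF \<omega> False] this t] show ?thesis by (simp add: E_def a_def algebra_simps)
    qed
    moreover have "(1 + 2 * E) powr q \<le> C * (1 + ?x powr q + u)"
    proof -
      have "1 + 2 * E = (1 + 2 * a * (A * T)) + 2 * a * ?x + (2 * a * \<kappa>) * R" by (simp add: E_def algebra_simps)
      then have "(1 + 2 * E) powr q \<le> 3 powr q * ((1 + 2 * a * (A * T)) powr q + (2 * a * ?x) powr q + ((2 * a * \<kappa>) * R) powr q)"
        using a AT \<kappa>0 R q by (simp only:) (rule powr_add3_le, auto)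
      also have "(2 * a * ?x) powr q = (2 * a) powr q * ?x powr q" using a by (simp add: powr_mult)
      also have "((2 * a * \<kappa>) * R) powr q = (2 * a * \<kappa>) powr q * R powr q" using a \<kappa>0 R by (simp add: powr_mult)
      also have "R powr q \<le> 1 + chain_const * u"
        using powr_le_1_plus[OF R(1), of q 6] q R by simp
      finally have "(1 + 2 * E) powr q \<le> 3 powr q * ((1 + 2 * a * (A * T)) powr q + (2 * a) powr q * ?x powr q + (2 * a * \<kappa>) powr q * (1 + chain_const * u))"
        by (simp add: mult_left_mono)
      also have "\<dots> \<le> C * (1 + ?x powr q + u)"
      proof -
        define c1 c2 c3 y where "c1 = (1 + 2 * a * (A * T)) powr q" and "c2 = (2 * a) powr q" and "c3 = (2 * a * \<kappa>) powr q" and "y = ?x powr q"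
        have nn: "0 \<le> c1" "0 \<le> c2" "0 \<le> c3" "0 \<le> y" "0 \<le> chain_const" using chain_const_ge_1 by (auto simp: c1_def c2_def c3_def y_def)
        have "c1 + c2 * y + c3 * (1 + chain_const * u) \<le> (c1 + c3 + c2 + c3 * chain_const) * (1 + y + u)"
        proof -
          have "(c1 + c3 + c2 + c3 * chain_const) * (1 + y + u) - (c1 + c2 * y + c3 * (1 + chain_const * u))
             = c1 * (y + u) + c3 * (y + u) + c2 * (1 + u) + c3 * chain_const * (1 + y)" by (simp add: algebra_simps)
          also have "0 \<le> \<dots>" using nn u by simp
          finally show ?thesis by simp
        qed
        then have "3 powr q * (c1 + c2 * y + c3 * (1 + chain_const * u)) \<le> 3 powr q * ((c1 + c3 + c2 + c3 * chain_const) * (1 + y + u))"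
          by (intro mult_left_mono) auto
        then show ?thesis unfolding C_def c1_def c2_def c3_def y_def by (simp only: mult.assoc)
      qed
      finally show ?thesis .
    qed
    ultimately show ?thesis using E by blast
  qed
  with C1 show thesis by (rule that)
qed

lemma copy_moment:
  assumes q: "0 < q" "q \<le> 6"
  obtains C where "0 < C" "\<And>i t \<omega>. \<omega> \<in> space M \<Longrightarrow> t \<in> {0..T} \<Longrightarrow>
    ennreal ((1 + 2 * norm (copy i t \<omega>)) powr q) \<le> ennreal C * (1 + ennreal (norm (X0 i \<omega>) powr q) + rough i 0 \<omega>)"
proof -
  obtain C where C: "0 < C" "\<And>i \<omega> u. \<omega> \<in> space M \<Longrightarrow> 0 \<le> u \<Longrightarrow> rough i 0 \<omega> = ennreal u \<Longrightarrow>
     \<exists>E\<ge>0. (\<forall>t\<in>{0..T}. norm (copy i t \<omega>) \<le> E) \<and> (1 + 2 * E) powr q \<le> C * (1 + norm (X0 i \<omega>) powr q + u)"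
    using envelope[OF q] by blast
  have "ennreal ((1 + 2 * norm (copy i t \<omega>)) powr q) \<le> ennreal C * (1 + ennreal (norm (X0 i \<omega>) powr q) + rough i 0 \<omega>)"
    if \<omega>: "\<omega> \<in> space M" "t \<in> {0..T}" for i t \<omega>
  proof (cases "rough i 0 \<omega>")
    case (real u)
    from C(2)[OF \<omega>(1) real] obtain E where E: "norm (copy i t \<omega>) \<le> E" "(1 + 2 * E) powr q \<le> C * (1 + norm (X0 i \<omega>) powr q + u)"
      using \<omega>(2) by blast
    have "(1 + 2 * norm (copy i t \<omega>)) powr q \<le> (1 + 2 * E) powr q" using E q by (intro powr_mono2) auto
    also note E(2)
    finally show ?thesis using C(1) real
      by (simp add: ennreal_mult[symmetric] ennreal_plus[symmetric] ennreal_leI del: ennreal_plus flip: ennreal_1)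
  next
    case top
    then show ?thesis using C(1) by (simp add: ennreal_mult_top)
  qed
  with C(1) show thesis by (rule that)
qed

text \<open>By \<open>chaining\<close> the sixth power of the oscillation is at most
  \<open>2 ^ (- 2 m)\<close> times a multiple of \<open>2 ^ m * rough i m\<close>, a variable whose
  expectation is bounded in \<open>m\<close>. Its sixth root gives the scale
  \<open>2 ^ (- m / 3)\<close>; the drift contributes only \<open>2 ^ (- m)\<close>.\<close>

lemma copy_modulus:
  assumes r: "1 \<le> r" "r \<le> 2"
  obtains C where "0 < C" "\<And>i s m \<omega>. \<omega> \<in> space M \<Longrightarrow> s \<in> {0..T} \<Longrightarrow>
    ennreal (dist (copy i s \<omega>) (copy i (grid T m s) \<omega>) powr r) \<le>
      ennreal (C * 2 powr (- (r * real m / 3))) * (1 + ennreal ((norm (X0 i \<omega>))\<^sup>2) + rough i 0 \<omega> + ennreal (2 ^ m) * rough i m \<omega>)"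
proof -
  obtain C2 where C2: "0 < C2" "\<And>i \<omega> u. \<omega> \<in> space M \<Longrightarrow> 0 \<le> u \<Longrightarrow> rough i 0 \<omega> = ennreal u \<Longrightarrow>
     \<exists>E\<ge>0. (\<forall>t\<in>{0..T}. norm (copy i t \<omega>) \<le> E) \<and> (1 + 2 * E) powr 2 \<le> C2 * (1 + norm (X0 i \<omega>) powr 2 + u)"
    using envelope[of 2] by auto
  define \<kappa> where "\<kappa> = onorm (\<lambda>x. \<sigma> *v x)"
  have bl: "bounded_linear (\<lambda>x. \<sigma> *v x)" by (simp add: linear_linear)
  have \<kappa>: "norm (\<sigma> *v x) \<le> \<kappa> * norm x" for x unfolding \<kappa>_def by (rule onorm[OF bl])
  have \<kappa>0: "0 \<le> \<kappa>" unfolding \<kappa>_def by (rule onorm_pos_le[OF bl])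
  define C where "C = 3 powr r * (\<kappa> powr r * chain_const + \<kappa> powr r + (T * (A + L)) powr r * C2 + 1)"
  have cc: "0 \<le> chain_const" using chain_const_ge_1 by simp
  have TA: "0 \<le> T * (A + L)" using T A L by simp
  have C: "0 < C" unfolding C_def using cc C2(1) by (intro mult_pos_pos add_nonneg_pos) auto
  have "ennreal (dist (copy i s \<omega>) (copy i (grid T m s) \<omega>) powr r) \<le>
      ennreal (C * 2 powr (- (r * real m / 3))) * (1 + ennreal ((norm (X0 i \<omega>))\<^sup>2) + rough i 0 \<omega> + ennreal (2 ^ m) * rough i m \<omega>)"
    if \<omega>: "\<omega> \<in> space M" and s: "s \<in> {0..T}" for i s m \<omega>
  proof (cases "\<omega> \<in> bad i")
    case True
    then show ?thesis by (simp add: copy_def)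
  next
    case False
    note g = not_bad[OF \<omega> False]
    show ?thesis
    proof (cases "rough i 0 \<omega> = \<infinity> \<or> rough i m \<omega> = \<infinity>")
      case True
      then show ?thesis using C by (auto simp: ennreal_mult_top)
    next
      case False2: False
      then obtain u0 um where u: "0 \<le> u0" "rough i 0 \<omega> = ennreal u0" "0 \<le> um" "rough i m \<omega> = ennreal um"
        by (cases "rough i 0 \<omega>"; cases "rough i m \<omega>") auto
      from C2(2)[OF \<omega> u(1,2)] obtain E where E: "0 \<le> E" "\<And>t. t \<in> {0..T} \<Longrightarrow> norm (copy i t \<omega>) \<le> E"
        "(1 + 2 * E) powr 2 \<le> C2 * (1 + norm (X0 i \<omega>) powr 2 + u0)" by auto
      define d where "d = norm (B i s \<omega> - B i (grid T m s) \<omega>)"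
      \<comment> \<open>Chosen with \<open>\<theta> ^ 6 = 2 ^ (- 2 m)\<close>, so that the sixth
        power of \<open>d / \<theta>\<close> is controlled by \<open>2 ^ m * um\<close>.\<close>
      define \<theta> where "\<theta> = 2 powr (- (real m / 3))"
      have \<theta>: "0 < \<theta>" "\<theta> \<le> 1" by (auto simp: \<theta>_def powr_le_one_le intro: powr_le1 order.trans[OF powr_mono[of _ 0]])
      have \<theta>r: "\<theta> powr r = 2 powr (- (r * real m / 3))" by (simp add: \<theta>_def powr_powr ac_simps)
      have \<theta>6: "\<theta> ^ 6 = 1 / 2 ^ m / 2 ^ m"
      proof -
        have "\<theta> ^ 6 = \<theta> powr real 6" using \<theta> by (intro powr_realpow[symmetric])
        also have "\<dots> = 2 powr (- real m + - real m)" by (simp add: \<theta>_def powr_powr)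
        also have "\<dots> = 1 / 2 ^ m / 2 ^ m" unfolding powr_add by (simp add: powr_minus powr_realpow field_simps)
        finally show ?thesis .
      qed
      have d6: "d ^ 6 \<le> chain_const / 2 ^ m * um"
      proof -
        have "ennreal (d ^ 6) \<le> ennreal (chain_const / 2 ^ m) * ennreal um"
          using chaining[OF T _ s, of "\<lambda>s. B i s \<omega>" m] g u(4) by (simp add: d_def)
        also have "\<dots> = ennreal (chain_const / 2 ^ m * um)"
          using u cc by (intro ennreal_mult[symmetric]) auto
        finally show ?thesis using u cc by simp
      qed
      have dr: "d powr r \<le> \<theta> powr r * (1 + chain_const * (2 ^ m * um))"
      proof -
        have "(d / \<theta>) powr r \<le> 1 + (d / \<theta>) powr 6" using r \<theta> by (intro powr_le_1_plus) (auto simp: d_def)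
        also have "(d / \<theta>) powr 6 = d ^ 6 / \<theta> ^ 6" using \<theta> by (simp add: d_def power_divide)
        also have "\<dots> \<le> (chain_const / 2 ^ m * um) / \<theta> ^ 6" using d6 \<theta> by (intro divide_right_mono) auto
        also have "\<dots> = chain_const * (2 ^ m * um)" unfolding \<theta>6 by (simp add: field_simps)
        finally have "(d / \<theta>) powr r \<le> 1 + chain_const * (2 ^ m * um)" by simp
        moreover have "d powr r = \<theta> powr r * (d / \<theta>) powr r" using \<theta> by (simp add: powr_divide d_def)
        ultimately show ?thesis by (simp add: mult_left_mono)
      qed
      let ?g = "(T * (A + L)) * (1 + 2 * E)"
      note gb = grid_bounds[OF T s, of m]
      \<comment> \<open>The summand 0 fills the third place of \<open>powr_add3_le\<close>.\<close>
      have dist: "dist (copy i s \<omega>) (copy i (grid T m s) \<omega>) \<le> \<kappa> * d + \<theta> * ?g + 0"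
      proof -
        have "norm (copy i s \<omega> - copy i (grid T m s) \<omega>) \<le> norm (drive i \<omega> s - drive i \<omega> (grid T m s)) + (s - grid T m s) * (A + L * E)"
          by (rule solves_increment[OF copy_solves[OF \<omega> False] _ gb(2) _ E(2)]) (use gb s in auto)
        moreover have "norm (drive i \<omega> s - drive i \<omega> (grid T m s)) \<le> \<kappa> * d"
          using \<kappa>[of "B i s \<omega> - B i (grid T m s) \<omega>"] by (simp add: d_def matrix_vector_mult_diff_distrib)
        moreover have "(s - grid T m s) * (A + L * E) \<le> \<theta> * ?g"
        proof -
          have "(1::real) / 2 ^ m \<le> \<theta>"
          proof -
            have "1 / 2 ^ m = 2 powr (- real m)" by (simp add: powr_minus_divide powr_realpow)
            also have "\<dots> \<le> \<theta>" unfolding \<theta>_def by (intro powr_mono) auto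
            finally show ?thesis .
          qed
          then have "s - grid T m s \<le> T * \<theta>" using gb(3) T mult_left_mono[of "1 / 2 ^ m" \<theta> T] by simp
          moreover have "A + L * E \<le> (A + L) * (1 + 2 * E)" using A L E(1) by (simp add: algebra_simps)
          ultimately have "(s - grid T m s) * (A + L * E) \<le> (T * \<theta>) * ((A + L) * (1 + 2 * E))"
            using A L E(1) gb T \<theta> by (intro mult_mono) auto
          then show ?thesis by (simp add: ac_simps)
        qed
        ultimately show ?thesis by (simp add: dist_norm)
      qed
      have "dist (copy i s \<omega>) (copy i (grid T m s) \<omega>) powr r \<le> (\<kappa> * d + \<theta> * ?g + 0) powr r"
        using dist r by (intro powr_mono2) auto
      also have "\<dots> \<le> 3 powr r * ((\<kappa> * d) powr r + (\<theta> * ?g) powr r + 0 powr r)"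
        using \<kappa>0 \<theta> TA E(1) r by (intro powr_add3_le) (auto simp: d_def)
      also have "\<dots> = 3 powr r * (\<kappa> powr r * d powr r + \<theta> powr r * ((T * (A + L)) powr r * (1 + 2 * E) powr r))"
        using \<kappa>0 \<theta> TA E(1) by (simp add: powr_mult d_def)
      also have "\<dots> \<le> 3 powr r * (\<kappa> powr r * (\<theta> powr r * (1 + chain_const * (2 ^ m * um))) + \<theta> powr r * ((T * (A + L)) powr r * (C2 * (1 + norm (X0 i \<omega>) powr 2 + u0))))"
      proof -
        have "(1 + 2 * E) powr r \<le> (1 + 2 * E) powr 2" using E(1) r by (intro powr_mono) auto
        also note E(3)
        finally show ?thesis using dr by (intro mult_left_mono add_mono) auto
      qed
      also have "\<dots> \<le> C * \<theta> powr r * (1 + (norm (X0 i \<omega>))\<^sup>2 + u0 + 2 ^ m * um)"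
      proof -
        define x v k t where "x = (norm (X0 i \<omega>))\<^sup>2" and "v = 2 ^ m * um" and "k = \<kappa> powr r" and "t = (T * (A + L)) powr r * C2"
        have nn: "0 \<le> x" "0 \<le> v" "0 \<le> k" "0 \<le> t" "0 \<le> u0" using u C2(1) by (auto simp: x_def v_def k_def t_def)
        have "k * (1 + chain_const * v) + t * (1 + x + u0) \<le> (k * chain_const + k + t + 1) * (1 + x + u0 + v)"
        proof -
          have "(k * chain_const + k + t + 1) * (1 + x + u0 + v) - (k * (1 + chain_const * v) + t * (1 + x + u0)) =
            k * chain_const * (1 + x + u0) + k * (x + u0 + v) + t * v + (1 + x + u0 + v)" by (simp add: algebra_simps)
          also have "0 \<le> \<dots>" using nn cc by simp
          finally show ?thesis by simp
        qed
        then have "(3 powr r * \<theta> powr r) * (k * (1 + chain_const * v) + t * (1 + x + u0)) \<le> (3 powr r * \<theta> powr r) * ((k * chain_const + k + t + 1) * (1 + x + u0 + v))"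
          by (intro mult_left_mono) auto
        then show ?thesis
          unfolding C_def k_def[symmetric] v_def[symmetric] powr_numeral t_def[symmetric]
          by (simp add: x_def[symmetric] algebra_simps t_def)
      qed
      finally have "dist (copy i s \<omega>) (copy i (grid T m s) \<omega>) powr r \<le> C * 2 powr (- (r * real m / 3)) * (1 + (norm (X0 i \<omega>))\<^sup>2 + u0 + 2 ^ m * um)"
        unfolding \<theta>r .
      then have "ennreal (dist (copy i s \<omega>) (copy i (grid T m s) \<omega>) powr r) \<le> ennreal (C * 2 powr (- (r * real m / 3)) * (1 + (norm (X0 i \<omega>))\<^sup>2 + u0 + 2 ^ m * um))"
        by (rule ennreal_leI)
      also have "\<dots> = ennreal (C * 2 powr (- (r * real m / 3))) * (1 + ennreal ((norm (X0 i \<omega>))\<^sup>2) + rough i 0 \<omega> + ennreal (2 ^ m) * rough i m \<omega>)"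
        using C u by (simp add: ennreal_mult)
      finally show ?thesis .
    qed
  qed
  with C show thesis by (rule that)
qed

end

subsection \<open>Comparison with the particle system\<close>

lemma integrable_on_bounded_measurable:
  fixes f :: "real \<Rightarrow> real"
  assumes m: "(\<lambda>s. indicator {0..T} s * f s) \<in> borel_measurable borel"
    and b: "\<And>s. s \<in> {0..T} \<Longrightarrow> \<bar>f s\<bar> \<le> K" and t: "t \<le> T"
  shows "f integrable_on {0..t}"
proof -
  have "integrable lborel (\<lambda>s. indicator {0..T} s *\<^sub>R (indicator {0..T} s * f s))"
  proof (rule integrableI_bounded_set_indicator[where B = K])
    show "AE s in lborel. s \<in> {0..T} \<longrightarrow> norm (indicator {0..T} s * f s) \<le> K"
      using b by (intro AE_I2) simp
  qed (use m in \<open>auto simp: emeasure_lborel_Icc_eq\<close>)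
  then have "set_integrable lborel {0..T} f"
    unfolding set_integrable_def by (rule Bochner_Integration.integrable_cong[THEN iffD1, rotated 2]) (auto simp: indicator_def)
  then have "f integrable_on {0..T}" by (rule set_borel_integral_eq_integral(1))
  then show ?thesis using t by (intro integrable_on_subinterval) auto
qed

text \<open>By convexity the graph of \<open>z powr r\<close> lies above its tangent at
  \<open>m\<close>; rearranged, this is a case of Young's inequality.\<close>

lemma powr_tangent:
  fixes m z r :: real
  assumes "1 \<le> r" "0 < m" "0 \<le> z"
  shows "r * (m powr (r - 1) * z) \<le> (r - 1) * m powr r + z powr r"
proof (cases "z = 0")
  case False
  have "(z powr r) powr (1 / r) * (m powr r) powr (1 - 1 / r) \<le> 1 / r * z powr r + (1 - 1 / r) * m powr r"
    by (rule Youngs_inequality_0) (use assms False in auto)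
  also have "(z powr r) powr (1 / r) = z" using assms by (simp add: powr_powr)
  also have "(m powr r) powr (1 - 1 / r) = m powr (r - 1)" using assms by (simp add: powr_powr right_diff_distrib)
  finally have "r * (z * m powr (r - 1)) \<le> r * (1 / r * z powr r + (1 - 1 / r) * m powr r)" using assms by (intro mult_left_mono) auto
  also have "\<dots> = z powr r + (r - 1) * m powr r" using assms by (simp add: distrib_left left_diff_distrib right_diff_distrib)
  finally show ?thesis by (simp add: ac_simps)
qed (use assms in auto)

lemma integral_powr_le:
  fixes f :: "real \<Rightarrow> real"
  assumes r: "1 \<le> r" and t: "0 \<le> t" and f: "f integrable_on {0..t}" "\<And>s. s \<in> {0..t} \<Longrightarrow> 0 \<le> f s"
    and fr: "(\<lambda>s. f s powr r) integrable_on {0..t}"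
  shows "integral {0..t} f powr r \<le> t powr (r - 1) * integral {0..t} (\<lambda>s. f s powr r)"
proof (cases "integral {0..t} f = 0")
  case True
  have "0 \<le> integral {0..t} (\<lambda>s. f s powr r)" by (intro integral_nonneg fr) auto
  then show ?thesis using True by simp
next
  case False
  then have I: "0 < integral {0..t} f" using integral_nonneg[OF f] by simp
  have t0: "0 < t" using False t by (cases "t = 0") auto
  \<comment> \<open>Integrating the tangent inequality at the mean value gives Jensen's
    inequality.\<close>
  define m where "m = integral {0..t} f / t"
  have m: "0 < m" using I t0 by (simp add: m_def)
  have "integral {0..t} (\<lambda>s. r * m powr (r - 1) * f s) \<le> integral {0..t} (\<lambda>s. (r - 1) * m powr r + f s powr r)"
    using powr_tangent[OF r m f(2)]
    by (intro integral_le integrable_add integrable_const_ivl fr integrable_on_mult_right[OF f(1)]) (auto simp: ac_simps)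
  also have "integral {0..t} (\<lambda>s. r * m powr (r - 1) * f s) = r * m powr (r - 1) * (t * m)"
    using t0 by (simp add: m_def)
  also have "integral {0..t} (\<lambda>s. (r - 1) * m powr r + f s powr r) = t * ((r - 1) * m powr r) + integral {0..t} (\<lambda>s. f s powr r)"
    using t0 by (subst integral_add) (auto intro: fr)
  also have "r * m powr (r - 1) * (t * m) = r * (t * m powr r)"
    using m by (simp add: powr_diff)
  finally have *: "t * m powr r \<le> integral {0..t} (\<lambda>s. f s powr r)" by (simp add: algebra_simps)
  have "integral {0..t} f powr r = (t * m) powr r" using t0 by (simp add: m_def)
  also have "\<dots> = t powr (r - 1) * (t * m powr r)" using t0 m by (simp add: powr_mult powr_diff)
  also have "\<dots> \<le> t powr (r - 1) * integral {0..t} (\<lambda>s. f s powr r)" using * by (intro mult_left_mono) auto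
  finally show ?thesis .
qed

text \<open>The inequality for a single \<open>u i\<close> contains the mean \<open>a\<close>. Its
  \<open>r\<close>-th power, averaged over \<open>i\<close>, is closed in \<open>a\<close>: the term
  \<open>u i\<close> contributes 1 and the mean contributes \<open>c\<close> to the factor
  \<open>1 + c\<close>. Jensen's inequality accounts for \<open>T powr (r - 1)\<close>, and
  \<open>3 powr r\<close> comes from \<open>powr_add3_le\<close> with third summand 0. Integrability
  is a premise within \<open>ineq\<close> because it is established here, from continuity of the
  \<open>u i\<close> and boundedness of \<open>G\<close>.\<close>

lemma mean_gronwall:
  fixes u :: "nat \<Rightarrow> real \<Rightarrow> real" and G :: "real \<Rightarrow> real" and n :: nat and r :: real
  defines "a \<equiv> \<lambda>s. (1 / real n) * (\<Sum>i<n. u i s powr r)"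
  assumes n: "n \<ge> 1" and T: "0 < T" and r: "1 \<le> r" and L: "0 \<le> L" and c: "0 \<le> c"
    and u: "\<And>i. i < n \<Longrightarrow> continuous_on {0..T} (u i)" "\<And>i s. 0 \<le> u i s"
    and G: "(\<lambda>s. G s) \<in> borel_measurable borel" "\<And>s. 0 \<le> G s" "\<And>s. G s \<le> Gb"
    and ineq: "\<And>i t. i < n \<Longrightarrow> t \<in> {0..T} \<Longrightarrow>
      (\<lambda>s. L * (u i s + (c * (a s + G s)) powr (1 / r))) integrable_on {0..t} \<Longrightarrow>
      u i t \<le> integral {0..t} (\<lambda>s. L * (u i s + (c * (a s + G s)) powr (1 / r)))"
    and t: "t \<in> {0..T}"
  shows "a t \<le> 2 * (T powr (r - 1) * (3 * L) powr r * c * integral {0..T} G) * exp (2 * (T powr (r - 1) * (3 * L) powr r * (1 + c)) * T)"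
proof -
  define k where "k = T powr (r - 1) * (3 * L) powr r"
  have k: "0 \<le> k" by (simp add: k_def)
  have a0: "0 \<le> a s" for s unfolding a_def by (intro mult_nonneg_nonneg sum_nonneg) auto
  have up: "continuous_on {0..T} (\<lambda>s. u i s powr r)" if "i < n" for i
    using u(1)[OF that] r u(2) by (intro continuous_on_powr') auto
  have ca: "continuous_on {0..T} a"
    unfolding a_def by (intro continuous_intros up) auto
  have bdd: "\<exists>K. \<forall>s\<in>{0..T}. f s \<le> K" if "continuous_on {0..T} f" for f :: "real \<Rightarrow> real"
  proof (cases "{0..T} = {}")
    case False
    then show ?thesis using continuous_attains_sup[OF compact_Icc False that] by blast
  qed simp
  have cm: "(\<lambda>s. indicator {0..T} s * f s) \<in> borel_measurable borel" if "continuous_on {0..T} f" for f :: "real \<Rightarrow> real"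
    using borel_measurable_continuous_on_indicator[OF _ that] by simp
  have Gi: "G integrable_on {0..t}" if "t \<le> T" for t
    by (rule integrable_on_bounded_measurable[OF _ _ that, where K = Gb]) (use G in auto)
  have ai: "a integrable_on {0..t}" if "t \<le> T" for t
    using that by (intro integrable_continuous_interval continuous_on_subset[OF ca]) auto
  have upi: "(\<lambda>s. u i s powr r) integrable_on {0..t}" if "i < n" "t \<le> T" for i t
    using that by (intro integrable_continuous_interval continuous_on_subset[OF up]) auto
  obtain Ab where Ab: "\<And>s. s \<in> {0..T} \<Longrightarrow> a s \<le> Ab" using bdd[OF ca] by blast
  have one: "u i t powr r \<le> k * (integral {0..t} (\<lambda>s. u i s powr r) + c * (integral {0..t} a + integral {0..t} G))"
    if i: "i < n" and t: "t \<in> {0..T}" for i t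
  proof -
    let ?f = "\<lambda>s. L * (u i s + (c * (a s + G s)) powr (1 / r))"
    obtain Ub where Ub: "\<And>s. s \<in> {0..T} \<Longrightarrow> u i s \<le> Ub" using bdd[OF u(1)[OF i]] by blast
    have f0: "0 \<le> ?f s" for s using L u(2) by simp
    define K where "K = L * (Ub + (c * (Ab + Gb)) powr (1 / r))"
    have fb: "?f s \<le> K" if "s \<in> {0..T}" for s
      unfolding K_def using L r c that Ub Ab G a0 by (intro mult_left_mono add_mono powr_mono2 mult_nonneg_nonneg) (auto simp: add_mono)
    have fm: "(\<lambda>s. indicator {0..T} s * ?f s) \<in> borel_measurable borel"
    proof -
      have [measurable]: "(\<lambda>s. indicator {0..T} s * u i s) \<in> borel_measurable borel" "(\<lambda>s. indicator {0..T} s * a s) \<in> borel_measurable borel" "G \<in> borel_measurable borel"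
        using cm[OF u(1)[OF i]] cm[OF ca] G(1) by auto
      have "(\<lambda>s. indicator {0..T} s * (L * ((indicator {0..T} s * u i s) + (c * (indicator {0..T} s * a s + G s)) powr (1 / r)))) \<in> borel_measurable borel"
        by measurable
      also have "(\<lambda>s. indicator {0..T} s * (L * ((indicator {0..T} s * u i s) + (c * (indicator {0..T} s * a s + G s)) powr (1 / r)))) = (\<lambda>s. indicator {0..T} s * ?f s)"
        by (auto simp: indicator_def)
      finally show ?thesis .
    qed
    have fi: "?f integrable_on {0..t}"
      by (rule integrable_on_bounded_measurable[OF fm, where K=K]) (use f0 fb t in auto)
    have fri: "(\<lambda>s. ?f s powr r) integrable_on {0..t}"
    proof (rule integrable_on_bounded_measurable[where K="K powr r" and T=T])
      have "(\<lambda>s. indicator {0..T} s * (indicator {0..T} s * ?f s) powr r) \<in> borel_measurable borel"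
        using fm by measurable
      also have "(\<lambda>s. indicator {0..T} s * (indicator {0..T} s * ?f s) powr r) = (\<lambda>s. indicator {0..T} s * ?f s powr r)"
        by (auto simp: indicator_def)
      finally show "(\<lambda>s. indicator {0..T} s * ?f s powr r) \<in> borel_measurable borel" .
      show "\<bar>?f s powr r\<bar> \<le> K powr r" if "s \<in> {0..T}" for s
        using fb[OF that] f0[of s] r by (simp add: powr_mono2)
    qed (use t in auto)
    have "u i t powr r \<le> integral {0..t} ?f powr r"
      using ineq[OF i t fi] u(2) r by (intro powr_mono2) auto
    also have "\<dots> \<le> t powr (r - 1) * integral {0..t} (\<lambda>s. ?f s powr r)"
      using t f0 by (intro integral_powr_le[OF r _ fi _ fri]) auto
    also have "\<dots> \<le> T powr (r - 1) * integral {0..t} (\<lambda>s. ?f s powr r)"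
      using t r fri f0 by (intro mult_right_mono powr_mono2 integral_nonneg) auto
    also have "integral {0..t} (\<lambda>s. ?f s powr r) \<le> integral {0..t} (\<lambda>s. (3 * L) powr r * (u i s powr r + c * (a s + G s)))"
    proof (rule integral_le[OF fri])
      show "(\<lambda>s. (3 * L) powr r * (u i s powr r + c * (a s + G s))) integrable_on {0..t}"
        using t by (intro integrable_on_mult_right integrable_add upi[OF i] ai Gi) auto
      fix s
      have "?f s powr r = L powr r * (u i s + (c * (a s + G s)) powr (1 / r) + 0) powr r"
        using L u(2) by (simp add: powr_mult)
      also have "\<dots> \<le> L powr r * (3 powr r * (u i s powr r + ((c * (a s + G s)) powr (1 / r)) powr r + 0 powr r))"
        using u(2) r by (intro mult_left_mono powr_add3_le) auto
      also have "((c * (a s + G s)) powr (1 / r)) powr r = c * (a s + G s)"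
        using r c a0 G(2) by (simp add: powr_powr)
      finally show "?f s powr r \<le> (3 * L) powr r * (u i s powr r + c * (a s + G s))"
        using L by (simp add: powr_mult ac_simps)
    qed
    also have "\<dots> = (3 * L) powr r * (integral {0..t} (\<lambda>s. u i s powr r) + c * (integral {0..t} a + integral {0..t} G))"
    proof -
      have "integral {0..t} (\<lambda>s. u i s powr r + c * (a s + G s)) = integral {0..t} (\<lambda>s. u i s powr r) + integral {0..t} (\<lambda>s. c * (a s + G s))"
        using t by (intro integral_add integrable_on_mult_right integrable_add upi[OF i] ai Gi) auto
      also have "integral {0..t} (\<lambda>s. c * (a s + G s)) = c * (integral {0..t} a + integral {0..t} G)"
        using t by (simp add: integral_add ai Gi)
      finally show ?thesis by simp
    qed
    finally show ?thesis unfolding k_def by (simp add: mult_left_mono mult.assoc)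
  qed
  have sum_i: "(1 / real n) * (\<Sum>i<n. integral {0..t} (\<lambda>s. u i s powr r)) = integral {0..t} a" if "t \<in> {0..T}" for t
  proof -
    have "integral {0..t} (\<lambda>s. \<Sum>i<n. u i s powr r) = (\<Sum>i<n. integral {0..t} (\<lambda>s. u i s powr r))"
      using that by (intro integral_sum upi) auto
    then show ?thesis unfolding a_def by simp
  qed
  have "a t \<le> k * c * integral {0..T} G + (k * (1 + c)) * integral {0..t} a" if t: "t \<in> {0..T}" for t
  proof -
    have "a t \<le> (1 / real n) * (\<Sum>i<n. k * (integral {0..t} (\<lambda>s. u i s powr r) + c * (integral {0..t} a + integral {0..t} G)))"
      unfolding a_def[of] using one[OF _ t] unfolding a_def by (intro mult_left_mono sum_mono) auto
    also have "\<dots> = k * ((1 / real n) * (\<Sum>i<n. integral {0..t} (\<lambda>s. u i s powr r)) + c * (integral {0..t} a + integral {0..t} G))"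
      using n by (simp add: sum_distrib_left[symmetric] sum.distrib distrib_left)
    also have "\<dots> = k * (1 + c) * integral {0..t} a + k * c * integral {0..t} G"
      unfolding sum_i[OF t] by (simp add: algebra_simps)
    also have "integral {0..t} G \<le> integral {0..T} G"
      using t by (intro integral_subset_le Gi) (auto simp: G(2))
    finally show ?thesis using k c by (simp add: mult_left_mono)
  qed
  then have "a t \<le> 2 * (k * c * integral {0..T} G) * exp (2 * (k * (1 + c)) * T)"
    using k c G(2) a0 by (intro gronwall[OF ca _ _ _ _ t]) (auto intro!: mult_nonneg_nonneg integral_nonneg Gi)
  then show ?thesis unfolding k_def .
qed

lemma wasserstein_le_of_epowr:
  assumes "0 < p" "0 \<le> c" "wasserstein p m m' epowr p \<le> ennreal c"
  shows "wasserstein p m m' \<le> ennreal (c powr (1 / p))"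
proof -
  have "(wasserstein p m m' epowr p) epowr (1 / p) \<le> ennreal c epowr (1 / p)"
    using assms by (intro epowr_mono) auto
  moreover have "(x epowr p) epowr (1 / p) = x" for x
    using assms(1) epowr_epowr_inverse[of "1 / p" x] by simp
  ultimately show ?thesis using assms(2) by (simp only:) (simp add: epowr_def)
qed

lemma wasserstein_self:
  assumes "0 < p" "sets m = sets borel" shows "wasserstein p m m = 0"
proof -
  have "distr m borel (\<lambda>x. x) = m" by (rule distr_id2) (simp add: assms(2))
  moreover have "(\<lambda>x. x) \<in> borel_measurable m" by (rule measurable_ident_sets[OF assms(2)])
  ultimately have "wasserstein p m m epowr p \<le> ennreal 0"
    using wasserstein_le_distr[OF assms(1), of "\<lambda>x. x" m "\<lambda>x. x"] by simp
  from wasserstein_le_of_epowr[OF assms(1) _ this] show ?thesis by simp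
qed

section \<open>Regularity of the limit flow\<close>

locale mean_field = prob_space M
  for M :: "'w measure" +
  fixes T p L :: real
    and b :: "real \<Rightarrow> real ^ 'd \<Rightarrow> (real ^ 'd) measure \<Rightarrow> real ^ 'd"
    and \<sigma> :: "real ^ 'd ^ 'd"
    and \<mu>0 :: "(real ^ 'd) measure"
    and X0 :: "nat \<Rightarrow> 'w \<Rightarrow> real ^ 'd"
    and B :: "nat \<Rightarrow> real \<Rightarrow> 'w \<Rightarrow> real ^ 'd"
    and Y :: "real \<Rightarrow> 'w \<Rightarrow> real ^ 'd"
    and \<mu> :: "real \<Rightarrow> (real ^ 'd) measure"
  assumes T: "0 < T"
    and p: "1 \<le> p" "p \<le> 2"
    and b_measurable: "(\<lambda>(t, x, m). b t x m) \<in>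
      borel_measurable (restrict_space borel {0..T} \<Otimes>\<^sub>M (borel \<Otimes>\<^sub>M wasserstein_borel p))"
    and b_lipschitz: "\<And>t x x' m m'. t \<in> {0..T} \<Longrightarrow>
      m \<in> finite_moment_measures p \<Longrightarrow> m' \<in> finite_moment_measures p \<Longrightarrow>
      ennreal (norm (b t x m - b t x' m')) \<le>
        ennreal L * (ennreal (norm (x - x')) + wasserstein p m m')"
    and b_bounded: "bdd_above ((\<lambda>t. norm (b t 0 (return borel 0))) ` {0..T})"
    and driving: "driving_data M \<mu>0 X0 B"
    and second_moment: "(\<integral>\<^sup>+\<omega>. ennreal ((norm (X0 0 \<omega>))\<^sup>2) \<partial>M) < \<infinity>"
    and limit: "mckean_vlasov M T p b \<sigma> X0 B Y \<mu>"
begin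

text \<open>The constant \<open>L\<close> may be negative; \<open>ennreal L\<close> is then 0, and
  so is \<open>Lp\<close>.\<close>

definition Lp :: real where "Lp = max L 0"

lemma Lp0: "0 \<le> Lp" by (simp add: Lp_def)

lemma p0: "0 < p" using p by simp

lemma X0m[measurable]: "X0 i \<in> borel_measurable M" and Bw: "wiener_process M (B i)" and X0law: "distr M borel (X0 i) = \<mu>0"
  using driving unfolding driving_data_def by auto

lemma b_lip:
  assumes "t \<in> {0..T}" "m \<in> finite_moment_measures p" "m' \<in> finite_moment_measures p" "0 \<le> w" "wasserstein p m m' \<le> ennreal w"
  shows "norm (b t x m - b t x' m') \<le> Lp * (norm (x - x') + w)"
proof -
  have "ennreal (norm (b t x m - b t x' m')) \<le> ennreal L * (ennreal (norm (x - x')) + wasserstein p m m')"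
    by (rule b_lipschitz) fact+
  also have "\<dots> \<le> ennreal Lp * (ennreal (norm (x - x')) + ennreal w)"
    using assms(5) by (intro mult_mono add_mono) (auto simp: Lp_def intro: ennreal_leI)
  also have "\<dots> = ennreal (Lp * (norm (x - x') + w))" using Lp0 assms(4) by (simp add: ennreal_mult)
  finally show ?thesis using Lp0 assms(4) by simp
qed

definition \<beta> :: "real \<Rightarrow> real ^ 'd \<Rightarrow> real ^ 'd" where "\<beta> s y = b s y (\<mu> s)"

lemma Ym[measurable]: "t \<in> {0..T} \<Longrightarrow> Y t \<in> borel_measurable M"
  and \<mu>law: "t \<in> {0..T} \<Longrightarrow> \<mu> t = distr M borel (Y t)"
  and \<mu>fm: "t \<in> {0..T} \<Longrightarrow> \<mu> t \<in> finite_moment_measures p"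
  and Ypath: "AE \<omega> in M. continuous_on {0..T} (\<lambda>t. Y t \<omega>) \<and> set_integrable lborel {0..T} (\<lambda>s. \<beta> s (Y s \<omega>)) \<and>
        (\<forall>t\<in>{0..T}. Y t \<omega> = X0 0 \<omega> + (LINT s:{0..t}|lborel. \<beta> s (Y s \<omega>)) + \<sigma> *v B 0 t \<omega>)"
  using limit unfolding mckean_vlasov_def strong_solution_def \<beta>_def by blast+

lemma \<beta>_lip: "s \<in> {0..T} \<Longrightarrow> norm (\<beta> s x - \<beta> s y) \<le> Lp * norm (x - y)"
proof -
  assume s: "s \<in> {0..T}"
  have "sets (\<mu> s) = sets borel" using \<mu>fm[OF s] by (simp add: finite_moment_measures_def)
  then have "wasserstein p (\<mu> s) (\<mu> s) \<le> ennreal 0" using wasserstein_self[OF p0] by simp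
  from b_lip[OF s \<mu>fm[OF s] \<mu>fm[OF s] order.refl this, of x y] show ?thesis by (simp add: \<beta>_def)
qed

lemma lint_eq:
  assumes "set_integrable lborel {0..T} f" "t \<in> {0..T}"
  shows "(LINT s:{0..t}|lborel. f s) = integral {0..t} (f :: real \<Rightarrow> real ^ 'd)" "f integrable_on {0..t}"
proof -
  have "set_integrable lborel {0..t} f"
    by (rule set_integrable_subset[OF assms(1)]) (use assms(2) in auto)
  from set_borel_integral_eq_integral[OF this] show "(LINT s:{0..t}|lborel. f s) = integral {0..t} f" "f integrable_on {0..t}" by auto
qed

lemma rough_AE_finite: "AE \<omega> in M. roughness T (\<lambda>s. B i s \<omega>) m \<noteq> \<infinity>"
proof (rule nn_integral_PInf_AE[OF roughness_measurable[OF Bw T]])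
  show "(\<integral>\<^sup>+\<omega>. roughness T (\<lambda>s. B i s \<omega>) m \<partial>M) \<noteq> \<infinity>"
    using roughness_expectation[OF Bw[of i] T, of m] by (auto simp: top_unique)
qed

lemma B_AE: "AE \<omega> in M. continuous_on {0..T} (\<lambda>t. B i t \<omega>) \<and> B i 0 \<omega> = 0"
proof -
  have "AE \<omega> in M. continuous_on {0..} (\<lambda>t. B i t \<omega>)" "AE \<omega> in M. B i 0 \<omega> = 0"
    using Bw[of i] unfolding wiener_process_def by blast+
  then show ?thesis by eventually_elim (auto intro: continuous_on_subset)
qed

text \<open>On one fixed trajectory the drift is integrable, and the drift along any other trajectory
  differs from it by at most the Lipschitz constant times the distance of the two; so no a priori
  bound on the moments of \<open>\<mu>\<close> is needed for Gronwall's inequality.\<close>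

lemma Y_dominated:
  obtains D where "D \<in> borel_measurable M" "\<And>\<omega>. 0 \<le> D \<omega>" "(\<integral>\<^sup>+\<omega>. ennreal ((D \<omega>)\<^sup>2) \<partial>M) < \<infinity>"
    "AE \<omega> in M. \<forall>t\<in>{0..T}. norm (Y t \<omega>) \<le> D \<omega>"
proof -
  have "\<exists>\<omega>0. continuous_on {0..T} (\<lambda>t. Y t \<omega>0) \<and> set_integrable lborel {0..T} (\<lambda>s. \<beta> s (Y s \<omega>0))"
  proof (rule ccontr)
    assume no: "\<nexists>\<omega>0. continuous_on {0..T} (\<lambda>t. Y t \<omega>0) \<and> set_integrable lborel {0..T} (\<lambda>s. \<beta> s (Y s \<omega>0))"
    from Ypath have "AE \<omega> in M. False" by eventually_elim (use no in blast)
    then show False by simp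
  qed
  then obtain \<omega>0 where w0: "continuous_on {0..T} (\<lambda>t. Y t \<omega>0)" "set_integrable lborel {0..T} (\<lambda>s. \<beta> s (Y s \<omega>0))" by blast
  define a where "a s = norm (\<beta> s (Y s \<omega>0)) + Lp * norm (Y s \<omega>0)" for s
  have a0: "0 \<le> a s" for s using Lp0 by (simp add: a_def)
  have ai: "a integrable_on {0..t}" if "t \<in> {0..T}" for t
  proof -
    have "set_integrable lborel {0..t} (\<lambda>s. norm (\<beta> s (Y s \<omega>0)))"
      by (rule set_integrable_subset[OF set_integrable_norm[OF w0(2)]]) (use that in auto)
    then have "(\<lambda>s. norm (\<beta> s (Y s \<omega>0))) integrable_on {0..t}" by (rule set_borel_integral_eq_integral)
    moreover have "(\<lambda>s. Lp * norm (Y s \<omega>0)) integrable_on {0..t}"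
      using that by (intro integrable_continuous_interval continuous_intros continuous_on_subset[OF w0(1)]) auto
    ultimately show ?thesis unfolding a_def by (rule integrable_add)
  qed
  define a1 where "a1 = integral {0..T} a"
  have a1: "0 \<le> a1" unfolding a1_def using a0 T by (intro integral_nonneg ai) auto
  define \<kappa> where "\<kappa> = onorm (\<lambda>x. \<sigma> *v x)"
  have bl: "bounded_linear (\<lambda>x. \<sigma> *v x)" by (simp add: linear_linear)
  have \<kappa>: "norm (\<sigma> *v x) \<le> \<kappa> * norm x" for x unfolding \<kappa>_def by (rule onorm[OF bl])
  have \<kappa>0: "0 \<le> \<kappa>" unfolding \<kappa>_def by (rule onorm_pos_le[OF bl])
  have cc: "0 \<le> chain_const" using chain_const_ge_1 by simp
  define \<rho> where "\<rho> \<omega> = roughness T (\<lambda>s. B 0 s \<omega>) 0" for \<omega>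
  have \<rho>m[measurable]: "\<rho> \<in> borel_measurable M" unfolding \<rho>_def by (rule roughness_measurable[OF Bw T])
  define R where "R \<omega> = root 6 (chain_const * enn2real (\<rho> \<omega>))" for \<omega>
  have R0: "0 \<le> R \<omega>" and R6: "R \<omega> ^ 6 = chain_const * enn2real (\<rho> \<omega>)" for \<omega>
    using cc by (auto simp: R_def real_root_pow_pos2)
  define e where "e = 2 * exp (2 * Lp * T)"
  define D where "D \<omega> = e * (norm (X0 0 \<omega>) + a1 + \<kappa> * R \<omega>)" for \<omega>
  have D0: "0 \<le> D \<omega>" for \<omega> using a1 \<kappa>0 R0 by (simp add: D_def e_def)
  have [measurable]: "R \<in> borel_measurable M" unfolding R_def by measurable
  have Dm: "D \<in> borel_measurable M" unfolding D_def by measurable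
  define c where "c = e\<^sup>2 * (3 * (1 + a1\<^sup>2 + \<kappa>\<^sup>2 * (1 + chain_const)))"
  have c0: "0 \<le> c" using cc by (simp add: c_def)
  have D2: "ennreal ((D \<omega>)\<^sup>2) \<le> ennreal c * (ennreal ((norm (X0 0 \<omega>))\<^sup>2) + 1 + \<rho> \<omega>)" if fin: "\<rho> \<omega> \<noteq> \<infinity>" for \<omega>
  proof -
    let ?x = "norm (X0 0 \<omega>)" and ?u = "enn2real (\<rho> \<omega>)"
    have "(R \<omega>)\<^sup>2 \<le> 1 + R \<omega> ^ 6" using powr_le_1_plus[OF R0[of \<omega>], of 2 6] by (simp add: R0)
    then have R2: "(R \<omega>)\<^sup>2 \<le> 1 + chain_const * ?u" unfolding R6 .
    have "(?x + a1 + \<kappa> * R \<omega>)\<^sup>2 \<le> 3 * (?x\<^sup>2 + a1\<^sup>2 + (\<kappa> * R \<omega>)\<^sup>2)"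
    proof -
      have "0 \<le> (?x - a1)\<^sup>2 + (a1 - \<kappa> * R \<omega>)\<^sup>2 + (?x - \<kappa> * R \<omega>)\<^sup>2" by simp
      then show ?thesis by (simp add: power2_eq_square algebra_simps)
    qed
    also have "(\<kappa> * R \<omega>)\<^sup>2 \<le> \<kappa>\<^sup>2 * (1 + chain_const * ?u)" unfolding power_mult_distrib using R2 by (intro mult_left_mono) auto
    also have "3 * (?x\<^sup>2 + a1\<^sup>2 + \<kappa>\<^sup>2 * (1 + chain_const * ?u)) \<le> 3 * (1 + a1\<^sup>2 + \<kappa>\<^sup>2 * (1 + chain_const)) * (?x\<^sup>2 + 1 + ?u)"
    proof -
      have "(1 + a1\<^sup>2 + \<kappa>\<^sup>2 * (1 + chain_const)) * (?x\<^sup>2 + 1 + ?u) - (?x\<^sup>2 + a1\<^sup>2 + \<kappa>\<^sup>2 * (1 + chain_const * ?u)) =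
        (1 + ?u) + a1\<^sup>2 * (?x\<^sup>2 + ?u) + \<kappa>\<^sup>2 * (?x\<^sup>2 + ?u) + \<kappa>\<^sup>2 * chain_const * (?x\<^sup>2 + 1)" by (simp add: algebra_simps)
      also have "0 \<le> \<dots>" using cc by simp
      finally have "?x\<^sup>2 + a1\<^sup>2 + \<kappa>\<^sup>2 * (1 + chain_const * ?u) \<le> (1 + a1\<^sup>2 + \<kappa>\<^sup>2 * (1 + chain_const)) * (?x\<^sup>2 + 1 + ?u)" by simp
      from mult_left_mono[OF this, of 3] show ?thesis by (simp only: mult.assoc)
    qed
    finally have "(D \<omega>)\<^sup>2 \<le> c * (?x\<^sup>2 + 1 + ?u)"
      unfolding D_def c_def power_mult_distrib by (simp add: mult_left_mono mult.assoc)
    then have "ennreal ((D \<omega>)\<^sup>2) \<le> ennreal (c * (?x\<^sup>2 + 1 + ?u))" by (rule ennreal_leI)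
    also have "\<dots> = ennreal c * (ennreal (?x\<^sup>2) + 1 + \<rho> \<omega>)" using c0 fin by (simp add: ennreal_mult less_top)
    finally show ?thesis .
  qed
  have "(\<integral>\<^sup>+\<omega>. ennreal ((D \<omega>)\<^sup>2) \<partial>M) \<le> (\<integral>\<^sup>+\<omega>. ennreal c * (ennreal ((norm (X0 0 \<omega>))\<^sup>2) + 1 + \<rho> \<omega>) \<partial>M)"
    using rough_AE_finite[of 0 0] by (intro nn_integral_mono_AE) (auto simp: \<rho>_def[symmetric] D2)
  also have "\<dots> = ennreal c * ((\<integral>\<^sup>+\<omega>. ennreal ((norm (X0 0 \<omega>))\<^sup>2) \<partial>M) + 1 + (\<integral>\<^sup>+\<omega>. \<rho> \<omega> \<partial>M))"
    by (simp add: nn_integral_cmult nn_integral_add emeasure_space_1)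
  also have "\<dots> < \<infinity>"
  proof -
    have "(\<integral>\<^sup>+\<omega>. \<rho> \<omega> \<partial>M) < \<infinity>"
      using roughness_expectation[OF Bw[of 0] T, of 0] unfolding \<rho>_def
      by (rule le_less_trans) (simp add: less_top[symmetric])
    then show ?thesis using second_moment by (simp add: ennreal_mult_less_top)
  qed
  finally have Dfin: "(\<integral>\<^sup>+\<omega>. ennreal ((D \<omega>)\<^sup>2) \<partial>M) < \<infinity>" .
  have "AE \<omega> in M. \<forall>t\<in>{0..T}. norm (Y t \<omega>) \<le> D \<omega>"
    using Ypath B_AE[of 0] rough_AE_finite[of 0 0]
  proof eventually_elim
    case (elim \<omega>)
    have cY: "continuous_on {0..T} (\<lambda>t. Y t \<omega>)" using elim(1) by blast
    have BR: "norm (\<sigma> *v B 0 t \<omega>) \<le> \<kappa> * R \<omega>" if t: "t \<in> {0..T}" for t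
    proof -
      have "\<rho> \<omega> = ennreal (enn2real (\<rho> \<omega>))" using elim(3) by (simp add: \<rho>_def less_top)
      then have "ennreal (norm (B 0 t \<omega>) ^ 6) \<le> ennreal chain_const * ennreal (enn2real (\<rho> \<omega>))"
        using roughness_sup[OF T _ t, of "\<lambda>s. B 0 s \<omega>"] elim(2) by (simp add: \<rho>_def)
      also have "\<dots> = ennreal (R \<omega> ^ 6)" using cc by (simp add: R6 ennreal_mult)
      finally have "norm (B 0 t \<omega>) ^ 6 \<le> R \<omega> ^ 6" using R0 by (simp add: zero_le_even_power)
      then have "norm (B 0 t \<omega>) \<le> R \<omega>" using R0 by (subst (asm) power_mono_iff) auto
      then have "\<kappa> * norm (B 0 t \<omega>) \<le> \<kappa> * R \<omega>" using \<kappa>0 by (rule mult_left_mono)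
      then show ?thesis using \<kappa>[of "B 0 t \<omega>"] by linarith
    qed
    have "norm (Y t \<omega>) \<le> 2 * (norm (X0 0 \<omega>) + a1 + \<kappa> * R \<omega>) * exp (2 * Lp * T)" if t: "t \<in> {0..T}" for t
    proof (rule gronwall[where u="\<lambda>t. norm (Y t \<omega>)", OF continuous_on_norm[OF cY] Lp0 _ _ _ t])
      fix t assume t: "t \<in> {0..T}"
      have int: "set_integrable lborel {0..T} (\<lambda>s. \<beta> s (Y s \<omega>))" using elim(1) by blast
      have nY: "(\<lambda>s. norm (Y s \<omega>)) integrable_on {0..t}"
        using t by (intro integrable_continuous_interval continuous_on_norm continuous_on_subset[OF cY]) auto
      have "norm (\<beta> s (Y s \<omega>)) \<le> a s + Lp * norm (Y s \<omega>)" if "s \<in> {0..T}" for s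
      proof -
        have "norm (\<beta> s (Y s \<omega>)) \<le> norm (\<beta> s (Y s \<omega>0)) + norm (\<beta> s (Y s \<omega>) - \<beta> s (Y s \<omega>0))"
          by (rule norm_triangle_sub)
        also have "norm (\<beta> s (Y s \<omega>) - \<beta> s (Y s \<omega>0)) \<le> Lp * norm (Y s \<omega> - Y s \<omega>0)" by (rule \<beta>_lip[OF that])
        also have "\<dots> \<le> Lp * (norm (Y s \<omega>) + norm (Y s \<omega>0))" using Lp0 by (intro mult_left_mono norm_triangle_ineq4)
        finally show ?thesis by (simp add: a_def algebra_simps)
      qed
      then have "norm (integral {0..t} (\<lambda>s. \<beta> s (Y s \<omega>))) \<le> integral {0..t} (\<lambda>s. a s + Lp * norm (Y s \<omega>))"
        using t by (intro integral_norm_bound_integral lint_eq[OF int] integrable_add ai integrable_on_mult_right nY) auto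
      also have "\<dots> = integral {0..t} a + Lp * integral {0..t} (\<lambda>s. norm (Y s \<omega>))"
        using t by (subst integral_add) (auto intro: ai integrable_on_mult_right nY)
      also have "integral {0..t} a \<le> a1"
        unfolding a1_def using t T by (intro integral_subset_le ai) (auto simp: a0)
      finally have "norm (integral {0..t} (\<lambda>s. \<beta> s (Y s \<omega>))) \<le> a1 + Lp * integral {0..t} (\<lambda>s. norm (Y s \<omega>))" by simp
      moreover have "norm (Y t \<omega>) \<le> norm (X0 0 \<omega> + integral {0..t} (\<lambda>s. \<beta> s (Y s \<omega>))) + norm (\<sigma> *v B 0 t \<omega>)"
      proof -
        have "Y t \<omega> = X0 0 \<omega> + integral {0..t} (\<lambda>s. \<beta> s (Y s \<omega>)) + \<sigma> *v B 0 t \<omega>"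
          using elim(1) t lint_eq(1)[OF int t] by auto
        then show ?thesis by (subst \<open>Y t \<omega> = _\<close>) (rule norm_triangle_ineq)
      qed
      ultimately show "norm (Y t \<omega>) \<le> norm (X0 0 \<omega>) + a1 + \<kappa> * R \<omega> + Lp * integral {0..t} (\<lambda>s. norm (Y s \<omega>))"
        using BR[OF t] norm_triangle_ineq[of "X0 0 \<omega>" "integral {0..t} (\<lambda>s. \<beta> s (Y s \<omega>))"] by linarith
    qed (use a1 \<kappa>0 R0 in auto)
    moreover have "2 * (norm (X0 0 \<omega>) + a1 + \<kappa> * R \<omega>) * exp (2 * Lp * T) = D \<omega>" by (simp add: D_def e_def)
    ultimately show ?case by auto
  qed
  with Dm D0 Dfin show thesis by (rule that)
qed

lemma Y_moment_p:
  obtains K where "0 \<le> K" "\<And>t. t \<in> {0..T} \<Longrightarrow> (\<integral>\<^sup>+\<omega>. ennreal (norm (Y t \<omega>) powr p) \<partial>M) \<le> ennreal K"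
proof -
  obtain D where D: "D \<in> borel_measurable M" "\<And>\<omega>. 0 \<le> D \<omega>" "(\<integral>\<^sup>+\<omega>. ennreal ((D \<omega>)\<^sup>2) \<partial>M) < \<infinity>"
    "AE \<omega> in M. \<forall>t\<in>{0..T}. norm (Y t \<omega>) \<le> D \<omega>" using Y_dominated by blast
  note [measurable] = D(1)
  have fin: "1 + (\<integral>\<^sup>+\<omega>. ennreal ((D \<omega>)\<^sup>2) \<partial>M) < \<infinity>" using D(3) by simp
  have bd: "(\<integral>\<^sup>+\<omega>. ennreal (norm (Y t \<omega>) powr p) \<partial>M) \<le> 1 + (\<integral>\<^sup>+\<omega>. ennreal ((D \<omega>)\<^sup>2) \<partial>M)" if t: "t \<in> {0..T}" for t
  proof -
    have "(\<integral>\<^sup>+\<omega>. ennreal (norm (Y t \<omega>) powr p) \<partial>M) \<le> (\<integral>\<^sup>+\<omega>. 1 + ennreal ((D \<omega>)\<^sup>2) \<partial>M)"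
    proof (rule nn_integral_mono_AE)
      show "AE \<omega> in M. ennreal (norm (Y t \<omega>) powr p) \<le> 1 + ennreal ((D \<omega>)\<^sup>2)"
        using D(4)
      proof eventually_elim
        case (elim \<omega>)
        then have "norm (Y t \<omega>) powr p \<le> D \<omega> powr p" using t p by (intro powr_mono2) auto
        also have "\<dots> \<le> 1 + D \<omega> powr 2" using p D(2) by (intro powr_le_1_plus) auto
        finally have "ennreal (norm (Y t \<omega>) powr p) \<le> ennreal (1 + (D \<omega>)\<^sup>2)" using D(2) by (intro ennreal_leI) simp
        then show ?case by simp
      qed
    qed
    also have "\<dots> = 1 + (\<integral>\<^sup>+\<omega>. ennreal ((D \<omega>)\<^sup>2) \<partial>M)" by (subst nn_integral_add) (auto simp: emeasure_space_1)
    finally show ?thesis .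
  qed
  obtain K where "0 \<le> K" "1 + (\<integral>\<^sup>+\<omega>. ennreal ((D \<omega>)\<^sup>2) \<partial>M) = ennreal K"
    using fin by (cases "1 + (\<integral>\<^sup>+\<omega>. ennreal ((D \<omega>)\<^sup>2) \<partial>M)") auto
  with bd show thesis by (intro that) auto
qed

text \<open>The values of one path at two times form a coupling. Its cost tends to 0 by dominated
  convergence, with the square of the bound from \<open>Y_dominated\<close> as majorant.\<close>

lemma \<mu>_continuous:
  assumes s: "s \<in> {0..T}" and e: "0 < e"
  obtains \<delta> where "0 < \<delta>" "\<And>t. t \<in> {0..T} \<Longrightarrow> dist t s < \<delta> \<Longrightarrow> wasserstein p (\<mu> s) (\<mu> t) < ennreal e"
proof -
  obtain D where D: "D \<in> borel_measurable M" "\<And>\<omega>. 0 \<le> D \<omega>" "(\<integral>\<^sup>+\<omega>. ennreal ((D \<omega>)\<^sup>2) \<partial>M) < \<infinity>"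
    "AE \<omega> in M. \<forall>t\<in>{0..T}. norm (Y t \<omega>) \<le> D \<omega>" using Y_dominated by blast
  note [measurable] = D(1)
  let ?\<phi> = "\<lambda>t. \<integral>\<^sup>+\<omega>. ennreal (dist (Y s \<omega>) (Y t \<omega>) powr p) \<partial>M"
  have "(?\<phi> \<longlongrightarrow> 0) (at s within {0..T})"
    unfolding tendsto_at_iff_sequentially
  proof (intro allI impI)
    fix X :: "nat \<Rightarrow> real" assume X: "\<forall>i. X i \<in> {0..T} - {s}" "X \<longlonglongrightarrow> s"
    have [measurable]: "Y (X i) \<in> borel_measurable M" "Y s \<in> borel_measurable M" for i using X s by auto
    have "(\<lambda>i. \<integral>\<^sup>+\<omega>. ennreal (dist (Y s \<omega>) (Y (X i) \<omega>) powr p) \<partial>M) \<longlonglongrightarrow> (\<integral>\<^sup>+\<omega>. 0 \<partial>M)"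
    proof (rule nn_integral_dominated_convergence[where w="\<lambda>\<omega>. 1 + ennreal (4 * (D \<omega>)\<^sup>2)"])
      show "AE \<omega> in M. ennreal (dist (Y s \<omega>) (Y (X i) \<omega>) powr p) \<le> 1 + ennreal (4 * (D \<omega>)\<^sup>2)" for i
        using D(4)
      proof eventually_elim
        case (elim \<omega>)
        then have "norm (Y s \<omega>) \<le> D \<omega>" "norm (Y (X i) \<omega>) \<le> D \<omega>" using s X(1) by auto
        then have "dist (Y s \<omega>) (Y (X i) \<omega>) \<le> 2 * D \<omega>"
          using norm_triangle_ineq4[of "Y s \<omega>" "Y (X i) \<omega>"] by (simp add: dist_norm)
        then have "dist (Y s \<omega>) (Y (X i) \<omega>) powr p \<le> (2 * D \<omega>) powr p" using p by (intro powr_mono2) auto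
        also have "\<dots> \<le> 1 + (2 * D \<omega>) powr 2" using p D(2) by (intro powr_le_1_plus) auto
        also have "(2 * D \<omega>) powr 2 = 4 * (D \<omega>)\<^sup>2" using D(2)[of \<omega>] by (simp add: power_mult_distrib)
        finally have "ennreal (dist (Y s \<omega>) (Y (X i) \<omega>) powr p) \<le> ennreal (1 + 4 * (D \<omega>)\<^sup>2)" by (rule ennreal_leI)
        then show ?case by simp
      qed
      have "(\<integral>\<^sup>+\<omega>. 1 + ennreal (4 * (D \<omega>)\<^sup>2) \<partial>M) = 1 + 4 * (\<integral>\<^sup>+\<omega>. ennreal ((D \<omega>)\<^sup>2) \<partial>M)"
        by (simp add: nn_integral_add nn_integral_cmult ennreal_mult emeasure_space_1)
      then show "(\<integral>\<^sup>+\<omega>. 1 + ennreal (4 * (D \<omega>)\<^sup>2) \<partial>M) < \<infinity>" using D(3) by (simp add: ennreal_mult_less_top)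
      show "AE \<omega> in M. (\<lambda>i. ennreal (dist (Y s \<omega>) (Y (X i) \<omega>) powr p)) \<longlonglongrightarrow> 0"
        using Ypath
      proof eventually_elim
        case (elim \<omega>)
        then have c: "continuous_on {0..T} (\<lambda>t. Y t \<omega>)" by blast
        have "(\<lambda>i. Y (X i) \<omega>) \<longlonglongrightarrow> Y s \<omega>"
          using X s by (intro continuous_on_tendsto_compose[OF c]) auto
        then have "(\<lambda>i. dist (Y s \<omega>) (Y (X i) \<omega>)) \<longlonglongrightarrow> dist (Y s \<omega>) (Y s \<omega>)" by (intro tendsto_intros)
        then have "(\<lambda>i. dist (Y s \<omega>) (Y (X i) \<omega>) powr p) \<longlonglongrightarrow> 0 powr p"
          using p by (intro tendsto_powr2) (auto intro: always_eventually)
        then show ?case using p by (intro tendsto_ennrealI[where x=0, simplified]) simp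
      qed
    qed auto
    then show "((\<lambda>t. ?\<phi> t) \<circ> X) \<longlonglongrightarrow> 0" by (simp add: comp_def)
  qed
  then have "eventually (\<lambda>t. ?\<phi> t < ennreal ((e / 2) powr p)) (at s within {0..T})"
    by (rule order_tendstoD(2)) (use e in simp)
  then obtain \<delta> where \<delta>: "0 < \<delta>" "\<And>t. t \<in> {0..T} \<Longrightarrow> t \<noteq> s \<Longrightarrow> dist t s < \<delta> \<Longrightarrow> ?\<phi> t < ennreal ((e / 2) powr p)"
    unfolding eventually_at by blast
  have "wasserstein p (\<mu> s) (\<mu> t) < ennreal e" if t: "t \<in> {0..T}" "dist t s < \<delta>" for t
  proof -
    have [measurable]: "Y t \<in> borel_measurable M" "Y s \<in> borel_measurable M" using t s by auto
    have "?\<phi> t \<le> ennreal ((e / 2) powr p)"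
      using \<delta>(2)[OF t(1) _ t(2)] by (cases "t = s") (auto simp: less_imp_le)
    moreover have "wasserstein p (\<mu> s) (\<mu> t) epowr p \<le> ?\<phi> t"
      unfolding \<mu>law[OF s] \<mu>law[OF t(1)] by (rule wasserstein_le_distr[OF p0]) measurable
    ultimately have "wasserstein p (\<mu> s) (\<mu> t) \<le> ennreal (((e / 2) powr p) powr (1 / p))"
      by (intro wasserstein_le_of_epowr[OF p0]) auto
    also have "((e / 2) powr p) powr (1 / p) = e / 2" using e p by (simp add: powr_powr)
    also have "ennreal (e / 2) < ennreal e" using e by (intro ennreal_lessI) auto
    finally show ?thesis .
  qed
  with \<delta>(1) show thesis by (rule that)
qed

text \<open>By \<open>\<mu>_continuous\<close> the generating sets have relatively open preimages.
  Inserting \<open>\<mu>\<close> into the jointly measurable \<open>b\<close> then gives a jointly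
  measurable \<open>\<beta>\<close>.\<close>

lemma \<mu>_measurable: "\<mu> \<in> restrict_space borel {0..T} \<rightarrow>\<^sub>M wasserstein_borel p"
  unfolding wasserstein_borel_def
proof (rule measurable_measure_of)
  show "\<mu> \<in> space (restrict_space borel {0..T}) \<rightarrow> finite_moment_measures p" using \<mu>fm by (auto simp: space_restrict_space)
  fix U :: "(real ^ 'd) measure set" assume "U \<in> {U. U \<subseteq> finite_moment_measures p \<and>
         (\<forall>m\<in>U. \<exists>e>0. \<forall>m'\<in>finite_moment_measures p. wasserstein p m m' < ennreal e \<longrightarrow> m' \<in> U)}"
  then have U: "\<And>m. m \<in> U \<Longrightarrow> \<exists>e>0. \<forall>m'\<in>finite_moment_measures p. wasserstein p m m' < ennreal e \<longrightarrow> m' \<in> U" by blast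
  let ?V = "{t \<in> {0..T}. \<mu> t \<in> U}"
  have "openin (top_of_set {0..T}) ?V"
    unfolding openin_euclidean_subtopology_iff
  proof (intro conjI ballI)
    fix s assume s: "s \<in> ?V"
    then obtain e where e: "e > 0" "\<And>m'. m' \<in> finite_moment_measures p \<Longrightarrow> wasserstein p (\<mu> s) m' < ennreal e \<Longrightarrow> m' \<in> U"
      using U[of "\<mu> s"] by blast
    from s have s': "s \<in> {0..T}" by simp
    obtain \<delta> where "0 < \<delta>" "\<And>t. t \<in> {0..T} \<Longrightarrow> dist t s < \<delta> \<Longrightarrow> wasserstein p (\<mu> s) (\<mu> t) < ennreal e"
      using \<mu>_continuous[OF s' e(1)] by blast
    then show "\<exists>\<delta>>0. \<forall>t\<in>{0..T}. dist t s < \<delta> \<longrightarrow> t \<in> ?V" using e(2) \<mu>fm by blast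
  qed auto
  then obtain O' where "open O'" "?V = {0..T} \<inter> O'" by (auto simp: openin_open)
  then have "?V \<in> sets (restrict_space borel {0..T})" by (auto simp: sets_restrict_space)
  then show "\<mu> -` U \<inter> space (restrict_space borel {0..T}) \<in> sets (restrict_space borel {0..T})"
    by (simp add: space_restrict_space vimage_def Int_def conj_commute)
qed auto

lemma \<beta>_measurable: "(\<lambda>(s, y). \<beta> s y) \<in> borel_measurable (restrict_space borel {0..T} \<Otimes>\<^sub>M borel)"
proof -
  note [measurable] = \<mu>_measurable
  have "(\<lambda>z. (fst z, snd z, \<mu> (fst z))) \<in> restrict_space borel {0..T} \<Otimes>\<^sub>M borel \<rightarrow>\<^sub>M restrict_space borel {0..T} \<Otimes>\<^sub>M (borel \<Otimes>\<^sub>M wasserstein_borel p)"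
    by measurable
  from measurable_compose[OF this b_measurable] show ?thesis by (simp add: \<beta>_def split_beta')
qed

text \<open>The Lipschitz condition compares \<open>\<mu> s\<close> with the Dirac measure at 0,
  where \<open>b\<close> is bounded; the distance between the two is controlled by the
  \<open>p\<close>-th moment, which is bounded uniformly in time.\<close>

lemma \<beta>_bounded: "\<exists>A\<ge>0. \<forall>s\<in>{0..T}. norm (\<beta> s 0) \<le> A"
proof -
  obtain K where K: "0 \<le> K" "\<And>t. t \<in> {0..T} \<Longrightarrow> (\<integral>\<^sup>+\<omega>. ennreal (norm (Y t \<omega>) powr p) \<partial>M) \<le> ennreal K" using Y_moment_p by blast
  obtain A0 where A0: "\<And>t. t \<in> {0..T} \<Longrightarrow> norm (b t 0 (return borel 0)) \<le> A0"
    using b_bounded unfolding bdd_above_def by blast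
  have d0: "return borel 0 \<in> finite_moment_measures p"
    using p by (auto simp: finite_moment_measures_def prob_space_return nn_integral_return)
  have "norm (\<beta> s 0) \<le> \<bar>A0\<bar> + Lp * K powr (1 / p)" if s: "s \<in> {0..T}" for s
  proof -
    have "distr M borel (\<lambda>_. 0) = return borel (0 :: real ^ 'd)" by (rule distr_const) simp
    then have "wasserstein p (\<mu> s) (return borel 0) epowr p \<le> (\<integral>\<^sup>+\<omega>. ennreal (dist (Y s \<omega>) 0 powr p) \<partial>M)"
      unfolding \<mu>law[OF s] using wasserstein_le_distr[OF p0, of "Y s" M "\<lambda>_. 0"] s by simp
    also have "\<dots> \<le> ennreal K" using K(2)[OF s] by simp
    finally have "wasserstein p (\<mu> s) (return borel 0) \<le> ennreal (K powr (1 / p))"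
      by (rule wasserstein_le_of_epowr[OF p0 K(1)])
    from b_lip[OF s \<mu>fm[OF s] d0 _ this, of 0 0] have "norm (b s 0 (\<mu> s) - b s 0 (return borel 0)) \<le> Lp * K powr (1 / p)" by simp
    then show ?thesis using A0[OF s] norm_triangle_sub[of "b s 0 (\<mu> s)" "b s 0 (return borel 0)"] by (simp add: \<beta>_def)
  qed
  moreover have "0 \<le> \<bar>A0\<bar> + Lp * K powr (1 / p)" using Lp0 by simp
  ultimately show ?thesis by blast
qed

definition Abd :: real where "Abd = (SOME A. A \<ge> 0 \<and> (\<forall>s\<in>{0..T}. norm (\<beta> s 0) \<le> A))"

lemma Abd: "0 \<le> Abd" "s \<in> {0..T} \<Longrightarrow> norm (\<beta> s 0) \<le> Abd"
  using someI_ex[OF \<beta>_bounded] unfolding Abd_def by auto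

sublocale copies M T Lp Abd \<beta> \<mu>0 X0 B \<sigma>
  by unfold_locales (use T Lp0 Abd \<beta>_measurable \<beta>_lip driving in auto)

lemma Y_eq_copy: "AE \<omega> in M. \<forall>t\<in>{0..T}. Y t \<omega> = copy 0 t \<omega>"
  using Ypath AE_not_bad[of 0] AE_space
proof eventually_elim
  case (elim \<omega>)
  have "solves (drive 0 \<omega>) (\<lambda>t. Y t \<omega>)"
    unfolding solves_def using elim(1) lint_eq(1)[of "\<lambda>s. \<beta> s (Y s \<omega>)"] by (auto simp: algebra_simps)
  then show ?case using solves_unique[OF _ copy_solves[OF elim(3,2)]] by blast
qed

text \<open>By uniqueness of solutions \<open>Y\<close> is copy 0, up to a null set, and all copies
  have the same law. The empirical measure of the copies thus samples from
  \<open>\<mu> t\<close>.\<close>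

lemma \<mu>_copy: "t \<in> {0..T} \<Longrightarrow> \<mu> t = distr M borel (copy i t)"
proof -
  assume t: "t \<in> {0..T}"
  have "distr M borel (Y t) = distr M borel (copy 0 t)"
    using Y_eq_copy t by (intro distr_cong_AE Ym copy_measurable) auto
  then show ?thesis by (simp add: \<mu>law[OF t] copy_law[OF t, of i])
qed

end

section \<open>Integrals over the particle indices\<close>

lemma nn_integral_uniform_count:
  "(\<integral>\<^sup>+i. f i \<partial>uniform_count_measure {..<n}) = ennreal (1 / real n) * (\<Sum>i<n. f i)"
  unfolding uniform_count_measure_def
  by (subst nn_integral_point_measure_finite) (simp_all add: sum_distrib_left sum_distrib_right mult.commute)

lemma uniform_count_measurable: "f \<in> borel_measurable (uniform_count_measure A)"
  by (simp add: measurable_def space_uniform_count_measure sets_uniform_count_measure)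

lemma prob_space_uniform_count: "n \<ge> 1 \<Longrightarrow> prob_space (uniform_count_measure {..<n::nat})"
  by (rule prob_space_uniform_count_measure) (auto simp: lessThan_empty_iff)

lemma empirical_finite_moment:
  assumes "n \<ge> 1" shows "empirical n x \<in> finite_moment_measures p"
proof -
  have "prob_space (empirical n x)"
    unfolding empirical_def by (rule prob_space.prob_space_distr[OF prob_space_uniform_count[OF assms] uniform_count_measurable])
  moreover have "sets (empirical n x) = sets borel" by (simp add: empirical_def)
  ultimately show ?thesis
    by (simp add: finite_moment_measures_def nn_integral_empirical[OF assms] ennreal_mult_less_top)
qed

lemma integral_indicator_le:
  fixes u v :: real
  assumes "u \<le> v" shows "(indicator {u..v} :: real \<Rightarrow> real) integrable_on {0..T}" "integral {0..T} (indicator {u..v} :: real \<Rightarrow> real) \<le> v - u"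
proof -
  have l: "{u..v} \<inter> {0..T} \<in> lmeasurable" by (simp add: fmeasurable_Int_fmeasurable)
  then show "(indicator {u..v} :: real \<Rightarrow> real) integrable_on {0..T}" by (rule integrable_on_indicator[THEN iffD2])
  have "integral {0..T} (indicator {u..v} :: real \<Rightarrow> real) = measure lebesgue ({u..v} \<inter> {0..T})"
    using l by (rule integral_indicator)
  also have "\<dots> \<le> measure lebesgue {u..v}" by (intro measure_mono_fmeasurable) auto
  also have "\<dots> = v - u" using assms by simp
  finally show "integral {0..T} (indicator {u..v} :: real \<Rightarrow> real) \<le> v - u" .
qed

section \<open>Error of the particle system along a fixed path\<close>

context mean_field
begin

text \<open>The right side of \<open>copy_modulus\<close> without its constant.\<close>

definition fluct :: "real \<Rightarrow> nat \<Rightarrow> nat \<Rightarrow> 'w \<Rightarrow> ennreal" where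
  "fluct r m i \<omega> = ennreal (2 powr (- (r * real m / 3))) * (1 + ennreal ((norm (X0 i \<omega>))\<^sup>2) + rough i 0 \<omega> + ennreal (2 ^ m) * rough i m \<omega>)"

definition mean_fluct :: "real \<Rightarrow> nat \<Rightarrow> ennreal" where
  "mean_fluct r m = (\<integral>\<^sup>+\<omega>. fluct r m 0 \<omega> \<partial>M)"

lemma fluct_measurable[measurable]: "fluct r m i \<in> borel_measurable M"
  unfolding fluct_def by measurable

abbreviation total_fluct :: "real \<Rightarrow> nat \<Rightarrow> nat \<Rightarrow> 'w \<Rightarrow> ennreal" where
  "total_fluct r n m \<omega> \<equiv> ennreal (1 / real n) * (\<Sum>i<n. fluct r m i \<omega>) + mean_fluct r m"

abbreviation grid_discrepancy :: "real \<Rightarrow> nat \<Rightarrow> nat \<Rightarrow> nat \<Rightarrow> nat \<Rightarrow> 'w \<Rightarrow> ennreal" where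
  "grid_discrepancy r Lv n m k \<omega> \<equiv>
     discrepancy r Lv (empirical n (\<lambda>i. copy i (T * real k / 2 ^ m) \<omega>)) (\<mu> (T * real k / 2 ^ m))"

text \<open>\<open>wasserstein_le_discrepancy\<close> is applied to the uniform measure on the
  indices and to \<open>M\<close>: particles at time \<open>t\<close> are compared with copies at
  the grid time, and \<open>\<mu> t\<close> with its value at the grid time through copy 0. The path
  is fixed in the first measure and integrated in the second, hence the two kinds of fluctuation in
  \<open>total_fluct\<close>.\<close>

lemma particle_to_copy:
  assumes r: "1 \<le> r" "r \<le> 2"
  obtains c where "0 < c" "\<And>n m Lv k t \<omega> xs. n \<ge> 1 \<Longrightarrow> \<omega> \<in> space M \<Longrightarrow> t \<in> {0..T} \<Longrightarrow> grid T m t = T * real k / 2 ^ m \<Longrightarrow>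
    wasserstein r (empirical n xs) (\<mu> t) epowr r \<le> ennreal c *
      (ennreal (1 / real n) * (\<Sum>i<n. ennreal (norm (xs i - copy i t \<omega>) powr r)) +
       total_fluct r n m \<omega> +
       grid_discrepancy r Lv n m k \<omega>)"
proof -
  obtain C where C: "0 < C" "\<And>i s m \<omega>. \<omega> \<in> space M \<Longrightarrow> s \<in> {0..T} \<Longrightarrow>
    ennreal (dist (copy i s \<omega>) (copy i (grid T m s) \<omega>) powr r) \<le>
      ennreal (C * 2 powr (- (r * real m / 3))) * (1 + ennreal ((norm (X0 i \<omega>))\<^sup>2) + rough i 0 \<omega> + ennreal (2 ^ m) * rough i m \<omega>)"
    using copy_modulus[OF r] by blast
  have C': "ennreal (dist (copy i s \<omega>) (copy i (grid T m s) \<omega>) powr r) \<le> ennreal C * fluct r m i \<omega>"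
    if "\<omega> \<in> space M" "s \<in> {0..T}" for i s m \<omega>
    using C(2)[OF that, of i m] C(1) by (simp add: fluct_def ennreal_mult mult.assoc)
  define c where "c = 3 powr r * (3 powr r * (1 + C) + C + (2 * real CARD('d)) powr r)"
  have c: "0 < c" unfolding c_def using C(1) by (intro mult_pos_pos add_pos_nonneg) auto
  have "wasserstein r (empirical n xs) (\<mu> t) epowr r \<le> ennreal c *
      (ennreal (1 / real n) * (\<Sum>i<n. ennreal (norm (xs i - copy i t \<omega>) powr r)) +
       total_fluct r n m \<omega> +
       grid_discrepancy r Lv n m k \<omega>)"
    if n: "n \<ge> 1" and \<omega>: "\<omega> \<in> space M" and t: "t \<in> {0..T}" and k: "grid T m t = T * real k / 2 ^ m" for n m Lv k t \<omega> xs
  proof -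
    let ?g = "T * real k / 2 ^ m"
    let ?disc = "discrepancy r Lv (empirical n (\<lambda>i. copy i ?g \<omega>)) (\<mu> ?g)"
    let ?S = "ennreal (1 / real n) * (\<Sum>i<n. ennreal (norm (xs i - copy i t \<omega>) powr r))"
    let ?F = "ennreal (1 / real n) * (\<Sum>i<n. fluct r m i \<omega>)"
    have g: "?g \<in> {0..T}" using grid_bounds(1)[OF T t, of m] k by simp
    have [measurable]: "copy i t \<in> borel_measurable M" "copy i ?g \<in> borel_measurable M" for i
      using copy_measurable t g by auto
    interpret U: prob_space "uniform_count_measure {..<n}" by (rule prob_space_uniform_count[OF n])
    have "wasserstein r (empirical n xs) (\<mu> t) epowr r \<le>
      ennreal (3 powr r) * ((\<integral>\<^sup>+i. ennreal (dist (xs i) (copy i ?g \<omega>) powr r) \<partial>uniform_count_measure {..<n}) + (\<integral>\<^sup>+\<omega>. ennreal (dist (copy 0 t \<omega>) (copy 0 ?g \<omega>) powr r) \<partial>M) +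
      ennreal ((2 * real CARD('d)) powr r) * ?disc)"
      using wasserstein_le_discrepancy[of r "uniform_count_measure {..<n}" M "\<lambda>i. copy i ?g \<omega>" xs "copy 0 ?g" "copy 0 t" Lv]
        r U.prob_space_axioms prob_space_axioms t g
      by (simp add: uniform_count_measurable \<mu>_copy[of _ 0] flip: empirical_def)
    also have "(\<integral>\<^sup>+i. ennreal (dist (xs i) (copy i ?g \<omega>) powr r) \<partial>uniform_count_measure {..<n}) \<le> ennreal (3 powr r * (1 + C)) * (?S + ?F)"
    proof -
      have "ennreal (dist (xs i) (copy i ?g \<omega>) powr r) \<le> ennreal (3 powr r * (1 + C)) * (ennreal (norm (xs i - copy i t \<omega>) powr r) + fluct r m i \<omega>)" for i
      proof -
        let ?a = "norm (xs i - copy i t \<omega>)" and ?b = "dist (copy i t \<omega>) (copy i ?g \<omega>)"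
        have "dist (xs i) (copy i ?g \<omega>) powr r \<le> (?a + ?b + 0) powr r"
          using dist_triangle[of "xs i" "copy i ?g \<omega>" "copy i t \<omega>"] r by (intro powr_mono2) (auto simp: dist_norm)
        also have "\<dots> \<le> 3 powr r * (?a powr r + ?b powr r + 0 powr r)" using r by (intro powr_add3_le) auto
        finally have "ennreal (dist (xs i) (copy i ?g \<omega>) powr r) \<le> ennreal (3 powr r) * (ennreal (?a powr r) + ennreal (?b powr r))"
          by (simp add: ennreal_mult[symmetric] ennreal_plus[symmetric] ennreal_leI del: ennreal_plus)
        also have "\<dots> \<le> ennreal (3 powr r) * (ennreal (1 + C) * ennreal (?a powr r) + ennreal (1 + C) * fluct r m i \<omega>)"
        proof (intro mult_left_mono add_mono)
          have 1: "(1::ennreal) \<le> ennreal (1 + C)" "ennreal C \<le> ennreal (1 + C)" using C(1) ennreal_leI[of 1 "1 + C"] by (auto intro: ennreal_leI)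
          show "ennreal (?a powr r) \<le> ennreal (1 + C) * ennreal (?a powr r)" using mult_right_mono[OF 1(1), of "ennreal (?a powr r)"] by simp
          have "ennreal (?b powr r) \<le> ennreal C * fluct r m i \<omega>" using C'[OF \<omega> t, of i m] unfolding k .
          also have "\<dots> \<le> ennreal (1 + C) * fluct r m i \<omega>" by (intro mult_right_mono 1) simp
          finally show "ennreal (?b powr r) \<le> ennreal (1 + C) * fluct r m i \<omega>" .
        qed auto
        also have "\<dots> = ennreal (3 powr r * (1 + C)) * (ennreal (?a powr r) + fluct r m i \<omega>)"
        proof -
          have "ennreal (3 powr r * (1 + C)) = ennreal (3 powr r) * ennreal (1 + C)" using C(1) by (intro ennreal_mult) auto
          then show ?thesis by (simp only: distrib_left mult.assoc)
        qed
        finally show ?thesis .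
      qed
      then have "(\<integral>\<^sup>+i. ennreal (dist (xs i) (copy i ?g \<omega>) powr r) \<partial>uniform_count_measure {..<n}) \<le>
         (\<integral>\<^sup>+i. ennreal (3 powr r * (1 + C)) * (ennreal (norm (xs i - copy i t \<omega>) powr r) + fluct r m i \<omega>) \<partial>uniform_count_measure {..<n})"
        by (intro nn_integral_mono)
      also have "\<dots> = ennreal (3 powr r * (1 + C)) * (?S + ?F)"
        by (simp only: nn_integral_uniform_count sum_distrib_left[symmetric] sum.distrib)
           (simp add: distrib_left mult.left_commute del: sum_ennreal)
      finally show ?thesis .
    qed
    also have "(\<integral>\<^sup>+\<omega>. ennreal (dist (copy 0 t \<omega>) (copy 0 ?g \<omega>) powr r) \<partial>M) \<le> ennreal C * mean_fluct r m"
    proof -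
      have "(\<integral>\<^sup>+\<omega>. ennreal (dist (copy 0 t \<omega>) (copy 0 ?g \<omega>) powr r) \<partial>M) \<le> (\<integral>\<^sup>+\<omega>. ennreal C * fluct r m 0 \<omega> \<partial>M)"
        using C'[OF _ t, of _ 0 m] unfolding k by (intro nn_integral_mono)
      then show ?thesis by (simp add: mean_fluct_def nn_integral_cmult)
    qed
    also have "ennreal (3 powr r) * (ennreal (3 powr r * (1 + C)) * (?S + ?F) + ennreal C * mean_fluct r m + ennreal ((2 * real CARD('d)) powr r) * ?disc)
       \<le> ennreal c * (?S + (?F + mean_fluct r m) + ?disc)"
    proof -
      define c' where "c' = 3 powr r * (1 + C) + C + (2 * real CARD('d)) powr r"
      have cc': "ennreal c = ennreal (3 powr r) * ennreal c'" unfolding c_def c'_def using C(1) by (intro ennreal_mult) auto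
      have l: "ennreal (3 powr r * (1 + C)) \<le> ennreal c'" "ennreal C \<le> ennreal c'" "ennreal ((2 * real CARD('d)) powr r) \<le> ennreal c'"
        unfolding c'_def using C(1) by (auto intro!: ennreal_leI)
      have "ennreal (3 powr r * (1 + C)) * (?S + ?F) + ennreal C * mean_fluct r m + ennreal ((2 * real CARD('d)) powr r) * ?disc \<le>
         ennreal c' * (?S + ?F) + ennreal c' * mean_fluct r m + ennreal c' * ?disc"
        by (intro add_mono mult_right_mono l) auto
      also have "\<dots> = ennreal c' * (?S + (?F + mean_fluct r m) + ?disc)" by (simp add: distrib_left ac_simps)
      finally show ?thesis unfolding cc' mult.assoc by (intro mult_left_mono) auto
    qed
    finally show ?thesis by (simp add: add_mono mult_left_mono)
  qed
  with c show thesis by (rule that)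
qed

lemma particle_drift_bound:
  assumes n: "n \<ge> 1" and r: "p \<le> r" and t: "t \<in> {0..T}" and w: "0 \<le> w"
    and W: "wasserstein r (empirical n xs) (\<mu> t) epowr r \<le> ennreal w"
  shows "norm (b t x (empirical n xs) - \<beta> t y) \<le> Lp * (norm (x - y) + w powr (1 / r))"
proof -
  have e: "empirical n xs \<in> finite_moment_measures p" by (rule empirical_finite_moment[OF n])
  have "wasserstein p (empirical n xs) (\<mu> t) \<le> wasserstein r (empirical n xs) (\<mu> t)"
    using e by (intro wasserstein_mono p r) (auto simp: finite_moment_measures_def)
  also have "\<dots> \<le> ennreal (w powr (1 / r))" using p r by (intro wasserstein_le_of_epowr W w) auto
  finally show ?thesis unfolding \<beta>_def by (intro b_lip[OF t e \<mu>fm[OF t]]) auto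
qed

text \<open>Majorants \<open>\<psi> k\<close> replace the discrepancies, whose measurability is then never needed.\<close>

lemma particles_bound:
  assumes r: "p \<le> r" "r \<le> 2"
  obtains C where "0 < C" "\<And>n X m Lv. n \<ge> 1 \<Longrightarrow> particle_system M T b \<sigma> X0 B n X \<Longrightarrow>
    AE \<omega> in M. \<forall>\<psi>. (\<forall>k\<le>2 ^ m. grid_discrepancy r Lv n m k \<omega> \<le> \<psi> k) \<longrightarrow>
      (\<forall>t\<in>{0..T}. \<forall>k\<le>2 ^ m. grid T m t = T * real k / 2 ^ m \<longrightarrow>
        wasserstein r (empirical n (\<lambda>i. X i t \<omega>)) (\<mu> t) epowr r \<le>
          ennreal C * (\<psi> k + ennreal (1 / 2 ^ m) * (\<Sum>k\<le>2 ^ m. \<psi> k) + total_fluct r n m \<omega>))"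
proof -
  have r1: "1 \<le> r" using p r by simp
  obtain c where c: "0 < c" "\<And>n m Lv k t \<omega> xs. n \<ge> 1 \<Longrightarrow> \<omega> \<in> space M \<Longrightarrow> t \<in> {0..T} \<Longrightarrow> grid T m t = T * real k / 2 ^ m \<Longrightarrow>
    wasserstein r (empirical n xs) (\<mu> t) epowr r \<le> ennreal c *
      (ennreal (1 / real n) * (\<Sum>i<n. ennreal (norm (xs i - copy i t \<omega>) powr r)) +
       total_fluct r n m \<omega> +
       grid_discrepancy r Lv n m k \<omega>)"
    using particle_to_copy[OF r1 r(2)] by blast
  \<comment> \<open>The constant of \<open>mean_gronwall\<close> with the integral of the forcing
    term taken out.\<close>
  define g where "g = 2 * (T powr (r - 1) * (3 * Lp) powr r * c) * exp (2 * (T powr (r - 1) * (3 * Lp) powr r * (1 + c)) * T)"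
  have g0: "0 \<le> g" using c(1) by (simp add: g_def)
  define C where "C = c * (1 + g * T)"
  have C0: "0 < C" using c(1) g0 T by (auto simp: C_def intro!: mult_pos_pos add_pos_nonneg)
  have "AE \<omega> in M. \<forall>\<psi>. (\<forall>k\<le>2 ^ m. grid_discrepancy r Lv n m k \<omega> \<le> \<psi> k) \<longrightarrow>
      (\<forall>t\<in>{0..T}. \<forall>k\<le>2 ^ m. grid T m t = T * real k / 2 ^ m \<longrightarrow>
        wasserstein r (empirical n (\<lambda>i. X i t \<omega>)) (\<mu> t) epowr r \<le>
          ennreal C * (\<psi> k + ennreal (1 / 2 ^ m) * (\<Sum>k\<le>2 ^ m. \<psi> k) + total_fluct r n m \<omega>))"
    if n: "n \<ge> 1" and X: "particle_system M T b \<sigma> X0 B n X" for n X m Lv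
  proof -
    have "AE \<omega> in M. continuous_on {0..T} (\<lambda>t. X i t \<omega>) \<and>
        set_integrable lborel {0..T} (\<lambda>s. b s (X i s \<omega>) (empirical n (\<lambda>j. X j s \<omega>))) \<and>
        (\<forall>t\<in>{0..T}. X i t \<omega> = X0 i \<omega> + (LINT s:{0..t}|lborel. b s (X i s \<omega>) (empirical n (\<lambda>j. X j s \<omega>))) + \<sigma> *v B i t \<omega>)"
      if "i < n" for i
      using X that unfolding particle_system_def strong_solution_def by blast
    then have "AE \<omega> in M. \<forall>i\<in>{..<n}. continuous_on {0..T} (\<lambda>t. X i t \<omega>) \<and>
        set_integrable lborel {0..T} (\<lambda>s. b s (X i s \<omega>) (empirical n (\<lambda>j. X j s \<omega>))) \<and>
        (\<forall>t\<in>{0..T}. X i t \<omega> = X0 i \<omega> + (LINT s:{0..t}|lborel. b s (X i s \<omega>) (empirical n (\<lambda>j. X j s \<omega>))) + \<sigma> *v B i t \<omega>)"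
      by (intro AE_finite_allI) auto
    moreover have "AE \<omega> in M. \<forall>i\<in>{..<n}. \<omega> \<notin> bad i" using AE_not_bad by (intro AE_finite_allI) auto
    ultimately show ?thesis using AE_space
    proof eventually_elim
      case (elim \<omega>)
      note path = elim(1)[rule_format] and nb = elim(2)[rule_format] and \<omega> = elim(3)
      show ?case
      proof (intro allI impI ballI)
        fix \<psi> :: "nat \<Rightarrow> ennreal" and t k
        assume \<psi>: "\<forall>k\<le>2 ^ m. grid_discrepancy r Lv n m k \<omega> \<le> \<psi> k"
          and t: "t \<in> {0..T}" and k: "k \<le> 2 ^ m" "grid T m t = T * real k / 2 ^ m"
        let ?F = "total_fluct r n m \<omega>"
        let ?goal = "wasserstein r (empirical n (\<lambda>i. X i t \<omega>)) (\<mu> t) epowr r \<le>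
          ennreal C * (\<psi> k + ennreal (1 / 2 ^ m) * (\<Sum>k\<le>2 ^ m. \<psi> k) + ?F)"
        show ?goal
        proof (cases "?F = \<infinity> \<or> (\<exists>j\<le>2 ^ m. \<psi> j = \<infinity>)")
          case True
          then have "\<psi> k + ennreal (1 / 2 ^ m) * (\<Sum>k\<le>2 ^ m. \<psi> k) + ?F = \<infinity>"
          proof
            assume "\<exists>j\<le>2 ^ m. \<psi> j = \<infinity>"
            then have top: "(\<Sum>k\<le>2 ^ m. \<psi> k) = \<infinity>" by (auto simp: ennreal_sum_eq_top)
            show ?thesis unfolding top by (simp add: ennreal_mult_top)
          qed simp
          then show ?thesis using C0 by (simp only:) (simp add: ennreal_mult_top)
        next
          case False
          define \<rho> where "\<rho> = enn2real ?F"
          define q where "q j = enn2real (\<psi> j)" for j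
          have \<rho>: "?F = ennreal \<rho>" "0 \<le> \<rho>" using False by (auto simp: \<rho>_def less_top)
          have q: "j \<le> 2 ^ m \<Longrightarrow> \<psi> j = ennreal (q j)" "0 \<le> q j" for j using False by (auto simp: q_def less_top)
          \<comment> \<open>A step function that dominates the grid majorants at all times. The
            closed intervals overlap in endpoints and the last one begins at \<open>T\<close>; as
            only an upper bound is wanted, this does no harm, and the integral is at most
            \<open>T\<close> times the normalised sum plus \<open>\<rho>\<close>.\<close>
          define G where "G s = (\<Sum>j\<le>2 ^ m. q j * indicator {T * real j / 2 ^ m..T * real (Suc j) / 2 ^ m} s) + \<rho>" for s
          have G0: "0 \<le> G s" for s unfolding G_def using q(2) \<rho>(2) by (intro add_nonneg_nonneg sum_nonneg mult_nonneg_nonneg) auto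
          have Gb: "G s \<le> (\<Sum>j\<le>2 ^ m. q j) + \<rho>" for s
            unfolding G_def using q(2) by (intro add_mono sum_mono) (auto simp: indicator_def)
          have Gm: "G \<in> borel_measurable borel" unfolding G_def by measurable
          define u where "u i s = norm (X i s \<omega> - copy i s \<omega>)" for i s
          define a where "a s = (1 / real n) * (\<Sum>i<n. u i s powr r)" for s
          have a0: "0 \<le> a s" for s unfolding a_def by (intro mult_nonneg_nonneg sum_nonneg) auto
          have ae: "ennreal (1 / real n) * (\<Sum>i<n. ennreal (norm (X i s \<omega> - copy i s \<omega>) powr r)) = ennreal (a s)" for s
            unfolding a_def u_def by (subst ennreal_mult) (auto intro!: sum_nonneg)
          have W: "wasserstein r (empirical n (\<lambda>i. X i s \<omega>)) (\<mu> s) epowr r \<le> ennreal (c * (a s + (q j + \<rho>)))"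
            if "s \<in> {0..T}" "j \<le> 2 ^ m" "grid T m s = T * real j / 2 ^ m" for s j
          proof -
            have "wasserstein r (empirical n (\<lambda>i. X i s \<omega>)) (\<mu> s) epowr r \<le> ennreal c * (ennreal (a s) + ennreal \<rho> +
               grid_discrepancy r Lv n m j \<omega>)"
              using c(2)[OF n \<omega> that(1,3), of "\<lambda>i. X i s \<omega>" Lv] unfolding ae \<rho>(1) .
            also have "\<dots> \<le> ennreal c * (ennreal (a s) + ennreal \<rho> + ennreal (q j))"
              using \<psi> that(2) q(1)[of j] by (intro mult_left_mono add_left_mono) auto
            also have "\<dots> = ennreal (c * (a s + (q j + \<rho>)))"
              using c(1) a0 q(2) \<rho>(2) by (simp add: ennreal_mult ac_simps)
            finally show ?thesis .
          qed
          have W': "wasserstein r (empirical n (\<lambda>i. X i s \<omega>)) (\<mu> s) epowr r \<le> ennreal (c * (a s + G s))" if s: "s \<in> {0..T}" for s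
          proof -
            obtain j where j: "j \<le> 2 ^ m" "grid T m s = T * real j / 2 ^ m" using grid_index[OF T s] by blast
            have "s \<in> {T * real j / 2 ^ m..T * real (Suc j) / 2 ^ m}"
              using grid_bounds[OF T s, of m] j(2) by (auto simp: add_divide_distrib algebra_simps)
            then have "q j = q j * indicator {T * real j / 2 ^ m..T * real (Suc j) / 2 ^ m} s" by simp
            also have "\<dots> \<le> (\<Sum>j\<le>2 ^ m. q j * indicator {T * real j / 2 ^ m..T * real (Suc j) / 2 ^ m} s)"
              using j(1) q(2) by (intro member_le_sum[of j "{..2 ^ m}" "\<lambda>j. q j * indicator {T * real j / 2 ^ m..T * real (Suc j) / 2 ^ m} s"]) auto
            finally have "c * (a s + (q j + \<rho>)) \<le> c * (a s + G s)" using c(1) by (simp add: G_def)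
            then show ?thesis using W[OF s j] by (meson ennreal_leI order.trans)
          qed
          have cX: "continuous_on {0..T} (\<lambda>t. X i t \<omega>)" if "i < n" for i using path that by auto
          have cC: "continuous_on {0..T} (\<lambda>t. copy i t \<omega>)" for i by (rule copy_continuous[OF \<omega>])
          have "a t \<le> 2 * (T powr (r - 1) * (3 * Lp) powr r * c * integral {0..T} G) * exp (2 * (T powr (r - 1) * (3 * Lp) powr r * (1 + c)) * T)"
            unfolding a_def
          proof (rule mean_gronwall[OF n T r1 Lp0 _ _ _ Gm G0 Gb _ t], unfold a_def[symmetric])
            fix i t assume i: "i < n" and t: "t \<in> {0..T}" and int: "(\<lambda>s. Lp * (u i s + (c * (a s + G s)) powr (1 / r))) integrable_on {0..t}"
            let ?f = "\<lambda>s. b s (X i s \<omega>) (empirical n (\<lambda>j. X j s \<omega>))"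
            have si: "set_integrable lborel {0..T} ?f" using path i by auto
            have s1: "X i t \<omega> = X0 i \<omega> + integral {0..t} ?f + \<sigma> *v B i t \<omega>"
              using path[of i] i t lint_eq(1)[OF si t] by auto
            have s2: "copy i t \<omega> = X0 i \<omega> + \<sigma> *v B i t \<omega> + integral {0..t} (\<lambda>s. \<beta> s (copy i s \<omega>))"
              using copy_solves[OF \<omega>, of i] nb[of i] i t by (auto simp: solves_def)
            have i1: "?f integrable_on {0..t}" by (rule lint_eq(2)[OF si t])
            have i2: "(\<lambda>s. \<beta> s (copy i s \<omega>)) integrable_on {0..t}" using t by (intro drift_integrable_sub cC) auto
            have "X i t \<omega> - copy i t \<omega> = integral {0..t} (\<lambda>s. ?f s - \<beta> s (copy i s \<omega>))"
              unfolding s1 s2 by (simp add: integral_diff[OF i1 i2])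
            then have "u i t = norm (integral {0..t} (\<lambda>s. ?f s - \<beta> s (copy i s \<omega>)))" by (simp add: u_def)
            also have "\<dots> \<le> integral {0..t} (\<lambda>s. Lp * (u i s + (c * (a s + G s)) powr (1 / r)))"
            proof (rule integral_norm_bound_integral[OF integrable_diff[OF i1 i2] int])
              fix s assume "s \<in> {0..t}"
              then have s: "s \<in> {0..T}" using t by auto
              show "norm (?f s - \<beta> s (copy i s \<omega>)) \<le> Lp * (u i s + (c * (a s + G s)) powr (1 / r))"
                unfolding u_def using c(1) a0 G0 by (intro particle_drift_bound[OF n r(1) s _ W'[OF s]]) auto
            qed
            finally show "u i t \<le> integral {0..t} (\<lambda>s. Lp * (u i s + (c * (a s + G s)) powr (1 / r)))" .
          qed (use c(1) in \<open>auto simp: u_def intro!: continuous_on_norm continuous_on_diff cX cC\<close>)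
          also have "\<dots> = g * integral {0..T} G" by (simp add: g_def)
          also have "integral {0..T} G \<le> T * (1 / 2 ^ m * (\<Sum>j\<le>2 ^ m. q j) + \<rho>)"
          proof -
            have le: "T * real j / 2 ^ m \<le> T * real (Suc j) / 2 ^ m" for j using T by (intro divide_right_mono mult_left_mono) auto
            have ii: "(\<lambda>s. q j * indicator {T * real j / 2 ^ m..T * real (Suc j) / 2 ^ m} s) integrable_on {0..T}" for j
              by (intro integrable_on_mult_right integral_indicator_le(1) le)
            have "integral {0..T} G = (\<Sum>j\<le>2 ^ m. integral {0..T} (\<lambda>s. q j * indicator {T * real j / 2 ^ m..T * real (Suc j) / 2 ^ m} s)) + integral {0..T} (\<lambda>_. \<rho>)"
            proof -
              let ?q = "\<lambda>s. \<Sum>j\<le>2 ^ m. q j * indicator {T * real j / 2 ^ m..T * real (Suc j) / 2 ^ m} s"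
              have "integral {0..T} (\<lambda>s. ?q s + \<rho>) = integral {0..T} ?q + integral {0..T} (\<lambda>_. \<rho>)"
                by (intro integral_add integrable_sum ii integrable_const_ivl) simp
              also have "integral {0..T} ?q = (\<Sum>j\<le>2 ^ m. integral {0..T} (\<lambda>s. q j * indicator {T * real j / 2 ^ m..T * real (Suc j) / 2 ^ m} s))"
                by (intro integral_sum ii) simp
              finally show ?thesis unfolding G_def .
            qed
            also have "\<dots> \<le> (\<Sum>j\<le>2 ^ m. q j * (T * real (Suc j) / 2 ^ m - T * real j / 2 ^ m)) + T * \<rho>"
              using T q(2) le by (intro add_mono sum_mono) (auto intro!: mult_left_mono integral_indicator_le(2))
            also have "(\<Sum>j\<le>2 ^ m. q j * (T * real (Suc j) / 2 ^ m - T * real j / 2 ^ m)) = T * (1 / 2 ^ m * (\<Sum>j\<le>2 ^ m. q j))"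
            proof -
              have "T * real (Suc j) / 2 ^ m - T * real j / 2 ^ m = T / 2 ^ m" for j
                by (simp add: diff_divide_distrib[symmetric] algebra_simps)
              then show ?thesis by (simp add: sum_distrib_left sum_divide_distrib ac_simps)
            qed
            finally show ?thesis by (simp add: algebra_simps)
          qed
          finally have at: "a t \<le> g * (T * (1 / 2 ^ m * (\<Sum>j\<le>2 ^ m. q j) + \<rho>))" using g0 by (simp add: mult_left_mono)
          define Sq where "Sq = 1 / 2 ^ m * (\<Sum>j\<le>2 ^ m. q j)"
          have Sq0: "0 \<le> Sq" unfolding Sq_def using q(2) by (intro mult_nonneg_nonneg sum_nonneg) auto
          have "wasserstein r (empirical n (\<lambda>i. X i t \<omega>)) (\<mu> t) epowr r \<le> ennreal (c * (a t + (q k + \<rho>)))"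
            by (rule W[OF t k])
          also have "\<dots> \<le> ennreal (C * (q k + Sq + \<rho>))"
          proof (rule ennreal_leI)
            have "a t + (q k + \<rho>) \<le> g * T * (Sq + \<rho>) + (q k + \<rho>)" using at by (simp add: Sq_def)
            also have "\<dots> \<le> (1 + g * T) * (q k + Sq + \<rho>)"
            proof -
              have "(1 + g * T) * (q k + Sq + \<rho>) - (g * T * (Sq + \<rho>) + (q k + \<rho>)) = Sq + g * T * q k" by (simp add: algebra_simps)
              also have "0 \<le> \<dots>" using Sq0 g0 T q(2) by simp
              finally show ?thesis by simp
            qed
            finally show "c * (a t + (q k + \<rho>)) \<le> C * (q k + Sq + \<rho>)" using c(1) by (simp add: C_def mult.assoc)
          qed
          also have "\<dots> = ennreal C * (ennreal (q k) + ennreal Sq + ennreal \<rho>)" using C0 q(2) Sq0 \<rho>(2) by (simp add: ennreal_mult)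
          also have "ennreal Sq = ennreal (1 / 2 ^ m) * (\<Sum>k\<le>2 ^ m. \<psi> k)"
          proof -
            have "(\<Sum>k\<le>2 ^ m. \<psi> k) = (\<Sum>k\<le>2 ^ m. ennreal (q k))" by (intro sum.cong) (auto simp: q(1))
            also have "\<dots> = ennreal (\<Sum>k\<le>2 ^ m. q k)" using q(2) by (intro sum_ennreal) auto
            finally show ?thesis unfolding Sq_def using q(2) by (simp add: ennreal_mult[symmetric] sum_nonneg)
          qed
          finally show ?thesis using q(1)[OF k(1)] \<rho>(1) by simp
        qed
      qed
    qed
  qed
  with C0 show thesis by (rule that)
qed

end

subsection \<open>Convergence rates\<close>

text \<open>The bound of \<open>expected_discrepancy\<close> up to constants; \<open>k\<close> is
  the number of times that are treated simultaneously.\<close>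

abbreviation level_bound :: "real \<Rightarrow> nat \<Rightarrow> nat \<Rightarrow> nat \<Rightarrow> nat \<Rightarrow> real" where
  "level_bound r d k n L \<equiv>
     (\<Sum>l\<le>L. 2 powr (- (r * real l)) * sqrt (2 ^ (l * d) * real k / real n)) + 2 powr (- (r * real L))"

lemma shell_powr_le: "0 \<le> q \<Longrightarrow> 2 powr (q * real (shell x)) \<le> (1 + 2 * norm x) powr q"
proof -
  assume q: "0 \<le> q"
  have "2 powr (q * real (shell x)) = (2 powr real (shell x)) powr q" by (simp add: powr_powr mult.commute)
  also have "\<dots> = (2 ^ shell x) powr q" by (simp add: powr_realpow)
  also have "\<dots> \<le> (1 + 2 * norm x) powr q" using q shell_le[of x] by (intro powr_mono2) auto
  finally show ?thesis .
qed

section \<open>Expectations of the error terms\<close>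

context mean_field
begin

lemma X0_integral_eq:
  assumes [measurable]: "f \<in> borel_measurable borel"
  shows "(\<integral>\<^sup>+\<omega>. f (X0 i \<omega>) \<partial>M) = (\<integral>\<^sup>+\<omega>. f (X0 0 \<omega>) \<partial>M)"
proof -
  have "(\<integral>\<^sup>+\<omega>. f (X0 i \<omega>) \<partial>M) = (\<integral>\<^sup>+x. f x \<partial>\<mu>0)" for i
    by (subst X0law[of i, symmetric]) (simp add: nn_integral_distr)
  then show ?thesis by simp
qed

text \<open>The factor \<open>2 ^ m\<close> in \<open>fluct\<close> cancels the decay of the
  expected roughness, so only the explicit power of 2 remains, with a constant uniform in
  \<open>r\<close>, \<open>m\<close> and \<open>i\<close>.\<close>

lemma fluct_expectation:
  obtains C where "0 < C" "\<And>r m i. (\<integral>\<^sup>+\<omega>. fluct r m i \<omega> \<partial>M) \<le> ennreal (C * 2 powr (- (r * real m / 3)))"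
proof -
  obtain S where S: "0 \<le> S" "(\<integral>\<^sup>+\<omega>. ennreal ((norm (X0 0 \<omega>))\<^sup>2) \<partial>M) = ennreal S"
    using second_moment by (cases "(\<integral>\<^sup>+\<omega>. ennreal ((norm (X0 0 \<omega>))\<^sup>2) \<partial>M)") auto
  define c where "c = 30 * real CARD('d) ^ 7 * T ^ 3"
  have c0: "0 \<le> c" using T by (simp add: c_def)
  have ro: "(\<integral>\<^sup>+\<omega>. rough i m \<omega> \<partial>M) \<le> ennreal (c / 2 ^ m)" for i m
    using roughness_expectation[OF Bw[of i] T, of m] by (simp add: c_def)
  have "(\<integral>\<^sup>+\<omega>. fluct r m i \<omega> \<partial>M) \<le> ennreal ((1 + S + c + c) * 2 powr (- (r * real m / 3)))" for r m i
  proof -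
    have "(\<integral>\<^sup>+\<omega>. fluct r m i \<omega> \<partial>M) = ennreal (2 powr (- (r * real m / 3))) * (1 + (\<integral>\<^sup>+\<omega>. ennreal ((norm (X0 i \<omega>))\<^sup>2) \<partial>M) + (\<integral>\<^sup>+\<omega>. rough i 0 \<omega> \<partial>M) + ennreal (2 ^ m) * (\<integral>\<^sup>+\<omega>. rough i m \<omega> \<partial>M))"
      unfolding fluct_def by (simp add: nn_integral_cmult nn_integral_add emeasure_space_1)
    also have "(\<integral>\<^sup>+\<omega>. ennreal ((norm (X0 i \<omega>))\<^sup>2) \<partial>M) = ennreal S"
      using X0_integral_eq[of "\<lambda>x. ennreal ((norm x)\<^sup>2)" i] S by simp
    also have "ennreal (2 powr (- (r * real m / 3))) * (1 + ennreal S + (\<integral>\<^sup>+\<omega>. rough i 0 \<omega> \<partial>M) + ennreal (2 ^ m) * (\<integral>\<^sup>+\<omega>. rough i m \<omega> \<partial>M))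
       \<le> ennreal (2 powr (- (r * real m / 3))) * (1 + ennreal S + ennreal (c / 2 ^ 0) + ennreal (2 ^ m) * ennreal (c / 2 ^ m))"
      by (intro mult_left_mono add_mono ro) auto
    also have "ennreal (2 ^ m) * ennreal (c / 2 ^ m) = ennreal c" using c0 by (simp add: ennreal_mult[symmetric])
    also have "ennreal (2 powr (- (r * real m / 3))) * (1 + ennreal S + ennreal (c / 2 ^ 0) + ennreal c) = ennreal ((1 + S + c + c) * 2 powr (- (r * real m / 3)))"
    proof -
      have e: "1 + ennreal S + ennreal (c / 2 ^ 0) + ennreal c = ennreal (1 + S + c + c)"
        using S c0 by (simp add: ennreal_plus[symmetric] flip: ennreal_1 del: ennreal_plus)
      show ?thesis unfolding e using S c0 by (subst ennreal_mult[symmetric]) (auto simp: mult.commute)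
    qed
    finally show ?thesis .
  qed
  moreover have "0 < 1 + S + c + c" using S c0 by simp
  ultimately show thesis using that by blast
qed

lemma env_expectation:
  assumes q: "0 < q" and fin: "(\<integral>\<^sup>+\<omega>. ennreal (norm (X0 0 \<omega>) powr q) \<partial>M) < \<infinity>" and C: "0 < C"
  obtains K where "0 \<le> K" "\<And>i. (\<integral>\<^sup>+\<omega>. ennreal C * (1 + ennreal (norm (X0 i \<omega>) powr q) + rough i 0 \<omega>) \<partial>M) \<le> ennreal K"
proof -
  obtain S where S: "0 \<le> S" "(\<integral>\<^sup>+\<omega>. ennreal (norm (X0 0 \<omega>) powr q) \<partial>M) = ennreal S"
    using fin by (cases "(\<integral>\<^sup>+\<omega>. ennreal (norm (X0 0 \<omega>) powr q) \<partial>M)") auto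
  define c where "c = 30 * real CARD('d) ^ 7 * T ^ 3"
  have c0: "0 \<le> c" using T by (simp add: c_def)
  have "(\<integral>\<^sup>+\<omega>. ennreal C * (1 + ennreal (norm (X0 i \<omega>) powr q) + rough i 0 \<omega>) \<partial>M) \<le> ennreal (C * (1 + S + c))" for i
  proof -
    have "(\<integral>\<^sup>+\<omega>. ennreal C * (1 + ennreal (norm (X0 i \<omega>) powr q) + rough i 0 \<omega>) \<partial>M) =
       ennreal C * (1 + (\<integral>\<^sup>+\<omega>. ennreal (norm (X0 i \<omega>) powr q) \<partial>M) + (\<integral>\<^sup>+\<omega>. rough i 0 \<omega> \<partial>M))"
      by (simp add: nn_integral_cmult nn_integral_add emeasure_space_1)
    also have "(\<integral>\<^sup>+\<omega>. ennreal (norm (X0 i \<omega>) powr q) \<partial>M) = ennreal S"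
      using X0_integral_eq[of "\<lambda>x. ennreal (norm x powr q)" i] S by simp
    also have "ennreal C * (1 + ennreal S + (\<integral>\<^sup>+\<omega>. rough i 0 \<omega> \<partial>M)) \<le> ennreal C * (1 + ennreal S + ennreal c)"
      using roughness_expectation[OF Bw[of i] T, of 0] by (intro mult_left_mono add_mono) (auto simp: c_def)
    also have "\<dots> = ennreal (C * (1 + S + c))" using C S c0 by (simp add: ennreal_mult)
    finally show ?thesis .
  qed
  moreover have "0 \<le> C * (1 + S + c)" using C S c0 by simp
  ultimately show thesis using that by blast
qed

lemma powr_moment_mono:
  assumes q: "0 \<le> q" "q \<le> q'" and fin: "(\<integral>\<^sup>+\<omega>. ennreal (norm (X0 0 \<omega>) powr q') \<partial>M) < \<infinity>"
  shows "(\<integral>\<^sup>+\<omega>. ennreal (norm (X0 0 \<omega>) powr q) \<partial>M) < \<infinity>"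
proof -
  have "(\<integral>\<^sup>+\<omega>. ennreal (norm (X0 0 \<omega>) powr q) \<partial>M) \<le> (\<integral>\<^sup>+\<omega>. 1 + ennreal (norm (X0 0 \<omega>) powr q') \<partial>M)"
  proof (intro nn_integral_mono)
    fix \<omega>
    show "ennreal (norm (X0 0 \<omega>) powr q) \<le> 1 + ennreal (norm (X0 0 \<omega>) powr q')"
      using ennreal_leI[OF powr_le_1_plus[OF norm_ge_zero q, of "X0 0 \<omega>"]] by simp
  qed
  also have "\<dots> = 1 + (\<integral>\<^sup>+\<omega>. ennreal (norm (X0 0 \<omega>) powr q') \<partial>M)" by (simp add: nn_integral_add emeasure_space_1)
  also have "\<dots> < \<infinity>" using fin by simp
  finally show ?thesis .
qed

text \<open>Two moments of the copies enter: the order \<open>2 * r + \<delta>\<close> at each time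
  for the sum over the shells, and the order \<open>r\<close> through an envelope uniform in time
  for the finest level. \<open>copy_moment\<close> limits both orders to 6.\<close>

lemma discrepancy_expectation:
  assumes r: "1 \<le> r" "r \<le> 2" and \<delta>: "0 < \<delta>" "2 * r + \<delta> \<le> 6"
    and fin: "(\<integral>\<^sup>+\<omega>. ennreal (norm (X0 0 \<omega>) powr (2 * r + \<delta>)) \<partial>M) < \<infinity>"
  obtains C where "0 < C" "\<And>n J Lv. n \<ge> 1 \<Longrightarrow> finite J \<Longrightarrow> J \<subseteq> {0..T} \<Longrightarrow> \<exists>\<Psi>\<in>borel_measurable M.
     (\<forall>t\<in>J. \<forall>\<omega>\<in>space M. discrepancy r Lv (empirical n (\<lambda>i. copy i t \<omega>)) (\<mu> t) \<le> \<Psi> \<omega>) \<and>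
     (\<integral>\<^sup>+\<omega>. \<Psi> \<omega> \<partial>M) \<le> ennreal (C * level_bound r CARD('d) (card J) n Lv)"
proof -
  define q where "q = 2 * r + \<delta>"
  have q: "0 < q" "q \<le> 6" using r \<delta> by (auto simp: q_def)
  obtain Cq where Cq: "0 < Cq" "\<And>i t \<omega>. \<omega> \<in> space M \<Longrightarrow> t \<in> {0..T} \<Longrightarrow>
    ennreal ((1 + 2 * norm (copy i t \<omega>)) powr q) \<le> ennreal Cq * (1 + ennreal (norm (X0 i \<omega>) powr q) + rough i 0 \<omega>)"
    using copy_moment[OF q] by blast
  have r6: "0 < r" "r \<le> 6" using r by auto
  obtain Cr where Cr: "0 < Cr" "\<And>i t \<omega>. \<omega> \<in> space M \<Longrightarrow> t \<in> {0..T} \<Longrightarrow>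
    ennreal ((1 + 2 * norm (copy i t \<omega>)) powr r) \<le> ennreal Cr * (1 + ennreal (norm (X0 i \<omega>) powr r) + rough i 0 \<omega>)"
    using copy_moment[OF r6] by blast
  have finr: "(\<integral>\<^sup>+\<omega>. ennreal (norm (X0 0 \<omega>) powr r) \<partial>M) < \<infinity>"
    by (rule powr_moment_mono[OF _ _ fin]) (use r \<delta> in auto)
  obtain Kq where Kq: "0 \<le> Kq" "\<And>i. (\<integral>\<^sup>+\<omega>. ennreal Cq * (1 + ennreal (norm (X0 i \<omega>) powr q) + rough i 0 \<omega>) \<partial>M) \<le> ennreal Kq"
    using env_expectation[OF q(1) _ Cq(1)] fin unfolding q_def by blast
  obtain Kr where Kr: "0 \<le> Kr" "\<And>i. (\<integral>\<^sup>+\<omega>. ennreal Cr * (1 + ennreal (norm (X0 i \<omega>) powr r) + rough i 0 \<omega>) \<partial>M) \<le> ennreal Kr"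
    using env_expectation[OF r6(1) finr Cr(1)] by blast
  define K where "K = Kq + Kr"
  have K: "0 \<le> K" "ennreal Kq \<le> ennreal K" "ennreal Kr \<le> ennreal K" using Kq(1) Kr(1) by (auto simp: K_def intro!: ennreal_leI)
  define s where "s = sqrt (3 ^ CARD('d) / (1 - 2 powr - \<delta>) * K)"
  have "2 powr - \<delta> < 2 powr (0::real)" using \<delta> by (intro powr_less_mono) auto
  then have s0: "0 \<le> s" using K by (simp add: s_def)
  have "\<exists>\<Psi>\<in>borel_measurable M.
     (\<forall>t\<in>J. \<forall>\<omega>\<in>space M. discrepancy r Lv (empirical n (\<lambda>i. copy i t \<omega>)) (\<mu> t) \<le> \<Psi> \<omega>) \<and>
     (\<integral>\<^sup>+\<omega>. \<Psi> \<omega> \<partial>M) \<le> ennreal ((s + K + 1) * level_bound r CARD('d) (card J) n Lv)"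
    if n: "n \<ge> 1" and J: "finite J" "J \<subseteq> {0..T}" for n J Lv
  proof (rule expected_discrepancy[OF n r6(1) \<delta>(1) J(1), where Y=copy and \<mu>=\<mu> and K=K and L=Lv and e="\<lambda>i \<omega>. ennreal Cr * (1 + ennreal (norm (X0 i \<omega>) powr r) + rough i 0 \<omega>)"])
    show "copy i t \<in> borel_measurable M" if "t \<in> J" for i t using that J copy_measurable by auto
    show "distr M borel (copy i t) = \<mu> t" if "t \<in> J" for i t using that J \<mu>_copy[of t i] by auto
    show "prob {\<omega> \<in> space M. copy i t \<omega> \<in> A \<and> copy k t \<omega> \<in> A} = measure (\<mu> t) A * measure (\<mu> t) A"
      if "i \<noteq> k" "t \<in> J" "A \<in> sets borel" for i k t A
      using that J copy_indep[of t i k A] \<mu>_copy[of t 0] by auto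
    show "(\<integral>\<^sup>+x. ennreal (2 powr ((2 * r + \<delta>) * real (shell x))) \<partial>\<mu> t) \<le> ennreal K" if "t \<in> J" for t
    proof -
      have t: "t \<in> {0..T}" using that J by auto
      note [measurable] = copy_measurable[OF t]
      have "(\<integral>\<^sup>+x. ennreal (2 powr (q * real (shell x))) \<partial>\<mu> t) = (\<integral>\<^sup>+\<omega>. ennreal (2 powr (q * real (shell (copy 0 t \<omega>)))) \<partial>M)"
        by (subst \<mu>_copy[OF t, of 0]) (simp add: nn_integral_distr)
      also have "\<dots> \<le> (\<integral>\<^sup>+\<omega>. ennreal Cq * (1 + ennreal (norm (X0 0 \<omega>) powr q) + rough 0 0 \<omega>) \<partial>M)"
        using q Cq(2)[OF _ t, of _ 0] by (intro nn_integral_mono order.trans[OF ennreal_leI[OF shell_powr_le]]) auto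
      also have "\<dots> \<le> ennreal K" using Kq(2)[of 0] K(2) by (rule order.trans)
      finally show ?thesis by (simp add: q_def)
    qed
    show "ennreal (2 powr (r * real (shell (copy i t \<omega>)))) \<le> ennreal Cr * (1 + ennreal (norm (X0 i \<omega>) powr r) + rough i 0 \<omega>)"
      if "t \<in> J" "\<omega> \<in> space M" for i t \<omega>
    proof -
      have t: "t \<in> {0..T}" using that J by auto
      show ?thesis using r6 Cr(2)[OF that(2) t, of i] by (intro order.trans[OF ennreal_leI[OF shell_powr_le]]) auto
    qed
    show "(\<integral>\<^sup>+\<omega>. ennreal Cr * (1 + ennreal (norm (X0 i \<omega>) powr r) + rough i 0 \<omega>) \<partial>M) \<le> ennreal K" for i
      using Kr(2)[of i] K(3) by (rule order.trans)
    show "0 \<le> K" by (rule K)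
    fix \<Psi> assume \<Psi>: "\<Psi> \<in> borel_measurable M"
      "\<And>j \<omega>. j \<in> J \<Longrightarrow> \<omega> \<in> space M \<Longrightarrow> discrepancy r Lv (empirical n (\<lambda>i. copy i j \<omega>)) (\<mu> j) \<le> \<Psi> \<omega>"
      "(\<integral>\<^sup>+\<omega>. \<Psi> \<omega> \<partial>M) \<le> ennreal (sqrt (3 ^ CARD('d) / (1 - 2 powr - \<delta>) * K) * (\<Sum>l\<le>Lv. 2 powr (- (r * real l)) * sqrt (2 ^ (l * CARD('d)) * real (card J) / real n))
        + K * 2 powr (- (r * real Lv)))"
    let ?S = "\<Sum>l\<le>Lv. 2 powr (- (r * real l)) * sqrt (2 ^ (l * CARD('d)) * real (card J) / real n)"
    have "0 \<le> ?S" by (intro sum_nonneg) auto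
    then have "s * ?S + K * 2 powr (- (r * real Lv)) \<le> (s + K + 1) * ?S + (s + K + 1) * 2 powr (- (r * real Lv))"
      using s0 K by (intro add_mono mult_right_mono) auto
    then have "ennreal (s * ?S + K * 2 powr (- (r * real Lv))) \<le> ennreal ((s + K + 1) * (?S + 2 powr (- (r * real Lv))))"
      unfolding distrib_left[of "s + K + 1"] by (rule ennreal_leI)
    with \<Psi>(3) have "(\<integral>\<^sup>+\<omega>. \<Psi> \<omega> \<partial>M) \<le> ennreal ((s + K + 1) * (?S + 2 powr (- (r * real Lv))))"
      unfolding s_def[symmetric] by (rule order.trans)
    then show ?thesis using \<Psi> by blast
  qed measurable
  moreover have "0 < s + K + 1" using s0 K by simp
  ultimately show thesis using that by blast
qed

end

section \<open>Choice of the finest level\<close>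

lemma level_term:
  fixes d l n :: nat and p :: real
  assumes "n \<ge> 1"
  shows "2 powr (- (p * real l)) * sqrt (2 ^ (l * d) * real (1::nat) / real n) = real n powr (- 1 / 2) * (2 powr (real d / 2 - p)) ^ l"
proof -
  have "sqrt (2 ^ (l * d) * real (1::nat) / real n) = sqrt (2 powr (real l * real d)) / sqrt (real n)"
    by (simp add: real_sqrt_divide powr_realpow flip: of_nat_mult)
  also have "sqrt (2 powr (real l * real d)) = 2 powr (real l * real d / 2)"
    by (simp add: powr_half_sqrt[symmetric] powr_powr)
  also have "\<dots> / sqrt (real n) = 2 powr (real l * real d / 2) * real n powr (- 1 / 2)"
    using assms by (simp add: powr_minus_divide powr_half_sqrt)
  finally have "2 powr (- (p * real l)) * sqrt (2 ^ (l * d) * real (1::nat) / real n) = real n powr (- 1 / 2) * (2 powr (- (p * real l)) * 2 powr (real l * real d / 2))"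
    by (simp only: ac_simps)
  also have "2 powr (- (p * real l)) * 2 powr (real l * real d / 2) = 2 powr ((real d / 2 - p) * real l)"
    by (simp add: powr_add[symmetric] algebra_simps)
  also have "\<dots> = (2 powr (real d / 2 - p)) ^ l" by (simp add: powr_powr[symmetric] powr_realpow)
  finally show ?thesis .
qed

text \<open>The sum over the levels is geometric with ratio \<open>x\<close>. For
  \<open>x < 1\<close> it is bounded and any large \<open>L\<close> will do; for
  \<open>x = 1\<close> its \<open>L + 1\<close> equal terms produce the logarithm; for
  \<open>x > 1\<close> the last term dominates and \<open>L\<close> is chosen to balance it with
  \<open>2 powr (- (p * L))\<close>.\<close>

lemma rate_levels:
  fixes d :: nat and p :: real
  assumes p: "1 \<le> p" and d: "d \<ge> 1"
  obtains C where "0 < C" "\<And>n. n \<ge> 1 \<Longrightarrow> \<exists>L. level_bound p d 1 n L \<le> C * rate d p n"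
proof -
  define x where "x = 2 powr (real d / 2 - p)"
  have x0: "0 < x" by (simp add: x_def)
  have S: "(\<Sum>l\<le>L. 2 powr (- (p * real l)) * sqrt (2 ^ (l * d) * real (1::nat) / real n)) = real n powr (- 1 / 2) * (\<Sum>l\<le>L. x ^ l)" if "n \<ge> 1" for n L
    unfolding level_term[OF that] x_def sum_distrib_left ..
  have half: "1 / real n \<le> real n powr (- 1 / 2)" if "n \<ge> 1" for n :: nat
  proof -
    have "1 / real n = real n powr (-1)" using that by (simp add: powr_minus_divide)
    also have "\<dots> \<le> real n powr (- 1 / 2)" using that by (intro powr_mono) auto
    finally show ?thesis .
  qed
  have tail: "2 powr (- (p * real L)) \<le> 1 / 2 ^ L" for L :: nat
  proof -
    have "2 powr (- (p * real L)) \<le> 2 powr (- real L)" using p by (intro powr_mono) (auto simp: mult_right_mono[of 1 p "real L", simplified])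
    then show ?thesis by (simp add: powr_minus_divide powr_realpow)
  qed
  consider "real d < 2 * p" | "real d = 2 * p" | "2 * p < real d" by linarith
  then show thesis
  proof cases
    case 1
    then have x1: "x < 1" using powr_less_mono[of "real d / 2 - p" 0 2] by (simp add: x_def)
    show thesis
    proof (rule that)
      show "0 < 1 / (1 - x) + 1" using x1 by (simp add: add_pos_pos)
      fix n :: nat assume n: "n \<ge> 1"
      have "(\<Sum>l\<le>n. x ^ l) \<le> 1 / (1 - x)" using x0 x1 by (simp add: sum_gp0 divide_right_mono)
      then have "real n powr (- 1 / 2) * (\<Sum>l\<le>n. x ^ l) \<le> real n powr (- 1 / 2) * (1 / (1 - x))" by (intro mult_left_mono) auto
      moreover have "2 powr (- (p * real n)) \<le> real n powr (- 1 / 2)"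
      proof -
        have "2 powr (- (p * real n)) \<le> 1 / 2 ^ n" by (rule tail)
        also have "\<dots> \<le> 1 / real n" using n less_imp_le[OF of_nat_less_two_power[of n]] by (intro divide_left_mono) auto
        also note half[OF n]
        finally show ?thesis .
      qed
      ultimately show "\<exists>L. level_bound p d 1 n L \<le> (1 / (1 - x) + 1) * rate d p n"
        using 1 by (intro exI[of _ n]) (simp only: S[OF n], simp add: rate_def algebra_simps)
    qed
  next
    case 2
    then have x1: "x = 1" by (simp add: x_def)
    show thesis
    proof (rule that)
      show "0 < 4 / ln (2::real)" by simp
      fix n :: nat assume n: "n \<ge> 1"
      \<comment> \<open>Large enough for \<open>1 / 2 ^ L \<le> 1 / n\<close>, small enough for
        \<open>L\<close> to be of order \<open>log n\<close>.\<close>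
      define L where "L = nat \<lceil>log 2 (real n)\<rceil>"
      have l0: "0 \<le> log 2 (real n)" using n by simp
      have L: "log 2 (real n) \<le> real L" "real L \<le> log 2 (real n) + 1" using l0 unfolding L_def by linarith+
      have "real n = 2 powr (log 2 (real n))" using n by simp
      also have "\<dots> \<le> 2 powr (real L)" using L by (intro powr_mono) auto
      finally have nL: "real n \<le> 2 ^ L" by (simp add: powr_realpow)
      have ln2: "ln 2 \<le> ln (1 + real n)" "ln (real n) \<le> ln (1 + real n)" using n by auto
      \<comment> \<open>One unit is due to rounding, the other to the number of levels. Both are
        absorbed since \<open>ln (1 + n) \<ge> ln 2\<close>; with \<open>ln n\<close> this would
        fail at \<open>n = 1\<close>.\<close>
      have "real L + 1 \<le> ln (real n) / ln 2 + 2" using L by (simp add: log_def)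
      also have "\<dots> \<le> ln (1 + real n) / ln 2 + 2 * (ln (1 + real n) / ln 2)"
        using ln2 by (intro add_mono divide_right_mono) (auto simp: field_simps)
      finally have L1: "real L + 1 \<le> 3 / ln 2 * ln (1 + real n)" by simp
      have "2 powr (- (p * real L)) \<le> 1 / 2 ^ L" by (rule tail)
      also have "\<dots> \<le> 1 / real n" using n nL by (intro divide_left_mono) auto
      also note half[OF n]
      finally have t: "2 powr (- (p * real L)) \<le> real n powr (- 1 / 2)" .
      have "1 \<le> 1 / ln 2 * ln (1 + real n)" using ln2 by simp
      then have "real n powr (- 1 / 2) * 1 \<le> real n powr (- 1 / 2) * (1 / ln 2 * ln (1 + real n))" by (intro mult_left_mono) auto
      moreover have "real n powr (- 1 / 2) * (real L + 1) \<le> real n powr (- 1 / 2) * (3 / ln 2 * ln (1 + real n))" using L1 by (intro mult_left_mono) auto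
      moreover have "real n powr (- 1 / 2) * (3 / ln 2 * ln (1 + real n)) + real n powr (- 1 / 2) * (1 / ln 2 * ln (1 + real n)) = 4 / ln 2 * (real n powr (- 1 / 2) * ln (1 + real n))"
        by (simp add: field_simps)
      ultimately have "real n powr (- 1 / 2) * (real L + 1) + 2 powr (- (p * real L)) \<le> 4 / ln 2 * (real n powr (- 1 / 2) * ln (1 + real n))"
        using t by linarith
      then show "\<exists>L. level_bound p d 1 n L \<le> 4 / ln 2 * rate d p n"
        using 2 by (intro exI[of _ L]) (simp only: S[OF n], simp add: rate_def x1 add.commute)
    qed
  next
    case 3
    define \<gamma> where "\<gamma> = real d / 2 - p"
    have \<gamma>: "0 < \<gamma>" using 3 by (simp add: \<gamma>_def)
    have x1: "1 < x" using powr_less_mono[of 0 \<gamma> 2] \<gamma> by (simp add: x_def \<gamma>_def)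
    show thesis
    proof (rule that)
      show "0 < x / (x - 1) * x + 1" using x1 by (intro add_pos_pos mult_pos_pos) auto
      fix n :: nat assume n: "n \<ge> 1"
      \<comment> \<open>Now \<open>2 ^ (d * L)\<close> is about \<open>n\<close>, so
        \<open>2 powr (- (p * L))\<close> and \<open>x ^ L / sqrt n\<close> are both of order
        \<open>n powr (- p / d)\<close>.\<close>
      define L where "L = nat \<lceil>log 2 (real n) / real d\<rceil>"
      have l0: "0 \<le> log 2 (real n) / real d" using n by simp
      have L: "log 2 (real n) / real d \<le> real L" "real L \<le> log 2 (real n) / real d + 1" using l0 unfolding L_def by linarith+
      have n2: "2 powr (log 2 (real n) * a) = real n powr a" for a using n by (simp add: powr_powr[symmetric])
      have "2 powr (- (p * real L)) \<le> 2 powr (- (p * (log 2 (real n) / real d)))"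
      proof (rule powr_mono)
        have "p * (log 2 (real n) / real d) \<le> p * real L" by (rule mult_left_mono[OF L(1)]) (use p in simp)
        then show "- (p * real L) \<le> - (p * (log 2 (real n) / real d))" by simp
      qed simp
      also have "\<dots> = real n powr (- p / real d)" using n2[of "- p / real d"] by (simp add: algebra_simps)
      finally have t: "2 powr (- (p * real L)) \<le> real n powr (- p / real d)" .
      have "x ^ L = 2 powr (\<gamma> * real L)" by (simp add: x_def \<gamma>_def powr_powr[symmetric] powr_realpow)
      also have "\<dots> \<le> 2 powr (\<gamma> * (log 2 (real n) / real d + 1))" using L \<gamma> by (intro powr_mono mult_left_mono) auto
      also have "\<dots> = 2 powr (log 2 (real n) * (\<gamma> / real d)) * x" by (simp add: x_def \<gamma>_def powr_add[symmetric] algebra_simps)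
      also have "\<dots> = real n powr (\<gamma> / real d) * x" unfolding n2 ..
      also have "\<gamma> / real d = 1 / 2 - p / real d" using d by (simp add: \<gamma>_def diff_divide_distrib)
      finally have xL: "x ^ L \<le> real n powr (1 / 2 - p / real d) * x" .
      have "(\<Sum>l\<le>L. x ^ l) = (x ^ Suc L - 1) / (x - 1)" using x1 by (subst sum_gp0) (auto simp: field_simps)
      also have "\<dots> \<le> x ^ Suc L / (x - 1)" using x1 by (intro divide_right_mono) auto
      also have "\<dots> = x / (x - 1) * x ^ L" by simp
      also have "\<dots> \<le> x / (x - 1) * (real n powr (1 / 2 - p / real d) * x)" using xL x1 by (intro mult_left_mono) auto
      finally have "real n powr (- 1 / 2) * (\<Sum>l\<le>L. x ^ l) \<le> real n powr (- 1 / 2) * (x / (x - 1) * (real n powr (1 / 2 - p / real d) * x))"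
        by (intro mult_left_mono) auto
      also have "\<dots> = x / (x - 1) * x * (real n powr (- 1 / 2) * real n powr (1 / 2 - p / real d))" by (simp only: ac_simps)
      also have "real n powr (- 1 / 2) * real n powr (1 / 2 - p / real d) = real n powr (- p / real d)"
        by (simp add: powr_add[symmetric])
      finally have "real n powr (- 1 / 2) * (\<Sum>l\<le>L. x ^ l) + 2 powr (- (p * real L)) \<le> (x / (x - 1) * x + 1) * real n powr (- p / real d)"
        using t by (simp only: distrib_right)
      then show "\<exists>L. level_bound p d 1 n L \<le> (x / (x - 1) * x + 1) * rate d p n"
        using 3 by (intro exI[of _ L]) (simp only: S[OF n], simp add: rate_def)
    qed
  qed
qed

section \<open>The two rates\<close>

context mean_field
begin

lemma mean_fluct_measurable_sum:
  assumes n: "n \<ge> 1" and C: "\<And>r m i. (\<integral>\<^sup>+\<omega>. fluct r m i \<omega> \<partial>M) \<le> ennreal (C * 2 powr (- (r * real m / 3)))" and C0: "0 < C"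
  shows "(\<integral>\<^sup>+\<omega>. total_fluct r n m \<omega> \<partial>M) \<le> ennreal (2 * C * 2 powr (- (r * real m / 3)))"
proof -
  let ?c = "C * 2 powr (- (r * real m / 3))"
  have "(\<integral>\<^sup>+\<omega>. (\<Sum>i<n. fluct r m i \<omega>) \<partial>M) = (\<Sum>i<n. \<integral>\<^sup>+\<omega>. fluct r m i \<omega> \<partial>M)" by (rule nn_integral_sum) measurable
  then have "(\<integral>\<^sup>+\<omega>. total_fluct r n m \<omega> \<partial>M) =
     ennreal (1 / real n) * (\<Sum>i<n. \<integral>\<^sup>+\<omega>. fluct r m i \<omega> \<partial>M) + mean_fluct r m"
    by (simp add: nn_integral_add nn_integral_cmult emeasure_space_1)
  also have "\<dots> \<le> ennreal (1 / real n) * (\<Sum>i<n. ennreal ?c) + ennreal ?c"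
    unfolding mean_fluct_def by (intro add_mono mult_left_mono sum_mono C) auto
  also have "ennreal (1 / real n) * (\<Sum>i<n. ennreal ?c) = ennreal (1 / real n * (\<Sum>i<n. ?c))"
    using C0 by (subst ennreal_mult) (auto simp: sum_ennreal sum_nonneg simp del: sum_constant)
  also have "1 / real n * (\<Sum>i<n. ?c) = ?c" using n by simp
  also have "ennreal ?c + ennreal ?c = ennreal (2 * C * 2 powr (- (r * real m / 3)))" using C0 by (simp flip: ennreal_plus)
  finally show ?thesis .
qed

text \<open>The bound concerns one time at a time, so for each \<open>n\<close> the grid may be
  taken fine enough to push the oscillation terms below the level bound. The majorants are chosen
  for each grid point separately, with \<open>card J = 1\<close>, and enter singly or averaged;
  therefore the fineness of the grid costs nothing.\<close>

lemma rate_pointwise: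
  assumes X: "\<And>n. n \<ge> 1 \<Longrightarrow> particle_system M T b \<sigma> X0 B n (X n)"
    and \<delta>: "0 < \<delta>" and fin: "(\<integral>\<^sup>+\<omega>. ennreal (norm (X0 0 \<omega>) powr (2 * p + \<delta>)) \<partial>M) < \<infinity>"
  shows "\<exists>C::real. \<forall>n\<ge>1. \<forall>t\<in>{0..T}. (\<integral>\<^sup>+\<omega>. wasserstein p (empirical n (\<lambda>i. X n i t \<omega>)) (\<mu> t) epowr p \<partial>M) \<le> ennreal (C * rate CARD('d) p n)"
proof -
  \<comment> \<open>Keeps \<open>2 * p + \<delta>'\<close> within the order 6 that
    \<open>discrepancy_expectation\<close> admits.\<close>
  define \<delta>' where "\<delta>' = min \<delta> 1"
  have \<delta>': "0 < \<delta>'" "2 * p + \<delta>' \<le> 6" using \<delta> p by (auto simp: \<delta>'_def)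
  have fin': "(\<integral>\<^sup>+\<omega>. ennreal (norm (X0 0 \<omega>) powr (2 * p + \<delta>')) \<partial>M) < \<infinity>"
    by (rule powr_moment_mono[OF _ _ fin]) (use p \<delta> in \<open>auto simp: \<delta>'_def\<close>)
  obtain Cd where Cd: "0 < Cd" "\<And>n J Lv. n \<ge> 1 \<Longrightarrow> finite J \<Longrightarrow> J \<subseteq> {0..T} \<Longrightarrow> \<exists>\<Psi>\<in>borel_measurable M.
     (\<forall>t\<in>J. \<forall>\<omega>\<in>space M. discrepancy p Lv (empirical n (\<lambda>i. copy i t \<omega>)) (\<mu> t) \<le> \<Psi> \<omega>) \<and>
     (\<integral>\<^sup>+\<omega>. \<Psi> \<omega> \<partial>M) \<le> ennreal (Cd * level_bound p CARD('d) (card J) n Lv)"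
    using discrepancy_expectation[OF p \<delta>' fin'] by blast
  obtain Cf where Cf: "0 < Cf" "\<And>r m i. (\<integral>\<^sup>+\<omega>. fluct r m i \<omega> \<partial>M) \<le> ennreal (Cf * 2 powr (- (r * real m / 3)))"
    using fluct_expectation by blast
  obtain Cb where Cb: "0 < Cb" "\<And>n X m Lv. n \<ge> 1 \<Longrightarrow> particle_system M T b \<sigma> X0 B n X \<Longrightarrow>
    AE \<omega> in M. \<forall>\<psi>. (\<forall>k\<le>2 ^ m. grid_discrepancy p Lv n m k \<omega> \<le> \<psi> k) \<longrightarrow>
      (\<forall>t\<in>{0..T}. \<forall>k\<le>2 ^ m. grid T m t = T * real k / 2 ^ m \<longrightarrow>
        wasserstein p (empirical n (\<lambda>i. X i t \<omega>)) (\<mu> t) epowr p \<le>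
          ennreal Cb * (\<psi> k + ennreal (1 / 2 ^ m) * (\<Sum>k\<le>2 ^ m. \<psi> k) + total_fluct p n m \<omega>))"
    using particles_bound[OF order.refl p(2)] by blast
  have d1: "1 \<le> CARD('d)" by (simp add: Suc_leI)
  obtain Cr where Cr: "0 < Cr" "\<And>n. n \<ge> 1 \<Longrightarrow> \<exists>L. level_bound p CARD('d) 1 n L \<le> Cr * rate CARD('d) p n"
    using rate_levels[OF p(1) d1] by blast
  have "(\<integral>\<^sup>+\<omega>. wasserstein p (empirical n (\<lambda>i. X n i t \<omega>)) (\<mu> t) epowr p \<partial>M) \<le> ennreal (Cb * 4 * Cd * Cr * rate CARD('d) p n)"
    if n: "n \<ge> 1" and t: "t \<in> {0..T}" for n t
  proof -
    obtain Lv where Lv: "level_bound p CARD('d) 1 n Lv \<le> Cr * rate CARD('d) p n"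
      using Cr(2)[OF n] by blast
    let ?D = "Cd * level_bound p CARD('d) 1 n Lv"
    have D0: "0 < ?D" using Cd(1) by (intro mult_pos_pos add_nonneg_pos sum_nonneg) auto
    \<comment> \<open>The level bound \<open>?D\<close> is positive and does not involve
      \<open>m\<close>, so some grid makes the expected fluctuation smaller.\<close>
    have "(\<lambda>m. 2 * Cf * ((2 powr (- (p / 3))) ^ m)) \<longlonglongrightarrow> 2 * Cf * 0"
      using powr_less_mono[of "- (p / 3)" 0 2] p by (intro tendsto_intros LIMSEQ_power_zero) simp
    then have "eventually (\<lambda>m. 2 * Cf * ((2 powr (- (p / 3))) ^ m) < ?D) sequentially"
      using D0 by (intro order_tendstoD) simp
    then obtain m where "2 * Cf * ((2 powr (- (p / 3))) ^ m) < ?D" by (auto simp: eventually_sequentially)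
    then have m: "2 * Cf * 2 powr (- (p * real m / 3)) \<le> ?D"
      by (simp add: powr_realpow[symmetric] powr_powr)
    have gr: "T * real k / 2 ^ m \<in> {0..T}" if "k \<le> 2 ^ m" for k :: nat
    proof -
      have "real k \<le> 2 ^ m" using that by (metis of_nat_le_iff of_nat_numeral of_nat_power)
      then show ?thesis using T by (auto simp: divide_simps)
    qed
    have "\<forall>k\<in>{..2 ^ m}. \<exists>\<Psi>\<in>borel_measurable M.
      (\<forall>\<omega>\<in>space M. grid_discrepancy p Lv n m k \<omega> \<le> \<Psi> \<omega>) \<and> (\<integral>\<^sup>+\<omega>. \<Psi> \<omega> \<partial>M) \<le> ennreal ?D"
    proof
      fix k :: nat assume "k \<in> {..2 ^ m}"
      then show "\<exists>\<Psi>\<in>borel_measurable M.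
      (\<forall>\<omega>\<in>space M. grid_discrepancy p Lv n m k \<omega> \<le> \<Psi> \<omega>) \<and> (\<integral>\<^sup>+\<omega>. \<Psi> \<omega> \<partial>M) \<le> ennreal ?D"
        using Cd(2)[OF n, of "{T * real k / 2 ^ m}" Lv] gr[of k] by simp
    qed
    then have "\<exists>\<Psi>. \<forall>k\<in>{..2 ^ m}. \<Psi> k \<in> borel_measurable M \<and>
      (\<forall>\<omega>\<in>space M. grid_discrepancy p Lv n m k \<omega> \<le> \<Psi> k \<omega>) \<and> (\<integral>\<^sup>+\<omega>. \<Psi> k \<omega> \<partial>M) \<le> ennreal ?D"
      unfolding Bex_def by (rule bchoice)
    then obtain \<Psi> where \<Psi>': "\<forall>k\<in>{..2 ^ m}. \<Psi> k \<in> borel_measurable M \<and>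
      (\<forall>\<omega>\<in>space M. grid_discrepancy p Lv n m k \<omega> \<le> \<Psi> k \<omega>) \<and> (\<integral>\<^sup>+\<omega>. \<Psi> k \<omega> \<partial>M) \<le> ennreal ?D" by (elim exE)
    have \<Psi>: "\<And>k. k \<le> 2 ^ m \<Longrightarrow> \<Psi> k \<in> borel_measurable M"
      "\<And>k \<omega>. k \<le> 2 ^ m \<Longrightarrow> \<omega> \<in> space M \<Longrightarrow> grid_discrepancy p Lv n m k \<omega> \<le> \<Psi> k \<omega>"
      "\<And>k. k \<le> 2 ^ m \<Longrightarrow> (\<integral>\<^sup>+\<omega>. \<Psi> k \<omega> \<partial>M) \<le> ennreal ?D"
      using \<Psi>' by simp_all
    note [measurable] = \<Psi>(1)
    obtain k where k: "k \<le> 2 ^ m" "grid T m t = T * real k / 2 ^ m" using grid_index[OF T t] by blast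
    let ?F = "total_fluct p n m"
    have "(\<integral>\<^sup>+\<omega>. wasserstein p (empirical n (\<lambda>i. X n i t \<omega>)) (\<mu> t) epowr p \<partial>M) \<le>
       (\<integral>\<^sup>+\<omega>. ennreal Cb * (\<Psi> k \<omega> + ennreal (1 / 2 ^ m) * (\<Sum>k\<le>2 ^ m. \<Psi> k \<omega>) + ?F \<omega>) \<partial>M)"
    proof (rule nn_integral_mono_AE)
      show "AE \<omega> in M. wasserstein p (empirical n (\<lambda>i. X n i t \<omega>)) (\<mu> t) epowr p \<le> ennreal Cb * (\<Psi> k \<omega> + ennreal (1 / 2 ^ m) * (\<Sum>k\<le>2 ^ m. \<Psi> k \<omega>) + ?F \<omega>)"
        using Cb(2)[OF n X[OF n], of m Lv] AE_space
      proof eventually_elim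
        case (elim \<omega>)
        show ?case using elim(1)[rule_format, of "\<lambda>k. \<Psi> k \<omega>" t k] \<Psi>(2)[OF _ elim(2)] t k by blast
      qed
    qed
    also have "\<dots> = ennreal Cb * ((\<integral>\<^sup>+\<omega>. \<Psi> k \<omega> \<partial>M) + ennreal (1 / 2 ^ m) * (\<Sum>k\<le>2 ^ m. \<integral>\<^sup>+\<omega>. \<Psi> k \<omega> \<partial>M) + (\<integral>\<^sup>+\<omega>. ?F \<omega> \<partial>M))"
    proof -
      have [measurable]: "\<Psi> k \<in> borel_measurable M" by (rule \<Psi>(1)[OF k(1)])
      have s: "(\<integral>\<^sup>+\<omega>. (\<Sum>k\<le>2 ^ m. \<Psi> k \<omega>) \<partial>M) = (\<Sum>k\<le>2 ^ m. \<integral>\<^sup>+\<omega>. \<Psi> k \<omega> \<partial>M)" by (rule nn_integral_sum) (auto intro: \<Psi>(1))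
      have sm[measurable]: "(\<lambda>\<omega>. \<Sum>k\<le>2 ^ m. \<Psi> k \<omega>) \<in> borel_measurable M" by (rule borel_measurable_sum) (auto intro: \<Psi>(1))
      have Fm[measurable]: "?F \<in> borel_measurable M" by measurable
      have "(\<integral>\<^sup>+\<omega>. ennreal Cb * (\<Psi> k \<omega> + ennreal (1 / 2 ^ m) * (\<Sum>k\<le>2 ^ m. \<Psi> k \<omega>) + ?F \<omega>) \<partial>M) =
         ennreal Cb * (\<integral>\<^sup>+\<omega>. (\<Psi> k \<omega> + ennreal (1 / 2 ^ m) * (\<Sum>k\<le>2 ^ m. \<Psi> k \<omega>)) + ?F \<omega> \<partial>M)"
        by (rule nn_integral_cmult) measurable
      also have "(\<integral>\<^sup>+\<omega>. (\<Psi> k \<omega> + ennreal (1 / 2 ^ m) * (\<Sum>k\<le>2 ^ m. \<Psi> k \<omega>)) + ?F \<omega> \<partial>M) =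
         (\<integral>\<^sup>+\<omega>. \<Psi> k \<omega> + ennreal (1 / 2 ^ m) * (\<Sum>k\<le>2 ^ m. \<Psi> k \<omega>) \<partial>M) + (\<integral>\<^sup>+\<omega>. ?F \<omega> \<partial>M)"
        by (rule nn_integral_add) measurable
      also have "(\<integral>\<^sup>+\<omega>. \<Psi> k \<omega> + ennreal (1 / 2 ^ m) * (\<Sum>k\<le>2 ^ m. \<Psi> k \<omega>) \<partial>M) = (\<integral>\<^sup>+\<omega>. \<Psi> k \<omega> \<partial>M) + ennreal (1 / 2 ^ m) * (\<integral>\<^sup>+\<omega>. (\<Sum>k\<le>2 ^ m. \<Psi> k \<omega>) \<partial>M)"
        by (subst nn_integral_add) (auto simp: nn_integral_cmult)
      finally show ?thesis unfolding s .
    qed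
    also have "\<dots> \<le> ennreal Cb * (ennreal ?D + ennreal (1 / 2 ^ m) * (\<Sum>k\<le>(2::nat) ^ m. ennreal ?D) + ennreal ?D)"
    proof (intro mult_left_mono add_mono sum_mono)
      show "(\<integral>\<^sup>+\<omega>. ?F \<omega> \<partial>M) \<le> ennreal ?D"
        using mean_fluct_measurable_sum[OF n Cf(2,1), of p m] m by (meson ennreal_leI order.trans)
      show "(\<integral>\<^sup>+\<omega>. \<Psi> k \<omega> \<partial>M) \<le> ennreal ?D" by (rule \<Psi>(3)[OF k(1)])
      show "(\<integral>\<^sup>+\<omega>. \<Psi> j \<omega> \<partial>M) \<le> ennreal ?D" if "j \<in> {..2 ^ m}" for j using that by (intro \<Psi>(3)) simp
    qed auto
    also have "\<dots> \<le> ennreal Cb * (ennreal ?D + ennreal (2 * ?D) + ennreal ?D)"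
    proof (intro mult_left_mono add_mono)
      have "ennreal (1 / 2 ^ m) * (\<Sum>k\<le>(2::nat) ^ m. ennreal ?D) = ennreal (1 / 2 ^ m) * ennreal (\<Sum>k\<le>(2::nat) ^ m. ?D)"
        using D0 by (subst sum_ennreal) auto
      also have "\<dots> = ennreal (1 / 2 ^ m * (\<Sum>k\<le>(2::nat) ^ m. ?D))"
        using D0 by (intro ennreal_mult[symmetric] sum_nonneg) auto
      \<comment> \<open>There are \<open>2 ^ m + 1\<close> grid points, so the normalised sum is at
        most twice the common bound.\<close>
      also have "1 / 2 ^ m * (\<Sum>k\<le>(2::nat) ^ m. ?D) = (1 / 2 ^ m * (2 ^ m + 1)) * ?D" by simp
      also have "\<dots> \<le> 2 * ?D"
        using D0 by (intro mult_right_mono) (auto simp: divide_simps)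
      finally show "ennreal (1 / 2 ^ m) * (\<Sum>k\<le>(2::nat) ^ m. ennreal ?D) \<le> ennreal (2 * ?D)"
        by (simp add: ennreal_leI)
    qed auto
    also have "ennreal ?D + ennreal (2 * ?D) + ennreal ?D = ennreal (4 * ?D)"
    proof -
      have "ennreal x + ennreal (2 * x) + ennreal x = ennreal (4 * x)" if "0 \<le> x" for x
        using that by (simp flip: ennreal_plus)
      then show ?thesis using D0 by simp
    qed
    also have "ennreal Cb * ennreal (4 * ?D) = ennreal (Cb * (4 * ?D))"
      using D0 Cb(1) by (intro ennreal_mult[symmetric]) auto
    also have "\<dots> \<le> ennreal (Cb * 4 * Cd * Cr * rate CARD('d) p n)"
    proof (rule ennreal_leI)
      have "?D \<le> Cd * (Cr * rate CARD('d) p n)" using Lv Cd(1) by (intro mult_left_mono) auto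
      then have "(Cb * 4) * ?D \<le> (Cb * 4) * (Cd * (Cr * rate CARD('d) p n))" using Cb(1) by (intro mult_left_mono[of ?D]) auto
      then show "Cb * (4 * ?D) \<le> Cb * 4 * Cd * Cr * rate CARD('d) p n" by (simp only: mult.assoc)
    qed
    finally show ?thesis .
  qed
  then show ?thesis by blast
qed

text \<open>One \<open>\<Psi>\<close> majorises the discrepancies at all grid points, so the bound
  of \<open>particles_bound\<close> holds for every time with a right side that is independent of
  time; the supremum then passes under the integral.\<close>

lemma rate_uniform:
  assumes X: "\<And>n. n \<ge> 1 \<Longrightarrow> particle_system M T b \<sigma> X0 B n (X n)"
    and fin: "(\<integral>\<^sup>+\<omega>. ennreal (norm (X0 0 \<omega>) powr 5) \<partial>M) < \<infinity>"
  shows "\<exists>C::real. \<forall>n\<ge>1. (\<integral>\<^sup>+\<omega>. (SUP s\<in>{0..T}. (wasserstein 2 (empirical n (\<lambda>i. X n i s \<omega>)) (\<mu> s))\<^sup>2) \<partial>M)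
               \<le> ennreal (C * real n powr (- 2 / (real CARD('d) + 8)))"
proof -
  have fin': "(\<integral>\<^sup>+\<omega>. ennreal (norm (X0 0 \<omega>) powr (2 * 2 + 1)) \<partial>M) < \<infinity>" using fin by simp
  obtain Cd where Cd: "0 < Cd" "\<And>n J Lv. n \<ge> 1 \<Longrightarrow> finite J \<Longrightarrow> J \<subseteq> {0..T} \<Longrightarrow> \<exists>\<Psi>\<in>borel_measurable M.
     (\<forall>t\<in>J. \<forall>\<omega>\<in>space M. discrepancy 2 Lv (empirical n (\<lambda>i. copy i t \<omega>)) (\<mu> t) \<le> \<Psi> \<omega>) \<and>
     (\<integral>\<^sup>+\<omega>. \<Psi> \<omega> \<partial>M) \<le> ennreal (Cd * level_bound 2 CARD('d) (card J) n Lv)"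
    using discrepancy_expectation[of 2 1, OF _ _ _ _ fin'] by auto
  obtain Cf where Cf: "0 < Cf" "\<And>r m i. (\<integral>\<^sup>+\<omega>. fluct r m i \<omega> \<partial>M) \<le> ennreal (Cf * 2 powr (- (r * real m / 3)))"
    using fluct_expectation by blast
  obtain Cb where Cb: "0 < Cb" "\<And>n X m Lv. n \<ge> 1 \<Longrightarrow> particle_system M T b \<sigma> X0 B n X \<Longrightarrow>
    AE \<omega> in M. \<forall>\<psi>. (\<forall>k\<le>2 ^ m. grid_discrepancy 2 Lv n m k \<omega> \<le> \<psi> k) \<longrightarrow>
      (\<forall>t\<in>{0..T}. \<forall>k\<le>2 ^ m. grid T m t = T * real k / 2 ^ m \<longrightarrow>
        wasserstein 2 (empirical n (\<lambda>i. X i t \<omega>)) (\<mu> t) epowr 2 \<le>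
          ennreal Cb * (\<psi> k + ennreal (1 / 2 ^ m) * (\<Sum>k\<le>2 ^ m. \<psi> k) + total_fluct 2 n m \<omega>))"
    using particles_bound[OF p(2) order.refl] by blast
  define d where "d = real CARD('d)"
  have d0: "0 \<le> d" by (simp add: d_def)
  \<comment> \<open>The 3 collects the grid value and the normalised sum, which is at most twice it;
    5 is 4 from the levels plus 1 from the finest scale; the last 4 is the loss from rounding
    \<open>Lv\<close> down.\<close>
  define C where "C = Cb * (3 * (5 * Cd) + 2 * Cf) * 4"
  have "(\<integral>\<^sup>+\<omega>. (SUP s\<in>{0..T}. (wasserstein 2 (empirical n (\<lambda>i. X n i s \<omega>)) (\<mu> s))\<^sup>2) \<partial>M) \<le> ennreal (C * real n powr (- 2 / (d + 8)))"
    if n: "n \<ge> 1" for n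
  proof -
    \<comment> \<open>Rounded down so that \<open>2 powr (Lv * (d + 8)) \<le> n\<close>; rounding
      costs at most one level, a factor 4 in \<open>e\<close>.\<close>
    define Lv where "Lv = nat \<lfloor>log 2 (real n) / (d + 8)\<rfloor>"
    have l0: "0 \<le> log 2 (real n) / (d + 8)" using n d0 by simp
    have Lv: "real Lv \<le> log 2 (real n) / (d + 8)" "log 2 (real n) / (d + 8) \<le> real Lv + 1" using l0 unfolding Lv_def by linarith+
    have n2: "2 powr (log 2 (real n) * a) = real n powr a" for a using n by (simp add: powr_powr[symmetric])
    define m where "m = 4 * Lv"
    define e where "e = 2 powr (- (2 * real Lv))"
    have e0: "0 < e" by (simp add: e_def)
    define J where "J = (\<lambda>k. T * real k / 2 ^ m) ` {..2 ^ m}"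
    have gr: "T * real k / 2 ^ m \<in> {0..T}" if "k \<le> 2 ^ m" for k :: nat
    proof -
      have "real k \<le> 2 ^ m" using that by (metis of_nat_le_iff of_nat_numeral of_nat_power)
      then show ?thesis using T by (auto simp: divide_simps)
    qed
    have J: "finite J" "J \<subseteq> {0..T}" using gr by (auto simp: J_def)
    have "card J \<le> card {..(2::nat) ^ m}" unfolding J_def by (rule card_image_le) simp
    then have "card J \<le> 2 ^ m + 1" by simp
    then have "real (card J) \<le> real (2 ^ m + 1)" by (rule of_nat_mono)
    also have "\<dots> \<le> 2 * 2 ^ m" by simp
    finally have cJ: "real (card J) \<le> 2 * 2 ^ m" .
    obtain \<Psi> where \<Psi>[measurable]: "\<Psi> \<in> borel_measurable M"
      and \<Psi>d: "\<And>t \<omega>. t \<in> J \<Longrightarrow> \<omega> \<in> space M \<Longrightarrow> discrepancy 2 Lv (empirical n (\<lambda>i. copy i t \<omega>)) (\<mu> t) \<le> \<Psi> \<omega>"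
      and \<Psi>e: "(\<integral>\<^sup>+\<omega>. \<Psi> \<omega> \<partial>M) \<le> ennreal (Cd * level_bound 2 CARD('d) (card J) n Lv)"
      using Cd(2)[OF n J, of Lv] by blast
    have lev: "(\<Sum>l\<le>Lv. 2 powr (- (2 * real l)) * sqrt (2 ^ (l * CARD('d)) * real (card J) / real n)) \<le> 4 * e"
    proof -
      \<comment> \<open>The root is estimated by its value at the finest level. There
        \<open>2 ^ (Lv * CARD('d))\<close> boxes and at most \<open>2 * 2 ^ (4 * Lv)\<close> times
        meet the target \<open>e\<^sup>2\<close>, which is \<open>2 powr (- (4 * Lv))\<close>. Since
        this estimate is the same for all levels, the decay in \<open>l\<close> alone makes the sum
        bounded.\<close>
      have root: "sqrt (2 ^ (l * CARD('d)) * real (card J) / real n) \<le> 2 * e" if l: "l \<le> Lv" for l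
      proof -
        have "2 ^ (l * CARD('d)) * real (card J) / real n \<le> 2 ^ (Lv * CARD('d)) * (2 * 2 ^ m) / real n"
          using cJ l by (intro divide_right_mono mult_mono power_increasing mult_right_mono) auto
        also have "\<dots> = 2 * 2 powr (real Lv * d + 4 * real Lv) / real n"
          by (simp add: powr_add powr_realpow[symmetric] d_def m_def)
        also have "\<dots> \<le> (2 * e)\<^sup>2"
        proof -
          have "real Lv * (d + 8) \<le> log 2 (real n)" using Lv(1) d0 by (simp add: pos_le_divide_eq)
          then have "2 powr (real Lv * (d + 8)) \<le> 2 powr (log 2 (real n))" by (intro powr_mono) auto
          also have "\<dots> = real n" using n by simp
          finally have "2 powr (real Lv * (d + 8)) / real n \<le> 1" using n by simp
          then have "e\<^sup>2 * (2 powr (real Lv * (d + 8)) / real n) \<le> e\<^sup>2 * 1" by (intro mult_left_mono) auto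
          moreover have "e\<^sup>2 * 2 powr (real Lv * (d + 8)) = 2 powr (real Lv * d + 4 * real Lv)"
            by (simp add: e_def power2_eq_square powr_add[symmetric] algebra_simps)
          ultimately have *: "2 powr (real Lv * d + 4 * real Lv) / real n \<le> e\<^sup>2" by simp
          have "2 * (2 powr (real Lv * d + 4 * real Lv) / real n) \<le> 4 * e\<^sup>2" using * e0 by (smt (verit) zero_le_power2)
          then show ?thesis by (simp add: power_mult_distrib)
        qed
        finally have "sqrt (2 ^ (l * CARD('d)) * real (card J) / real n) \<le> sqrt ((2 * e)\<^sup>2)" by (rule real_sqrt_le_mono)
        also have "sqrt ((2 * e)\<^sup>2) = 2 * e" using e0 by (intro real_sqrt_unique) auto
        finally show ?thesis .
      qed
      have "(\<Sum>l\<le>Lv. 2 powr (- (2 * real l)) * sqrt (2 ^ (l * CARD('d)) * real (card J) / real n)) \<le> (\<Sum>l\<le>Lv. (1/2) ^ l * (2 * e))"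
      proof (intro sum_mono mult_mono root)
        fix l
        have "2 powr (- (2 * real l)) \<le> 2 powr (- real l)" by (intro powr_mono) auto
        then show "2 powr (- (2 * real l)) \<le> (1/2) ^ l" by (simp add: powr_minus_divide powr_realpow power_one_over)
      qed (auto simp: e0)
      also have "\<dots> = (\<Sum>l\<le>Lv. (1/2) ^ l) * (2 * e)" by (simp add: sum_distrib_right)
      also have "\<dots> \<le> 2 * (2 * e)" using e0 by (intro mult_right_mono) (auto simp: sum_gp0)
      finally show ?thesis by simp
    qed
    have \<Psi>E: "(\<integral>\<^sup>+\<omega>. \<Psi> \<omega> \<partial>M) \<le> ennreal (5 * Cd * e)"
    proof (rule order.trans[OF \<Psi>e ennreal_leI])
      have "Cd * ((\<Sum>l\<le>Lv. 2 powr (- (2 * real l)) * sqrt (2 ^ (l * CARD('d)) * real (card J) / real n)) + e) \<le> Cd * (4 * e + e)"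
        using lev Cd(1) by (intro mult_left_mono) auto
      then show "Cd * level_bound 2 CARD('d) (card J) n Lv \<le> 5 * Cd * e"
        by (simp add: e_def)
    qed
    let ?F = "total_fluct 2 n m"
    have FE: "(\<integral>\<^sup>+\<omega>. ?F \<omega> \<partial>M) \<le> ennreal (2 * Cf * e)"
    proof -
      \<comment> \<open>For \<open>m = 4 * Lv\<close> the exponent is \<open>- 8 * Lv / 3\<close>,
        which is at most \<open>- 2 * Lv\<close>.\<close>
      have "2 powr (- (2 * real m / 3)) \<le> e" unfolding e_def m_def by (intro powr_mono) auto
      then have "ennreal (2 * Cf * 2 powr (- (2 * real m / 3))) \<le> ennreal (2 * Cf * e)" using Cf(1) by (intro ennreal_leI mult_left_mono) auto
      with mean_fluct_measurable_sum[OF n Cf(2,1), of 2 m] show ?thesis by (rule order.trans)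
    qed
    have "(\<integral>\<^sup>+\<omega>. (SUP s\<in>{0..T}. (wasserstein 2 (empirical n (\<lambda>i. X n i s \<omega>)) (\<mu> s))\<^sup>2) \<partial>M) \<le> (\<integral>\<^sup>+\<omega>. ennreal Cb * (3 * \<Psi> \<omega> + ?F \<omega>) \<partial>M)"
    proof (rule nn_integral_mono_AE)
      show "AE \<omega> in M. (SUP s\<in>{0..T}. (wasserstein 2 (empirical n (\<lambda>i. X n i s \<omega>)) (\<mu> s))\<^sup>2) \<le> ennreal Cb * (3 * \<Psi> \<omega> + ?F \<omega>)"
        using Cb(2)[OF n X[OF n], of m Lv] AE_space
      proof eventually_elim
        case (elim \<omega>)
        show ?case
        proof (rule SUP_least)
          fix s assume s: "s \<in> {0..T}"
          obtain k where k: "k \<le> 2 ^ m" "grid T m s = T * real k / 2 ^ m" using grid_index[OF T s] by blast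
          have "grid_discrepancy 2 Lv n m k \<omega> \<le> \<Psi> \<omega>" if "k \<le> 2 ^ m" for k
            using \<Psi>d[OF _ elim(2), of "T * real k / 2 ^ m"] that by (auto simp: J_def)
          then have "wasserstein 2 (empirical n (\<lambda>i. X n i s \<omega>)) (\<mu> s) epowr 2 \<le>
             ennreal Cb * (\<Psi> \<omega> + ennreal (1 / 2 ^ m) * (\<Sum>k\<le>(2::nat) ^ m. \<Psi> \<omega>) + ?F \<omega>)"
            using elim(1)[rule_format, of "\<lambda>_. \<Psi> \<omega>" s k] s k by blast
          also have "\<dots> \<le> ennreal Cb * (\<Psi> \<omega> + 2 * \<Psi> \<omega> + ?F \<omega>)"
          proof (intro mult_left_mono add_mono)
            have "ennreal (1 / 2 ^ m) * (\<Sum>k\<le>(2::nat) ^ m. \<Psi> \<omega>) = ennreal (1 / 2 ^ m) * ennreal (2 ^ m + 1) * \<Psi> \<omega>"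
              by (simp add: mult.assoc ennreal_of_nat_eq_real_of_nat add.commute)
            also have "ennreal (1 / 2 ^ m) * ennreal (2 ^ m + 1) = ennreal (1 / 2 ^ m * (2 ^ m + 1))" by (intro ennreal_mult[symmetric]) auto
            also have "\<dots> \<le> ennreal 2" by (intro ennreal_leI) (simp add: divide_simps)
            finally show "ennreal (1 / 2 ^ m) * (\<Sum>k\<le>(2::nat) ^ m. \<Psi> \<omega>) \<le> 2 * \<Psi> \<omega>" by (simp add: mult_right_mono)
          qed auto
          also have "\<Psi> \<omega> + 2 * \<Psi> \<omega> = 3 * \<Psi> \<omega>"
          proof -
            have "(3::ennreal) = 1 + 2" by simp
            then show ?thesis by (simp only: distrib_right mult_1)
          qed
          finally show "(wasserstein 2 (empirical n (\<lambda>i. X n i s \<omega>)) (\<mu> s))\<^sup>2 \<le> ennreal Cb * (3 * \<Psi> \<omega> + ?F \<omega>)"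
            by (simp only: epowr_2)
        qed
      qed
    qed
    also have "\<dots> = ennreal Cb * (3 * (\<integral>\<^sup>+\<omega>. \<Psi> \<omega> \<partial>M) + (\<integral>\<^sup>+\<omega>. ?F \<omega> \<partial>M))"
    proof -
      have "(\<integral>\<^sup>+\<omega>. ennreal Cb * (3 * \<Psi> \<omega> + ?F \<omega>) \<partial>M) = ennreal Cb * (\<integral>\<^sup>+\<omega>. 3 * \<Psi> \<omega> + ?F \<omega> \<partial>M)"
        by (rule nn_integral_cmult) measurable
      also have "(\<integral>\<^sup>+\<omega>. 3 * \<Psi> \<omega> + ?F \<omega> \<partial>M) = (\<integral>\<^sup>+\<omega>. 3 * \<Psi> \<omega> \<partial>M) + (\<integral>\<^sup>+\<omega>. ?F \<omega> \<partial>M)"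
        by (rule nn_integral_add) measurable
      finally show ?thesis by (simp add: nn_integral_cmult)
    qed
    also have "\<dots> \<le> ennreal Cb * (ennreal 3 * ennreal (5 * Cd * e) + ennreal (2 * Cf * e))"
      using mult_left_mono[OF \<Psi>E, of 3] by (intro mult_left_mono add_mono FE) auto
    also have "\<dots> = ennreal (Cb * (3 * (5 * Cd) + 2 * Cf) * e)"
    proof -
      have "ennreal 3 * ennreal (5 * Cd * e) + ennreal (2 * Cf * e) = ennreal ((3 * (5 * Cd) + 2 * Cf) * e)"
        using Cd(1) Cf(1) e0 by (simp add: ennreal_mult[symmetric] ennreal_plus[symmetric] distrib_right del: ennreal_plus ennreal_numeral)
      then show ?thesis using Cd(1) Cf(1) e0 Cb(1) by (simp only: mult.assoc) (rule ennreal_mult[symmetric], auto)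
    qed
    also have "\<dots> \<le> ennreal (C * real n powr (- 2 / (d + 8)))"
    proof (rule ennreal_leI)
      have "e \<le> 2 powr (2 + log 2 (real n) * (- 2 / (d + 8)))"
        unfolding e_def using Lv(2) by (intro powr_mono) auto
      also have "\<dots> = 4 * real n powr (- 2 / (d + 8))" unfolding powr_add n2 by simp
      finally have "Cb * (3 * (5 * Cd) + 2 * Cf) * e \<le> Cb * (3 * (5 * Cd) + 2 * Cf) * (4 * real n powr (- 2 / (d + 8)))"
        using Cb(1) Cd(1) Cf(1) by (intro mult_left_mono) auto
      then show "Cb * (3 * (5 * Cd) + 2 * Cf) * e \<le> C * real n powr (- 2 / (d + 8))" by (simp only: C_def mult.assoc)
    qed
    finally show ?thesis .
  qed
  then show ?thesis unfolding d_def by blast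
qed

end

theorem theorem5p6:
  fixes M :: "'w measure"
    and T p L :: real
    and \<sigma> :: "real ^ 'd ^ 'd"
    and b :: "real \<Rightarrow> real ^ 'd \<Rightarrow> (real ^ 'd) measure \<Rightarrow> real ^ 'd"
    and \<mu>0 :: "(real ^ 'd) measure"
    and X0 :: "nat \<Rightarrow> 'w \<Rightarrow> real ^ 'd"
    and B :: "nat \<Rightarrow> real \<Rightarrow> 'w \<Rightarrow> real ^ 'd"
    and X :: "nat \<Rightarrow> nat \<Rightarrow> real \<Rightarrow> 'w \<Rightarrow> real ^ 'd"
    and Y :: "real \<Rightarrow> 'w \<Rightarrow> real ^ 'd"
    and \<mu> :: "real \<Rightarrow> (real ^ 'd) measure"
  assumes M: "prob_space M"
    and T: "0 < T"
    and p: "1 \<le> p" "p \<le> 2"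
    and b_measurable: "(\<lambda>(t, x, m). b t x m) \<in>
      borel_measurable (restrict_space borel {0..T} \<Otimes>\<^sub>M (borel \<Otimes>\<^sub>M wasserstein_borel p))"
    and b_lipschitz: "\<And>t x x' m m'. t \<in> {0..T} \<Longrightarrow>
      m \<in> finite_moment_measures p \<Longrightarrow> m' \<in> finite_moment_measures p \<Longrightarrow>
      ennreal (norm (b t x m - b t x' m')) \<le>
        ennreal L * (ennreal (norm (x - x')) + wasserstein p m m')"
    and b_bounded: "bdd_above ((\<lambda>t. norm (b t 0 (return borel 0))) ` {0..T})"
    and driving: "driving_data M \<mu>0 X0 B"
    and second_moment: "(\<integral>\<^sup>+\<omega>. ennreal ((norm (X0 0 \<omega>))\<^sup>2) \<partial>M) < \<infinity>"
    and particles: "\<And>n. n \<ge> 1 \<Longrightarrow> particle_system M T b \<sigma> X0 B n (X n)"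
    and limit: "mckean_vlasov M T p b \<sigma> X0 B Y \<mu>"
  shows "((\<exists>\<delta>>0. (\<integral>\<^sup>+\<omega>. ennreal (norm (X0 0 \<omega>) powr (2 * p + \<delta>)) \<partial>M) < \<infinity>) \<longrightarrow>
          (\<exists>C::real. \<forall>n\<ge>1. \<forall>t\<in>{0..T}.
             (\<integral>\<^sup>+\<omega>. wasserstein p (empirical n (\<lambda>i. X n i t \<omega>)) (\<mu> t) epowr p \<partial>M)
               \<le> ennreal (C * rate CARD('d) p n)))
       \<and> ((\<integral>\<^sup>+\<omega>. ennreal (norm (X0 0 \<omega>) ^ (CARD('d) + 5)) \<partial>M) < \<infinity> \<longrightarrow>
          (\<exists>C::real. \<forall>n\<ge>1.
             (\<integral>\<^sup>+\<omega>. (SUP s\<in>{0..T}. (wasserstein 2 (empirical n (\<lambda>i. X n i s \<omega>)) (\<mu> s))\<^sup>2) \<partial>M)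
               \<le> ennreal (C * real n powr (- 2 / (real CARD('d) + 8)))))"
proof -
  interpret prob_space M by (rule M)
  interpret mean_field M T p L b \<sigma> \<mu>0 X0 B Y \<mu>
    by unfold_locales fact+
  show ?thesis
  proof (intro conjI impI)
    assume "\<exists>\<delta>>0. (\<integral>\<^sup>+\<omega>. ennreal (norm (X0 0 \<omega>) powr (2 * p + \<delta>)) \<partial>M) < \<infinity>"
    then obtain \<delta> where "0 < \<delta>" "(\<integral>\<^sup>+\<omega>. ennreal (norm (X0 0 \<omega>) powr (2 * p + \<delta>)) \<partial>M) < \<infinity>" by blast
    from rate_pointwise[of X, OF _ this]
    show "\<exists>C::real. \<forall>n\<ge>1. \<forall>t\<in>{0..T}. (\<integral>\<^sup>+\<omega>. wasserstein p (empirical n (\<lambda>i. X n i t \<omega>)) (\<mu> t) epowr p \<partial>M) \<le> ennreal (C * rate CARD('d) p n)"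
      using particles by simp
  next
    assume fin: "(\<integral>\<^sup>+\<omega>. ennreal (norm (X0 0 \<omega>) ^ (CARD('d) + 5)) \<partial>M) < \<infinity>"
    \<comment> \<open>The exponent is positive, so the natural and the real power agree at norm 0
      too.\<close>
    have "norm (X0 0 \<omega>) powr real (CARD('d) + 5) = norm (X0 0 \<omega>) ^ (CARD('d) + 5)" for \<omega>
      by (rule powr_realpow') auto
    with fin have "(\<integral>\<^sup>+\<omega>. ennreal (norm (X0 0 \<omega>) powr real (CARD('d) + 5)) \<partial>M) < \<infinity>" by simp
    then have "(\<integral>\<^sup>+\<omega>. ennreal (norm (X0 0 \<omega>) powr 5) \<partial>M) < \<infinity>"
      by (rule powr_moment_mono[rotated 2]) auto
    from rate_uniform[of X, OF _ this]
    show "\<exists>C::real. \<forall>n\<ge>1. (\<integral>\<^sup>+\<omega>. (SUP s\<in>{0..T}. (wasserstein 2 (empirical n (\<lambda>i. X n i s \<omega>)) (\<mu> s))\<^sup>2) \<partial>M)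
               \<le> ennreal (C * real n powr (- 2 / (real CARD('d) + 8)))"
      using particles by simp
  qed
qed

end
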